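(* Let $n\ge3$ and let $P\in\mathcal P_{\mathfrak h}\cap\mathcal P_*$. Let $A$ be a $\sigma$-stable split component of $P$ with Lie algebra $\mathfrak a$, let $L=Z_G(A)$ and let $M$ be the maximal compact subgroup of $L$, so that $L=MA$. Let $v\in\mathfrak a\cap\mathfrak q$ be such that $\rho_P(v)>0$. (i) Assume $n$ is even. Then for every $\phi\in\mathcal C(X_n)$ and every $N\in\mathbb N$, $$\sup_{m\in M,\,t\in\mathbb R}\left|t^N\,\mathcal H_P\phi\big(m\exp(tv)\big)\right|<\infty.$$ (ii) Assume $n$ is odd. Then for every $\phi\in\mathcal C(X_n)$, every $r\in\mathbb R$ and every $N\in\mathbb N$, $$\sup_{m\in M,\,t<r}\left|t^N\,\mathcal H_P\phi\big(m\exp(tv)\big)\right|<\infty.$$ Moreover, the limit $\mu_P(\phi):=\lim_{t\to\infty}\mathcal H_P\phi(\exp(tv))$ exists, and there exist an $\mathfrak h$-compatible $Q\in\mathcal Q$ and an element $g\in G$ such that for every $\phi\in\mathcal C(X_n)$, $$\mu_P(\phi)=\int_{N_Q/(N_Q\cap H)}\phi(gn)\,dn.$$ Vice versa, if $Q\in\mathcal Q$ is $\mathfrak h$-compatible, then there exist $P'\in\mathcal P_{\mathfrak h}\cap\mathcal P_*$ and $g\in G$ such that for every $\phi\in\mathcal C(X_n)$, $$\int_{N_Q/(N_Q\cap H)}\phi(gn)\,dn=\mu_{P'}(\phi).$$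
   Context: Let $n\ge3$, $G=\mathrm{SL}(n,\mathbb R)$, $\mathfrak g=\mathfrak{sl}(n,\mathbb R)$. Let $S$ be the $n\times n$ matrix defined by $Se_1=-e_n$, $Se_n=-e_1$, $Se_j=e_j$ for $2\le j\le n-1$ (standard basis vectors), $\sigma(g)=SgS^{-1}$ (also its differential on $\mathfrak g$), and $H=G^\sigma$. Put $X_n=G/H$; write $\mathfrak g=\mathfrak h\oplus\mathfrak q$ for the $\pm1$ eigenspaces of $\sigma$. Let $K=\mathrm{SO}(n)$ and $a_t=\mathrm{diag}(e^t,1,\dots,1,e^{-t})$. Every point of $X_n$ has the form $ka_t\cdot H$ with $k\in K$, $t\in\mathbb R$. Functions on $X_n$ are identified with right $H$-invariant functions on $G$. Schwartz space: $\mathcal C(X_n)$ is the space of smooth $\phi:X_n\to\mathbb C$ such that for all $u\in U(\mathfrak g)$ (acting by the left regular action) and $m\ge0$, $\sup_{k\in K,t\in\mathbb R}\cosh^{n-1}(t)(1+|t|)^m|(u\phi)(ka_t\cdot H)|<\infty$. A split component of a minimal parabolic subgroup $P$ (unipotent radical $N_P$, $\mathfrak n_P=\mathrm{Lie}(N_P)$) is a maximal connected split subgroup of the center of a Levi subgroup of $P$. Every minimal parabolic $P$ has a $\sigma$-stable split component $A$, unique up to conjugation by $N_P\cap H$; let $\mathfrak a$ be its Lie algebra. The $\sigma$-parabolic rank of $P$ is $\dim(A/(A\cap H))\in\{0,1\}$. $\mathcal P$ (resp. $\mathcal Q$) is the set of minimal parabolic subgroups of $\sigma$-parabolic rank $1$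 (resp. $0$). $\Sigma(\mathfrak a)$ is the root system of $\mathfrak a$ in $\mathfrak g$, $\Sigma(\mathfrak a;P)$ is the set of roots $\alpha$ with $\mathfrak g_\alpha\subseteq\mathfrak n_P$, $\Sigma_{\mathfrak h}(\mathfrak a)=\{\alpha\in\Sigma(\mathfrak a):\mathfrak g_\alpha\cap\mathfrak h\ne\{0\}\}$, $\rho_P=\frac12\sum_{\alpha\in\Sigma(\mathfrak a;P)}\alpha$, and $\rho_{P,\mathfrak h}=\frac12\sum_{\alpha\in\Sigma(\mathfrak a;P)\cap\Sigma_{\mathfrak h}(\mathfrak a)}\alpha$. Let $\langle\cdot,\cdot\rangle$ be the inner product on $\mathfrak a^*$ dual to the restriction of $(X,Y)\mapsto\mathrm{tr}(XY)$ to $\mathfrak a$. $P$ is called $\mathfrak h$-compatible if either (a) $P\in\mathcal P$ and $\langle\alpha,\rho_{P,\mathfrak h}\rangle\ge0$ for all $\alpha\in\Sigma(\mathfrak a;P)$, or (b) $P\in\mathcal Q$ and $\langle\alpha,\rho_{P,\mathfrak h}\rangle>0$ for all $\alpha\in\Sigma(\mathfrak a;P)$. $\mathcal P_{\mathfrak h}$ is the set of $\mathfrak h$-compatible $P\in\mathcal P$, and $\mathcal P_*=\{P\in\mathcal P:\dim(N_P\cap H)=\max_{Q\in\mathcal P}\dim(N_Q\cap H)\}$. For each minimal parabolic $P$, $dn$ denotes a non-zero (positive) $N_P$-invariant Radon measure on $N_P/(N_P\cap H)$. For $\mathfrak h$-compatible $P$ the integrals $\int_{N_P/(N_P\cap H)}\phi(gn)\,dn$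 converge absolutely for all $\phi\in\mathcal C(X_n)$, $g\in G$. For $P\in\mathcal P_{\mathfrak h}\cap\mathcal P_*$ with $A$, $L$, $M$ as in the claim, put, for $l\in L$, $$\delta_P(l)=\left|\frac{\det\mathrm{Ad}(l)|_{\mathfrak n_P}}{\det\mathrm{Ad}(l)|_{\mathfrak n_P\cap Z_{\mathfrak g}(\mathfrak a\cap\mathfrak q)}}\right|^{1/2},\qquad \mathcal H_P\phi(l)=\delta_P(l)\int_{N_P/(N_P\cap H)}\phi(ln)\,dn .$$ One has $\delta_P(ma)=a^{\rho_P-\rho_{P,\mathfrak h}}$ for $m\in M$, $a\in A$. For $P'\in\mathcal P_{\mathfrak h}\cap\mathcal P_*$, $\mu_{P'}(\phi)$ is the limit defined in the claim, formed with $P'$ in place of $P$. *)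

theory Defs
  imports "HOL-Analysis.Analysis" "HOL-Algebra.Left_Coset"
begin

text \<open>
  Matrices are indexed by an arbitrary finite linearly ordered type \<open>'n\<close>, so that
  \<open>n = CARD('n)\<close> and the first and the last standard basis vector make sense.
  A subset of the group, and a function on it, is represented inside the ambient matrix space;
  the values of functions outside \<open>SL(n,R)\<close> never matter.
\<close>

type_synonym 'n rmat = "real^'n^'n"

definition SL :: "('n::finite) rmat monoid" where
  "SL = \<lparr>carrier = {g. det g = 1}, mult = (**), one = mat 1\<rparr>"

definition sl :: "('n::finite) rmat set" where
  "sl = {X. trace X = 0}"

definition SO :: "('n::finite) rmat set" where
  "SO = {k. orthogonal_matrix k \<and> det k = 1}"

definition first_ix :: "'n::{finite,linorder}" where "first_ix = Min UNIV"
definition last_ix :: "'n::{finite,linorder}" where "last_ix = Max UNIV"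

text \<open>The \<open>j\<close>-th column of \<open>S\<close> is the image of the \<open>j\<close>-th standard basis vector.\<close>

definition Smat :: "('n::{finite,linorder}) rmat" where
  "Smat = (\<chi> i j. (if j = first_ix then - axis last_ix 1
                   else if j = last_ix then - axis first_ix 1
                   else axis j 1) $ i)"

lemma Smat_axis: "Smat *v axis j 1 =
    (if j = first_ix then - axis last_ix 1
     else if j = last_ix then - axis first_ix 1 else axis j 1)"
proof -
  have "column j Smat = (if j = first_ix then - axis last_ix 1
     else if j = last_ix then - axis first_ix 1 else axis j 1)"
    by (simp add: column_def Smat_def vec_eq_iff)
  then show ?thesis
    by (simp add: matrix_vector_mult_basis)
qed

definition sigma :: "('n::{finite,linorder}) rmat \<Rightarrow> 'n rmat" where
  "sigma g = Smat ** g ** matrix_inv Smat"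

definition Hgrp :: "('n::{finite,linorder}) rmat set" where
  "Hgrp = {g \<in> carrier SL. sigma g = g}"

definition h_alg :: "('n::{finite,linorder}) rmat set" where
  "h_alg = {X \<in> sl. sigma X = X}"

definition q_alg :: "('n::{finite,linorder}) rmat set" where
  "q_alg = {X \<in> sl. sigma X = - X}"

definition a_elt :: "real \<Rightarrow> ('n::{finite,linorder}) rmat" where
  "a_elt t = (\<chi> i j. if i = j then (if i = first_ix then exp t
                                  else if i = last_ix then exp (- t) else 1) else 0)"

definition mat_pow :: "('n::finite) rmat \<Rightarrow> nat \<Rightarrow> 'n rmat" where
  "mat_pow X k = (((**) X) ^^ k) (mat 1)"

definition mat_exp :: "('n::finite) rmat \<Rightarrow> 'n rmat" where
  "mat_exp X = (\<Sum>k. (1 / fact k) *\<^sub>R mat_pow X k)"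

definition lie_alg :: "('n::finite) rmat set \<Rightarrow> 'n rmat set" where
  "lie_alg U = {X. \<forall>t::real. mat_exp (t *\<^sub>R X) \<in> U}"

definition Ad :: "('n::finite) rmat \<Rightarrow> 'n rmat \<Rightarrow> 'n rmat" where
  "Ad g X = g ** X ** matrix_inv g"

fun Ck_on :: "nat \<Rightarrow> ('a::euclidean_space \<Rightarrow> complex) \<Rightarrow> 'a set \<Rightarrow> bool" where
  "Ck_on 0 f U \<longleftrightarrow> continuous_on U f"
| "Ck_on (Suc k) f U \<longleftrightarrow> f differentiable_on U \<and>
     (\<forall>v. Ck_on k (\<lambda>x. frechet_derivative f (at x) v) U)"

text \<open>
  Smoothness on the embedded submanifold \<open>SL(n,R)\<close> of the matrix space: locally the restriction
  of a smooth function. For right \<open>H\<close>-invariant functions this is smoothness on the quotient.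
\<close>

definition smooth_on_SL :: "(('n::finite) rmat \<Rightarrow> complex) \<Rightarrow> bool" where
  "smooth_on_SL \<phi> \<longleftrightarrow> (\<forall>g \<in> carrier SL. \<exists>U F. open U \<and> g \<in> U \<and> (\<forall>k. Ck_on k F U) \<and>
     (\<forall>x \<in> U \<inter> carrier SL. F x = \<phi> x))"

definition left_deriv :: "('n::finite) rmat \<Rightarrow> ('n rmat \<Rightarrow> complex) \<Rightarrow> ('n rmat \<Rightarrow> complex)" where
  "left_deriv X \<phi> g = vector_derivative (\<lambda>t. \<phi> (mat_exp (- t *\<^sub>R X) ** g)) (at 0)"

text \<open>The operators by which the elements of the universal enveloping algebra of
  \<open>sl(n,R)\<close> act in the left regular representation.\<close>

inductive_set Ug_ops :: "((('n::finite) rmat \<Rightarrow> complex) \<Rightarrow> ('n rmat \<Rightarrow> complex)) set" where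
  Ug_one: "(\<lambda>\<phi>. \<phi>) \<in> Ug_ops"
| Ug_mult: "X \<in> sl \<Longrightarrow> D \<in> Ug_ops \<Longrightarrow> (\<lambda>\<phi>. left_deriv X (D \<phi>)) \<in> Ug_ops"
| Ug_add: "D \<in> Ug_ops \<Longrightarrow> E \<in> Ug_ops \<Longrightarrow> (\<lambda>\<phi> g. D \<phi> g + E \<phi> g) \<in> Ug_ops"
| Ug_scale: "D \<in> Ug_ops \<Longrightarrow> (\<lambda>\<phi> g. (c::complex) * D \<phi> g) \<in> Ug_ops"

definition schwartz :: "(('n::{finite,linorder}) rmat \<Rightarrow> complex) set" where
  "schwartz = {\<phi>. (\<forall>g \<in> carrier SL. \<forall>h \<in> Hgrp. \<phi> (g ** h) = \<phi> g) \<and> smooth_on_SL \<phi> \<and>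
     (\<forall>D \<in> Ug_ops. \<forall>m::nat. bdd_above
        ((\<lambda>(k, t). cosh t ^ (CARD('n) - 1) * (1 + \<bar>t\<bar>) ^ m * norm (D \<phi> (k ** a_elt t)))
          ` (SO \<times> UNIV)))}"

definition upper_triangular_SL :: "('n::{finite,linorder}) rmat set" where
  "upper_triangular_SL = {g \<in> carrier SL. \<forall>i j. j < i \<longrightarrow> g $ i $ j = 0}"

definition min_parabolics :: "('n::{finite,linorder}) rmat set set" where
  "min_parabolics = {Ad g ` upper_triangular_SL | g. g \<in> carrier SL}"

definition unipotent :: "('n::finite) rmat \<Rightarrow> bool" where
  "unipotent g \<longleftrightarrow> (\<exists>k. mat_pow (g - mat 1) k = 0)"

text \<open>The largest connected normal subgroup consisting of unipotent elements.\<close>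

definition unipotent_radical :: "('n::finite) rmat set \<Rightarrow> 'n rmat set" where
  "unipotent_radical P =
     \<Union>{N. N \<lhd> (SL\<lparr>carrier := P\<rparr>) \<and> connected N \<and> (\<forall>g \<in> N. unipotent g)}"

text \<open>A closed complement of the unipotent radical; it is isomorphic to the quotient of \<open>P\<close> by
  the unipotent radical, hence automatically reductive.\<close>

definition levi_subgroup :: "('n::finite) rmat set \<Rightarrow> 'n rmat set \<Rightarrow> bool" where
  "levi_subgroup L P \<longleftrightarrow> subgroup L SL \<and> closed L \<and> L \<inter> unipotent_radical P = {mat 1} \<and>
     P = {l ** n | l n. l \<in> L \<and> n \<in> unipotent_radical P}"

definition center_of :: "('n::finite) rmat set \<Rightarrow> 'n rmat set" where
  "center_of L = {z \<in> L. \<forall>l \<in> L. z ** l = l ** z}"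

definition centralizer_SL :: "('n::finite) rmat set \<Rightarrow> 'n rmat set" where
  "centralizer_SL A = {g \<in> carrier SL. \<forall>a \<in> A. g ** a = a ** g}"

text \<open>Split: simultaneously diagonalizable over the reals.\<close>

definition split_group :: "('n::finite) rmat set \<Rightarrow> bool" where
  "split_group A \<longleftrightarrow> (\<exists>g. invertible g \<and> (\<forall>a \<in> A. \<forall>i j. i \<noteq> j \<longrightarrow> (Ad g a) $ i $ j = 0))"

definition connected_split_central :: "('n::finite) rmat set \<Rightarrow> 'n rmat set \<Rightarrow> bool" where
  "connected_split_central A L \<longleftrightarrow>
     subgroup A SL \<and> A \<subseteq> center_of L \<and> connected A \<and> split_group A"

definition split_component :: "('n::finite) rmat set \<Rightarrow> 'n rmat set \<Rightarrow> bool" where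
  "split_component A P \<longleftrightarrow> (\<exists>L. levi_subgroup L P \<and> connected_split_central A L \<and>
     (\<forall>B. connected_split_central B L \<and> A \<subseteq> B \<longrightarrow> B = A))"

definition sigma_split_component :: "('n::{finite,linorder}) rmat set \<Rightarrow> 'n rmat set \<Rightarrow> bool" where
  "sigma_split_component A P \<longleftrightarrow> split_component A P \<and> sigma ` A = A"

definition maximal_compact_subgroup :: "('n::finite) rmat set \<Rightarrow> 'n rmat set \<Rightarrow> bool" where
  "maximal_compact_subgroup M L \<longleftrightarrow> subgroup M SL \<and> M \<subseteq> L \<and> compact M \<and>
     (\<forall>M'. subgroup M' SL \<and> M' \<subseteq> L \<and> compact M' \<and> M \<subseteq> M' \<longrightarrow> M' = M)"

text \<open>
  The \<open>\<sigma>\<close>-parabolic rank and \<open>\<hh>\<close>-compatibility do not depend on the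
  \<open>\<sigma>\<close>-stable split component, since these components are all conjugate under
  \<open>N\<^sub>P \<inter> H\<close>; below one such component is quantified existentially.
  The dimension of \<open>A/(A \<inter> H)\<close> is the difference of the dimensions of the Lie algebras.
\<close>

definition sigma_rank_is :: "('n::{finite,linorder}) rmat set \<Rightarrow> nat \<Rightarrow> bool" where
  "sigma_rank_is P r \<longleftrightarrow> (\<exists>A. sigma_split_component A P \<and>
     dim (lie_alg A) - dim (lie_alg (A \<inter> Hgrp)) = r)"

definition cal_P :: "('n::{finite,linorder}) rmat set set" where
  "cal_P = {P \<in> min_parabolics. sigma_rank_is P 1}"

definition cal_Q :: "('n::{finite,linorder}) rmat set set" where
  "cal_Q = {P \<in> min_parabolics. sigma_rank_is P 0}"

text \<open>Linear functionals on \<open>\<aa>\<close> are extended by \<open>0\<close> outside \<open>\<aa>\<close>,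
  so that they are determined as functions by their values on \<open>\<aa>\<close>.\<close>

definition dual_space :: "('n::finite) rmat set \<Rightarrow> ('n rmat \<Rightarrow> real) set" where
  "dual_space \<aa> = {\<alpha>. (\<forall>X \<in> \<aa>. \<forall>Y \<in> \<aa>. \<alpha> (X + Y) = \<alpha> X + \<alpha> Y) \<and>
     (\<forall>c. \<forall>X \<in> \<aa>. \<alpha> (c *\<^sub>R X) = c * \<alpha> X) \<and> (\<forall>X. X \<notin> \<aa> \<longrightarrow> \<alpha> X = 0)}"

definition root_space :: "('n::finite) rmat set \<Rightarrow> ('n rmat \<Rightarrow> real) \<Rightarrow> 'n rmat set" where
  "root_space \<aa> \<alpha> = {X \<in> sl. \<forall>Y \<in> \<aa>. Y ** X - X ** Y = \<alpha> Y *\<^sub>R X}"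

definition roots :: "('n::finite) rmat set \<Rightarrow> ('n rmat \<Rightarrow> real) set" where
  "roots \<aa> = {\<alpha> \<in> dual_space \<aa>. \<alpha> \<noteq> (\<lambda>X. 0) \<and> root_space \<aa> \<alpha> \<noteq> {0}}"

definition roots_of :: "('n::finite) rmat set \<Rightarrow> 'n rmat set \<Rightarrow> ('n rmat \<Rightarrow> real) set" where
  "roots_of \<aa> P = {\<alpha> \<in> roots \<aa>. root_space \<aa> \<alpha> \<subseteq> lie_alg (unipotent_radical P)}"

definition roots_h :: "('n::{finite,linorder}) rmat set \<Rightarrow> ('n rmat \<Rightarrow> real) set" where
  "roots_h \<aa> = {\<alpha> \<in> roots \<aa>. root_space \<aa> \<alpha> \<inter> h_alg \<noteq> {0}}"

definition rho :: "('n::finite) rmat set \<Rightarrow> 'n rmat set \<Rightarrow> 'n rmat \<Rightarrow> real" where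
  "rho \<aa> P X = (1/2) * (\<Sum>\<alpha> \<in> roots_of \<aa> P. \<alpha> X)"

definition rho_h :: "('n::{finite,linorder}) rmat set \<Rightarrow> 'n rmat set \<Rightarrow> 'n rmat \<Rightarrow> real" where
  "rho_h \<aa> P X = (1/2) * (\<Sum>\<alpha> \<in> roots_of \<aa> P \<inter> roots_h \<aa>. \<alpha> X)"

text \<open>The inner product on \<open>\<aa>\<^sup>*\<close> dual to the restriction of the trace form to
  \<open>\<aa>\<close>, through the elements of \<open>\<aa>\<close> representing the functionals.\<close>

definition dual_vec :: "('n::finite) rmat set \<Rightarrow> ('n rmat \<Rightarrow> real) \<Rightarrow> 'n rmat" where
  "dual_vec \<aa> \<alpha> = (THE Y. Y \<in> \<aa> \<and> (\<forall>X \<in> \<aa>. trace (X ** Y) = \<alpha> X))"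

definition dual_inner ::
  "('n::finite) rmat set \<Rightarrow> ('n rmat \<Rightarrow> real) \<Rightarrow> ('n rmat \<Rightarrow> real) \<Rightarrow> real" where
  "dual_inner \<aa> \<alpha> \<beta> = trace (dual_vec \<aa> \<alpha> ** dual_vec \<aa> \<beta>)"

definition h_compatible :: "('n::{finite,linorder}) rmat set \<Rightarrow> bool" where
  "h_compatible P \<longleftrightarrow> (\<exists>A. sigma_split_component A P \<and>
     (P \<in> cal_P \<and> (\<forall>\<alpha> \<in> roots_of (lie_alg A) P.
          dual_inner (lie_alg A) \<alpha> (rho_h (lie_alg A) P) \<ge> 0) \<or>
      P \<in> cal_Q \<and> (\<forall>\<alpha> \<in> roots_of (lie_alg A) P.
          dual_inner (lie_alg A) \<alpha> (rho_h (lie_alg A) P) > 0)))"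

definition cal_P_h :: "('n::{finite,linorder}) rmat set set" where
  "cal_P_h = {P \<in> cal_P. h_compatible P}"

definition cal_P_star :: "('n::{finite,linorder}) rmat set set" where
  "cal_P_star = {P \<in> cal_P. \<forall>Q \<in> (cal_P :: 'n rmat set set).
     dim (lie_alg (unipotent_radical Q \<inter> Hgrp)) \<le> dim (lie_alg (unipotent_radical P \<inter> Hgrp))}"

text \<open>The homogeneous space \<open>N/J\<close>, for a subgroup \<open>J\<close> of \<open>N\<close>, is the set of left
  cosets \<open>nJ\<close>, with the quotient topology.\<close>

definition coset_space :: "('n::finite) rmat set \<Rightarrow> 'n rmat set \<Rightarrow> 'n rmat set set" where
  "coset_space N J = lcosets\<^bsub>SL\<lparr>carrier := N\<rparr>\<^esub> J"

definition coset_topology :: "('n::finite) rmat set \<Rightarrow> 'n rmat set \<Rightarrow> 'n rmat set topology" where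
  "coset_topology N J = topology (\<lambda>U. U \<subseteq> coset_space N J \<and>
     openin (top_of_set N) {n \<in> N. n <#\<^bsub>SL\<^esub> J \<in> U})"

lemma openin_coset_topology:
  "openin (coset_topology N J) U \<longleftrightarrow>
     U \<subseteq> coset_space N J \<and> openin (top_of_set N) {n \<in> N. n <#\<^bsub>SL\<^esub> J \<in> U}"
proof -
  have "istopology (\<lambda>U. U \<subseteq> coset_space N J \<and>
     openin (top_of_set N) {n \<in> N. n <#\<^bsub>SL\<^esub> J \<in> U})"
    unfolding istopology_def
  proof (intro conjI allI impI)
    fix U V
    assume "U \<subseteq> coset_space N J \<and> openin (top_of_set N) {n \<in> N. n <#\<^bsub>SL\<^esub> J \<in> U}"
      "V \<subseteq> coset_space N J \<and> openin (top_of_set N) {n \<in> N. n <#\<^bsub>SL\<^esub> J \<in> V}"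
    moreover have "{n \<in> N. n <#\<^bsub>SL\<^esub> J \<in> U \<inter> V} =
      {n \<in> N. n <#\<^bsub>SL\<^esub> J \<in> U} \<inter> {n \<in> N. n <#\<^bsub>SL\<^esub> J \<in> V}" by auto
    ultimately show "U \<inter> V \<subseteq> coset_space N J"
      "openin (top_of_set N) {n \<in> N. n <#\<^bsub>SL\<^esub> J \<in> U \<inter> V}"
      by (auto intro: openin_Int)
  next
    fix \<K>
    assume K: "\<forall>U\<in>\<K>. U \<subseteq> coset_space N J \<and>
      openin (top_of_set N) {n \<in> N. n <#\<^bsub>SL\<^esub> J \<in> U}"
    have "{n \<in> N. n <#\<^bsub>SL\<^esub> J \<in> \<Union>\<K>} = \<Union>((\<lambda>U. {n \<in> N. n <#\<^bsub>SL\<^esub> J \<in> U}) ` \<K>)"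
      by auto
    with K show "openin (top_of_set N) {n \<in> N. n <#\<^bsub>SL\<^esub> J \<in> \<Union>\<K>}"
      by (auto intro!: openin_Union)
    show "\<Union>\<K> \<subseteq> coset_space N J" using K by auto
  qed
  then show ?thesis
    by (simp add: coset_topology_def topology_inverse')
qed

definition radon_measure :: "'a topology \<Rightarrow> 'a measure \<Rightarrow> bool" where
  "radon_measure T \<mu> \<longleftrightarrow>
     space \<mu> = topspace T \<and> sets \<mu> = sigma_sets (topspace T) {U. openin T U} \<and>
     (\<forall>C. compactin T C \<longrightarrow> emeasure \<mu> C < \<infinity>) \<and>
     (\<forall>E \<in> sets \<mu>. emeasure \<mu> E = (INF U \<in> {U. openin T U \<and> E \<subseteq> U}. emeasure \<mu> U)) \<and>
     (\<forall>U. openin T U \<longrightarrow> emeasure \<mu> U = (SUP C \<in> {C. compactin T C \<and> C \<subseteq> U}. emeasure \<mu> C))"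

definition nonzero_invariant_radon ::
  "('n::finite) rmat set \<Rightarrow> 'n rmat set \<Rightarrow> 'n rmat set measure \<Rightarrow> bool" where
  "nonzero_invariant_radon N J \<mu> \<longleftrightarrow> radon_measure (coset_topology N J) \<mu> \<and>
     emeasure \<mu> (space \<mu>) \<noteq> 0 \<and>
     (\<forall>n \<in> N. \<forall>E \<in> sets \<mu>. emeasure \<mu> ((\<lambda>c. n <#\<^bsub>SL\<^esub> c) ` E) = emeasure \<mu> E)"

text \<open>
  \<open>hor_int dn P \<phi> g\<close> is the integral of \<open>n \<mapsto> \<phi> (g n)\<close> over \<open>N\<^sub>P/(N\<^sub>P \<inter> H)\<close>
  with respect to the measure \<open>dn P\<close>. For right \<open>H\<close>-invariant \<open>\<phi>\<close> the integrand does not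
  depend on the representative of the coset.
\<close>

definition hor_int :: "(('n::{finite,linorder}) rmat set \<Rightarrow> 'n rmat set measure) \<Rightarrow> 'n rmat set \<Rightarrow>
    ('n rmat \<Rightarrow> complex) \<Rightarrow> 'n rmat \<Rightarrow> complex" where
  "hor_int dn P \<phi> g = (\<integral>c. \<phi> (g ** (SOME n. n \<in> c)) \<partial>(dn P))"

text \<open>Determinant of (the restriction of) \<open>f\<close> on an \<open>f\<close>-stable subspace \<open>V\<close>: the Leibniz formula
  for the matrix of \<open>f\<close> with respect to some basis of \<open>V\<close>.\<close>

definition det_on :: "'a::euclidean_space set \<Rightarrow> ('a \<Rightarrow> 'a) \<Rightarrow> real" where
  "det_on V f = (let B = (SOME B. B \<subseteq> V \<and> independent B \<and> span B = V) in
     (\<Sum>p \<in> {p. p permutes B}. of_int (sign p) * (\<Prod>b \<in> B. representation B (f b) (p b))))"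

definition lie_centralizer :: "('n::finite) rmat set \<Rightarrow> 'n rmat set" where
  "lie_centralizer V = {X \<in> sl. \<forall>Y \<in> V. Y ** X = X ** Y}"

definition delta_P ::
  "('n::{finite,linorder}) rmat set \<Rightarrow> 'n rmat set \<Rightarrow> 'n rmat \<Rightarrow> real" where
  "delta_P P A l = (let \<nn> = lie_alg (unipotent_radical P) in
     sqrt \<bar>det_on \<nn> (Ad l) / det_on (\<nn> \<inter> lie_centralizer (lie_alg A \<inter> q_alg)) (Ad l)\<bar>)"

definition H_P :: "(('n::{finite,linorder}) rmat set \<Rightarrow> 'n rmat set measure) \<Rightarrow> 'n rmat set \<Rightarrow>
    'n rmat set \<Rightarrow> ('n rmat \<Rightarrow> complex) \<Rightarrow> 'n rmat \<Rightarrow> complex" where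
  "H_P dn P A \<phi> l = of_real (delta_P P A l) * hor_int dn P \<phi> l"

definition admissible ::
  "('n::{finite,linorder}) rmat set \<Rightarrow> 'n rmat set \<Rightarrow> 'n rmat \<Rightarrow> bool" where
  "admissible P A v \<longleftrightarrow> sigma_split_component A P \<and> v \<in> lie_alg A \<inter> q_alg \<and> rho (lie_alg A) P v > 0"

definition mu :: "(('n::{finite,linorder}) rmat set \<Rightarrow> 'n rmat set measure) \<Rightarrow> 'n rmat set \<Rightarrow>
    'n rmat set \<Rightarrow> 'n rmat \<Rightarrow> ('n rmat \<Rightarrow> complex) \<Rightarrow> complex" where
  "mu dn P A v \<phi> = Lim at_top (\<lambda>t::real. H_P dn P A \<phi> (mat_exp (t *\<^sub>R v)))"

end

theory Submission
 imports Defs 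
begin

text \<open>
  A point \<open>g H\<close> of the symmetric space is a rank one idempotent \<open>\<xi> \<eta>\<close>, and a minimal parabolic subgroup is a
  full flag; its position relative to the involution singles out two indices \<open>j \<le> i\<close>, with \<open>j = i\<close> in rank zero.
  \<open>P\<close> has maximal stabilizer iff \<open>j\<close> and \<open>i\<close> are adjacent, and it is compatible iff the numbers \<open>L\<close> of indices
  below \<open>j\<close> and \<open>R\<close> above \<open>i\<close> differ by at most one. A horosphere is an affine space of idempotents, so the
  integrals become Lebesgue integrals of functions bounded by
  \<open>(|\<xi>| |\<eta>|)\<^sup>-\<^sup>(\<^sup>n\<^sup>-\<^sup>1\<^sup>)\<^sup>/\<^sup>2\<close> times arbitrary powers of a logarithm. These factor into one-variable
  integrals, which gives rapid decay on the side where both vectors grow; on the other side one rescales: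
  for \<open>L = R\<close> the decay persists, while for \<open>|L - R| = 1\<close> dominated convergence yields the horospherical integral
  of a parabolic of rank zero with pivot \<open>i\<close> or \<open>j\<close>.
\<close>

text \<open>The problem is exactly critical. A horosphere has n - 1 free coordinates, and kappa = (n
  - 1)/2 powers of each of two vectors are to be spread over them: this leaves 1/|x| for each
  coordinate, and only the logarithms make it integrable. The first vector has L coordinates of its
  own, the second R, and one coordinate x_j enters both. Since n = L + R + 2, compatibility says L,
  R \<le> kappa, so that no coordinate needs more than its share. The shared coordinate appears as
  x_j in one vector and as 2 - x_j in the other; these are never small together, and x_j |-> 2 - x_j
  exchanges the vectors. Along exp(t v) the scale is tau = exp(- t c) and the modulus 1/tau, so
  every estimate must produce exactly one factor tau.

  The measures are given only up to positive factors that may vary with P. The limit is therefore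
  found up to a constant first, and a diagonal matrix that multiplies the integral by that constant
  absorbs it into g. The same g must serve all Schwartz functions and all choices of A and
  v.\<close>

type_synonym 'n rvec = "real^'n"

subsection \<open>Matrices, the reflection and its centralizer\<close>

text \<open>\<open>matrix_inv\<close> is defined by choice; for square matrices a one-sided inverse
  already pins it down.\<close>

lemma matrix_inv_eqI:
 fixes A B :: "'n::finite rmat"
 assumes "A ** B = mat 1"
 shows "matrix_inv A = B"
proof -
 have BA: "B ** A = mat 1" using assms matrix_left_right_inverse by blast
 have "A ** matrix_inv A = mat 1 \<and> matrix_inv A ** A = mat 1"
  unfolding matrix_inv_def by (rule someI[of _ B]) (use assms BA in auto)
 then have "B ** (A ** matrix_inv A) = B" by simp
 then show ?thesis using BA by (simp add: matrix_mul_assoc)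
qed

lemma matrix_inv_mult_cancel:
 fixes A :: "'n::finite rmat"
 assumes "invertible A"
 shows "A ** matrix_inv A = mat 1" "matrix_inv A ** A = mat 1"
proof -
 obtain B where B: "A ** B = mat 1" "B ** A = mat 1" using assms invertible_def by blast
 then show "A ** matrix_inv A = mat 1" "matrix_inv A ** A = mat 1"
  using matrix_inv_eqI[OF B(1)] by auto
qed

lemma mem_SL: "g \<in> carrier SL \<longleftrightarrow> det g = 1"
 by (simp add: SL_def)

lemma mult_SL [simp]: "x \<otimes>\<^bsub>SL\<^esub> y = x ** y"
 by (simp add: SL_def)

lemma one_SL [simp]: "\<one>\<^bsub>SL\<^esub> = mat 1"
 by (simp add: SL_def)

lemma SL_invertible: "g \<in> carrier SL ==> invertible g"
 by (simp add: mem_SL invertible_det_nz)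

lemmas SL_cancel = matrix_inv_mult_cancel[OF SL_invertible]

lemma SL_cancel_left:
 fixes g :: "'n::finite rmat"
 assumes "g \<in> carrier SL"
 shows "g ** (matrix_inv g ** X) = X" "matrix_inv g ** (g ** X) = X"
  "X ** g ** matrix_inv g = X" "X ** matrix_inv g ** g = X"
 by (simp_all add: matrix_mul_assoc SL_cancel[OF assms])
  (simp_all add: matrix_mul_assoc[symmetric] SL_cancel[OF assms])

lemma SL_cancel_vec:
 fixes g :: "'n::finite rmat"
 assumes "g \<in> carrier SL"
 shows "g *v (matrix_inv g *v x) = x" "matrix_inv g *v (g *v x) = x"
  "x v* g v* matrix_inv g = x" "x v* matrix_inv g v* g = x"
 by (simp_all add: matrix_vector_mul_assoc vector_matrix_mul_assoc SL_cancel[OF assms])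

lemma matrix_inv_mult:
 fixes A B :: "'n::finite rmat"
 assumes "invertible A" "invertible B"
 shows "matrix_inv (A ** B) = matrix_inv B ** matrix_inv A"
proof (rule matrix_inv_eqI)
 have "A ** B ** (matrix_inv B ** matrix_inv A) = A ** (B ** matrix_inv B) ** matrix_inv A"
  by (simp add: matrix_mul_assoc)
 then show "A ** B ** (matrix_inv B ** matrix_inv A) = mat 1"
  by (simp add: matrix_inv_mult_cancel assms)
qed

lemma SL_mult [intro]: "g \<in> carrier SL ==> h \<in> carrier SL ==> g ** h \<in> carrier SL"
 by (simp add: mem_SL det_mul)

lemma SL_one [simp, intro]: "mat 1 \<in> carrier SL"
 by (simp add: mem_SL)

lemma SL_inv [intro]: 
 fixes g :: "'n::finite rmat"
 assumes "g \<in> carrier SL" shows "matrix_inv g \<in> carrier SL"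
proof -
 have "det g * det (matrix_inv g) = 1"
  using SL_cancel(1)[OF assms] by (metis det_I det_mul)
 then show ?thesis using assms by (simp add: mem_SL)
qed

lemma SL_inv_mult:
 fixes g h :: "'n::finite rmat"
 assumes "g \<in> carrier SL" "h \<in> carrier SL"
 shows "matrix_inv (g ** h) = matrix_inv h ** matrix_inv g"
 by (rule matrix_inv_mult) (use assms SL_invertible in auto)

lemma SL_inv_inv:
 fixes g :: "'n::finite rmat"
 assumes "g \<in> carrier SL" shows "matrix_inv (matrix_inv g) = g"
 by (rule matrix_inv_eqI) (simp add: SL_cancel[OF assms])

lemma group_SL: "group (SL :: 'n::finite rmat monoid)"
proof (rule groupI)
 fix x :: "'n rmat" assume "x \<in> carrier SL"
 then show "\<exists>y\<in>carrier SL. y \<otimes>\<^bsub>SL\<^esub> x = \<one>\<^bsub>SL\<^esub>"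
  by (intro bexI[of _ "matrix_inv x"]) (auto simp: SL_cancel)
qed (auto simp: matrix_mul_assoc)

lemma inv_SL: 
 fixes g :: "'n::finite rmat"
 assumes "g \<in> carrier SL" shows "inv\<^bsub>SL\<^esub> g = matrix_inv g"
proof -
 interpret group "SL :: 'n rmat monoid" by (rule group_SL)
 show ?thesis using assms by (intro inv_equality) (auto simp: SL_cancel)
qed

lemma subgroup_SL_iff:
 fixes K :: "'n::finite rmat set"
 shows "subgroup K SL \<longleftrightarrow> K \<subseteq> carrier SL \<and> mat 1 \<in> K \<and> (\<forall>x\<in>K. \<forall>y\<in>K. x ** y \<in> K) \<and>
  (\<forall>x\<in>K. matrix_inv x \<in> K)"
proof -
 interpret group "SL :: 'n rmat monoid" by (rule group_SL)
 have "(\<forall>x\<in>K. inv\<^bsub>SL\<^esub> x \<in> K) \<longleftrightarrow> (\<forall>x\<in>K. matrix_inv x \<in> K)" if "K \<subseteq> carrier SL"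
  using that inv_SL by (metis subsetD)
 then show ?thesis unfolding subgroup_def by auto
qed

definition outer :: "real^'n => real^'n => 'n::finite rmat" where
 "outer x y = (\<chi> k l. x $ k * y $ l)"

lemma outer_nth [simp]: "outer x y $ k $ l = x $ k * y $ l"
 by (simp add: outer_def)

lemma mult_outer: "A ** outer x y = outer (A *v x) y"
 by (simp add: vec_eq_iff matrix_matrix_mult_def matrix_vector_mult_def sum_distrib_right mult.assoc)

lemma outer_mult: "outer x y ** A = outer x (y v* A)"
 by (simp add: vec_eq_iff matrix_matrix_mult_def vector_matrix_mult_def sum_distrib_left mult_ac)

lemma outer_mult_vec: "outer x y *v z = (y \<bullet> z) *\<^sub>R x"
 by (simp add: vec_eq_iff matrix_vector_mult_def inner_vec_def sum_distrib_left mult_ac)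

lemma outer_scaleR: "outer (c *\<^sub>R x) y = c *\<^sub>R outer x y" "outer x (c *\<^sub>R y) = c *\<^sub>R outer x y"
 by (simp_all add: vec_eq_iff)

lemma norm_outer: "norm (outer x y) = norm x * norm y"
proof -
 have "(norm (outer x y))\<^sup>2 = (\<Sum>k\<in>UNIV. \<Sum>l\<in>UNIV. (x $ k * x $ k) * (y $ l * y $ l))"
  unfolding power2_norm_eq_inner inner_vec_def by (intro sum.cong refl) (simp add: mult_ac)
 also have "\<dots> = (norm x)\<^sup>2 * (norm y)\<^sup>2"
  unfolding power2_norm_eq_inner inner_vec_def by (simp add: sum_product)
 finally have "(norm (outer x y))\<^sup>2 = (norm x * norm y)\<^sup>2" by (simp add: power_mult_distrib)
 then show ?thesis by (metis norm_ge_zero mult_nonneg_nonneg power2_eq_iff_nonneg)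
qed

text \<open>Unit vector spanning the -1 eigenspace of \<open>Smat\<close>, which is thus the
  orthogonal reflection along \<open>uvec\<close>.\<close>

definition uvec :: "real^'n::{finite,linorder}" where
 "uvec = (1 / sqrt 2) *\<^sub>R (axis first_ix 1 + axis last_ix 1)"

lemma first_neq_last:
 assumes "CARD('n::{finite,linorder}) \<ge> 2"
 shows "(first_ix :: 'n) ~= last_ix"
proof
 assume eq: "(first_ix :: 'n) = last_ix"
 have "x = first_ix" for x :: 'n
  using Min_le[of UNIV x] Max_ge[of UNIV x] eq unfolding first_ix_def last_ix_def
  by (metis UNIV_I antisym finite)
 then have "UNIV = {first_ix :: 'n}" by auto
 then have "CARD('n) = 1" by (metis card_1_singleton_iff is_singletonI is_singleton_altdef)
 then show False using assms by simp
qed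

lemma uvec_inner:
 assumes "CARD('n::{finite,linorder}) \<ge> 2"
 shows "(uvec :: 'n rvec) \<bullet> uvec = 1"
 using first_neq_last[OF assms] 
 by (simp add: uvec_def inner_add_left inner_add_right inner_axis_axis)

lemma mat_mult_minus [simp]:
 fixes A B C :: "'n::finite rmat"
 shows "(A - B) ** C = A ** C - B ** C" "C ** (A - B) = C ** A - C ** B"
  "(- A) ** C = - (A ** C)" "C ** (- A) = - (C ** A)"
 by (simp_all add: vec_eq_iff matrix_matrix_mult_def sum_subtractf algebra_simps sum_negf)

lemma mat_mult_plus [simp]:
 fixes A B C :: "'n::finite rmat"
 shows "(A + B) ** C = A ** C + B ** C" "C ** (A + B) = C ** A + C ** B"
 by (simp_all add: vec_eq_iff matrix_matrix_mult_def sum.distrib algebra_simps)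

lemma mat_mult_scaleR [simp]:
 fixes A C :: "'n::finite rmat"
 shows "(c *\<^sub>R A) ** C = c *\<^sub>R (A ** C)" "C ** (c *\<^sub>R A) = c *\<^sub>R (C ** A)"
 by (simp_all add: vec_eq_iff matrix_matrix_mult_def sum_distrib_left mult_ac)

lemma mat_mult_zero [simp]:
 fixes A :: "'n::finite rmat"
 shows "0 ** A = 0" "A ** 0 = 0"
 by (simp_all add: vec_eq_iff matrix_matrix_mult_def)

lemma Smat_uvec:
 assumes "CARD('n::{finite,linorder}) \<ge> 2"
 shows "(Smat :: 'n rmat) = mat 1 - 2 *\<^sub>R outer uvec uvec"
 using first_neq_last[OF assms] 
 by (auto simp: vec_eq_iff Smat_def uvec_def mat_def axis_def)

lemma Smat_Smat:
 assumes "CARD('n::{finite,linorder}) \<ge> 2"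
 shows "(Smat :: 'n rmat) ** Smat = mat 1"
 by (simp add: Smat_uvec[OF assms] mult_outer outer_mult_vec uvec_inner[OF assms] outer_scaleR
  matrix_vector_mult_diff_rdistrib scaleR_matrix_vector_assoc[symmetric])
  (simp add: vec_eq_iff)

lemma matrix_inv_Smat:
 assumes "CARD('n::{finite,linorder}) \<ge> 2"
 shows "matrix_inv (Smat :: 'n rmat) = Smat"
 by (rule matrix_inv_eqI[OF Smat_Smat[OF assms]])

lemma sigma_eq:
 assumes "CARD('n::{finite,linorder}) \<ge> 2"
 shows "sigma (X :: 'n rmat) = Smat ** X ** Smat"
 by (simp add: sigma_def matrix_inv_Smat[OF assms])

text \<open>\<open>Smat\<close> is its own inverse, so a fixed point is a matrix commuting with
  \<open>Smat\<close>, and only the rank one part \<open>outer uvec uvec\<close> can obstruct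
  this.\<close>

lemma sigma_fixed_iff:
 assumes "CARD('n::{finite,linorder}) \<ge> 2"
 shows "sigma (X :: 'n rmat) = X \<longleftrightarrow> outer (X *v uvec) uvec = outer uvec (uvec v* X)"
proof -
 have "sigma X = X \<longleftrightarrow> Smat ** X = X ** Smat"
  unfolding sigma_eq[OF assms]
  by (metis Smat_Smat[OF assms] matrix_mul_assoc matrix_mul_rid)
 also have "\<dots> \<longleftrightarrow> outer (X *v uvec) uvec = outer uvec (uvec v* X)"
  by (auto simp: Smat_uvec[OF assms] mult_outer outer_mult)
 finally show ?thesis .
qed

text \<open>A point \<open>g H\<close> is recorded by \<open>orb g\<close>, the rank one idempotent with image \<open>g u\<close> and kernel
 \<open>g u\<^sup>\<bottom>\<close>; \<open>1 - 2 orb g = g S g\<^sup>-\<^sup>1\<close>.\<close>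

definition orb :: "'n::{finite,linorder} rmat => 'n rmat" where
 "orb g = outer (g *v uvec) (uvec v* matrix_inv g)"

lemma orb_mult:
 fixes g h :: "'n::{finite,linorder} rmat"
 assumes "g \<in> carrier SL" "h \<in> carrier SL"
 shows "orb (g ** h) = g ** orb h ** matrix_inv g"
 by (simp add: orb_def SL_inv_mult assms mult_outer outer_mult matrix_vector_mul_assoc
  vector_matrix_mul_assoc)

lemma Hgrp_iff:
 assumes "CARD('n::{finite,linorder}) \<ge> 2"
 shows "(h :: 'n rmat) \<in> Hgrp \<longleftrightarrow> h \<in> carrier SL \<and> orb h = outer uvec uvec"
proof (cases "h \<in> carrier SL")
 case True
 have "sigma h = h \<longleftrightarrow> outer (h *v uvec) uvec = outer uvec (uvec v* h)"
  by (rule sigma_fixed_iff[OF assms])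
 also have "\<dots> \<longleftrightarrow> h ** outer uvec uvec = outer uvec uvec ** h" by (simp add: mult_outer outer_mult)
 also have "\<dots> \<longleftrightarrow> h ** outer uvec uvec ** matrix_inv h = outer uvec uvec"
  by (metis SL_cancel_left(3,4)[OF True])
 also have "h ** outer uvec uvec ** matrix_inv h = orb h" by (simp add: orb_def mult_outer outer_mult)
 finally show ?thesis using True by (simp add: Hgrp_def)
qed (simp add: Hgrp_def)

text \<open>H is the stabilizer of \<open>outer uvec uvec\<close> under conjugation, so
  \<open>orb\<close> is injective on G/H. Right invariant functions therefore depend on
  \<open>orb g\<close> alone.\<close>

lemma orb_eq_iff:
 fixes g h :: "'n::{finite,linorder} rmat"
 assumes "CARD('n) \<ge> 2" and g: "g \<in> carrier SL" and h: "h \<in> carrier SL"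
 shows "orb g = orb h \<longleftrightarrow> matrix_inv g ** h \<in> Hgrp"
proof -
 have "orb h = orb (g ** (matrix_inv g ** h))" by (simp add: SL_cancel_left g)
 also have "\<dots> = g ** orb (matrix_inv g ** h) ** matrix_inv g" using g h by (intro orb_mult) auto
 finally have *: "orb h = g ** orb (matrix_inv g ** h) ** matrix_inv g" .
 have "orb g = g ** outer uvec uvec ** matrix_inv g" by (simp add: orb_def mult_outer outer_mult)
 have inj: "g ** X ** matrix_inv g = g ** Y ** matrix_inv g ==> X = Y" for X Y
 proof -
  assume "g ** X ** matrix_inv g = g ** Y ** matrix_inv g"
  then have "matrix_inv g ** (g ** X ** matrix_inv g ** g) = matrix_inv g ** (g ** Y ** matrix_inv g ** g)"
  by simp
  then show "X = Y" by (simp only: SL_cancel_left[OF g])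
 qed
 have "orb g = orb h \<longleftrightarrow> orb (matrix_inv g ** h) = outer uvec uvec"
  unfolding * \<open>orb g = _\<close> using inj by metis
 then show ?thesis using g h by (auto simp: Hgrp_iff[OF assms(1)])
qed

lemma subgroup_Hgrp:
 assumes "CARD('n::{finite,linorder}) \<ge> 2"
 shows "subgroup (Hgrp :: 'n rmat set) SL"
proof -
 have one: "orb (mat 1 :: 'n rmat) = outer uvec uvec"
  by (simp add: orb_def matrix_inv_eqI)
 have mult: "x ** y \<in> Hgrp" if "x \<in> Hgrp" "y \<in> Hgrp" for x y :: "'n rmat"
  using that by (auto simp: Hgrp_iff[OF assms] orb_mult) (simp add: orb_def mult_outer outer_mult)
 have inv: "matrix_inv x \<in> Hgrp" if "x \<in> Hgrp" for x :: "'n rmat"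
  using orb_eq_iff[OF assms, of x "mat 1"] that one by (auto simp: Hgrp_iff[OF assms])
 show ?thesis unfolding subgroup_SL_iff using one mult inv by (auto simp: Hgrp_iff[OF assms])
qed

subsection \<open>Triangular matrices\<close>

text \<open>Induction on the number of smaller elements; the index type is a finite linear order
  without a \<open>wellorder\<close> sort.\<close>

lemma finite_linorder_less_induct [case_names less]:
 fixes k :: "'n::{finite,linorder}"
 assumes "\<And>k. (\<And>l. l < k ==> P l) ==> P k"
 shows "P k"
proof (induct "card {..<k}" arbitrary: k rule: less_induct)
 case less
 show ?case
 proof (rule assms)
  fix l assume "l < k"
  then have "{..<l} \<subset> {..<k}" by auto
  then show "P l" by (intro less psubset_card_mono) auto
 qed
qed

text \<open>By induction p fixes everything below k, so p k < k would give p (p k) = p k, against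
  injectivity.\<close>

lemma permutes_decreasing_id:
 fixes p :: "'n::{finite,linorder} => 'n"
 assumes p: "p permutes UNIV" and le: "\<And>k. p k \<le> k"
 shows "p = id"
proof
 fix k show "p k = id k"
 proof (induct k rule: finite_linorder_less_induct)
  case (less k)
  show ?case
  proof (rule ccontr)
  assume "p k ~= id k"
  then have "p k < k" using le[of k] by auto
  then have "p (p k) = p k" using less by auto
  then have "p k = k" using permutes_inj[OF p] by (metis injD)
  with \<open>p k < k\<close> show False by simp
  qed
 qed
qed

lemma permutes_increasing_id:
 fixes p :: "'n::{finite,linorder} => 'n"
 assumes p: "p permutes UNIV" and le: "\<And>k. k \<le> p k"
 shows "p = id"
proof -
 have "Hilbert_Choice.inv p = id"
 proof (rule permutes_decreasing_id)
  show "Hilbert_Choice.inv p permutes UNIV" by (rule permutes_inv[OF p])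
  show "Hilbert_Choice.inv p k \<le> k" for k using le[of "Hilbert_Choice.inv p k"] permutes_inverses(1)[OF p] by simp
 qed
 then show ?thesis using permutes_inv_inv[OF p] by (metis inv_id)
qed

text \<open>A nonzero Leibniz term needs k \<le> p k for every k, which leaves the identity
  permutation.\<close>

lemma det_upper_triangular:
 fixes g :: "'n::{finite,linorder} rmat"
 assumes up: "\<And>k l. l < k ==> g $ k $ l = 0"
 shows "det g = (\<Prod>k\<in>UNIV. g $ k $ k)"
proof -
 have "det g = (\<Sum>p\<in>{id}. of_int (sign p) * (\<Prod>k\<in>UNIV. g $ k $ p k))"
  unfolding det_def
 proof (rule sum.mono_neutral_right)
  show "\<forall>p\<in>{p. p permutes UNIV} - {id}. of_int (sign p) * (\<Prod>k\<in>UNIV. g $ k $ p k) = 0"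
  proof
  fix p :: "'n => 'n" assume "p \<in> {p. p permutes UNIV} - {id}"
  then obtain k where "\<not> k \<le> p k" using permutes_increasing_id by blast
  then have "g $ k $ p k = 0" using up by auto
  then show "of_int (sign p) * (\<Prod>k\<in>UNIV. g $ k $ p k) = 0" by (auto intro!: prod_zero)
  qed
 qed (auto simp: permutes_id)
 then show ?thesis by (simp add: sign_id)
qed

lemma mult_upper_entry:
 fixes g h :: "'n::{finite,linorder} rmat"
 assumes "\<And>k l. l < k ==> g $ k $ l = 0" "\<And>k l. l < k ==> h $ k $ l = 0"
 shows "(g ** h) $ k $ l = (\<Sum>m\<in>{k..l}. g $ k $ m * h $ m $ l)"
 unfolding matrix_matrix_mult_def
 by (simp, rule sum.mono_neutral_right) (auto simp: not_le assms)

lemma upper_mult: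
 fixes g h :: "'n::{finite,linorder} rmat"
 assumes "\<And>k l. l < k ==> g $ k $ l = 0" "\<And>k l. l < k ==> h $ k $ l = 0"
 shows "l < k ==> (g ** h) $ k $ l = 0" "(g ** h) $ k $ k = g $ k $ k * h $ k $ k"
 by (simp_all add: mult_upper_entry assms)

lemma upper_inverse:
 fixes g :: "'n::{finite,linorder} rmat"
 assumes up: "\<And>k l. l < k ==> g $ k $ l = 0" and g: "g \<in> carrier SL" and lk: "l < k"
 shows "matrix_inv g $ k $ l = 0"
proof (rule ccontr)
 let ?h = "matrix_inv g"
 assume "?h $ k $ l ~= 0"
 \<comment> \<open>Take the last nonzero entry of column l below the diagonal, in row m. In row m of
   \<open>g ** matrix_inv g\<close> every other product vanishes, so this entry times the m-th
   diagonal entry of g is an off-diagonal entry of the identity.\<close>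
 define K where "K = {m. l < m \<and> ?h $ m $ l ~= 0}"
 define m where "m = Max K"
 have "K ~= {}" using \<open>?h $ k $ l ~= 0\<close> lk by (auto simp: K_def)
 then have m: "m \<in> K" "\<And>p. p \<in> K ==> p \<le> m" by (auto simp: m_def)
 have "(g ** ?h) $ m $ l = (\<Sum>p\<in>UNIV. g $ m $ p * ?h $ p $ l)" by (simp add: matrix_matrix_mult_def)
 also have "\<dots> = (\<Sum>p\<in>{m}. g $ m $ p * ?h $ p $ l)"
 proof (rule sum.mono_neutral_right)
  show "\<forall>p\<in>UNIV - {m}. g $ m $ p * ?h $ p $ l = 0"
  proof
  fix p assume "p \<in> UNIV - {m}"
  then consider "p < m" | "m < p" by force
  then show "g $ m $ p * ?h $ p $ l = 0"
  proof cases
  case 2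
  have "l < m" using m(1) by (simp add: K_def)
  then have "matrix_inv g $ p $ l = 0" using m(2)[of p] 2 by (force simp: K_def)
  then show ?thesis by simp
  qed (simp add: up)
  qed
 qed auto
 finally have "(g ** ?h) $ m $ l = g $ m $ m * ?h $ m $ l" by simp
 moreover have "(g ** ?h) $ m $ l = 0"
  unfolding SL_cancel(1)[OF g] using m(1) by (auto simp: mat_def K_def)
 ultimately have "g $ m $ m * ?h $ m $ l = 0" by simp
 moreover have "g $ m $ m ~= 0"
 proof -
  have "(\<Prod>k\<in>UNIV. g $ k $ k) = 1" using det_upper_triangular[of g] up g by (simp add: mem_SL)
  then have "(\<Prod>k\<in>UNIV. g $ k $ k) ~= 0" by simp
  then show ?thesis by (simp add: prod_zero_iff)
 qed
 ultimately show False using m by (auto simp: K_def)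
qed

abbreviation "Bup \<equiv> upper_triangular_SL"

lemma Bup_iff: "g \<in> Bup \<longleftrightarrow> g \<in> carrier SL \<and> (\<forall>k l. l < k --> g $ k $ l = 0)"
 by (auto simp: upper_triangular_SL_def)

lemma Bup_diag_nz: "g \<in> Bup ==> g $ k $ k ~= 0"
proof -
 assume g: "g \<in> Bup"
 then have "(\<Prod>k\<in>UNIV. g $ k $ k) ~= 0" using det_upper_triangular[of g] by (auto simp: Bup_iff mem_SL)
 then show ?thesis by (simp add: prod_zero_iff)
qed

lemma Bup_inv_diag: "g \<in> Bup ==> matrix_inv g $ k $ k = 1 / g $ k $ k"
proof -
 assume g: "g \<in> Bup"
 have "(g ** matrix_inv g) $ k $ k = g $ k $ k * matrix_inv g $ k $ k"
  by (rule upper_mult(2)) (use g upper_inverse[of g] in \<open>auto simp: Bup_iff\<close>)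
 then show ?thesis using g Bup_diag_nz[OF g] SL_cancel(1)[of g]
  by (simp add: Bup_iff mat_def divide_simps mult.commute)
qed

lemma subgroup_Bup: "subgroup (Bup :: 'n::{finite,linorder} rmat set) SL"
 unfolding subgroup_SL_iff by (auto simp: Bup_iff upper_mult upper_inverse) (auto simp: mat_def)

lemma Bup_inv: "(x :: 'n::{finite,linorder} rmat) \<in> Bup ==> matrix_inv x \<in> Bup"
 and Bup_mult: "(x :: 'n rmat) \<in> Bup ==> y \<in> Bup ==> x ** y \<in> Bup"
 using subgroup_Bup[where 'n = 'n] by (simp_all add: subgroup_SL_iff)

definition Uni :: "'n::{finite,linorder} rmat set" where
 "Uni = {g. (\<forall>k l. l < k --> g $ k $ l = 0) \<and> (\<forall>k. g $ k $ k = 1)}"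

lemma Uni_sub_Bup: "Uni \<subseteq> Bup"
 by (auto simp: Uni_def Bup_iff mem_SL det_upper_triangular)

lemma subgroup_Uni: "subgroup (Uni :: 'n::{finite,linorder} rmat set) SL"
proof -
 have inv: "matrix_inv x \<in> Uni" if x: "x \<in> Uni" for x :: "'n rmat"
 proof -
  have B: "x \<in> Bup" using x Uni_sub_Bup by blast
  then have "matrix_inv x \<in> Bup" by (rule Bup_inv)
  then show ?thesis using x Bup_inv_diag[OF B] by (auto simp: Uni_def Bup_iff)
 qed
 have "x ** y \<in> Uni" if "x \<in> Uni" "y \<in> Uni" for x y :: "'n rmat"
  using that by (auto simp: Uni_def upper_mult)
 with inv show ?thesis
  unfolding subgroup_SL_iff using Uni_sub_Bup by (auto simp: Bup_iff) (auto simp: Uni_def mat_def)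
qed

lemma Uni_inv: "(x :: 'n::{finite,linorder} rmat) \<in> Uni ==> matrix_inv x \<in> Uni"
 and Uni_mult: "(x :: 'n rmat) \<in> Uni ==> y \<in> Uni ==> x ** y \<in> Uni"
 using subgroup_Uni[where 'n = 'n] by (simp_all add: subgroup_SL_iff)

text \<open>Each factor moves the support at least one place further from the diagonal;
  \<open>card {k..<l}\<close> measures that distance.\<close>

lemma strict_upper_power:
 fixes X :: "'n::{finite,linorder} rmat"
 assumes "\<And>k l. l \<le> k ==> X $ k $ l = 0"
 shows "card {k..<l} < m \<or> l < k ==> mat_pow X m $ k $ l = 0"
proof (induct m arbitrary: k)
 case (Suc m)
 have "mat_pow X (Suc m) $ k $ l = (\<Sum>p\<in>UNIV. X $ k $ p * mat_pow X m $ p $ l)"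
  by (simp add: mat_pow_def matrix_matrix_mult_def)
 also have "\<dots> = 0"
 proof (rule sum.neutral, rule ballI)
  fix p
  show "X $ k $ p * mat_pow X m $ p $ l = 0"
  proof (cases "p \<le> k")
  case False
  have "card {p..<l} < m \<or> l < p"
  proof (cases "k < l")
  case True
  have "{p..<l} \<subset> {k..<l}" using False True by auto
  then have "card {p..<l} < card {k..<l}" by (simp add: psubset_card_mono)
  then show ?thesis using Suc(2) True by auto
  qed (use False in auto)
  then show ?thesis using Suc by simp
  qed (simp add: assms)
 qed
 finally show ?case .
qed (auto simp: mat_pow_def mat_def)

lemma strict_upper_nilpotent:
 fixes X :: "'n::{finite,linorder} rmat"
 assumes "\<And>k l. l \<le> k ==> X $ k $ l = 0"
 shows "mat_pow X (Suc CARD('n)) = 0"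
proof -
 have "mat_pow X (Suc CARD('n)) $ k $ l = 0" for k l
  using card_mono[of UNIV "{k..<l}"] by (intro strict_upper_power assms) auto
 then show ?thesis by (simp add: vec_eq_iff)
qed

lemma Uni_unipotent: "g \<in> Uni ==> unipotent (g :: 'n::{finite,linorder} rmat)"
 unfolding unipotent_def
 by (intro exI[of _ "Suc CARD('n)"] strict_upper_nilpotent) (auto simp: Uni_def mat_def le_less)

lemma upper_power:
 fixes X :: "'n::{finite,linorder} rmat"
 assumes "\<And>k l. l < k ==> X $ k $ l = 0"
 shows "(\<forall>k l. l < k --> mat_pow X m $ k $ l = 0) \<and> (\<forall>k. mat_pow X m $ k $ k = (X $ k $ k) ^ m)"
proof (induct m)
 case (Suc m)
 have "mat_pow X (Suc m) = X ** mat_pow X m" by (simp add: mat_pow_def)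
 then show ?case using Suc by (simp add: upper_mult assms)
qed (auto simp: mat_pow_def mat_def)

text \<open>The diagonal of a power of \<open>g - mat 1\<close> consists of the powers of its
  diagonal entries, and nilpotency forces these to vanish.\<close>

lemma Bup_unipotent:
 fixes g :: "'n::{finite,linorder} rmat"
 assumes "g \<in> Bup" "unipotent g"
 shows "g \<in> Uni"
proof -
 obtain m where m: "mat_pow (g - mat 1) m = 0" using assms(2) by (auto simp: unipotent_def)
 have "((g - mat 1) $ k $ k) ^ m = 0" for k
 proof -
  have "(\<forall>k. mat_pow (g - mat 1) m $ k $ k = ((g - mat 1) $ k $ k) ^ m)"
  by (rule conjunct2[OF upper_power]) (use assms(1) in \<open>auto simp: Bup_iff mat_def\<close>)
  then show ?thesis by (simp only: m zero_index)
 qed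
 then have "(g - mat 1) $ k $ k = 0" for k by (simp only: power_eq_0_iff)
 then have "g $ k $ k = 1" for k by (simp add: mat_def)
 then show ?thesis using assms(1) by (auto simp: Uni_def Bup_iff)
qed

subsection \<open>Conjugation\<close>

lemma Ad_mult:
 fixes g X Y :: "'n::finite rmat"
 assumes "g \<in> carrier SL"
 shows "Ad g X ** Ad g Y = Ad g (X ** Y)"
 by (simp add: Ad_def SL_cancel_left[OF assms] flip: matrix_mul_assoc)

lemma Ad_one [simp]: "g \<in> carrier SL ==> Ad g (mat 1) = mat 1"
 by (simp add: Ad_def SL_cancel)

lemma Ad_linear: "linear (Ad g :: 'n::finite rmat => 'n rmat)"
 by (rule linearI) (simp_all add: Ad_def)

lemma Ad_Ad:
 fixes g h X :: "'n::finite rmat"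
 assumes "g \<in> carrier SL" "h \<in> carrier SL"
 shows "Ad g (Ad h X) = Ad (g ** h) X"
 by (simp add: Ad_def SL_inv_mult assms matrix_mul_assoc)

lemma Ad_inv_cancel [simp]:
 fixes g X :: "'n::finite rmat"
 assumes "g \<in> carrier SL"
 shows "Ad g (Ad (matrix_inv g) X) = X" "Ad (matrix_inv g) (Ad g X) = X"
 using assms by (simp_all add: Ad_Ad SL_inv SL_cancel) (simp_all add: Ad_def matrix_inv_eqI)

lemma Ad_inj: "g \<in> carrier SL ==> inj (Ad g :: 'n::finite rmat => 'n rmat)"
 by (metis Ad_inv_cancel(2) injI)

lemma Ad_SL [intro]: "g \<in> carrier SL ==> X \<in> carrier SL ==> Ad g X \<in> carrier SL"
 by (auto simp: Ad_def)

lemma Ad_inverse: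
 fixes g X :: "'n::finite rmat"
 assumes "g \<in> carrier SL" "invertible X"
 shows "matrix_inv (Ad g X) = Ad g (matrix_inv X)"
 by (rule matrix_inv_eqI) (simp add: Ad_mult matrix_inv_mult_cancel assms)

lemma mat_pow_Ad:
 fixes g X :: "'n::finite rmat"
 assumes "g \<in> carrier SL"
 shows "mat_pow (Ad g X) m = Ad g (mat_pow X m)"
 by (induct m) (simp_all add: mat_pow_def assms Ad_mult)

lemma Ad_image_iff:
 fixes g X :: "'n::finite rmat"
 assumes "g \<in> carrier SL"
 shows "X \<in> Ad g ` V \<longleftrightarrow> Ad (matrix_inv g) X \<in> V"
proof
 assume "Ad (matrix_inv g) X \<in> V"
 then have "Ad g (Ad (matrix_inv g) X) \<in> Ad g ` V" by (rule imageI)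
 then show "X \<in> Ad g ` V" using assms by simp
qed (use assms in auto)

lemma unipotent_Ad:
 fixes g X :: "'n::finite rmat"
 assumes "g \<in> carrier SL"
 shows "unipotent (Ad g X) \<longleftrightarrow> unipotent X"
proof -
 have "mat_pow (Ad g X - mat 1) k = Ad g (mat_pow (X - mat 1) k)" for k
  using mat_pow_Ad[OF assms, of "X - mat 1"] linear_diff[OF Ad_linear, of g X "mat 1"]
  by (simp add: assms)
 then show ?thesis
  using Ad_inj[OF assms] linear_0[OF Ad_linear, of g] unfolding unipotent_def by (metis injD)
qed

lemma subgroup_Ad:
 fixes g :: "'n::finite rmat"
 assumes "g \<in> carrier SL" "subgroup K SL"
 shows "subgroup (Ad g ` K) SL"
 using assms unfolding subgroup_SL_iff
 by (auto simp: Ad_mult Ad_inverse SL_invertible subset_iff intro!: rev_image_eqI[of "mat 1"])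

lemma SL_sub_group:
 fixes K :: "'n::finite rmat set"
 assumes "subgroup K SL"
 shows "group (SL\<lparr>carrier := K\<rparr>)"
 using group.subgroup_imp_group[OF group_SL assms] .

text \<open>The radical is a union over all connected normal unipotent subgroups. Each of them lies
  in the conjugate of \<open>Uni\<close>, because a unipotent triangular matrix has unit diagonal;
  and this conjugate is itself one of them, connected because \<open>Uni\<close> is convex.\<close>

lemma unipotent_radical_conj:
 fixes g :: "'n::{finite,linorder} rmat"
 assumes g: "g \<in> carrier SL"
 shows "unipotent_radical (Ad g ` Bup) = Ad g ` Uni"
proof
 show "unipotent_radical (Ad g ` Bup) \<subseteq> Ad g ` Uni"
 proof
  fix x assume "x \<in> unipotent_radical (Ad g ` Bup)"
  then obtain N where N: "N \<lhd> (SL\<lparr>carrier := Ad g ` Bup\<rparr>)" "\<forall>g\<in>N. unipotent g" "x \<in> N"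
  by (auto simp: unipotent_radical_def)
  then have "x \<in> Ad g ` Bup" using normal_imp_subgroup[OF N(1)] subgroup.subset by fastforce
  then obtain b where b: "b \<in> Bup" "x = Ad g b" by auto
  have "unipotent (Ad g b)" using N b by auto
  then have "b \<in> Uni" using Bup_unipotent[OF b(1)] unipotent_Ad[OF g] by blast
  then show "x \<in> Ad g ` Uni" using b by auto
 qed
 have sP: "subgroup (Ad g ` Bup) SL" by (rule subgroup_Ad[OF g subgroup_Bup])
 have sN: "subgroup (Ad g ` Uni) SL" by (rule subgroup_Ad[OF g subgroup_Uni])
 interpret G: group "SL :: 'n rmat monoid" by (rule group_SL)
 have NP: "Ad g ` Uni \<subseteq> Ad g ` Bup" using Uni_sub_Bup by auto
 have "Ad g ` Uni \<lhd> (SL\<lparr>carrier := Ad g ` Bup\<rparr>)"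
 proof (rule group.normal_invI[OF SL_sub_group[OF sP]])
  show "subgroup (Ad g ` Uni) (SL\<lparr>carrier := Ad g ` Bup\<rparr>)"
  using G.subgroup_incl[OF sN sP NP] .
  fix x h assume x: "x \<in> carrier (SL\<lparr>carrier := Ad g ` Bup\<rparr>)" and h: "h \<in> Ad g ` Uni"
  obtain b where b: "b \<in> Bup" "x = Ad g b" using x by auto
  obtain n where n: "n \<in> Uni" "h = Ad g n" using h by auto
  have bS: "b \<in> carrier SL" using b by (auto simp: Bup_iff)
  have "inv\<^bsub>SL\<lparr>carrier := Ad g ` Bup\<rparr>\<^esub> x = matrix_inv x"
  using G.m_inv_consistent[OF sP] x inv_SL[of x] b g bS by auto
  then have "inv\<^bsub>SL\<lparr>carrier := Ad g ` Bup\<rparr>\<^esub> x = Ad g (matrix_inv b)"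
  using b g bS by (simp add: Ad_inverse SL_invertible)
  moreover have "b ** n ** matrix_inv b \<in> Uni"
  proof -
  have ib: "matrix_inv b \<in> Bup" using b by (simp add: Bup_inv)
  have nb: "n \<in> Bup" using n Uni_sub_Bup by blast
  have bn: "b ** n \<in> Bup" using b nb by (simp add: Bup_mult)
  show ?thesis unfolding Uni_def
  using upper_mult[of "b ** n" "matrix_inv b"] upper_mult[of b n] b ib bn n nb Bup_inv_diag[OF b(1)]
  Bup_diag_nz[OF b(1)]
  by (auto simp: Bup_iff Uni_def)
  qed
  ultimately show "x \<otimes>\<^bsub>SL\<lparr>carrier := Ad g ` Bup\<rparr>\<^esub> h \<otimes>\<^bsub>SL\<lparr>carrier := Ad g ` Bup\<rparr>\<^esub> inv\<^bsub>SL\<lparr>carrier := Ad g ` Bup\<rparr>\<^esub> x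
  \<in> Ad g ` Uni"
  using b n g by (auto simp: Ad_mult)
 qed
 moreover have "connected (Ad g ` Uni)"
 proof (rule connected_continuous_image)
  show "continuous_on Uni (Ad g)" using Ad_linear linear_continuous_on linear_conv_bounded_linear by blast
  have "convex (Uni :: 'n rmat set)"
  by (auto simp: convex_def Uni_def)
  then show "connected (Uni :: 'n rmat set)" by (rule convex_connected)
 qed
 moreover have "\<forall>x\<in>Ad g ` Uni. unipotent x" using g by (auto simp: unipotent_Ad Uni_unipotent)
 ultimately show "Ad g ` Uni \<subseteq> unipotent_radical (Ad g ` Bup)"
  unfolding unipotent_radical_def by blast
qed

subsection \<open>The exponential and Lie algebras\<close>

lemma norm_matrix_mult:
 fixes A B :: "'n::finite rmat"
 shows "norm (A ** B) \<le> norm A * norm B"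
proof -
 have entry: "(A ** B) $ k $ l = A $ k \<bullet> column l B" for k l
  by (simp add: matrix_matrix_mult_def inner_vec_def column_def)
 have cols: "(\<Sum>l\<in>UNIV. column l B \<bullet> column l B) = norm B * norm B"
  unfolding norm_eq_sqrt_inner
  by (simp add: inner_vec_def column_def sum_nonneg) (rule sum.swap)
 have "(norm (A ** B))\<^sup>2 = (\<Sum>k\<in>UNIV. \<Sum>l\<in>UNIV. (A $ k \<bullet> column l B)\<^sup>2)"
  unfolding power2_norm_eq_inner inner_vec_def[of "A ** B"] inner_vec_def[of "(A ** B) $ _"] entry
  by (simp add: power2_eq_square)
 also have "\<dots> \<le> (\<Sum>k\<in>UNIV. \<Sum>l\<in>UNIV. (A $ k \<bullet> A $ k) * (column l B \<bullet> column l B))"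
  by (intro sum_mono Cauchy_Schwarz_ineq)
 also have "\<dots> = (norm A * norm B)\<^sup>2"
  unfolding sum_product[symmetric] cols
  by (simp add: power_mult_distrib power2_norm_eq_inner inner_vec_def[of A A] flip: power2_eq_square)
 finally show ?thesis by (simp add: power2_le_iff_abs_le)
qed

lemma norm_mat_pow:
 fixes X :: "'n::finite rmat"
 shows "norm (mat_pow X k) \<le> norm (mat 1 :: 'n rmat) * norm X ^ k"
proof (induct k)
 case (Suc k)
 have "norm (mat_pow X (Suc k)) \<le> norm X * norm (mat_pow X k)"
  using norm_matrix_mult[of X "mat_pow X k"] by (simp add: mat_pow_def)
 also have "\<dots> \<le> norm X * (norm (mat 1 :: 'n rmat) * norm X ^ k)"
  by (intro mult_left_mono Suc) auto
 finally show ?case by (simp add: mult_ac)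
qed (simp add: mat_pow_def)

lemma summable_norm_mat_exp:
 fixes X :: "'n::finite rmat"
 shows "summable (%k. norm ((1 / fact k) *\<^sub>R mat_pow X k))"
proof (rule summable_comparison_test')
 show "summable (%k. norm (mat 1 :: 'n rmat) * (inverse (fact k) * norm X ^ k))"
  by (intro summable_mult summable_exp)
 show "norm (norm ((1 / fact k) *\<^sub>R mat_pow X k)) \<le> norm (mat 1 :: 'n rmat) * (inverse (fact k) * norm X ^ k)"
  if "k \<ge> 0" for k
  using norm_mat_pow[of X k] by (simp add: divide_simps mult_ac)
qed

lemma summable_mat_exp:
 fixes X :: "'n::finite rmat"
 shows "summable (%k. (1 / fact k) *\<^sub>R mat_pow X k)"
 by (rule summable_norm_cancel[OF summable_norm_mat_exp])

lemma mat_pow_scaleR: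
 fixes X :: "'n::finite rmat"
 shows "mat_pow (t *\<^sub>R X) k = t ^ k *\<^sub>R mat_pow X k"
 by (induct k) (simp_all add: mat_pow_def mult_ac)

text \<open>For |t| \<le> 1 every power |t|^k with k \<ge> 2 is at most t^2, so the tail of the
  series is quadratic in t with the norm series as constant.\<close>

lemma mat_exp_remainder:
 fixes X :: "'n::finite rmat"
 assumes "\<bar>t\<bar> \<le> 1"
 shows "norm (mat_exp (t *\<^sub>R X) - mat 1 - t *\<^sub>R X) \<le> t\<^sup>2 * (\<Sum>k. norm ((1 / fact k) *\<^sub>R mat_pow X k))"
proof -
 let ?f = "%k. (1 / fact k) *\<^sub>R mat_pow (t *\<^sub>R X) k"
 let ?g = "%k. norm ((1 / fact k) *\<^sub>R mat_pow X k)"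
 have "mat_exp (t *\<^sub>R X) = (\<Sum>k. ?f (k + 2)) + (\<Sum>k<2. ?f k)"
  unfolding mat_exp_def by (rule suminf_split_initial_segment[OF summable_mat_exp])
 moreover have "(\<Sum>k<2. ?f k) = mat 1 + t *\<^sub>R X" by (simp add: numeral_2_eq_2 mat_pow_def)
 ultimately have "mat_exp (t *\<^sub>R X) - mat 1 - t *\<^sub>R X = (\<Sum>k. ?f (k + 2))" by simp
 also have "norm \<dots> \<le> (\<Sum>k. t\<^sup>2 * ?g (k + 2))"
 proof (rule norm_suminf_le)
  show "summable (%k. t\<^sup>2 * ?g (k + 2))"
  by (intro summable_mult summable_ignore_initial_segment[OF summable_norm_mat_exp])
  fix k
  have "\<bar>t\<bar> ^ (k + 2) \<le> \<bar>t\<bar> ^ 2" using assms by (intro power_decreasing) auto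
  then have "\<bar>t\<bar> ^ (k + 2) * ?g (k + 2) \<le> \<bar>t\<bar>\<^sup>2 * ?g (k + 2)" by (intro mult_right_mono) auto
  moreover have "norm (?f (k + 2)) = \<bar>t\<bar> ^ (k + 2) * ?g (k + 2)"
  by (simp add: mat_pow_scaleR power_abs mult_ac del: power_Suc add_2_eq_Suc')
  ultimately show "norm (?f (k + 2)) \<le> t\<^sup>2 * ?g (k + 2)" by simp
 qed
 also have "\<dots> = t\<^sup>2 * (\<Sum>k. ?g (k + 2))"
  by (intro suminf_mult summable_ignore_initial_segment[OF summable_norm_mat_exp])
 also have "\<dots> \<le> t\<^sup>2 * (\<Sum>k. ?g k)"
 proof (intro mult_left_mono)
  have "(\<Sum>k. ?g k) = (\<Sum>k. ?g (k + 2)) + (\<Sum>k<2. ?g k)"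
  by (rule suminf_split_initial_segment[OF summable_norm_mat_exp])
  moreover have "(\<Sum>k<2. ?g k) \<ge> 0" by (intro sum_nonneg) auto
  ultimately show "(\<Sum>k. ?g (k + 2)) \<le> (\<Sum>k. ?g k)" by simp
 qed auto
 finally show ?thesis .
qed

text \<open>X is the limit of the difference quotients of its one-parameter group at times 1/(m +
  1); these lie in \<open>V\<close>, and subspaces are closed.\<close>

lemma mat_exp_derivative_in_subspace:
 fixes X :: "'n::finite rmat"
 assumes V: "subspace V" and X: "\<And>t. mat_exp (t *\<^sub>R X) - mat 1 \<in> V"
 shows "X \<in> V"
proof -
 define C where "C = (\<Sum>k. norm ((1 / fact k) *\<^sub>R mat_pow X k))"
 define a where "a m = real (Suc m) *\<^sub>R (mat_exp (inverse (real (Suc m)) *\<^sub>R X) - mat 1)" for m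
 have aV: "a m \<in> V" for m unfolding a_def by (intro subspace_scale V X)
 have bound: "norm (a m - X) \<le> inverse (real (Suc m)) * C" for m
 proof -
  let ?t = "inverse (real (Suc m))"
  have "a m - X = real (Suc m) *\<^sub>R (mat_exp (?t *\<^sub>R X) - mat 1 - ?t *\<^sub>R X)"
  by (simp add: a_def algebra_simps del: of_nat_Suc)
  then have "norm (a m - X) = real (Suc m) * norm (mat_exp (?t *\<^sub>R X) - mat 1 - ?t *\<^sub>R X)" by simp
  also have "\<dots> \<le> real (Suc m) * (?t\<^sup>2 * C)"
  unfolding C_def by (intro mult_left_mono mat_exp_remainder) (auto simp: field_simps)
  also have "\<dots> = ?t * C" by (simp add: power2_eq_square del: of_nat_Suc)
  finally show ?thesis .
 qed
 have "(%m. inverse (real (Suc m)) * C) \<longlonglongrightarrow> 0"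
  using tendsto_mult_left_zero[OF LIMSEQ_inverse_real_of_nat] by blast
 then have "(%m. a m - X) \<longlonglongrightarrow> 0"
  by (rule Lim_null_comparison[rotated]) (use bound in auto)
 then have "a \<longlonglongrightarrow> X" by (simp add: LIM_zero_iff)
 then show ?thesis using closed_sequentially[OF closed_subspace[OF V]] aV by blast
qed

lemma mat_exp_minus_one_in_subalgebra:
 fixes X :: "'n::finite rmat"
 assumes V: "subspace V" and mult: "\<And>A B. A \<in> V ==> B \<in> V ==> A ** B \<in> V" and X: "X \<in> V"
 shows "mat_exp X - mat 1 \<in> V"
proof -
 have pow: "mat_pow X (Suc k) \<in> V" for k
  by (induct k) (use X mult in \<open>auto simp: mat_pow_def\<close>)
 let ?f = "%k. (1 / fact k) *\<^sub>R mat_pow X k"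
 have "mat_exp X = (\<Sum>k. ?f (k + 1)) + (\<Sum>k<1. ?f k)"
  unfolding mat_exp_def by (rule suminf_split_initial_segment[OF summable_mat_exp])
 then have eq: "mat_exp X - mat 1 = (\<Sum>k. ?f (k + 1))" by (simp add: mat_pow_def)
 have lim: "(%m. \<Sum>k<m. ?f (k + 1)) \<longlonglongrightarrow> (\<Sum>k. ?f (k + 1))"
  by (rule summable_LIMSEQ[OF summable_ignore_initial_segment[OF summable_mat_exp]])
 have mem: "(\<Sum>k<m. ?f (k + 1)) \<in> V" for m
  by (intro subspace_sum V subspace_scale) (use pow in auto)
 show ?thesis unfolding eq by (rule closed_sequentially[OF closed_subspace[OF V] mem lim])
qed

text \<open>Up to conjugation, N and N \<inter> H both have the form 1 + V with V a subalgebra of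
  strictly triangular matrices.\<close>

lemma lie_alg_affine:
 fixes V :: "'n::finite rmat set"
 assumes V: "subspace V" and mult: "\<And>A B. A \<in> V ==> B \<in> V ==> A ** B \<in> V"
 shows "lie_alg {g. g - mat 1 \<in> V} = V"
proof
 show "lie_alg {g. g - mat 1 \<in> V} \<subseteq> V"
  using mat_exp_derivative_in_subspace[OF V] by (auto simp: lie_alg_def)
 show "V \<subseteq> lie_alg {g. g - mat 1 \<in> V}"
  using mat_exp_minus_one_in_subalgebra[OF V mult] subspace_scale[OF V] by (auto simp: lie_alg_def)
qed

lemma mat_exp_Ad:
 fixes X :: "'n::finite rmat"
 assumes "g \<in> carrier SL"
 shows "mat_exp (Ad g X) = Ad g (mat_exp X)"
proof -
 have bl: "bounded_linear (Ad g :: 'n rmat => 'n rmat)"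
  using Ad_linear linear_conv_bounded_linear by blast
 have "Ad g (mat_exp X) = (\<Sum>k. Ad g ((1 / fact k) *\<^sub>R mat_pow X k))"
  unfolding mat_exp_def by (rule bounded_linear.suminf[OF bl summable_mat_exp])
 then show ?thesis by (simp add: mat_exp_def mat_pow_Ad[OF assms] linear_cmul[OF Ad_linear])
qed

lemma lie_alg_Ad:
 fixes V :: "'n::finite rmat set"
 assumes "g \<in> carrier SL"
 shows "lie_alg (Ad g ` V) = Ad g ` lie_alg V"
proof -
 have "X \<in> lie_alg (Ad g ` V) \<longleftrightarrow> X \<in> Ad g ` lie_alg V" for X
  by (simp add: lie_alg_def Ad_image_iff assms SL_inv mat_exp_Ad[symmetric]
  linear_cmul[OF Ad_linear])
 then show ?thesis by blast
qed

section \<open>Diagonal matrices and their exponentials\<close>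

definition dg :: "'n::finite rvec => 'n rmat" where
 "dg x = (\<chi> k l. if k = l then x $ k else 0)"

lemma dg_nth: "dg x $ k $ l = (if k = l then x $ k else 0)"
 by (simp add: dg_def)

lemma dg_mult_nth [simp]: "(dg x ** A) $ k $ l = x $ k * A $ k $ l" "(A ** dg x) $ k $ l = A $ k $ l * x $ l"
 by (simp_all add: matrix_matrix_mult_def dg_nth if_distrib[of "%c. c * _"] if_distrib[of "%c. _ * c"] cong: if_cong)

lemma dg_vec [simp]: "(dg x *v y) $ k = x $ k * y $ k" "(y v* dg x) $ k = x $ k * y $ k"
 by (simp_all add: matrix_vector_mult_def vector_matrix_mult_def dg_nth if_distrib[of "%c. c * _"]
  if_distrib[of "%c. _ * c"] cong: if_cong)

lemma dg_one: "dg (\<chi> k. 1) = mat 1"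
 by (simp add: vec_eq_iff dg_nth mat_def)

lemma dg_mult: "dg x ** dg y = dg (\<chi> k. x $ k * y $ k)"
 by (simp add: vec_eq_iff dg_nth)

lemma dg_add: "dg (x + y) = dg x + dg y" and dg_scaleR: "dg (c *\<^sub>R x) = c *\<^sub>R dg x"
 by (simp_all add: vec_eq_iff dg_nth)

lemma dg_eq_iff: "dg x = dg y \<longleftrightarrow> x = y"
 by (auto simp: vec_eq_iff dg_nth)

lemma det_dg: "det (dg x) = (\<Prod>k\<in>UNIV. x $ k)"
 by (subst det_diagonal) (auto simp: dg_nth)

lemma trace_dg: "trace (dg x) = (\<Sum>k\<in>UNIV. x $ k)"
 by (simp add: trace_def dg_nth)

lemma matrix_inv_dg: "(\<And>k. x $ k ~= 0) ==> matrix_inv (dg x) = dg (\<chi> k. 1 / x $ k)"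
 by (rule matrix_inv_eqI) (simp add: dg_mult dg_one)

lemma mat_pow_dg: "mat_pow (dg x) m = dg (\<chi> k. x $ k ^ m)"
 by (induct m) (simp_all add: mat_pow_def dg_mult dg_one)

lemma mat_exp_dg: "mat_exp (dg x) = dg (\<chi> k. exp (x $ k))"
proof -
 have "mat_exp (dg x) $ k $ l = dg (\<chi> k. exp (x $ k)) $ k $ l" for k l
 proof -
  have bl: "bounded_linear (%A :: 'a rmat. A $ k $ l)"
  by (intro bounded_linear_compose[OF bounded_linear_vec_nth bounded_linear_vec_nth])
  have "mat_exp (dg x) $ k $ l = (\<Sum>m. ((1 / fact m) *\<^sub>R mat_pow (dg x) m) $ k $ l)"
  unfolding mat_exp_def by (rule bounded_linear.suminf[OF bl summable_mat_exp])
  also have "\<dots> = (if k = l then exp (x $ k) else 0)"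
  by (simp add: mat_pow_dg dg_nth exp_def divide_inverse mult.commute)
  finally show ?thesis by (simp add: dg_nth)
 qed
 then show ?thesis by (simp add: vec_eq_iff)
qed

lemma diagonal_eq_dg: "(\<And>k l. k ~= l ==> A $ k $ l = 0) ==> A = dg (\<chi> k. A $ k $ k)"
 by (auto simp: vec_eq_iff dg_nth)

subsection \<open>Determinants of diagonalizable maps on subspaces\<close>

text \<open>\<open>det_on\<close> is a Leibniz sum for an arbitrarily chosen basis. To compare it
  with an eigenbasis, both bases are indexed by a subset \<open>A\<close> of an auxiliary finite
  type \<open>'m\<close> that is large enough, and the matrices are padded by the identity so that
  multiplicativity of \<open>det\<close> applies.\<close>

lemma det_on_eigenbasis:
 fixes f :: "'a::euclidean_space => 'a" and m :: "'m::finite itself"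
 assumes f: "linear f" and C: "independent C" "span C = V"
  and card: "card C \<le> CARD('m)" and eig: "\<And>c. c \<in> C ==> f c = lam c *\<^sub>R c"
 shows "det_on V f = (\<Prod>c\<in>C. lam c)"
proof -
 define B where "B = (SOME B. B \<subseteq> V \<and> independent B \<and> span B = V)"
 have "C \<subseteq> V \<and> independent C \<and> span C = V" using C span_superset by blast
 then have B: "B \<subseteq> V" "independent B" "span B = V"
  unfolding B_def by (metis (mono_tags, lifting) someI_ex)+
 have finB: "finite B" and finC: "finite C" using B C independent_imp_finite by auto
 have "card B = dim V" "card C = dim V"
  using dim_eq_card_independent[OF B(2)] dim_eq_card_independent[OF C(1)] dim_span[of B] dim_span[of C]
  unfolding B(3) C(2) by simp_all
 then have cBC: "card B = card C" by simp
 obtain A :: "'m set" where A: "card A = card C" 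
  using card obtain_subset_with_card_n by blast
 have finA: "finite A" by simp
 obtain bt where bt: "bij_betw bt A B" using finB A cBC finite_same_card_bij[OF finA finB] by auto
 obtain gam where gam: "bij_betw gam A C" using finC A finite_same_card_bij[OF finA finC] by auto
 have btB: "bt a \<in> B" if "a \<in> A" for a using bt that by (auto simp: bij_betw_def)
 have gamC: "gam a \<in> C" if "a \<in> A" for a using gam that by (auto simp: bij_betw_def)
 have fV: "f v \<in> V" if "v \<in> V" for v
 proof -
  have "v \<in> span C" using that C by simp
  then have "f v \<in> span (f ` C)" using linear_span_image[OF f] by blast
  also have "span (f ` C) \<subseteq> span C"
  by (rule span_minimal) (auto simp: eig span_base span_scale)
  finally show ?thesis using C by simp
 qed
 \<comment> \<open>M represents f in the chosen basis and D in the eigenbasis; T is the change of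
   basis and T' its inverse. Then \<open>T ** M = D ** T\<close> yields equal determinants.\<close>
 define M :: "real^'m^'m" where "M = (\<chi> a b. if a \<in> A \<and> b \<in> A then representation B (f (bt a)) (bt b)
  else if a = b then 1 else 0)"
 define T :: "real^'m^'m" where "T = (\<chi> a b. if a \<in> A \<and> b \<in> A then representation B (gam a) (bt b)
  else if a = b then 1 else 0)"
 define T' :: "real^'m^'m" where "T' = (\<chi> a b. if a \<in> A \<and> b \<in> A then representation C (bt a) (gam b)
  else if a = b then 1 else 0)"
 define D :: "real^'m^'m" where "D = dg (\<chi> a. if a \<in> A then lam (gam a) else 1)"
 have block: "(X ** Y) $ a $ b = (if a \<in> A \<and> b \<in> A then \<Sum>c\<in>A. X $ a $ c * Y $ c $ b else if a = b then 1 else 0)"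
  if X: "\<And>a b. \<not> (a \<in> A \<and> b \<in> A) ==> X $ a $ b = (if a = b then 1 else 0)"
  and Y: "\<And>a b. \<not> (a \<in> A \<and> b \<in> A) ==> Y $ a $ b = (if a = b then 1 else 0)"
  for X Y :: "real^'m^'m" and a b
 proof (cases "a \<in> A \<and> b \<in> A")
  case True
  then show ?thesis unfolding matrix_matrix_mult_def
  by (simp, intro sum.mono_neutral_right) (auto simp: X)
 next
  case False
  have "(X ** Y) $ a $ b = (\<Sum>c\<in>UNIV. X $ a $ c * Y $ c $ b)" by (simp add: matrix_matrix_mult_def)
  also have "\<dots> = (\<Sum>c\<in>{a}. X $ a $ c * Y $ c $ b)" if "a \<notin> A"
  using that by (intro sum.mono_neutral_right) (auto simp: X)
  also have "\<dots> = (if a = b then 1 else 0)" if "a \<notin> A" using that X Y by simp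
  finally have 1: "a \<notin> A ==> ?thesis" by simp
  have "(X ** Y) $ a $ b = (\<Sum>c\<in>UNIV. X $ a $ c * Y $ c $ b)" by (simp add: matrix_matrix_mult_def)
  also have "\<dots> = (\<Sum>c\<in>{b}. X $ a $ c * Y $ c $ b)" if "b \<notin> A"
  using that by (intro sum.mono_neutral_right) (auto simp: Y)
  also have "\<dots> = (if a = b then 1 else 0)" if "b \<notin> A" using that X Y by simp
  finally have 2: "b \<notin> A ==> ?thesis" by simp
  show ?thesis using False 1 2 by blast
 qed
 have repB: "(\<Sum>c\<in>A. representation B v (bt c) *\<^sub>R bt c) = v" if "v \<in> V" for v
 proof -
  have "(\<Sum>c\<in>A. representation B v (bt c) *\<^sub>R bt c) = (\<Sum>b\<in>B. representation B v b *\<^sub>R b)"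
  by (rule sum.reindex_bij_betw[OF bt])
  also have "\<dots> = v" by (rule sum_representation_eq) (use B finB that in auto)
  finally show ?thesis .
 qed
 have "T ** M = D ** T"
 proof -
  have "(T ** M) $ a $ b = (D ** T) $ a $ b" for a b
  proof (cases "a \<in> A \<and> b \<in> A")
  case True
  then have gamV: "gam a \<in> V" using gamC C span_base by metis
  have "(T ** M) $ a $ b = (\<Sum>c\<in>A. representation B (gam a) (bt c) * representation B (f (bt c)) (bt b))"
  by (subst block) (use True in \<open>auto simp: T_def M_def\<close>)
  also have "\<dots> = (\<Sum>c\<in>A. representation B (representation B (gam a) (bt c) *\<^sub>R f (bt c)) (bt b))"
  proof (intro sum.cong refl)
  fix x assume "x \<in> A"
  then have "f (bt x) \<in> span B" using fV btB B by blast
  then show "representation B (gam a) (bt x) * representation B (f (bt x)) (bt b) =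
  representation B (representation B (gam a) (bt x) *\<^sub>R f (bt x)) (bt b)"
  using B by (simp add: representation_scale)
  qed
  also have "\<dots> = representation B (\<Sum>c\<in>A. representation B (gam a) (bt c) *\<^sub>R f (bt c)) (bt b)"
  by (subst representation_sum) (use B fV btB in \<open>auto intro!: span_scale\<close>)
  also have "(\<Sum>c\<in>A. representation B (gam a) (bt c) *\<^sub>R f (bt c)) = f (gam a)"
  by (subst (2) repB[OF gamV, symmetric]) (simp add: linear_sum[OF f] linear_cmul[OF f])
  also have "representation B (f (gam a)) (bt b) = lam (gam a) * representation B (gam a) (bt b)"
  using True B gamV eig gamC by (simp add: representation_scale)
  finally show ?thesis using True by (simp add: D_def T_def)
  next
  case False
  have "(T ** M) $ a $ b = (if a = b then 1 else 0)"
  by (subst block) (use False in \<open>auto simp: T_def M_def\<close>)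
  then show ?thesis using False by (auto simp: D_def T_def)
  qed
  then show ?thesis by (simp add: vec_eq_iff)
 qed
 moreover have "T ** T' = mat 1"
 proof -
  have "(T ** T') $ a $ b = (if a = b then 1 else 0)" for a b
  proof (cases "a \<in> A \<and> b \<in> A")
  case True
  then have gamV: "gam a \<in> V" using gamC C span_base by metis
  have "(T ** T') $ a $ b = (\<Sum>c\<in>A. representation B (gam a) (bt c) * representation C (bt c) (gam b))"
  by (subst block) (use True in \<open>auto simp: T_def T'_def\<close>)
  also have "\<dots> = (\<Sum>c\<in>A. representation C (representation B (gam a) (bt c) *\<^sub>R bt c) (gam b))"
  using B C btB by (intro sum.cong refl) (auto simp: representation_scale subset_iff)
  also have "\<dots> = representation C (gam a) (gam b)"
  by (subst representation_sum[symmetric, THEN fun_cong]) (use B C btB repB[OF gamV] in \<open>auto intro!: span_scale simp: subset_iff\<close>)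
  also have "\<dots> = (if a = b then 1 else 0)"
  using True gamC C gam by (auto simp: representation_basis bij_betw_def inj_on_def)
  finally show ?thesis .
  qed (subst block, auto simp: T_def T'_def)
  then show ?thesis by (simp add: vec_eq_iff mat_def)
 qed
 ultimately have "det T * det M = det D * det T" "det T * det T' = 1"
  by (metis det_mul, metis det_I det_mul)
 then have "det M = det D" by auto
 also have "det D = (\<Prod>a\<in>A. lam (gam a))"
  unfolding D_def det_dg by (simp add: prod.If_cases)
 also have "\<dots> = (\<Prod>c\<in>C. lam c)" by (rule prod.reindex_bij_betw[OF gam])
 finally have detM: "det M = (\<Prod>c\<in>C. lam c)" .
 \<comment> \<open>The padding kills every permutation that moves a point outside \<open>A\<close>.
   What remains is a Leibniz sum over \<open>A\<close>, which \<open>bt\<close> transports to the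
   basis \<open>B\<close>.\<close>
 have "det M = (\<Sum>p\<in>{p. p permutes A}. of_int (sign p) * (\<Prod>a\<in>UNIV. M $ a $ p a))"
  unfolding det_def
 proof (rule sum.mono_neutral_right)
  show "finite {p. p permutes (UNIV :: 'm set)}" by (simp add: finite_permutations)
  show "{p. p permutes A} \<subseteq> {p. p permutes UNIV}" using permutes_subset by blast
  show "\<forall>p\<in>{p. p permutes UNIV} - {p. p permutes A}. of_int (sign p) * (\<Prod>a\<in>UNIV. M $ a $ p a) = 0"
  proof
  fix p :: "'m => 'm" assume p: "p \<in> {p. p permutes UNIV} - {p. p permutes A}"
  then have "\<exists>a. a \<notin> A \<and> p a ~= a" by (auto simp: permutes_def)
  then obtain a where "a \<notin> A" "p a ~= a" by auto
  then have "M $ a $ p a = 0" by (simp add: M_def)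
  then show "of_int (sign p) * (\<Prod>a\<in>UNIV. M $ a $ p a) = 0" by (auto intro!: prod_zero)
  qed
 qed
 also have "\<dots> = (\<Sum>p\<in>{p. p permutes A}. of_int (sign p) * (\<Prod>a\<in>A. representation B (f (bt a)) (bt (p a))))"
 proof (intro sum.cong refl arg_cong2[where f = "(*)"])
  fix p assume "p \<in> {p. p permutes A}"
  then have p: "p permutes A" by simp
  have "(\<Prod>a\<in>UNIV. M $ a $ p a) = (\<Prod>a\<in>A. M $ a $ p a)"
  by (rule prod.mono_neutral_right) (auto simp: M_def permutes_not_in[OF p])
  also have "\<dots> = (\<Prod>a\<in>A. representation B (f (bt a)) (bt (p a)))"
  by (intro prod.cong refl) (simp add: M_def permutes_in_image[OF p])
  finally show "(\<Prod>a\<in>UNIV. M $ a $ p a) = (\<Prod>a\<in>A. representation B (f (bt a)) (bt (p a)))" .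
 qed
 also have "\<dots> = (\<Sum>q\<in>{q. q permutes B}. of_int (sign q) * (\<Prod>b\<in>B. representation B (f b) (q b)))"
 proof (rule sum.reindex_bij_witness[of _ "map_permutation B (inv_into A bt)" "map_permutation A bt"])
  have inj: "inj_on bt A" using bt by (simp add: bij_betw_def)
  have ibt: "bij_betw (inv_into A bt) B A" by (rule bij_betw_inv_into[OF bt])
  fix p assume "p \<in> {p. p permutes A}"
  then have p: "p permutes A" by simp
  show "map_permutation B (inv_into A bt) (map_permutation A bt p) = p"
  by (rule map_permutation_compose_inv[OF bt p]) (use inj in auto)
  show "map_permutation A bt p \<in> {q. q permutes B}" using map_permutation_permutes[OF bt p] by simp
  show "of_int (sign (map_permutation A bt p)) * (\<Prod>b\<in>B. representation B (f b) (map_permutation A bt p b)) =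
  of_int (sign p) * (\<Prod>a\<in>A. representation B (f (bt a)) (bt (p a)))"
  unfolding sign_map_permutation[OF inj p finA]
  by (subst prod.reindex_bij_betw[OF bt, symmetric])
  (simp add: map_permutation_apply[OF inj])
 next
  have ibt: "bij_betw (inv_into A bt) B A" by (rule bij_betw_inv_into[OF bt])
  fix q assume "q \<in> {q. q permutes B}"
  then have q: "q permutes B" by simp
  show "map_permutation A bt (map_permutation B (inv_into A bt) q) = q"
  by (rule map_permutation_compose_inv[OF ibt q]) (use bt in \<open>auto simp: bij_betw_def f_inv_into_f\<close>)
  show "map_permutation B (inv_into A bt) q \<in> {p. p permutes A}"
  using map_permutation_permutes[OF ibt q] by simp
 qed
 finally have "det M = (\<Sum>q\<in>{q. q permutes B}. of_int (sign q) * (\<Prod>b\<in>B. representation B (f b) (q b)))" .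
 then show ?thesis using detM unfolding det_on_def B_def Let_def by simp
qed

subsection \<open>Levi subgroups and split components\<close>

text \<open>The Levi subgroup MA of \<open>Bup\<close>; its identity component \<open>Dpos\<close>
  below is A.\<close>

definition Dall :: "'n::finite rmat set" where
 "Dall = {dg x | x. (\<Prod>k\<in>UNIV. x $ k) = 1}"

definition Dpos :: "'n::finite rmat set" where
 "Dpos = {dg x | x. (\<forall>k. 0 < x $ k) \<and> (\<Prod>k\<in>UNIV. x $ k) = 1}"

lemma Dpos_sub_Dall: "Dpos \<subseteq> Dall"
 by (auto simp: Dpos_def Dall_def)

lemma Dall_sub_Bup: "(Dall :: 'n::{finite,linorder} rmat set) \<subseteq> Bup"
 by (auto simp: Dall_def Bup_iff mem_SL det_dg dg_nth)

lemma prod_one_nz: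
 fixes f :: "'n::finite => real"
 shows "(\<Prod>k\<in>UNIV. f k) = 1 ==> f k ~= 0"
 by (metis finite UNIV_I prod_zero_iff zero_neq_one)

lemma Dall_SL: "x \<in> Dall ==> (x :: 'n::finite rmat) \<in> carrier SL"
 by (auto simp: Dall_def mem_SL det_dg)

lemma Dall_commute: "x \<in> Dall ==> y \<in> Dall ==> x ** y = y ** (x :: 'n::finite rmat)"
 by (auto simp: Dall_def dg_mult mult.commute)

lemma subgroup_Dall: "subgroup (Dall :: 'n::finite rmat set) SL"
 unfolding subgroup_SL_iff
proof (intro conjI ballI)
 show "(mat 1 :: 'n rmat) \<in> Dall" unfolding Dall_def by (auto simp: dg_one intro!: exI[of _ "\<chi> k. 1"])
 fix x :: "'n rmat" assume "x \<in> Dall"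
 then obtain z where z: "x = dg z" "z \<in> {z. (\<Prod>k\<in>UNIV. z $ k) = 1}" by (auto simp: Dall_def)
 then have "matrix_inv x = dg (\<chi> k. 1 / z $ k)" by (auto intro!: matrix_inv_dg dest: prod_one_nz)
 then show "matrix_inv x \<in> Dall" using z by (auto simp: Dall_def prod_dividef)
next
 fix x y :: "'n rmat" assume "x \<in> Dall" "y \<in> Dall"
 then show "x ** y \<in> Dall" unfolding Dall_def by (force simp: dg_mult prod.distrib)
qed (auto intro: Dall_SL)

lemma subgroup_Dpos: "subgroup (Dpos :: 'n::finite rmat set) SL"
 unfolding subgroup_SL_iff
proof (intro conjI ballI)
 show "(mat 1 :: 'n rmat) \<in> Dpos" unfolding Dpos_def by (auto simp: dg_one intro!: exI[of _ "\<chi> k. 1"])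
 fix x :: "'n rmat" assume "x \<in> Dpos"
 then obtain z where z: "x = dg z" "z \<in> {z. (\<forall>k. 0 < z $ k) \<and> (\<Prod>k\<in>UNIV. z $ k) = 1}" by (auto simp: Dpos_def)
 then have "matrix_inv x = dg (\<chi> k. 1 / z $ k)" by (auto intro!: matrix_inv_dg dest: prod_one_nz)
 then show "matrix_inv x \<in> Dpos" using z by (auto simp: Dpos_def prod_dividef)
next
 fix x y :: "'n rmat" assume "x \<in> Dpos" "y \<in> Dpos"
 then show "x ** y \<in> Dpos" unfolding Dpos_def by (force simp: dg_mult prod.distrib)
qed (use Dpos_sub_Dall Dall_SL in auto)

text \<open>A regular point of \<open>Dpos\<close>: only diagonal matrices commute with
  \<open>dg regvec\<close>, so this one element can stand for the whole torus. Subtracting the mean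
  of the exponents gives determinant 1.\<close>

definition regvec :: "'n::{finite,linorder} rvec" where
 "regvec = (\<chi> k. exp (real (card {..<k}) - (\<Sum>l\<in>UNIV. real (card {..<l :: 'n})) / real CARD('n)))"

lemma card_lessThan_inj: "card {..<k} = card {..<l :: 'n::{finite,linorder}} ==> k = l"
proof (rule ccontr)
 assume eq: "card {..<k} = card {..<l}" and "k ~= l"
 then consider "{..<k} \<subset> {..<l}" | "{..<l} \<subset> {..<k}" by force
 then show False using eq by cases (metis finite less_irrefl psubset_card_mono)+
qed

lemma regvec: "0 < (regvec :: 'n::{finite,linorder} rvec) $ k" "(\<Prod>k\<in>UNIV. (regvec :: 'n rvec) $ k) = 1" "k ~= l ==> (regvec :: 'n rvec) $ k ~= regvec $ l"
proof -
 show "0 < (regvec :: 'n rvec) $ k" by (simp add: regvec_def)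
 have "(\<Prod>k\<in>UNIV. (regvec :: 'n rvec) $ k) =
  exp (\<Sum>k\<in>(UNIV :: 'n set). real (card {..<k}) - (\<Sum>l\<in>UNIV. real (card {..<l :: 'n})) / real CARD('n))"
  by (subst exp_sum) (auto simp: regvec_def)
 also have "\<dots> = 1" by (simp add: sum_subtractf)
 finally show "(\<Prod>k\<in>UNIV. (regvec :: 'n rvec) $ k) = 1" .
 show "k ~= l ==> (regvec :: 'n rvec) $ k ~= regvec $ l" using card_lessThan_inj[of k l] by (auto simp: regvec_def)
qed

lemma regvec_Dpos: "dg regvec \<in> Dpos"
 using regvec by (auto simp: Dpos_def)

lemma commute_regular:
 assumes "\<And>k l. k ~= l ==> x $ k ~= x $ l" "A ** dg x = dg x ** A" "k ~= l"
 shows "A $ k $ l = 0"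
proof -
 have "A $ k $ l * x $ l = x $ k * A $ k $ l" using assms(2) by (metis dg_mult_nth)
 then show ?thesis using assms(1)[OF assms(3)] by (simp add: mult.commute)
qed

text \<open>The eigenvector for the k-th diagonal entry can be supported on the indices up to k with
  k-th entry 1; such columns form a unitriangular matrix.\<close>

lemma upper_diagonalizable:
 fixes l :: "'n::{finite,linorder} rmat"
 assumes up: "\<And>a b. b < a ==> l $ a $ b = 0" and dist: "\<And>a b. a ~= b ==> l $ a $ a ~= l $ b $ b"
 obtains nu where "nu \<in> Uni" "l ** nu = nu ** dg (\<chi> k. l $ k $ k)"
proof -
 have ex: "\<exists>v. (l - mat (l $ k $ k)) *v v = 0 \<and> v $ k = 1 \<and> (\<forall>a. k < a --> v $ a = 0)" for k
 proof -
  define L where "L = l - mat (l $ k $ k)"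
  have L: "L $ a $ b = 0" if "b < a" for a b using that up by (auto simp: L_def mat_def)
  have Lk: "L $ k $ k = 0" by (simp add: L_def mat_def)
  \<comment> \<open>The columns from k on are replaced by those of the identity. The diagonal of
    \<open>M\<close> is then nonzero, and solving \<open>M *v w = - column k L\<close> gives the
    part of the eigenvector strictly before k.\<close>
  define M :: "'n rmat" where "M = (\<chi> a b. if b < k then L $ a $ b else if a = b then 1 else 0)"
  have "det M = (\<Prod>a\<in>UNIV. M $ a $ a)"
  by (rule det_upper_triangular) (auto simp: M_def L)
  also have "\<dots> ~= 0" using dist by (auto simp: M_def L_def mat_def)
  finally have "invertible M" by (simp add: invertible_det_nz)
  then obtain w where w: "M *v w = - column k L" 
  by (metis matrix_inv_mult_cancel(1) matrix_vector_mul_assoc matrix_vector_mul_lid)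
  have wa: "w $ a = 0" if "k \<le> a" for a
  proof -
  have "(M *v w) $ a = (\<Sum>b\<in>UNIV. M $ a $ b * w $ b)" by (simp add: matrix_vector_mult_def)
  also have "\<dots> = (\<Sum>b\<in>{a}. M $ a $ b * w $ b)"
  using that by (intro sum.mono_neutral_right) (auto simp: M_def L)
  finally have "w $ a = - (L $ a $ k)" using that w by (simp add: M_def column_def)
  then show ?thesis using that L[of k a] Lk by (cases "a = k") auto
  qed
  have Mw: "M *v w = L *v w"
  unfolding vec_eq_iff matrix_vector_mult_def M_def
  by (auto intro!: sum.cong simp: wa not_less)
  have "L *v (w + axis k 1) = 0"
  using w Mw by (simp add: matrix_vector_right_distrib matrix_vector_mult_basis)
  then show ?thesis using wa
  by (intro exI[of _ "w + axis k 1"]) (auto simp: L_def axis_def)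
 qed
 then obtain v where v: "\<And>k. (l - mat (l $ k $ k)) *v v k = 0" "\<And>k. v k $ k = 1" "\<And>k a. k < a ==> v k $ a = 0"
  by metis
 define nu :: "'n rmat" where "nu = (\<chi> a k. v k $ a)"
 have lv: "l *v v k = l $ k $ k *\<^sub>R v k" for k
 proof -
  have "mat (l $ k $ k) *v v k = l $ k $ k *\<^sub>R v k"
  by (simp add: vec_eq_iff matrix_vector_mult_def mat_def if_distrib[of "%c. c * _"] cong: if_cong)
  then show ?thesis using v(1)[of k] by (simp add: matrix_vector_mult_diff_rdistrib)
 qed
 have "(l ** nu) $ a $ k = (nu ** dg (\<chi> k. l $ k $ k)) $ a $ k" for a k
 proof -
  have "(l ** nu) $ a $ k = (l *v v k) $ a" by (simp add: nu_def matrix_matrix_mult_def matrix_vector_mult_def)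
  then show ?thesis by (simp add: lv nu_def mult.commute)
 qed
 then have "l ** nu = nu ** dg (\<chi> k. l $ k $ k)" by (simp add: vec_eq_iff)
 moreover have "nu \<in> Uni" using v by (auto simp: Uni_def nu_def)
 ultimately show thesis using that by blast
qed

text \<open>A complement is determined by its diagonals, so it is abelian. It contains an element
  with diagonal \<open>regvec\<close>; the unipotent matrix that diagonalizes this element
  diagonalizes everything commuting with it.\<close>

lemma Uni_complement:
 fixes L :: "'n::{finite,linorder} rmat set"
 assumes L: "subgroup L SL" "L \<inter> Uni = {mat 1}" "Bup = {l ** n | l n. l \<in> L \<and> n \<in> Uni}"
 obtains nu where "nu \<in> Uni" "L = Ad nu ` Dall"
proof -
 have Lone: "mat 1 \<in> L" and Lmult: "\<And>x y. x \<in> L ==> y \<in> L ==> x ** y \<in> L"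
  and Linv: "\<And>x. x \<in> L ==> matrix_inv x \<in> L"
  using L(1) by (auto simp: subgroup_SL_iff)
 have LB: "L \<subseteq> Bup"
 proof
  fix l assume "l \<in> L"
  moreover have "(mat 1 :: 'n rmat) \<in> Uni" by (auto simp: Uni_def mat_def)
  ultimately have "l ** mat 1 \<in> Bup" using L(3) by blast
  then show "l \<in> Bup" by simp
 qed
 have uniq: "x = y" if "x \<in> L" "y \<in> L" "\<And>k. x $ k $ k = y $ k $ k" for x y
 proof -
  have xy: "x \<in> Bup" "y \<in> Bup" using that LB by auto
  have "x ** matrix_inv y \<in> Uni"
  unfolding Uni_def using Bup_mult[OF xy(1) Bup_inv[OF xy(2)]] that(3) Bup_diag_nz[OF xy(2)]
  upper_mult(2)[of x "matrix_inv y"] xy Bup_inv[OF xy(2)] Bup_inv_diag[OF xy(2)]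
  by (auto simp: Bup_iff)
  moreover have "x ** matrix_inv y \<in> L" using that Lmult Linv by auto
  ultimately have "x ** matrix_inv y = mat 1" using L(2) by blast
  then have "x ** matrix_inv y ** y = y" by simp
  then show ?thesis using SL_cancel_left(4)[of y x] xy by (auto simp: Bup_iff)
 qed
 have comm: "x ** y = y ** x" if "x \<in> L" "y \<in> L" for x y
 proof (rule uniq)
  fix k show "(x ** y) $ k $ k = (y ** x) $ k $ k"
  using that LB upper_mult(2)[of x y k] upper_mult(2)[of y x k] by (auto simp: Bup_iff subset_iff)
 qed (use that Lmult in auto)
 have "(dg regvec :: 'n rmat) \<in> Bup" using regvec_Dpos Dpos_sub_Dall Dall_sub_Bup by blast
 then have "(dg regvec :: 'n rmat) \<in> {l ** n | l n. l \<in> L \<and> n \<in> Uni}" by (simp only: L(3)[symmetric])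
 then obtain l n where l: "l \<in> L" and n: "n \<in> Uni" and ln: "dg regvec = l ** n" by blast
 have lk: "l $ k $ k = regvec $ k" for k
 proof -
  have "(l ** n) $ k $ k = l $ k $ k * n $ k $ k"
  by (rule upper_mult(2)) (use l n LB in \<open>auto simp: Bup_iff Uni_def subset_iff\<close>)
  then show ?thesis using n unfolding ln[symmetric] by (simp add: Uni_def dg_nth)
 qed
 have lup: "\<And>a b. b < a ==> l $ a $ b = 0" using l LB by (auto simp: Bup_iff)
 have ldist: "a ~= b ==> l $ a $ a ~= l $ b $ b" for a b unfolding lk by (rule regvec(3))
 obtain nu where nu: "nu \<in> Uni" "l ** nu = nu ** dg (\<chi> k. l $ k $ k)"
  using upper_diagonalizable[OF lup ldist] by blast
 have nuS: "nu \<in> carrier SL" using nu(1) Uni_sub_Bup by (auto simp: Bup_iff)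
 have lnu: "l = Ad nu (dg regvec)"
 proof -
  have "(\<chi> k. l $ k $ k) = regvec" by (simp add: lk vec_eq_iff)
  then have "l ** nu ** matrix_inv nu = nu ** dg regvec ** matrix_inv nu" using nu by simp
  then show ?thesis by (simp add: Ad_def SL_cancel_left nuS)
 qed
 have sub: "\<exists>d\<in>Dall. x = Ad nu d" if x: "x \<in> L" for x
 proof -
  define d where "d = Ad (matrix_inv nu) x"
  have xd: "x = Ad nu d" by (simp add: d_def nuS)
  have "Ad nu (d ** dg regvec) = Ad nu (dg regvec ** d)"
  using comm[OF x l] by (simp add: xd lnu Ad_mult nuS)
  then have "d ** dg regvec = dg regvec ** d" using Ad_inj[OF nuS] by (simp add: inj_def)
  then have "d = dg (\<chi> k. d $ k $ k)" using commute_regular[of regvec d] regvec(3) by (intro diagonal_eq_dg) blast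
  moreover have "x \<in> carrier SL" using x LB by (auto simp: Bup_iff)
  then have "d \<in> carrier SL" unfolding d_def by (rule Ad_SL[OF SL_inv[OF nuS]])
  ultimately have "d \<in> Dall" unfolding Dall_def by (metis (mono_tags, lifting) det_dg mem_Collect_eq mem_SL)
  then show ?thesis using xd by auto
 qed
 \<comment> \<open>The whole torus is reached: decompose \<open>Ad nu d\<close> along L and
   \<open>Uni\<close>. The L-part is diagonal in the same frame and has the same diagonal as d,
   hence equals \<open>Ad nu d\<close>.\<close>
 have "Ad nu d \<in> L" if d: "d \<in> Dall" for d
 proof -
  have nuB: "nu \<in> Bup" using nu(1) Uni_sub_Bup by auto
  have dB: "d \<in> Bup" using d Dall_sub_Bup by auto
  have AdB: "Ad nu e \<in> Bup \<and> (\<forall>k. Ad nu e $ k $ k = e $ k $ k)" if e: "e \<in> Bup" for e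
  proof
  show "Ad nu e \<in> Bup" unfolding Ad_def by (intro Bup_mult Bup_inv nuB e)
  show "\<forall>k. Ad nu e $ k $ k = e $ k $ k"
  using upper_mult(2)[of "nu ** e" "matrix_inv nu"] upper_mult(2)[of nu e] nu e nuB Bup_inv[OF nuB] Bup_mult[OF nuB e]
  by (auto simp: Ad_def Bup_iff Bup_inv_diag[OF nuB] Uni_def)
  qed
  have "Ad nu d \<in> Bup" using AdB[OF dB] by simp
  then have "Ad nu d \<in> {l ** n | l n. l \<in> L \<and> n \<in> Uni}" by (simp only: L(3)[symmetric])
  then obtain l' n' where l': "l' \<in> L" and n': "n' \<in> Uni" and eq: "Ad nu d = l' ** n'" by blast
  obtain e where e: "e \<in> Dall" "l' = Ad nu e" using sub[OF l'] by auto
  have eB: "e \<in> Bup" using e Dall_sub_Bup by auto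
  have diag: "d $ k $ k = e $ k $ k" for k
  proof -
  have "(l' ** n') $ k $ k = l' $ k $ k * n' $ k $ k"
  by (rule upper_mult(2)) (use l' n' LB in \<open>auto simp: Bup_iff Uni_def subset_iff\<close>)
  then show ?thesis using AdB[OF dB] AdB[OF eB] eq e n' by (simp add: Uni_def)
  qed
  have "d = e" using d e diag by (auto simp: Dall_def dg_nth vec_eq_iff)
  then show ?thesis using e l' by simp
 qed
 then have "L = Ad nu ` Dall" using sub by auto
 with nu show thesis using that by blast
qed

lemma center_abelian: "(\<And>x y. x \<in> L ==> y \<in> L ==> x ** y = y ** x) ==> center_of L = L"
 by (auto simp: center_of_def)

lemma continuous_on_Ad: "continuous_on S (Ad g :: 'n::finite rmat => 'n rmat)"
 using Ad_linear linear_continuous_on linear_conv_bounded_linear by blast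

lemma connected_Dpos: "connected (Dpos :: 'n::finite rmat set)"
proof -
 have "Dpos = (%x. dg (\<chi> k. exp (x $ k))) ` {x :: 'n rvec. (\<Sum>k\<in>UNIV. x $ k) = 0}"
 proof (intro equalityI subsetI)
  fix d :: "'n rmat" assume "d \<in> Dpos"
  then obtain x where x: "d = dg x" "\<And>k. 0 < x $ k" "(\<Prod>k\<in>UNIV. x $ k) = 1" by (auto simp: Dpos_def)
  have "(\<Sum>k\<in>UNIV. ln (x $ k)) = ln (\<Prod>k\<in>UNIV. x $ k)" by (subst ln_prod) (auto simp: x(2) less_imp_neq[OF x(2), symmetric])
  then show "d \<in> (%x. dg (\<chi> k. exp (x $ k))) ` {x. (\<Sum>k\<in>UNIV. x $ k) = 0}"
  using x by (intro image_eqI[of _ _ "\<chi> k. ln (x $ k)"]) auto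
 qed (auto simp: Dpos_def exp_sum[symmetric])
 moreover have "connected {x :: 'n rvec. (\<Sum>k\<in>UNIV. x $ k) = 0}"
  by (intro convex_connected) (auto simp: convex_def sum.distrib sum_distrib_left[symmetric])
 moreover have "continuous_on {x :: 'n rvec. (\<Sum>k\<in>UNIV. x $ k) = 0} (%x. dg (\<chi> k. exp (x $ k)))"
 proof -
  have "continuous_on S (%x :: 'n rvec. if k = l then (\<chi> k. exp (x $ k)) $ k else 0)" for S k and l :: 'n
  by (cases "k = l") (auto intro!: continuous_intros)
  then show ?thesis unfolding dg_def by (intro continuous_on_vec_lambda)
 qed
 ultimately show ?thesis using connected_continuous_image by metis
qed

lemma split_Ad_Dpos:
 fixes h :: "'n::{finite,linorder} rmat"
 assumes h: "h \<in> carrier SL" and L: "L = Ad h ` Dall"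
 shows "connected_split_central A L ==> A \<subseteq> Ad h ` Dpos" "connected_split_central (Ad h ` Dpos) L"
proof -
 have cL: "center_of L = L"
  by (rule center_abelian) (auto simp: L Ad_mult h Dall_commute)
 {
  assume A: "connected_split_central A L"
  show "A \<subseteq> Ad h ` Dpos"
  proof
  fix a assume a: "a \<in> A"
  then obtain x where x: "a = Ad h (dg x)" "(\<Prod>k\<in>UNIV. x $ k) = 1"
  using A cL by (auto simp: connected_split_central_def L Dall_def)
  \<comment> \<open>The k-th diagonal entry is continuous on the connected group A, never zero, and
    1 at the identity, so it cannot change sign.\<close>
  have "0 < x $ k" for k
  proof -
  define f where "f b = Ad (matrix_inv h) b $ k $ k" for b :: "'n rmat"
  have "connected (f ` A)"
  proof (rule connected_continuous_image)
  show "continuous_on A f" unfolding f_def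
  by (intro continuous_intros continuous_on_Ad)
  show "connected A" using A by (simp add: connected_split_central_def)
  qed
  moreover have "0 \<notin> f ` A"
  proof
  assume "0 \<in> f ` A"
  then obtain b where b: "b \<in> A" "f b = 0" by auto
  then obtain z where z: "b = Ad h (dg z)" "(\<Prod>k\<in>UNIV. z $ k) = 1"
  using A cL by (auto simp: connected_split_central_def L Dall_def)
  then show False using b prod_one_nz[OF z(2), of k] h by (simp add: f_def dg_nth)
  qed
  moreover have "1 \<in> f ` A"
  proof
  show "mat 1 \<in> A" using A by (auto simp: connected_split_central_def subgroup_SL_iff)
  have "Ad (matrix_inv h) (mat 1) = mat 1" by (rule Ad_one[OF SL_inv[OF h]])
  then show "1 = f (mat 1)" unfolding f_def by (simp add: mat_def)
  qed
  moreover have "f a \<in> f ` A" using a by simp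
  ultimately have "\<not> f a \<le> 0" using connectedD_interval[of "f ` A" "f a" 1 0] by auto
  then show ?thesis using h by (simp add: f_def x dg_nth)
  qed
  then show "a \<in> Ad h ` Dpos" using x by (auto simp: Dpos_def)
  qed
 }
 show "connected_split_central (Ad h ` Dpos) L"
  unfolding connected_split_central_def cL
 proof (intro conjI)
  show "subgroup (Ad h ` Dpos) SL" by (rule subgroup_Ad[OF h subgroup_Dpos])
  show "Ad h ` Dpos \<subseteq> L" using Dpos_sub_Dall by (auto simp: L)
  show "connected (Ad h ` Dpos)" by (rule connected_continuous_image[OF continuous_on_Ad connected_Dpos])
  show "split_group (Ad h ` Dpos)" unfolding split_group_def
  by (rule exI[of _ "matrix_inv h"]) (use h SL_invertible[OF SL_inv[OF h]] in \<open>auto simp: Dpos_def dg_nth\<close>)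
 qed
qed

lemma Ad_image_products:
 fixes g :: "'n::finite rmat"
 assumes g: "g \<in> carrier SL"
 shows "Ad g ` {l ** n | l n. l \<in> U \<and> n \<in> V} = {l ** n | l n. l \<in> Ad g ` U \<and> n \<in> Ad g ` V}"
proof (intro equalityI subsetI)
 fix x assume "x \<in> {l ** n | l n. l \<in> Ad g ` U \<and> n \<in> Ad g ` V}"
 then obtain l n where "l \<in> U" "n \<in> V" "x = Ad g l ** Ad g n" by blast
 then show "x \<in> Ad g ` {l ** n | l n. l \<in> U \<and> n \<in> V}" unfolding Ad_mult[OF g] by blast
next
 fix x assume "x \<in> Ad g ` {l ** n | l n. l \<in> U \<and> n \<in> V}"
 then obtain l n where "l \<in> U" "n \<in> V" "x = Ad g (l ** n)" by blast
 then show "x \<in> {l ** n | l n. l \<in> Ad g ` U \<and> n \<in> Ad g ` V}" unfolding Ad_mult[OF g, symmetric] by blast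
qed

lemma levi_conj:
 fixes g :: "'n::{finite,linorder} rmat"
 assumes g: "g \<in> carrier SL"
 shows "levi_subgroup (Ad g ` Dall) (Ad g ` Bup)"
 unfolding levi_subgroup_def unipotent_radical_conj[OF g]
proof (intro conjI)
 show "subgroup (Ad g ` Dall) SL" by (rule subgroup_Ad[OF g subgroup_Dall])
 let ?D = "{A :: 'n rmat. (\<forall>k l. k ~= l --> A $ k $ l = 0) \<and> det A = 1}"
 have "A \<in> Dall \<longleftrightarrow> A \<in> ?D" for A :: "'n rmat"
 proof
  assume A: "A \<in> ?D"
  then have "A = dg (\<chi> k. A $ k $ k)" by (intro diagonal_eq_dg) auto
  then show "A \<in> Dall" using A det_dg unfolding Dall_def by (metis (mono_tags, lifting) mem_Collect_eq)
 qed (auto simp: Dall_def dg_nth det_dg)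
 then have eq: "Ad g ` Dall = Ad (matrix_inv g) -` ?D" using g by (auto simp: Ad_image_iff)
 have "closed ?D"
  unfolding det_def
  by (intro closed_Collect_conj closed_Collect_all closed_Collect_imp closed_Collect_eq continuous_intros) auto
 moreover have "isCont (Ad (matrix_inv g)) x" for x :: "'n rmat"
  using continuous_on_Ad[of UNIV "matrix_inv g"] by (simp add: continuous_on_eq_continuous_at)
 ultimately show "closed (Ad g ` Dall)" unfolding eq by (rule continuous_closed_vimage)
 have "Dall \<inter> Uni = {mat 1 :: 'n rmat}"
  by (auto simp: Dall_def Uni_def dg_nth vec_eq_iff mat_def intro!: exI[of _ "\<chi> k. 1"])
 then show "Ad g ` Dall \<inter> Ad g ` Uni = {mat 1}" 
  using Ad_inj[OF g] g by (simp add: image_Int[symmetric])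
 have BU: "Bup = {l ** n | (l :: 'n rmat) n. l \<in> Dall \<and> n \<in> Uni}"
 proof (intro equalityI subsetI)
  fix b :: "'n rmat" assume b: "b \<in> Bup"
  define d where "d = dg (\<chi> k. b $ k $ k)"
  have dD: "d \<in> Dall"
  using b det_upper_triangular[of b] by (auto simp: Dall_def d_def Bup_iff mem_SL intro!: exI[of _ "\<chi> k. b $ k $ k"])
  have dk: "d $ k $ k = b $ k $ k" for k by (simp add: d_def dg_nth)
  have dB: "d \<in> Bup" using dD Dall_sub_Bup by auto
  have "matrix_inv d ** b \<in> Uni" unfolding Uni_def
  using Bup_mult[OF Bup_inv[OF dB] b] upper_mult(2)[of "matrix_inv d" b] Bup_inv[OF dB] b Bup_diag_nz[OF b] Bup_inv_diag[OF dB]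
  dk by (auto simp: Bup_iff)
  moreover have "b = d ** (matrix_inv d ** b)" using dB by (simp add: SL_cancel_left Bup_iff)
  ultimately show "b \<in> {l ** n | l n. l \<in> Dall \<and> n \<in> Uni}" using dD by blast
 qed (use Bup_mult Uni_sub_Bup Dall_sub_Bup in blast)
 show "Ad g ` Bup = {l ** n | l n. l \<in> Ad g ` Dall \<and> n \<in> Ad g ` Uni}"
  by (subst BU) (rule Ad_image_products[OF g])
qed

lemma Bup_conj_Bup:
 fixes b :: "'n::{finite,linorder} rmat"
 assumes "b \<in> Bup"
 shows "Ad b ` Bup = Bup"
proof (intro equalityI subsetI)
 fix x :: "'n rmat" assume x: "x \<in> Bup"
 have bS: "b \<in> carrier SL" using assms by (simp add: Bup_iff)
 then show "x \<in> Ad b ` Bup"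
  using x Bup_mult[OF Bup_mult[OF Bup_inv[OF assms] x] assms] by (auto simp: Ad_image_iff) (simp add: Ad_def SL_inv_inv)
qed (auto simp: Ad_def intro!: Bup_mult Bup_inv assms)

lemma conj_Bup_mult:
 fixes g b :: "'n::{finite,linorder} rmat"
 assumes "g \<in> carrier SL" "b \<in> Bup"
 shows "Ad (g ** b) ` Bup = Ad g ` Bup"
proof -
 have "Ad (g ** b) ` Bup = Ad g ` Ad b ` Bup"
  using assms by (auto simp: Ad_Ad Bup_iff image_image)
 then show ?thesis using Bup_conj_Bup[OF assms(2)] by simp
qed

text \<open>Every Levi subgroup is a unipotent conjugate of the diagonal one and, being abelian, its
  own centre. Its positive part contains every connected split subgroup and is one itself, so
  maximality leaves no choice.\<close>

lemma split_component_iff: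
 fixes g :: "'n::{finite,linorder} rmat"
 assumes g: "g \<in> carrier SL"
 shows "split_component A (Ad g ` Bup) \<longleftrightarrow> (\<exists>n\<in>Uni. A = Ad (g ** n) ` Dpos)"
proof
 assume "split_component A (Ad g ` Bup)"
 then obtain L where L: "levi_subgroup L (Ad g ` Bup)" "connected_split_central A L"
  "\<And>B. connected_split_central B L ==> A \<subseteq> B ==> B = A" by (auto simp: split_component_def)
 define L' where "L' = Ad (matrix_inv g) ` L"
 have gi: "matrix_inv g \<in> carrier SL" using g by auto
 have L'L: "L = Ad g ` L'" using g by (auto simp: L'_def image_image)
 have lv: "subgroup L SL" "L \<inter> Ad g ` Uni = {mat 1}" "Ad g ` Bup = {l ** n | l n. l \<in> L \<and> n \<in> Ad g ` Uni}"
  using L(1) unfolding levi_subgroup_def unipotent_radical_conj[OF g] by auto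
 have 1: "subgroup L' SL" unfolding L'_def by (rule subgroup_Ad[OF gi lv(1)])
 have 2: "L' \<inter> Uni = {mat 1}"
 proof -
  have "Ad g ` (L' \<inter> Uni) = Ad g ` {mat 1}"
  using lv(2) Ad_inj[OF g] g by (simp add: L'L image_Int)
  then show ?thesis by (rule inj_image_eq_iff[OF Ad_inj[OF g], THEN iffD1])
 qed
 have 3: "Bup = {l ** n | l n. l \<in> L' \<and> n \<in> Uni}"
 proof -
  have "Ad g ` {l ** n | l n. l \<in> L' \<and> n \<in> Uni} = {l ** n | l n. l \<in> L \<and> n \<in> Ad g ` Uni}"
  unfolding L'L by (rule Ad_image_products[OF g])
  then have "Ad g ` Bup = Ad g ` {l ** n | l n. l \<in> L' \<and> n \<in> Uni}" using lv(3) by simp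
  then show ?thesis by (rule inj_image_eq_iff[OF Ad_inj[OF g], THEN iffD1])
 qed
 obtain n where n: "n \<in> Uni" "L' = Ad n ` Dall" using Uni_complement[OF 1 2 3] .
 have nS: "n \<in> carrier SL" using n Uni_sub_Bup by (auto simp: Bup_iff)
 have LD: "L = Ad (g ** n) ` Dall" unfolding L'L n by (simp add: image_image Ad_Ad g nS)
 have "A = Ad (g ** n) ` Dpos"
  using split_Ad_Dpos[OF SL_mult[OF g nS] LD] L by metis
 then show "\<exists>n\<in>Uni. A = Ad (g ** n) ` Dpos" using n by auto
next
 assume "\<exists>n\<in>Uni. A = Ad (g ** n) ` Dpos"
 then obtain n where n: "n \<in> Uni" "A = Ad (g ** n) ` Dpos" by auto
 have nB: "n \<in> Bup" using n Uni_sub_Bup by auto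
 have S: "g ** n \<in> carrier SL" using nB g by (auto simp: Bup_iff)
 have "levi_subgroup (Ad (g ** n) ` Dall) (Ad g ` Bup)"
  using levi_conj[OF S] conj_Bup_mult[OF g nB] by simp
 then show "split_component A (Ad g ` Bup)" unfolding split_component_def n
  using split_Ad_Dpos[OF S refl] by (metis subset_antisym)
qed

subsection \<open>The position of a flag relative to the reflection\<close>

text \<open>\<open>yv\<close> and \<open>wv\<close> are the two factors of the base idempotent seen
  from the frame h: conjugating \<open>outer uvec uvec\<close> by \<open>matrix_inv h\<close> gives
  \<open>outer (yv h) (wv h)\<close>, and the involution becomes conjugation by 1 - 2 y w.\<close>

definition yv :: "'n::{finite,linorder} rmat => 'n rvec" where "yv h = matrix_inv h *v uvec"
definition wv :: "'n::{finite,linorder} rmat => 'n rvec" where "wv h = uvec v* h"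

text \<open>\<open>j < i\<close> is the case of rank one, \<open>j = i\<close> the case of rank zero.\<close>

definition std :: "'n::{finite,linorder} rmat => 'n => 'n => bool" where
 "std h j i \<longleftrightarrow> h \<in> carrier SL \<and> j \<le> i \<and>
  (if j = i then yv h = axis i 1 \<and> wv h = axis i 1
  else yv h = axis i 1 + axis j 1 \<and> wv h = (1/2) *\<^sub>R (axis i 1 + axis j 1))"

lemma std_SL: "std h j i ==> h \<in> carrier SL" by (simp add: std_def)

lemma yv_wv_mult:
 fixes h b :: "'n::{finite,linorder} rmat"
 assumes "h \<in> carrier SL" "b \<in> carrier SL"
 shows "yv (h ** b) = matrix_inv b *v yv h" "wv (h ** b) = wv h v* b"
 by (simp_all add: yv_def wv_def SL_inv_mult assms matrix_vector_mul_assoc vector_matrix_mul_assoc)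

lemma wv_yv:
 fixes h :: "'n::{finite,linorder} rmat"
 assumes "CARD('n) \<ge> 2" "h \<in> carrier SL"
 shows "wv h \<bullet> yv h = 1"
 by (simp add: yv_def wv_def dot_lmul_matrix SL_cancel_vec assms uvec_inner)

lemma Ad_inv_Smat:
 fixes h :: "'n::{finite,linorder} rmat"
 assumes "CARD('n) \<ge> 2" "h \<in> carrier SL"
 shows "matrix_inv h ** Smat ** h = mat 1 - 2 *\<^sub>R outer (yv h) (wv h)"
 by (simp add: Smat_uvec[OF assms(1)] yv_def wv_def mult_outer outer_mult SL_cancel assms)

lemma sigma_Ad:
 fixes h X :: "'n::{finite,linorder} rmat"
 assumes "CARD('n) \<ge> 2" "h \<in> carrier SL"
 shows "sigma (Ad h X) = Ad h ((mat 1 - 2 *\<^sub>R outer (yv h) (wv h)) ** X ** (mat 1 - 2 *\<^sub>R outer (yv h) (wv h)))"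
 unfolding Ad_inv_Smat[OF assms, symmetric] sigma_eq[OF assms(1)] Ad_def
 by (simp only: matrix_mul_assoc SL_cancel_left[OF assms(2)] SL_cancel[OF assms(2)] matrix_mul_lid)

lemma position_involution:
 fixes h :: "'n::{finite,linorder} rmat"
 assumes "CARD('n) \<ge> 2" "h \<in> carrier SL"
 shows "(mat 1 - 2 *\<^sub>R outer (yv h) (wv h)) ** (mat 1 - 2 *\<^sub>R outer (yv h) (wv h)) = mat 1"
proof -
 have "matrix_inv h ** Smat ** h ** (matrix_inv h ** Smat ** h) = matrix_inv h ** (Smat ** Smat) ** h"
  by (simp only: matrix_mul_assoc SL_cancel_left[OF assms(2)])
 then show ?thesis unfolding Ad_inv_Smat[OF assms] Smat_Smat[OF assms(1)] by (simp add: SL_cancel assms)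
qed

text \<open>An index outside K absorbs the determinant. With two prescribed entries this calls for n
  \<ge> 3.\<close>

lemma exists_prescribed_diagonal:
 fixes f :: "'n::finite => real"
 assumes "\<And>k. k \<in> K ==> f k ~= 0" "K ~= UNIV"
 obtains d :: "'n rvec" where "\<And>k. k \<in> K ==> d $ k = f k" "(\<Prod>k\<in>UNIV. d $ k) = 1"
proof -
 obtain m where m: "m \<notin> K" using assms(2) by auto
 define d :: "'n rvec" where "d = (\<chi> k. if k \<in> K then f k else if k = m then 1 / (\<Prod>k\<in>K. f k) else 1)"
 have "(\<Prod>k\<in>UNIV. d $ k) = (\<Prod>k\<in>insert m K. d $ k)"
  by (rule prod.mono_neutral_right) (auto simp: d_def)
 also have "\<dots> = d $ m * (\<Prod>k\<in>K. d $ k)" using m by simp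
 also have "(\<Prod>k\<in>K. d $ k) = (\<Prod>k\<in>K. f k)" by (intro prod.cong) (auto simp: d_def)
 also have "d $ m * (\<Prod>k\<in>K. f k) = 1" using m assms(1) by (simp add: d_def)
 finally show thesis using that[of d] by (simp add: d_def)
qed

lemma Ad_dg_Dpos:
 fixes h :: "'n::finite rmat"
 assumes "h \<in> carrier SL" "d \<in> Dall"
 shows "Ad (h ** d) ` Dpos = Ad h ` Dpos"
proof -
 have "Ad d x = x" if "x \<in> Dpos" for x
 proof -
  have "d ** x = x ** d" using assms(2) that Dpos_sub_Dall Dall_commute by blast
  then show ?thesis using Dall_SL[OF assms(2)] by (simp add: Ad_def SL_cancel_left)
 qed
 then show ?thesis using assms by (auto simp: Ad_Ad[symmetric] Dall_SL image_iff)
qed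

text \<open>T is the reflection 1 - 2 y w. If each of its rows has at most one nonzero entry then,
  its off-diagonal entries being -2 y_k w_l, the supports of y and w are confined to one common
  index or to one pair that T exchanges up to scale.\<close>

lemma monomial_position:
 fixes y w :: "'n::finite rvec" 
 defines "T \<equiv> %k l. (if k = l then 1 else 0) - 2 * y $ k * w $ l"
 assumes row: "\<And>k l m. T k l ~= 0 ==> T k m ~= 0 ==> l = m" and sum1: "(\<Sum>k\<in>UNIV. w $ k * y $ k) = 1"
 obtains (zero) i where "w $ i * y $ i = 1" "\<And>k. k ~= i ==> y $ k = 0 \<and> w $ k = 0"
 | (one) i j where "i ~= j" "w $ i * y $ i = 1/2" "w $ j * y $ j = 1/2"
  "\<And>k. k ~= i ==> k ~= j ==> y $ k = 0 \<and> w $ k = 0"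
proof -
 have "\<exists>i. w $ i * y $ i ~= 0" using sum1 by (metis (no_types, lifting) sum.neutral zero_neq_one)
 then obtain i where i: "w $ i ~= 0" "y $ i ~= 0" by auto
 show thesis
 proof (cases "\<exists>l. l ~= i \<and> w $ l ~= 0")
  case False
  have "(\<Sum>k\<in>UNIV. w $ k * y $ k) = (\<Sum>k\<in>{i}. w $ k * y $ k)"
  by (rule sum.mono_neutral_right) (use False in auto)
  then have "w $ i * y $ i = 1" using sum1 by simp
  moreover have "y $ k = 0" if "k ~= i" for k
  proof (rule ccontr)
  assume "y $ k ~= 0"
  then have "T k i ~= 0" "T k k ~= 0" using that i False by (auto simp: T_def)
  then show False using row that by blast
  qed
  ultimately show ?thesis using zero[of i] False by blast
 next
  case True
  then obtain j where j: "j ~= i" "w $ j ~= 0" by auto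
  \<comment> \<open>Row i already has its nonzero entry in column j, so its diagonal entry 1 - 2 y_i
    w_i vanishes; the sum condition then gives the same product at j.\<close>
  have Tij: "T i j ~= 0" using i j by (simp add: T_def)
  then have Ti: "T i m = 0" if "m ~= j" for m using row that by blast
  have wi: "w $ i * y $ i = 1/2" using Ti[of i] j by (simp add: T_def mult_ac)
  have w0: "w $ m = 0" if "m ~= i" "m ~= j" for m using Ti[of m] that i by (simp add: T_def)
  have "(\<Sum>k\<in>UNIV. w $ k * y $ k) = (\<Sum>k\<in>{i,j}. w $ k * y $ k)"
  by (rule sum.mono_neutral_right) (use w0 in auto)
  then have wj: "w $ j * y $ j = 1/2" using sum1 wi j by simp
  have "y $ k = 0" if "k ~= i" "k ~= j" for k
  proof (rule ccontr)
  assume "y $ k ~= 0"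
  then have "T k i ~= 0" "T k j ~= 0" using that i j by (auto simp: T_def)
  then show False using row j by blast
  qed
  then show ?thesis using one[of i j] w0 wi wj j by blast
 qed
qed

text \<open>Stability of A sends one regular torus element back into the torus, and this alone makes
  the reflection monomial. A diagonal matrix of determinant 1 then rescales y to entries 1 on its
  support, and the products w_k y_k determine w.\<close>

lemma sigma_split_component_std:
 fixes g :: "'n::{finite,linorder} rmat"
 assumes n: "CARD('n) \<ge> 3" and g: "g \<in> carrier SL" and A: "sigma_split_component A (Ad g ` Bup)"
 obtains b j i where "b \<in> Bup" "std (g ** b) j i" "A = Ad (g ** b) ` Dpos"
proof -
 note main = that
 have n2: "CARD('n) \<ge> 2" using n by simp
 obtain m where m: "m \<in> Uni" "A = Ad (g ** m) ` Dpos"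
  using A split_component_iff[OF g] by (auto simp: sigma_split_component_def)
 have mB: "m \<in> Bup" using m Uni_sub_Bup by auto
 define h where "h = g ** m"
 have h: "h \<in> carrier SL" using g mB by (auto simp: h_def Bup_iff)
 define y where "y = yv h"
 define w where "w = wv h"
 define T where "T = mat 1 - 2 *\<^sub>R outer y w"
 have TT: "T ** T = mat 1" using position_involution[OF n2 h] by (simp add: T_def y_def w_def)
 have "sigma (Ad h (dg regvec)) \<in> A"
 proof -
  have "Ad h (dg regvec) \<in> A" using m regvec_Dpos by (auto simp: h_def)
  then show ?thesis using A by (auto simp: sigma_split_component_def)
 qed
 then have "Ad h (T ** dg regvec ** T) \<in> Ad h ` Dpos"
  using sigma_Ad[OF n2 h] m by (simp add: T_def y_def w_def h_def)
 then have "T ** dg regvec ** T \<in> Dpos" using Ad_inj[OF h] by (simp add: inj_image_mem_iff)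
 then obtain x' where x': "T ** dg regvec ** T = dg x'" by (auto simp: Dpos_def)
 have "T ** dg regvec = dg x' ** T"
  using arg_cong[OF x', of "%X. X ** T"] by (simp add: TT flip: matrix_mul_assoc)
 then have entry: "T $ k $ l * regvec $ l = x' $ k * T $ k $ l" for k l by (metis dg_mult_nth)
 have T: "T $ k $ l = (if k = l then 1 else 0) - 2 * y $ k * w $ l" for k l by (simp add: T_def mat_def)
 have row: "l = p" if "T $ k $ l ~= 0" "T $ k $ p ~= 0" for k l p
  using entry[of k l] entry[of k p] that regvec(3)[of l p] by (auto simp: mult.commute)
 have sum1: "(\<Sum>k\<in>UNIV. w $ k * y $ k) = 1"
  using wv_yv[OF n2 h] by (simp add: inner_vec_def y_def w_def)
 have fin: thesis if K: "K ~= UNIV" "\<And>k. k \<in> K ==> y $ k ~= 0" 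
  and st: "\<And>d. (\<Prod>k\<in>UNIV. d $ k) = 1 ==> (\<And>k. k \<in> K ==> d $ k = y $ k) ==> std (h ** dg d) j i" for K j i
 proof -
  obtain d :: "'n rvec" where d: "\<And>k. k \<in> K ==> d $ k = y $ k" "(\<Prod>k\<in>UNIV. d $ k) = 1"
  using exists_prescribed_diagonal[of K "%k. y $ k"] K by blast
  have dD: "dg d \<in> Dall" using d by (auto simp: Dall_def)
  have "std (h ** dg d) j i" using st d by blast
  moreover have "A = Ad (h ** dg d) ` Dpos" using Ad_dg_Dpos[OF h dD] m by (simp add: h_def)
  moreover have "m ** dg d \<in> Bup" using mB dD Dall_sub_Bup by (intro Bup_mult) auto
  ultimately show thesis using main[of "m ** dg d"] by (simp add: h_def matrix_mul_assoc)
 qed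
 have hd: "yv (h ** dg d) = (\<chi> k. y $ k / d $ k) \<and> wv (h ** dg d) = (\<chi> k. w $ k * d $ k) \<and> h ** dg d \<in> carrier SL"
  if d: "(\<Prod>k\<in>UNIV. d $ k) = 1" for d
 proof -
  have dS: "dg d \<in> carrier SL" using d by (simp add: mem_SL det_dg)
  have mi: "matrix_inv (dg d) = dg (\<chi> k. 1 / d $ k)" by (rule matrix_inv_dg) (rule prod_one_nz[OF d])
  show ?thesis using h dS unfolding yv_wv_mult[OF h dS] mi by (auto simp: vec_eq_iff y_def w_def)
 qed
 show thesis
 proof (rule monomial_position[of y w])
  show "\<And>k l m. (if k = l then 1 else 0) - 2 * y $ k * w $ l ~= 0 ==> (if k = m then 1 else 0) - 2 * y $ k * w $ m ~= 0 ==> l = m"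
  using row unfolding T by blast
  show "(\<Sum>k\<in>UNIV. w $ k * y $ k) = 1" by (rule sum1)
 next
  fix i assume i: "w $ i * y $ i = 1" "\<And>k. k ~= i ==> y $ k = 0 \<and> w $ k = 0"
  show thesis
  proof (rule fin[of "{i}" i i])
  show "{i} ~= UNIV"
  proof
  assume "{i} = UNIV"
  then have "card {i} = CARD('n)" by simp
  then show False using n by simp
  qed
  show "y $ k ~= 0" if "k \<in> {i}" for k using that i by auto
  fix d assume "(\<Prod>k\<in>UNIV. d $ k) = 1" "\<And>k. k \<in> {i} ==> d $ k = y $ k"
  then show "std (h ** dg d) i i" using hd[of d] i by (auto simp: std_def vec_eq_iff axis_def)
  qed
 next
  fix i j assume ij: "i ~= j" "w $ i * y $ i = 1/2" "w $ j * y $ j = 1/2"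
  "\<And>k. k ~= i ==> k ~= j ==> y $ k = 0 \<and> w $ k = 0"
  show thesis
  proof (rule fin[of "{i,j}" "min i j" "max i j"])
  show "{i,j} ~= UNIV" 
  proof
  assume "{i,j} = UNIV"
  then have "card {i,j} = CARD('n)" by simp
  then show False using n ij(1) by simp
  qed
  show "y $ k ~= 0" if "k \<in> {i,j}" for k using that ij by auto
  fix d assume d: "(\<Prod>k\<in>UNIV. d $ k) = 1" "\<And>k. k \<in> {i,j} ==> d $ k = y $ k"
  have hS: "h ** dg d \<in> carrier SL" and yd: "yv (h ** dg d) $ k = y $ k / d $ k"
  and wd: "wv (h ** dg d) $ k = w $ k * d $ k" for k using hd[OF d(1)] by simp_all
  have "yv (h ** dg d) $ k = (axis i 1 + axis j 1) $ k" for k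
  using yd[of k] d(2)[of k] ij by (cases "k = i"; cases "k = j") (auto simp: axis_def)
  moreover have "wv (h ** dg d) $ k = ((1/2) *\<^sub>R (axis i 1 + axis j 1)) $ k" for k
  using wd[of k] d(2)[of k] ij by (cases "k = i"; cases "k = j") (auto simp: axis_def)
  ultimately have "yv (h ** dg d) = axis i 1 + axis j 1" "wv (h ** dg d) = (1/2) *\<^sub>R (axis i 1 + axis j 1)"
  unfolding vec_eq_iff by blast+
  then show "std (h ** dg d) (min i j) (max i j)"
  using hS ij(1) by (cases "i < j") (auto simp: std_def min_def max_def add.commute)
  qed
 qed
qed

lemma std_yv:
 assumes "std h j i"
 shows "yv h $ i = 1" "i < l ==> yv h $ l = 0" "wv h $ j ~= 0" "k < j ==> wv h $ k = 0"
  "yv h $ k = (if k = i \<or> k = j then 1 else 0)"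
  "wv h $ k = (if k = i \<or> k = j then if i = j then 1 else 1/2 else 0)"
 using assms by (auto simp: std_def axis_def split: if_splits)

lemma upper_mult_vec:
 fixes b :: "'n::{finite,linorder} rmat"
 assumes b: "\<And>k l. l < k ==> b $ k $ l = 0"
 shows "(\<And>l. i < l ==> y $ l = 0) ==> i \<le> l ==> (b *v y) $ l = b $ l $ l * y $ l"
  and "(\<And>k. k < j ==> w $ k = 0) ==> k \<le> j ==> (w v* b) $ k = w $ k * b $ k $ k"
proof -
 assume "\<And>l. i < l ==> y $ l = 0" "i \<le> l"
 then have "(\<Sum>m\<in>UNIV. b $ l $ m * y $ m) = (\<Sum>m\<in>{l}. b $ l $ m * y $ m)"
  by (intro sum.mono_neutral_right) (auto simp: b, metis antisym_conv3 b le_less_trans)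
 then show "(b *v y) $ l = b $ l $ l * y $ l" by (simp add: matrix_vector_mult_def)
next
 assume "\<And>k. k < j ==> w $ k = 0" "k \<le> j"
 then have "(\<Sum>m\<in>UNIV. b $ m $ k * w $ m) = (\<Sum>m\<in>{k}. b $ m $ k * w $ m)"
  by (intro sum.mono_neutral_right) (auto simp: b, metis antisym_conv3 b less_le_trans)
 then show "(w v* b) $ k = w $ k * b $ k $ k" by (simp add: vector_matrix_mult_def mult.commute)
qed

text \<open>Triangular matrices preserve the last nonzero index of y and the first nonzero index of
  w, which are i and j. This is why rank and compatibility do not depend on the chosen
  component.\<close>

lemma std_unique:
 assumes "std h j i" "std (h ** b) j' i'" "b \<in> Bup"
 shows "j = j'" "i = i'"
proof -
 have S: "h \<in> carrier SL" "b \<in> carrier SL" using assms by (auto simp: std_def Bup_iff)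
 have bi: "matrix_inv b \<in> Bup" using assms Bup_inv by auto
 have y: "yv (h ** b) $ l = matrix_inv b $ l $ l * yv h $ l" if "i \<le> l" for l
  unfolding yv_wv_mult[OF S] using bi by (intro upper_mult_vec(1)[OF _ _ that]) (auto simp: Bup_iff std_yv(2)[OF assms(1)])
 have w: "wv (h ** b) $ l = wv h $ l * b $ l $ l" if "l \<le> j" for l
  unfolding yv_wv_mult[OF S] using assms by (intro upper_mult_vec(2)[OF _ _ that]) (auto simp: Bup_iff std_yv(4)[OF assms(1)])
 show "i = i'"
 proof (rule antisym)
  show "i \<le> i'"
  proof (rule ccontr)
  assume "\<not> i \<le> i'"
  then show False using y[of i] std_yv(1)[OF assms(1)] std_yv(2)[OF assms(2), of i] Bup_diag_nz[OF bi, of i] by simp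
  qed
  show "i' \<le> i"
  proof (rule ccontr)
  assume "\<not> i' \<le> i"
  then show False using y[of i'] std_yv(2)[OF assms(1), of i'] std_yv(1)[OF assms(2)]
  by (metis linear mult_zero_right not_le zero_neq_one)
  qed
 qed
 show "j = j'"
 proof (rule antisym)
  show "j' \<le> j"
  proof (rule ccontr)
  assume "\<not> j' \<le> j"
  then show False using w[of j] std_yv(3)[OF assms(1)] std_yv(4)[OF assms(2), of j] Bup_diag_nz[OF assms(3), of j] by simp
  qed
  show "j \<le> j'"
  proof (rule ccontr)
  assume "\<not> j \<le> j'"
  then show False using w[of j'] std_yv(4)[OF assms(1), of j'] std_yv(3)[OF assms(2)]
  by (metis linear mult_zero_left not_le)
  qed
 qed
qed


section \<open>The Lie algebra of the split component and the rank in a standard frame\<close>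

lemma lie_alg_Int: "lie_alg (U \<inter> V) = lie_alg U \<inter> lie_alg V"
 by (auto simp: lie_alg_def)

definition a0 :: "'n::finite rmat set" where "a0 = {dg x | x. (\<Sum>k\<in>UNIV. x $ k) = 0}"

lemma lie_alg_Dpos: "lie_alg (Dpos :: 'n::finite rmat set) = a0"
proof (intro equalityI subsetI)
 fix X :: "'n rmat" assume X: "X \<in> lie_alg Dpos"
 have V: "subspace {A :: 'n rmat. \<forall>k l. k ~= l --> A $ k $ l = 0}" by (auto simp: subspace_def)
 have "X \<in> {A :: 'n rmat. \<forall>k l. k ~= l --> A $ k $ l = 0}"
 proof (rule mat_exp_derivative_in_subspace[OF V])
  fix t :: real
  have "mat_exp (t *\<^sub>R X) \<in> Dpos" using X by (simp add: lie_alg_def)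
  then show "mat_exp (t *\<^sub>R X) - mat 1 \<in> {A. \<forall>k l. k ~= l --> A $ k $ l = 0}"
  by (auto simp: Dpos_def dg_nth mat_def)
 qed
 then have Xd: "X = dg (\<chi> k. X $ k $ k)" by (intro diagonal_eq_dg) auto
 have "mat_exp (1 *\<^sub>R X) \<in> Dpos" using X unfolding lie_alg_def by blast
 then have "dg (\<chi> k. exp (X $ k $ k)) \<in> Dpos" by (subst (asm) Xd) (simp add: mat_exp_dg)
 then have "exp (\<Sum>k\<in>UNIV. X $ k $ k) = 1" by (auto simp: Dpos_def dg_eq_iff exp_sum)
 then have "(\<Sum>k\<in>UNIV. X $ k $ k) = 0" by simp
 then show "X \<in> a0" using Xd unfolding a0_def by (auto intro!: exI[of _ "\<chi> k. X $ k $ k"])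
next
 fix X :: "'n rmat" assume "X \<in> a0"
 then obtain x where x: "X = dg x" "(\<Sum>k\<in>UNIV. x $ k) = 0" by (auto simp: a0_def)
 have "mat_exp (t *\<^sub>R X) \<in> Dpos" for t
  using x(2) unfolding x(1) dg_scaleR[symmetric] mat_exp_dg
  by (auto simp: Dpos_def exp_sum[symmetric] sum_distrib_left[symmetric])
 then show "X \<in> lie_alg Dpos" by (simp add: lie_alg_def)
qed

text \<open>In a standard frame the reflection permutes the basis by the transposition of i and j up
  to signs, and on diagonal matrices the signs cancel. For i = j only one sign is left.\<close>

lemma std_conj_dg:
 fixes h :: "'n::{finite,linorder} rmat"
 assumes s: "std h j i"
 shows "(mat 1 - 2 *\<^sub>R outer (yv h) (wv h)) ** dg x ** (mat 1 - 2 *\<^sub>R outer (yv h) (wv h)) =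
  dg (\<chi> k. x $ Transposition.transpose i j k)"
proof (cases "i = j")
 case True
 define T where "T = mat 1 - 2 *\<^sub>R outer (yv h) (wv h)"
 have T: "T = dg (\<chi> k. if k = i then -1 else 1)"
  using True by (auto simp: T_def vec_eq_iff dg_nth mat_def std_yv[OF s])
 have "T ** dg x ** T = dg (\<chi> k. x $ Transposition.transpose i j k)"
  unfolding T dg_mult by (rule arg_cong[where f = dg]) (use True in \<open>simp add: vec_eq_iff\<close>)
 then show ?thesis by (simp add: T_def)
next
 case False
 define T where "T = mat 1 - 2 *\<^sub>R outer (yv h) (wv h)"
 let ?tau = "Transposition.transpose i j"
 define c :: "'n => real" where "c k = (if k = i \<or> k = j then -1 else 1)" for k
 have T: "T $ k $ l = (if l = ?tau k then c k else 0)" for k l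
  using False by (auto simp: T_def mat_def std_yv[OF s] c_def Transposition.transpose_def)
 have "(T ** dg x ** T) $ k $ l = dg (\<chi> k. x $ ?tau k) $ k $ l" for k l
 proof -
  have "(T ** dg x ** T) $ k $ l = (\<Sum>m\<in>UNIV. (T ** dg x) $ k $ m * T $ m $ l)"
  by (simp add: matrix_matrix_mult_def)
  also have "\<dots> = (\<Sum>m\<in>{?tau k}. (T ** dg x) $ k $ m * T $ m $ l)"
  by (rule sum.mono_neutral_right) (auto simp: T)
  also have "\<dots> = dg (\<chi> k. x $ ?tau k) $ k $ l"
  by (auto simp: T dg_nth c_def Transposition.transpose_def split: if_splits)
  finally show ?thesis .
 qed
 then show ?thesis by (simp add: T_def vec_eq_iff)
qed

lemma std_sigma_dg:
 fixes h :: "'n::{finite,linorder} rmat"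
 assumes "CARD('n) \<ge> 2" "std h j i"
 shows "sigma (Ad h (dg x)) = Ad h (dg (\<chi> k. x $ Transposition.transpose i j k))"
 using sigma_Ad[OF assms(1) std_SL[OF assms(2)]] std_conj_dg[OF assms(2)] by simp

lemma std_sigma_split_component:
 fixes h :: "'n::{finite,linorder} rmat"
 assumes n: "CARD('n) \<ge> 2" and s: "std h j i"
 shows "sigma_split_component (Ad h ` Dpos) (Ad h ` Bup)"
 unfolding sigma_split_component_def
proof
 have "(mat 1 :: 'n rmat) \<in> Uni" by (auto simp: Uni_def mat_def)
 then show "split_component (Ad h ` Dpos) (Ad h ` Bup)"
  unfolding split_component_iff[OF std_SL[OF s]] by (intro bexI[of _ "mat 1"]) auto
 have sub: "sigma ` Ad h ` Dpos \<subseteq> Ad h ` Dpos"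
 proof
  fix z assume "z \<in> sigma ` Ad h ` Dpos"
  then obtain x where x: "\<forall>k. 0 < x $ k" "(\<Prod>k\<in>UNIV. x $ k) = 1" "z = sigma (Ad h (dg x))" by (auto simp: Dpos_def)
  have "(\<Prod>k\<in>UNIV. x $ Transposition.transpose i j k) = (\<Prod>k\<in>UNIV. x $ k)"
  by (rule prod.reindex_bij_betw) simp
  then have "dg (\<chi> k. x $ Transposition.transpose i j k) \<in> Dpos" using x by (auto simp: Dpos_def)
  then show "z \<in> Ad h ` Dpos" using x std_sigma_dg[OF n s, of x] by simp
 qed
 have inv: "sigma (sigma z) = z" for z :: "'n rmat"
  unfolding sigma_eq[OF n]
  by (metis Smat_Smat[OF n] matrix_mul_assoc matrix_mul_lid matrix_mul_rid)
 show "sigma ` Ad h ` Dpos = Ad h ` Dpos"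
 proof
  show "Ad h ` Dpos \<subseteq> sigma ` Ad h ` Dpos"
  proof
  fix z assume z: "z \<in> Ad h ` Dpos"
  then have "sigma z \<in> Ad h ` Dpos" using sub by blast
  then show "z \<in> sigma ` Ad h ` Dpos" using inv[of z] by (metis imageI)
  qed
 qed (rule sub)
qed

lemma std_lie_A: "std h j i ==> lie_alg (Ad h ` Dpos) = Ad h ` a0"
 by (simp add: lie_alg_Ad std_SL lie_alg_Dpos)

lemma subspace_a0: "subspace (a0 :: 'n::finite rmat set)"
 unfolding subspace_def
proof (intro conjI ballI allI)
 show "(0 :: 'n rmat) \<in> a0" unfolding a0_def by (rule CollectI, rule exI[of _ 0]) (simp add: vec_eq_iff dg_nth)
 fix x y :: "'n rmat" assume "x \<in> a0" "y \<in> a0"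
 then show "x + y \<in> a0" unfolding a0_def by (force simp: dg_add[symmetric] sum.distrib)
next
 fix c :: real and x :: "'n rmat" assume "x \<in> a0"
 then show "c *\<^sub>R x \<in> a0" unfolding a0_def by (force simp: dg_scaleR[symmetric] sum_distrib_left[symmetric])
qed

lemma std_lie_A_Int_H:
 fixes h :: "'n::{finite,linorder} rmat"
 assumes n: "CARD('n) \<ge> 2" and s: "std h j i"
 shows "lie_alg (Ad h ` Dpos \<inter> Hgrp) = Ad h ` {dg x | x. (\<Sum>k\<in>UNIV. x $ k) = 0 \<and> x $ i = x $ j}"
proof -
 have "Ad h (dg x) \<in> lie_alg Hgrp \<longleftrightarrow> x $ i = x $ j" if x: "(\<Sum>k\<in>UNIV. x $ k) = 0" for x
 proof -
  have e: "mat_exp (t *\<^sub>R Ad h (dg x)) = Ad h (dg (\<chi> k. exp (t * x $ k)))" for t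
  by (simp add: mat_exp_Ad std_SL[OF s] mat_exp_dg flip: linear_cmul[OF Ad_linear] dg_scaleR)
  have S: "Ad h (dg (\<chi> k. exp (t * x $ k))) \<in> carrier SL" for t
  using x by (intro Ad_SL std_SL[OF s]) (simp add: mem_SL det_dg exp_sum[symmetric] sum_distrib_left[symmetric])
  have "Ad h (dg x) \<in> lie_alg Hgrp \<longleftrightarrow>
  (\<forall>t k. exp (t * x $ Transposition.transpose i j k) = exp (t * x $ k))"
  proof -
  have "Ad h (dg x) \<in> lie_alg Hgrp \<longleftrightarrow> (\<forall>t. Ad h (dg (\<chi> k. exp (t * x $ k))) \<in> Hgrp)"
  by (simp add: lie_alg_def e)
  also have "\<dots> \<longleftrightarrow> (\<forall>t. (\<chi> k. exp (t * x $ Transposition.transpose i j k)) = (\<chi> k. exp (t * x $ k)))"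
  using S by (simp add: Hgrp_def std_sigma_dg[OF n s] inj_eq[OF Ad_inj[OF std_SL[OF s]]] dg_eq_iff)
  finally show ?thesis by (simp only: vec_eq_iff vec_lambda_beta)
  qed
  also have "\<dots> \<longleftrightarrow> (\<forall>t k. t * x $ Transposition.transpose i j k = t * x $ k)" by simp
  also have "\<dots> \<longleftrightarrow> x $ i = x $ j"
  by (auto simp: Transposition.transpose_def split: if_splits)
  finally show ?thesis .
 qed
 then show ?thesis
  unfolding lie_alg_Int std_lie_A[OF s] a0_def by auto
qed

lemma std_rank:
 fixes h :: "'n::{finite,linorder} rmat"
 assumes n: "CARD('n) \<ge> 2" and s: "std h j i"
 shows "dim (lie_alg (Ad h ` Dpos)) - dim (lie_alg (Ad h ` Dpos \<inter> Hgrp)) = (if j = i then 0 else 1)"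
proof (cases "j = i")
 case True
 then show ?thesis unfolding std_lie_A_Int_H[OF assms] std_lie_A[OF s] a0_def by simp
next
 case False
 let ?W = "{dg x | x. (\<Sum>k\<in>UNIV. x $ k) = 0 \<and> x $ i = x $ j} :: 'n rmat set"
 have W: "subspace ?W" unfolding subspace_def
 proof (intro conjI ballI allI)
  show "(0 :: 'n rmat) \<in> ?W" by (rule CollectI, rule exI[of _ 0]) (simp add: vec_eq_iff dg_nth)
  fix x y :: "'n rmat" assume "x \<in> ?W" "y \<in> ?W"
  then show "x + y \<in> ?W" by (force simp: dg_add[symmetric] sum.distrib)
 next
  fix c :: real and x :: "'n rmat" assume "x \<in> ?W"
  then show "c *\<^sub>R x \<in> ?W" by (force simp: dg_scaleR[symmetric] sum_distrib_left[symmetric])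
 qed
 \<comment> \<open>The fixed part is the hyperplane x_i = x_j of the diagonal algebra, and e spans a
   complement.\<close>
 define e :: "'n rvec" where "e = axis i 1 - axis j 1"
 have e0: "(\<Sum>k\<in>UNIV. e $ k) = 0" by (simp add: e_def axis_def sum_subtractf)
 have span: "span (insert (dg e) ?W) = a0"
 proof
  show "span (insert (dg e) ?W) \<subseteq> a0"
  by (rule span_minimal[OF _ subspace_a0]) (use e0 in \<open>auto simp: a0_def\<close>)
  show "a0 \<subseteq> span (insert (dg e) ?W)"
  proof
  fix X :: "'n rmat" assume "X \<in> a0"
  then obtain x where x: "X = dg x" "(\<Sum>k\<in>UNIV. x $ k) = 0" by (auto simp: a0_def)
  define c where "c = (x $ i - x $ j) / 2"
  have "x $ i - c * e $ i = x $ j - c * e $ j"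
  using False by (simp add: e_def axis_def c_def field_simps)
  then have "dg (x - c *\<^sub>R e) \<in> ?W"
  using x e0 by (auto intro!: exI[of _ "x - c *\<^sub>R e"] simp: sum_subtractf sum_distrib_left[symmetric])
  then have "dg (x - c *\<^sub>R e) + c *\<^sub>R dg e \<in> span (insert (dg e) ?W)"
  by (intro span_add span_scale span_base) auto
  moreover have "dg (x - c *\<^sub>R e) + c *\<^sub>R dg e = X"
  unfolding x(1) by (simp flip: dg_scaleR dg_add)
  ultimately show "X \<in> span (insert (dg e) ?W)" by simp
  qed
 qed
 have "dg e \<notin> span ?W"
  unfolding span_eq_iff[THEN iffD2, OF W] using False by (auto simp: dg_eq_iff e_def axis_def)
 then have "dim (a0 :: 'n rmat set) = Suc (dim ?W)"
  using dim_insert[of "dg e" ?W] dim_span[of "insert (dg e) ?W"] span by simp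
 moreover have "dim (Ad h ` V) = dim V" for V
  by (rule dim_image_eq[OF Ad_linear]) (use Ad_inj[OF std_SL[OF s]] in \<open>auto intro: inj_on_subset\<close>)
 ultimately show ?thesis using False unfolding std_lie_A_Int_H[OF assms] std_lie_A[OF s] by simp
qed

lemma std_sigma_rank:
 fixes h :: "'n::{finite,linorder} rmat"
 assumes n: "CARD('n) \<ge> 3" and s: "std h j i"
 shows "sigma_rank_is (Ad h ` Bup) r \<longleftrightarrow> r = (if j = i then 0 else 1)"
proof
 have n2: "CARD('n) \<ge> 2" using n by simp
 {
  assume "sigma_rank_is (Ad h ` Bup) r"
  then obtain A where A: "sigma_split_component A (Ad h ` Bup)"
  "dim (lie_alg A) - dim (lie_alg (A \<inter> Hgrp)) = r" by (auto simp: sigma_rank_is_def)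
  obtain b j' i' where b: "b \<in> Bup" "std (h ** b) j' i'" "A = Ad (h ** b) ` Dpos"
  using sigma_split_component_std[OF n std_SL[OF s] A(1)] .
  show "r = (if j = i then 0 else 1)"
  using std_rank[OF n2 b(2)] A(2) b(3) std_unique[OF s b(2,1)] by auto
 }
 assume "r = (if j = i then 0 else 1)"
 then show "sigma_rank_is (Ad h ` Bup) r"
  unfolding sigma_rank_is_def using std_sigma_split_component[OF n2 s] std_rank[OF n2 s] by blast
qed

lemma std_min_parabolic: "std h j i ==> Ad h ` Bup \<in> min_parabolics"
 by (auto simp: min_parabolics_def std_def)

lemma std_cal_P_cal_Q:
 fixes h :: "'n::{finite,linorder} rmat"
 assumes "CARD('n) \<ge> 3" "std h j i"
 shows "Ad h ` Bup \<in> cal_P \<longleftrightarrow> j < i" "Ad h ` Bup \<in> cal_Q \<longleftrightarrow> j = i"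
 using std_sigma_rank[OF assms] std_min_parabolic[OF assms(2)] assms(2)
 by (auto simp: cal_P_def cal_Q_def std_def)

lemma min_parabolic_std:
 fixes P :: "'n::{finite,linorder} rmat set"
 assumes n: "CARD('n) \<ge> 3" and P: "P \<in> min_parabolics" and A: "sigma_split_component A P"
 obtains h j i where "std h j i" "P = Ad h ` Bup" "A = Ad h ` Dpos"
proof -
 obtain g where g: "g \<in> carrier SL" "P = Ad g ` Bup" using P by (auto simp: min_parabolics_def)
 obtain b j i where b: "b \<in> Bup" "std (g ** b) j i" "A = Ad (g ** b) ` Dpos"
  using sigma_split_component_std[OF n g(1)] A g by metis
 then show thesis using that[of "g ** b" j i] conj_Bup_mult[OF g(1) b(1)] g by simp
qed

subsection \<open>Roots and compatibility\<close>

definition nn :: "'n::{finite,linorder} rmat set" where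
 "nn = {X. \<forall>k l. l \<le> k --> X $ k $ l = 0}"

lemma subspace_nn: "subspace (nn :: 'n::{finite,linorder} rmat set)"
 by (auto simp: subspace_def nn_def)

lemma nn_mult: "A \<in> nn ==> B \<in> nn ==> A ** B \<in> (nn :: 'n::{finite,linorder} rmat set)"
proof -
 assume A: "A \<in> nn" and B: "B \<in> nn"
 have "(A ** B) $ k $ l = 0" if "l \<le> k" for k l
  unfolding matrix_matrix_mult_def using A B that
  by (simp, intro sum.neutral) (auto simp: nn_def, metis le_cases order_trans)
 then show ?thesis by (simp add: nn_def)
qed

lemma Uni_SL: "(x :: 'n::{finite,linorder} rmat) \<in> Uni ==> x \<in> carrier SL"
 by (drule subsetD[OF Uni_sub_Bup]) (simp add: Bup_iff)

lemma Uni_eq_affine: "(Uni :: 'n::{finite,linorder} rmat set) = {g. g - mat 1 \<in> nn}"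
 by (auto simp: Uni_def nn_def mat_def le_less)

lemma lie_alg_Uni: "lie_alg (Uni :: 'n::{finite,linorder} rmat set) = nn"
 unfolding Uni_eq_affine by (rule lie_alg_affine[OF subspace_nn nn_mult])

lemma std_lie_N: "h \<in> carrier SL ==> lie_alg (unipotent_radical (Ad h ` Bup)) = Ad h ` nn"
 by (simp add: unipotent_radical_conj lie_alg_Ad lie_alg_Uni)

definition unit_mat :: "'n::finite => 'n => 'n rmat" where
 "unit_mat k l = axis k (axis l 1)"

lemma unit_mat_nth: "unit_mat k l $ p $ q = (if p = k \<and> q = l then 1 else 0)"
 by (auto simp: unit_mat_def axis_def)

lemma unit_mat_eq_iff: "unit_mat a b = unit_mat c d \<longleftrightarrow> a = c \<and> b = d"
 by (auto simp: unit_mat_def axis_eq_axis)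

lemma unit_mat_mult: 
 fixes A B :: "'n::finite rmat"
 shows "(A ** unit_mat k l ** B) $ p $ q = A $ p $ k * B $ l $ q"
proof -
 have 1: "(A ** unit_mat k l) $ p $ r = (if r = l then A $ p $ k else 0)" for p r
  by (cases "r = l") (simp_all add: matrix_matrix_mult_def unit_mat_nth if_distrib cong: if_cong)
 have "(A ** unit_mat k l ** B) $ p $ q = (\<Sum>r\<in>UNIV. (A ** unit_mat k l) $ p $ r * B $ r $ q)"
  by (simp add: matrix_matrix_mult_def[of "A ** unit_mat k l"])
 also have "\<dots> = (\<Sum>r\<in>UNIV. if r = l then A $ p $ k * B $ r $ q else 0)"
  unfolding 1 by (intro sum.cong) auto
 finally show ?thesis by simp
qed

text \<open>The functional with coefficient vector c in the frame h, set to 0 off its domain as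
  \<open>dual_space\<close> demands; \<open>al h k l\<close> is the root of the matrix unit (k,
  l).\<close>

definition fl :: "'n::finite rmat => 'n rvec => 'n rmat => real" where
 "fl h c X = (if X \<in> Ad h ` a0 then \<Sum>k\<in>UNIV. c $ k * Ad (matrix_inv h) X $ k $ k else 0)"

abbreviation al :: "'n::finite rmat => 'n => 'n => 'n rmat => real" where
 "al h k l \<equiv> fl h (axis k 1 - axis l 1)"

lemma fl_apply:
 fixes h :: "'n::finite rmat"
 assumes "h \<in> carrier SL" "(\<Sum>k\<in>UNIV. x $ k) = 0"
 shows "fl h c (Ad h (dg x)) = (\<Sum>k\<in>UNIV. c $ k * x $ k)"
proof -
 have "dg x \<in> a0" using assms by (auto simp: a0_def)
 then show ?thesis using assms by (simp add: fl_def dg_nth)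
qed

lemma sum_axis_diff: "(\<Sum>m\<in>UNIV. (axis k 1 - axis l 1 :: 'n::finite rvec) $ m * x $ m) = x $ k - x $ l"
proof -
 have "(\<Sum>m\<in>UNIV. (axis k 1 - axis l 1 :: 'n rvec) $ m * x $ m)
  = (\<Sum>m\<in>UNIV. (if m = k then x $ m else 0) - (if m = l then x $ m else 0))"
  by (intro sum.cong refl) (auto simp: axis_def)
 then show ?thesis by (simp add: sum_subtractf)
qed

lemma al_apply:
 fixes h :: "'n::finite rmat"
 assumes "h \<in> carrier SL" "(\<Sum>k\<in>UNIV. x $ k) = 0"
 shows "al h k l (Ad h (dg x)) = x $ k - x $ l"
 unfolding fl_apply[OF assms] by (rule sum_axis_diff)

lemma sum_axis_diff_zero: "(\<Sum>m\<in>UNIV. (axis k 1 - axis l 1 :: 'n::finite rvec) $ m) = 0"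
 using sum_axis_diff[of k l "\<chi> m. 1"] by simp

lemma fl_dual_space:
 assumes "h \<in> carrier SL"
 shows "fl h c \<in> dual_space (Ad h ` a0)"
proof -
 have sub: "subspace (Ad h ` a0)" by (rule linear_subspace_image[OF Ad_linear subspace_a0])
 show ?thesis unfolding dual_space_def
  using subspace_add[OF sub] subspace_scale[OF sub]
  by (auto simp: fl_def linear_add[OF Ad_linear] linear_cmul[OF Ad_linear] algebra_simps sum.distrib sum_distrib_left)
qed

text \<open>At the point e_k - e_l the right side is 2, and only the difference of the coordinates k
  and l reaches 2 there.\<close>

lemma al_inj:
 fixes h :: "'n::finite rmat" and k l p q :: 'n
 assumes h: "h \<in> carrier SL" and "k ~= l" and eq: "\<And>x :: 'n rvec. (\<Sum>m\<in>UNIV. x $ m) = 0 ==> x $ p - x $ q = x $ k - x $ l"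
 shows "p = k \<and> q = l"
 using eq[OF sum_axis_diff_zero, of k l] assms(2) by (auto simp: axis_def split: if_splits)

lemma trace_Ad: "h \<in> carrier SL ==> trace (Ad h X) = trace X"
 unfolding Ad_def by (subst trace_mul_sym) (simp add: matrix_mul_assoc SL_cancel)

text \<open>Bracketing with \<open>dg x\<close> multiplies the (p, q) entry by x_p - x_q, so
  membership can be read off entry by entry.\<close>

lemma mem_root_space_Ad:
 fixes h :: "'n::finite rmat"
 assumes h: "h \<in> carrier SL"
 shows "Ad h X \<in> root_space (Ad h ` a0) alpha \<longleftrightarrow>
  trace X = 0 \<and> (\<forall>x p q. (\<Sum>k\<in>UNIV. x $ k) = 0 --> X $ p $ q ~= 0 --> alpha (Ad h (dg x)) = x $ p - x $ q)"
proof -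
 have "Ad h (dg x) ** Ad h X - Ad h X ** Ad h (dg x) = alpha (Ad h (dg x)) *\<^sub>R Ad h X \<longleftrightarrow>
  (\<forall>p q. X $ p $ q ~= 0 --> alpha (Ad h (dg x)) = x $ p - x $ q)" for x
 proof -
  have "Ad h (dg x) ** Ad h X - Ad h X ** Ad h (dg x) = alpha (Ad h (dg x)) *\<^sub>R Ad h X \<longleftrightarrow>
  Ad h (dg x ** X - X ** dg x) = Ad h (alpha (Ad h (dg x)) *\<^sub>R X)"
  by (simp add: Ad_mult h linear_diff[OF Ad_linear] linear_cmul[OF Ad_linear])
  also have "\<dots> \<longleftrightarrow> dg x ** X - X ** dg x = alpha (Ad h (dg x)) *\<^sub>R X"
  by (rule inj_eq[OF Ad_inj[OF h]])
  also have "\<dots> \<longleftrightarrow> (\<forall>p q. X $ p $ q ~= 0 --> alpha (Ad h (dg x)) = x $ p - x $ q)"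
  by (auto simp: vec_eq_iff) (metis (no_types, opaque_lifting) left_diff_distrib mult.commute mult_cancel_right)+
  finally show ?thesis .
 qed
 then show ?thesis
  by (auto simp: root_space_def sl_def trace_Ad[OF h] a0_def)
qed

lemma root_space_al:
 fixes h :: "'n::finite rmat"
 assumes h: "h \<in> carrier SL" and kl: "k ~= l"
 shows "root_space (Ad h ` a0) (al h k l) = {c *\<^sub>R Ad h (unit_mat k l) | c. True}"
proof (intro equalityI subsetI)
 fix Z assume Z: "Z \<in> root_space (Ad h ` a0) (al h k l)"
 define X where "X = Ad (matrix_inv h) Z"
 have ZX: "Z = Ad h X" by (simp add: X_def h)
 have "X $ p $ q = 0" if "\<not> (p = k \<and> q = l)" for p q
 proof (rule ccontr)
  assume "X $ p $ q ~= 0"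
  then have "x $ p - x $ q = x $ k - x $ l" if "(\<Sum>m\<in>UNIV. x $ m) = 0" for x :: "'n rvec"
  using Z[unfolded ZX mem_root_space_Ad[OF h]] al_apply[OF h that] that by metis
  then show False using al_inj[OF h kl] that by blast
 qed
 then have "X = X $ k $ l *\<^sub>R unit_mat k l" by (auto simp: vec_eq_iff unit_mat_nth)
 then have "Z = X $ k $ l *\<^sub>R Ad h (unit_mat k l)" unfolding ZX by (metis linear_cmul[OF Ad_linear])
 then show "Z \<in> {c *\<^sub>R Ad h (unit_mat k l) | c. True}" by blast
next
 fix Z assume "Z \<in> {c *\<^sub>R Ad h (unit_mat k l) | c. True}"
 then obtain c where "Z = Ad h (c *\<^sub>R unit_mat k l)" by (auto simp: linear_cmul[OF Ad_linear])
 then show "Z \<in> root_space (Ad h ` a0) (al h k l)"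
  using kl by (auto simp: mem_root_space_Ad[OF h] al_apply[OF h] unit_mat_nth trace_def intro!: sum.neutral split: if_splits)
qed

lemma unit_mat_nz: "h \<in> carrier SL ==> Ad h (unit_mat k l) ~= 0"
proof
 assume h: "h \<in> carrier SL" and "Ad h (unit_mat k l) = 0"
 then have "unit_mat k l = 0" using Ad_inj[OF h] linear_0[OF Ad_linear, of h] by (metis injD)
 then have "unit_mat k l $ k $ l = 0" by simp
 then show False by (simp add: unit_mat_nth)
qed

lemma roots_eq:
 fixes h :: "'n::finite rmat"
 assumes h: "h \<in> carrier SL"
 shows "roots (Ad h ` a0) = {al h k l | k l. k ~= l}"
proof (intro equalityI subsetI)
 fix alpha assume a: "alpha \<in> roots (Ad h ` a0)"
 then have d: "alpha \<in> dual_space (Ad h ` a0)" and nz: "alpha ~= (%X. 0)" and rs: "root_space (Ad h ` a0) alpha ~= {0}"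
  by (auto simp: roots_def)
 have "0 \<in> root_space (Ad h ` a0) alpha" by (simp add: root_space_def sl_def trace_def)
 then obtain Z where Z: "Z \<in> root_space (Ad h ` a0) alpha" "Z ~= 0" using rs by blast
 define X where "X = Ad (matrix_inv h) Z"
 have ZX: "Z = Ad h X" by (simp add: X_def h)
 have "X ~= 0" using Z ZX linear_0[OF Ad_linear, of h] by auto
 then obtain k l where kl: "X $ k $ l ~= 0" by (auto simp: vec_eq_iff)
 have val: "alpha (Ad h (dg x)) = x $ k - x $ l" if "(\<Sum>m\<in>UNIV. x $ m) = 0" for x :: "'n rvec"
  using Z(1) kl that unfolding ZX mem_root_space_Ad[OF h] by blast
 have eq: "alpha = al h k l"
 proof
  fix Y show "alpha Y = al h k l Y"
  proof (cases "Y \<in> Ad h ` a0")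
  case True
  then obtain x where "Y = Ad h (dg x)" "(\<Sum>m\<in>UNIV. x $ m) = 0" by (auto simp: a0_def)
  then show ?thesis using val al_apply[OF h] by simp
  next
  case False
  then show ?thesis using d by (simp add: dual_space_def fl_def)
  qed
 qed
 moreover have "k ~= l"
 proof
  assume "k = l"
  then have "alpha = (%X. 0)" using eq by (auto simp: fl_def)
  then show False using nz by simp
 qed
 ultimately show "alpha \<in> {al h k l | k l. k ~= l}" by blast
next
 fix alpha assume "alpha \<in> {al h k l | k l. k ~= l}"
 then obtain k l where kl: "alpha = al h k l" "k ~= l" by auto
 have "al h k l (Ad h (dg (axis k 1 - axis l 1))) = 2"
  using kl(2) by (subst al_apply[OF h sum_axis_diff_zero]) (simp add: axis_def)
 then have "alpha ~= (%X. 0)" unfolding kl(1) by (metis zero_neq_numeral)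
 moreover have "1 *\<^sub>R Ad h (unit_mat k l) \<in> root_space (Ad h ` a0) alpha" 
  unfolding kl(1) root_space_al[OF h kl(2)] by blast
 then have "root_space (Ad h ` a0) alpha ~= {0}" using unit_mat_nz[OF h, of k l] by auto
 ultimately show "alpha \<in> roots (Ad h ` a0)" unfolding roots_def kl(1) using fl_dual_space[OF h] by blast
qed

lemma roots_of_eq:
 fixes h :: "'n::{finite,linorder} rmat"
 assumes h: "h \<in> carrier SL"
 shows "roots_of (Ad h ` a0) (Ad h ` Bup) = {al h k l | k l. k < l}"
proof -
 have "root_space (Ad h ` a0) (al h k l) \<subseteq> Ad h ` nn \<longleftrightarrow> k < l" if kl: "k ~= l" for k l
 proof -
  have "root_space (Ad h ` a0) (al h k l) \<subseteq> Ad h ` nn \<longleftrightarrow> Ad h (unit_mat k l) \<in> Ad h ` nn"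
  proof
  assume "Ad h (unit_mat k l) \<in> Ad h ` nn"
  then have "c *\<^sub>R Ad h (unit_mat k l) \<in> Ad h ` nn" for c
  by (intro subspace_scale linear_subspace_image[OF Ad_linear subspace_nn])
  then show "root_space (Ad h ` a0) (al h k l) \<subseteq> Ad h ` nn" by (auto simp: root_space_al[OF h kl])
  next
  assume "root_space (Ad h ` a0) (al h k l) \<subseteq> Ad h ` nn"
  moreover have "1 *\<^sub>R Ad h (unit_mat k l) \<in> root_space (Ad h ` a0) (al h k l)"
  unfolding root_space_al[OF h kl] by blast
  ultimately show "Ad h (unit_mat k l) \<in> Ad h ` nn" by auto
  qed
  also have "\<dots> \<longleftrightarrow> k < l" using kl by (auto simp: inj_image_mem_iff[OF Ad_inj[OF h]] nn_def unit_mat_nth)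
  finally show ?thesis .
 qed
 then show ?thesis unfolding roots_of_def roots_eq[OF h] std_lie_N[OF h] using less_imp_neq by blast
qed

lemma std_T:
 fixes h :: "'n::{finite,linorder} rmat"
 assumes s: "std h j i"
 shows "(mat 1 - 2 *\<^sub>R outer (yv h) (wv h)) $ k $ l =
  (if l = Transposition.transpose i j k then if k = i \<or> k = j then -1 else 1 else 0)"
 by (auto simp: mat_def std_yv[OF s] Transposition.transpose_def)

lemma std_unit_mat_h:
 fixes h :: "'n::{finite,linorder} rmat"
 assumes n: "CARD('n) \<ge> 2" and s: "std h j i" and kl: "k ~= l"
 shows "sigma (Ad h (unit_mat k l)) = Ad h (unit_mat k l) \<longleftrightarrow> k \<notin> {i,j} \<and> l \<notin> {i,j}"
proof -
 define T where "T = mat 1 - 2 *\<^sub>R outer (yv h) (wv h)"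
 note T = std_T[OF s, folded T_def]
 have "sigma (Ad h (unit_mat k l)) = Ad h (unit_mat k l) \<longleftrightarrow> T ** unit_mat k l ** T = unit_mat k l"
  unfolding sigma_Ad[OF n std_SL[OF s]] T_def[symmetric] by (rule inj_eq[OF Ad_inj[OF std_SL[OF s]]])
 also have "\<dots> \<longleftrightarrow> (\<forall>p q. T $ p $ k * T $ l $ q = (if p = k \<and> q = l then 1 else 0))"
  by (simp add: vec_eq_iff unit_mat_mult unit_mat_nth)
 also have "\<dots> \<longleftrightarrow> k \<notin> {i,j} \<and> l \<notin> {i,j}"
 proof
  assume "\<forall>p q. T $ p $ k * T $ l $ q = (if p = k \<and> q = l then 1 else 0)"
  \<comment> \<open>The diagonal of T at i and j is 0 when they differ and -1 when they agree; as k
    and l are distinct, the product is 1 only if both avoid i and j.\<close>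
  then have "T $ k $ k * T $ l $ l = 1" by auto
  then show "k \<notin> {i,j} \<and> l \<notin> {i,j}" using kl unfolding T
  by (auto simp: Transposition.transpose_def split: if_splits)
 qed (auto simp: T Transposition.transpose_def)
 finally show ?thesis .
qed

lemma std_roots_h:
 fixes h :: "'n::{finite,linorder} rmat"
 assumes n: "CARD('n) \<ge> 2" and s: "std h j i"
 shows "roots_of (Ad h ` a0) (Ad h ` Bup) \<inter> roots_h (Ad h ` a0) =
  {al h k l | k l. k < l \<and> k \<notin> {i,j} \<and> l \<notin> {i,j}}"
proof -
 note h = std_SL[OF s]
 have "al h k l \<in> roots_h (Ad h ` a0) \<longleftrightarrow> k \<notin> {i,j} \<and> l \<notin> {i,j}" if kl: "k ~= l" for k l
 proof -
  have rt: "al h k l \<in> roots (Ad h ` a0)" using kl by (auto simp: roots_eq[OF h])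
  have "root_space (Ad h ` a0) (al h k l) \<inter> h_alg ~= {0} \<longleftrightarrow> sigma (Ad h (unit_mat k l)) = Ad h (unit_mat k l)"
  proof
  assume "root_space (Ad h ` a0) (al h k l) \<inter> h_alg ~= {0}"
  moreover have "0 \<in> root_space (Ad h ` a0) (al h k l) \<inter> h_alg"
  by (simp add: root_space_def sl_def trace_def h_alg_def sigma_def)
  ultimately obtain Z where Z: "Z \<in> root_space (Ad h ` a0) (al h k l)" "Z \<in> h_alg" "Z ~= 0" by blast
  then obtain c where c: "Z = c *\<^sub>R Ad h (unit_mat k l)" by (auto simp: root_space_al[OF h kl])
  then have "c *\<^sub>R sigma (Ad h (unit_mat k l)) = c *\<^sub>R Ad h (unit_mat k l)"
  using Z(2) by (simp add: h_alg_def sigma_def)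
  then show "sigma (Ad h (unit_mat k l)) = Ad h (unit_mat k l)" using Z(3) c by simp
  next
  assume a: "sigma (Ad h (unit_mat k l)) = Ad h (unit_mat k l)"
  have "1 *\<^sub>R Ad h (unit_mat k l) \<in> root_space (Ad h ` a0) (al h k l)" 
  unfolding root_space_al[OF h kl] by blast
  then have "Ad h (unit_mat k l) \<in> root_space (Ad h ` a0) (al h k l) \<inter> h_alg"
  using a by (simp add: h_alg_def root_space_def)
  then show "root_space (Ad h ` a0) (al h k l) \<inter> h_alg ~= {0}" using unit_mat_nz[OF h, of k l] by blast
  qed
  then show ?thesis using std_unit_mat_h[OF n s kl] rt by (simp add: roots_h_def)
 qed
 then have "al h k l \<in> roots_h (Ad h ` a0) \<longleftrightarrow> k \<notin> {i,j} \<and> l \<notin> {i,j}" if "k < l" for k l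
  using that less_imp_neq by blast
 then show ?thesis unfolding roots_of_eq[OF h] by blast
qed

lemma inj_al:
 fixes h :: "'n::finite rmat"
 assumes h: "h \<in> carrier SL"
 shows "inj_on (%(k, l). al h k l) {(k, l). k ~= l}"
proof (rule inj_onI, clarify)
 fix k l p q assume kl: "k ~= l" and eq: "al h k l = al h p q"
 have "x $ p - x $ q = x $ k - x $ l" if "(\<Sum>m\<in>UNIV. x $ m) = 0" for x :: "'n rvec"
  using al_apply[OF h that] eq by metis
 then show "k = p \<and> l = q" using al_inj[OF h kl] by blast
qed

lemma sum_roots:
 fixes h :: "'n::{finite,linorder} rmat"
 assumes h: "h \<in> carrier SL" and S: "S \<subseteq> {(k, l). k ~= l}"
 shows "(\<Sum>alpha\<in>(%(k, l). al h k l) ` S. alpha X) = fl h (\<Sum>(k, l)\<in>S. axis k 1 - axis l 1) X"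
proof -
 have "(\<Sum>alpha\<in>(%(k, l). al h k l) ` S. alpha X) = (\<Sum>(k, l)\<in>S. al h k l X)"
  by (subst sum.reindex[OF inj_on_subset[OF inj_al[OF h] S]]) (simp add: case_prod_unfold)
 also have "\<dots> = fl h (\<Sum>(k, l)\<in>S. axis k 1 - axis l 1) X"
  by (cases "X \<in> Ad h ` a0")
  (auto simp: fl_def case_prod_unfold sum_distrib_right intro!: sum.swap)
 finally show ?thesis .
qed

text \<open>The trace form is positive definite on real diagonal matrices: the difference of two
  representing vectors pairs to zero with itself.\<close>

lemma dual_vec_fl:
 fixes h :: "'n::{finite,linorder} rmat"
 assumes h: "h \<in> carrier SL" and c: "(\<Sum>k\<in>UNIV. c $ k) = 0"
 shows "dual_vec (Ad h ` a0) (fl h c) = Ad h (dg c)"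
 unfolding dual_vec_def
proof (rule the_equality)
 have tr: "trace (Ad h (dg x) ** Ad h (dg y)) = (\<Sum>k\<in>UNIV. x $ k * y $ k)" for x y
  by (simp add: Ad_mult h trace_Ad dg_mult trace_dg)
 have dgc: "dg c \<in> a0" using c by (auto simp: a0_def)
 show "Ad h (dg c) \<in> Ad h ` a0 \<and> (\<forall>X\<in>Ad h ` a0. trace (X ** Ad h (dg c)) = fl h c X)"
 proof
  show "Ad h (dg c) \<in> Ad h ` a0" using dgc by simp
  show "\<forall>X\<in>Ad h ` a0. trace (X ** Ad h (dg c)) = fl h c X"
  by (auto simp: a0_def tr fl_apply[OF h] mult.commute)
 qed
 fix Y assume Y: "Y \<in> Ad h ` a0 \<and> (\<forall>X\<in>Ad h ` a0. trace (X ** Y) = fl h c X)"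
 then obtain y where y: "Y = Ad h (dg y)" "(\<Sum>k\<in>UNIV. y $ k) = 0" by (auto simp: a0_def)
 define z where "z = y - c"
 have z0: "(\<Sum>k\<in>UNIV. z $ k) = 0" using y c by (simp add: z_def sum_subtractf)
 then have "Ad h (dg z) \<in> Ad h ` a0" by (auto simp: a0_def)
 then have "trace (Ad h (dg z) ** Y) = fl h c (Ad h (dg z))" using Y by blast
 then have "(\<Sum>k\<in>UNIV. z $ k * y $ k) = (\<Sum>k\<in>UNIV. c $ k * z $ k)"
  unfolding y(1) tr fl_apply[OF h z0] .
 then have "(\<Sum>k\<in>UNIV. z $ k * (y $ k - c $ k)) = 0"
  by (simp add: right_diff_distrib sum_subtractf mult.commute[of "c $ _"])
 then have "(\<Sum>k\<in>UNIV. z $ k * z $ k) = 0" by (simp add: z_def)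
 then have "z = 0" by (simp add: sum_nonneg_eq_0_iff vec_eq_iff)
 then show "Y = Ad h (dg c)" using y z_def by simp
qed

text \<open>The m-th coordinate of \<open>rho_h\<close> in a standard frame: the roots meeting the
  fixed algebra are those of the pairs avoiding i and j.\<close>

definition cc :: "'n::{finite,linorder} => 'n => 'n => real" where
 "cc j i m = (if m \<in> {i,j} then 0 else
  (real (card {l. m < l \<and> l \<notin> {i,j}}) - real (card {k. k < m \<and> k \<notin> {i,j}})) / 2)"

lemma std_dual_inner:
 fixes h :: "'n::{finite,linorder} rmat"
 assumes n: "CARD('n) \<ge> 2" and s: "std h j i" 
 shows "dual_inner (Ad h ` a0) (al h k l) (rho_h (Ad h ` a0) (Ad h ` Bup)) = cc j i k - cc j i l"
proof -
 note h = std_SL[OF s]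
 define S where "S = {(k, l). k < l \<and> k \<notin> {i,j} \<and> l \<notin> {i,j}}"
 define c :: "'n rvec" where "c = (1/2) *\<^sub>R (\<Sum>(k, l)\<in>S. axis k 1 - axis l 1)"
 have "roots_of (Ad h ` a0) (Ad h ` Bup) \<inter> roots_h (Ad h ` a0) = (%(k, l). al h k l) ` S"
  unfolding std_roots_h[OF n s] by (auto simp: S_def)
 note S_eq = this
 have rho: "rho_h (Ad h ` a0) (Ad h ` Bup) = fl h c"
 proof
  fix X
  have "rho_h (Ad h ` a0) (Ad h ` Bup) X = (1/2) * fl h (\<Sum>(k, l)\<in>S. axis k 1 - axis l 1) X"
  unfolding rho_h_def S_eq by (subst sum_roots[OF h]) (auto simp: S_def)
  also have "\<dots> = fl h c X" unfolding c_def fl_def by (simp add: sum_distrib_left flip: sum_divide_distrib)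
  finally show "rho_h (Ad h ` a0) (Ad h ` Bup) X = fl h c X" .
 qed
 have cm: "c $ m = cc j i m" for m
 proof -
  have "c $ m = (1/2) * ((\<Sum>(k, l)\<in>S. if k = m then 1 else 0) - (\<Sum>(k, l)\<in>S. if l = m then 1 else 0))"
  by (simp add: c_def case_prod_unfold axis_def sum_subtractf eq_commute)
  also have "(\<Sum>(k, l)\<in>S. if k = m then 1 else 0 :: real) = real (card {p\<in>S. fst p = m})"
  by (simp add: case_prod_unfold sum.If_cases Int_def conj_commute)
  also have "{p\<in>S. fst p = m} = (if m \<in> {i,j} then {} else Pair m ` {l. m < l \<and> l \<notin> {i,j}})"
  by (auto simp: S_def)
  also have "(\<Sum>(k, l)\<in>S. if l = m then 1 else 0 :: real) = real (card {p\<in>S. snd p = m})"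
  by (simp add: case_prod_unfold sum.If_cases Int_def conj_commute)
  also have "{p\<in>S. snd p = m} = (if m \<in> {i,j} then {} else (%k. (k, m)) ` {k. k < m \<and> k \<notin> {i,j}})"
  by (auto simp: S_def)
  finally show ?thesis by (cases "m \<in> {i,j}") (auto simp: cc_def card_image inj_on_def)
 qed
 have c0: "(\<Sum>k\<in>UNIV. c $ k) = 0"
 proof -
  have "(\<Sum>k\<in>UNIV. c $ k) = (1/2) * (\<Sum>p\<in>S. \<Sum>m\<in>UNIV. (axis (fst p) 1 - axis (snd p) 1 :: 'n rvec) $ m)"
  unfolding c_def by (subst sum.swap) (simp add: case_prod_unfold sum_distrib_left)
  then show ?thesis by (simp only: sum_axis_diff_zero) simp
 qed
 have "dual_inner (Ad h ` a0) (al h k l) (fl h c) = trace (Ad h (dg (axis k 1 - axis l 1)) ** Ad h (dg c))"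
  unfolding dual_inner_def by (simp only: dual_vec_fl[OF h c0] dual_vec_fl[OF h sum_axis_diff_zero])
 also have "\<dots> = (\<Sum>m\<in>UNIV. (axis k 1 - axis l 1 :: 'n rvec) $ m * c $ m)"
  by (simp add: Ad_mult h trace_Ad dg_mult trace_dg)
 also have "\<dots> = c $ k - c $ l" by (rule sum_axis_diff)
 finally show ?thesis unfolding rho cm .
qed

text \<open>The pairing of a root with \<open>rho_h\<close> is a difference of two coordinates
  \<open>cc\<close>, and by \<open>std_unique\<close> every stable component leads to the same j and
  i.\<close>

lemma std_h_compatible:
 fixes h :: "'n::{finite,linorder} rmat"
 assumes n: "CARD('n) \<ge> 3" and s: "std h j i" 
 shows "h_compatible (Ad h ` Bup) \<longleftrightarrow>
  (j < i \<and> (\<forall>k l. k < l --> cc j i k \<ge> cc j i l)) \<or> (j = i \<and> (\<forall>k l. k < l --> cc j i k > cc j i l))"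
proof -
 have n2: "CARD('n) \<ge> 2" using n by simp
 have eq: "(Ad h ` Bup \<in> cal_P \<and> (\<forall>alpha \<in> roots_of (lie_alg A) (Ad h ` Bup).
  dual_inner (lie_alg A) alpha (rho_h (lie_alg A) (Ad h ` Bup)) \<ge> 0) \<or>
  Ad h ` Bup \<in> cal_Q \<and> (\<forall>alpha \<in> roots_of (lie_alg A) (Ad h ` Bup).
  dual_inner (lie_alg A) alpha (rho_h (lie_alg A) (Ad h ` Bup)) > 0)) \<longleftrightarrow>
  (j < i \<and> (\<forall>k l. k < l --> cc j i k \<ge> cc j i l)) \<or> (j = i \<and> (\<forall>k l. k < l --> cc j i k > cc j i l))"
  if A: "sigma_split_component A (Ad h ` Bup)" for A
 proof -
  obtain b j' i' where b: "b \<in> Bup" "std (h ** b) j' i'" "A = Ad (h ** b) ` Dpos"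
  using sigma_split_component_std[OF n std_SL[OF s] A] .
  have ji: "j' = j" "i' = i" using std_unique[OF s b(2,1)] by auto
  have hb: "Ad h ` Bup = Ad (h ** b) ` Bup" using conj_Bup_mult[OF std_SL[OF s] b(1)] by simp
  have lie: "lie_alg A = Ad (h ** b) ` a0" using std_lie_A[OF b(2)] b(3) by simp
  have set: "(\<forall>alpha\<in>{al (h ** b) k l | k l. k < l}. R alpha) \<longleftrightarrow> (\<forall>k l. k < l --> R (al (h ** b) k l))" for R
  by blast
  show ?thesis unfolding hb lie std_cal_P_cal_Q[OF n b(2)] roots_of_eq[OF std_SL[OF b(2)]] set
  std_dual_inner[OF n2 b(2)] ji by simp
 qed
 note A0 = std_sigma_split_component[OF n2 s]
 show ?thesis unfolding h_compatible_def
  by (rule iffI, elim exE conjE, erule (1) eq[THEN iffD1], intro exI conjI, rule A0, erule eq[OF A0, THEN iffD2])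
qed


section \<open>Combinatorics of the two positions and of compatibility\<close>

definition adj :: "'n::{finite,linorder} => 'n => bool" where
 "adj j i \<longleftrightarrow> j < i \<and> {j<..<i} = {}"

lemma card_split_pair:
 fixes i j :: "'n::{finite,linorder}"
 assumes "j < i"
 shows "card {..<j} + card {j<..<i} + card {i<..} + 2 = CARD('n)"
proof -
 have "UNIV = {..<j} \<union> {j<..<i} \<union> {i<..} \<union> {i, j}" by auto
 then have "CARD('n) = card ({..<j} \<union> {j<..<i} \<union> {i<..} \<union> {i, j})" by simp
 also have "\<dots> = card ({..<j} \<union> {j<..<i} \<union> {i<..}) + card {i, j}"
  using assms by (subst card_Un_disjoint) auto
 also have "card ({..<j} \<union> {j<..<i} \<union> {i<..}) = card ({..<j} \<union> {j<..<i}) + card {i<..}"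
  using assms by (subst card_Un_disjoint) auto
 also have "card ({..<j} \<union> {j<..<i}) = card {..<j} + card {j<..<i}"
  using assms by (subst card_Un_disjoint) auto
 finally show ?thesis using assms by simp
qed

lemma card_split_point:
 fixes i :: "'n::{finite,linorder}"
 shows "card {..<i} + card {i<..} + 1 = CARD('n)"
proof -
 have "UNIV = {..<i} \<union> {i<..} \<union> {i}" by auto
 then have "CARD('n) = card ({..<i} \<union> {i<..} \<union> {i})" by simp
 also have "\<dots> = card ({..<i} \<union> {i<..}) + card {i}" by (subst card_Un_disjoint) auto
 also have "card ({..<i} \<union> {i<..}) = card {..<i} + card {i<..}" by (subst card_Un_disjoint) auto
 finally show ?thesis by simp
qed

text \<open>Away from i and j the coordinates of \<open>rho_h\<close> always decrease, so
  compatibility comes down to comparisons with the value 0 at i and j.\<close>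

lemma cc_strict:
 assumes "k < l" "k \<notin> {i,j}" "l \<notin> {i,j}"
 shows "cc j i k > cc j i l"
proof -
 have "card {m. l < m \<and> m \<notin> {i,j}} \<le> card {m. k < m \<and> m \<notin> {i,j}}"
  using assms by (intro card_mono) auto
 moreover have "card {m. m < k \<and> m \<notin> {i,j}} < card {m. m < l \<and> m \<notin> {i,j}}"
  using assms by (intro psubset_card_mono) auto
 ultimately show ?thesis using assms by (simp add: cc_def)
qed

text \<open>With the gap \<open>j..i\<close> filled, \<open>cc\<close> only depends on the positions of the remaining indices.\<close>

lemma cc_compatible:
 fixes i j :: "'n::{finite,linorder}"
 assumes ji: "j \<le> i" and gap: "{j<..<i} = {}"
 defines "L \<equiv> card {..<j}" and "R \<equiv> card {i<..}"
 shows "(\<forall>k l. k < l --> cc j i k \<ge> cc j i l) \<longleftrightarrow> L \<le> R + 1 \<and> R \<le> L + 1"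
  and "j = i ==> (\<forall>k l. k < l --> cc j i k > cc j i l) \<longleftrightarrow> L = R"
proof -
 have out: "k < j \<or> i < k" if "k \<notin> {i,j}" for k
 proof -
  have "k \<notin> {j<..<i}" using gap by auto
  then show ?thesis using that by auto
 qed
 have low: "2 * cc j i k = real (card {l. k < l \<and> l \<notin> {i,j}}) - real (card {..<k})" if "k < j" for k
 proof -
  have "{m. m < k \<and> m \<notin> {i,j}} = {..<k}" using that ji by auto
  then show ?thesis using that ji by (auto simp: cc_def)
 qed
 have high: "2 * cc j i l = real (card {l<..}) - real (card {k. k < l \<and> k \<notin> {i,j}})" if "i < l" for l
 proof -
  have "{m. l < m \<and> m \<notin> {i,j}} = {l<..}" using that ji by auto
  then show ?thesis using that ji by (auto simp: cc_def)
 qed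
 have cij: "cc j i i = 0" "cc j i j = 0" by (auto simp: cc_def)
 \<comment> \<open>Below j the values of \<open>cc\<close> are at least (R - L + 1) / 2, above i at
   most (R - L - 1) / 2, and at i and j they are 0. Only the signs of these two extremes matter, and
   the outer neighbours of j and i attain them.\<close>
 have low_ge: "2 * cc j i k \<ge> real R - real L + 1" if "k < j" for k
 proof -
  have "R \<le> card {l. k < l \<and> l \<notin> {i,j}}" unfolding R_def using that ji by (intro card_mono) auto
  moreover have "card {..<k} < L" unfolding L_def using that by (intro psubset_card_mono) auto
  ultimately show ?thesis using low[OF that] by linarith
 qed
 have high_le: "2 * cc j i l \<le> real R - real L - 1" if "i < l" for l
 proof -
  have "L \<le> card {k. k < l \<and> k \<notin> {i,j}}" unfolding L_def using that ji by (intro card_mono) auto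
  moreover have "card {l<..} < R" unfolding R_def using that by (intro psubset_card_mono) auto
  ultimately show ?thesis using high[OF that] by linarith
 qed
 have low_ex: "\<exists>k<j. 2 * cc j i k = real R - real L + 1" if "L > 0"
 proof -
  have ne: "{..<j} ~= {}" using that L_def by auto
  define k where "k = Max {..<j}"
  have k: "k < j" "\<And>m. m < j ==> m \<le> k" using Max_in[OF _ ne] by (auto simp: k_def)
  have "{l. k < l \<and> l \<notin> {i,j}} = {i<..}"
  proof (intro equalityI subsetI)
  fix l assume "l \<in> {l. k < l \<and> l \<notin> {i,j}}"
  then show "l \<in> {i<..}" using out[of l] k(2)[of l] by auto
  qed (use k ji in auto)
  moreover have "{..<j} = insert k {..<k}" using k by force
  then have "L = card {..<k} + 1" unfolding L_def by simp
  ultimately show ?thesis using low[OF k(1)] k(1) by (auto simp: R_def)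
 qed
 have high_ex: "\<exists>l>i. 2 * cc j i l = real R - real L - 1" if "R > 0"
 proof -
  have ne: "{i<..} ~= {}" using that R_def by auto
  define k where "k = Min {i<..}"
  have k: "i < k" "\<And>m. i < m ==> k \<le> m" using Min_in[OF _ ne] by (auto simp: k_def)
  have "{l. l < k \<and> l \<notin> {i,j}} = {..<j}"
  proof (intro equalityI subsetI)
  fix l assume "l \<in> {l. l < k \<and> l \<notin> {i,j}}"
  then show "l \<in> {..<j}" using out[of l] k(2)[of l] by auto
  qed (use k ji in auto)
  moreover have "{i<..} = insert k {k<..}" using k by force
  then have "R = card {k<..} + 1" unfolding R_def by simp
  ultimately show ?thesis using high[OF k(1)] k(1) by (auto simp: L_def)
 qed
 show "(\<forall>k l. k < l --> cc j i k \<ge> cc j i l) \<longleftrightarrow> L \<le> R + 1 \<and> R \<le> L + 1"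
 proof
  assume mono: "\<forall>k l. k < l --> cc j i k \<ge> cc j i l"
  have "L \<le> R + 1"
  proof (cases "L > 0")
  case True
  then obtain k where k: "k < j" "2 * cc j i k = real R - real L + 1" using low_ex by auto
  then have "cc j i k \<ge> 0" using mono cij(2) by force
  then show ?thesis using k by linarith
  qed simp
  moreover have "R \<le> L + 1"
  proof (cases "R > 0")
  case True
  then obtain k where k: "i < k" "2 * cc j i k = real R - real L - 1" using high_ex by auto
  then have "cc j i k \<le> 0" using mono cij(1) by force
  then show ?thesis using k by linarith
  qed simp
  ultimately show "L \<le> R + 1 \<and> R \<le> L + 1" ..
 next
  assume LR: "L \<le> R + 1 \<and> R \<le> L + 1"
  show "\<forall>k l. k < l --> cc j i k \<ge> cc j i l"
  proof (intro allI impI)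
  fix k l :: 'n assume kl: "k < l"
  have k0: "cc j i k \<ge> 0" if "k < j" using low_ge[OF that] LR by linarith
  have l0: "cc j i l \<le> 0" if "i < l" using high_le[OF that] LR by linarith
  show "cc j i k \<ge> cc j i l"
  proof (cases "k \<in> {i,j} \<or> l \<in> {i,j}")
  case True
  have "k \<in> {i,j} ==> l \<notin> {i,j} ==> i < l" using out[of l] kl ji by auto
  moreover have "l \<in> {i,j} ==> k \<notin> {i,j} ==> k < j" using out[of k] kl ji by auto
  ultimately show ?thesis using True k0 l0 cij by (metis insert_iff order_refl singletonD)
  next
  case False
  then show ?thesis using cc_strict[OF kl, of i j] by simp
  qed
  qed
 qed
 show "(\<forall>k l. k < l --> cc j i k > cc j i l) \<longleftrightarrow> L = R" if eq: "j = i"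
 proof
  assume mono: "\<forall>k l. k < l --> cc j i k > cc j i l"
  have "L \<le> R"
  proof (cases "L > 0")
  case True
  then obtain k where k: "k < j" "2 * cc j i k = real R - real L + 1" using low_ex by auto
  then have "cc j i k > 0" using mono cij(2) by force
  then show ?thesis using k by linarith
  qed simp
  moreover have "R \<le> L"
  proof (cases "R > 0")
  case True
  then obtain k where k: "i < k" "2 * cc j i k = real R - real L - 1" using high_ex by auto
  then have "cc j i k < 0" using mono cij(1) by force
  then show ?thesis using k by linarith
  qed simp
  ultimately show "L = R" by simp
 next
  assume LR: "L = R"
  show "\<forall>k l. k < l --> cc j i k > cc j i l"
  proof (intro allI impI)
  fix k l :: 'n assume kl: "k < l"
  show "cc j i k > cc j i l"
  proof (cases "k = i \<or> l = i")
  case True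
  then consider "k = i" "i < l" | "l = i" "k < j" using kl eq by auto
  then show ?thesis
  proof cases
  case 1 then show ?thesis using high_le[of l] LR cij by simp
  next
  case 2 then show ?thesis using low_ge[of k] LR cij by simp
  qed
  next
  case False
  then show ?thesis using cc_strict[OF kl, of i j] eq by simp
  qed
  qed
 qed
qed

subsection \<open>The dimension of the stabilizer\<close>

lemma involution_commute:
 fixes T X :: "'n::finite rmat"
 assumes TT: "T ** T = mat 1"
 shows "T ** X ** T = X \<longleftrightarrow> T ** X = X ** T"
proof
 assume "T ** X ** T = X"
 then have "T ** X ** T ** T = X ** T" by simp
 then show "T ** X = X ** T" using TT by (simp flip: matrix_mul_assoc)
next
 assume "T ** X = X ** T"
 then show "T ** X ** T = X" using TT by (simp flip: matrix_mul_assoc)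
qed

text \<open>Commuting with 1 - 2 y w means y (w X) = (X y) w. As X is strictly triangular and y ends
  at i with y_i = 1, row i of the right side is 0, so w X = 0; then X y = 0 because w_j is
  nonzero.\<close>

lemma sigma_fixed_nn:
 fixes h :: "'n::{finite,linorder} rmat"
 assumes n: "CARD('n) \<ge> 2" and s: "std h j i" and X: "X \<in> nn"
 shows "sigma (Ad h X) = Ad h X \<longleftrightarrow> X *v yv h = 0 \<and> wv h v* X = 0"
proof -
 let ?T = "mat 1 - 2 *\<^sub>R outer (yv h) (wv h)"
 have TT: "?T ** ?T = mat 1" by (rule position_involution[OF n std_SL[OF s]])
 have "sigma (Ad h X) = Ad h X \<longleftrightarrow> ?T ** X ** ?T = X"
  unfolding sigma_Ad[OF n std_SL[OF s]] by (rule inj_eq[OF Ad_inj[OF std_SL[OF s]]])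
 also have "\<dots> \<longleftrightarrow> ?T ** X = X ** ?T" by (rule involution_commute[OF TT])
 also have "\<dots> \<longleftrightarrow> outer (yv h) (wv h v* X) = outer (X *v yv h) (wv h)"
  by (auto simp: mult_outer outer_mult)
 also have "\<dots> \<longleftrightarrow> X *v yv h = 0 \<and> wv h v* X = 0"
 proof
  assume eq: "outer (yv h) (wv h v* X) = outer (X *v yv h) (wv h)"
  have "(X *v yv h) $ i = 0" unfolding matrix_vector_mult_def
  by (simp, intro sum.neutral ballI) (use X std_yv(2)[OF s] in \<open>auto simp: nn_def, metis not_le\<close>)
  moreover have "outer (yv h) (wv h v* X) $ i $ k = outer (X *v yv h) (wv h) $ i $ k" for k using eq by simp
  ultimately have 1: "wv h v* X = 0" using std_yv(1)[OF s] by (simp add: vec_eq_iff)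
  have "outer (yv h) (wv h v* X) $ k $ j = outer (X *v yv h) (wv h) $ k $ j" for k using eq by simp
  then have "X *v yv h = 0" using std_yv(3)[OF s] 1 by (simp add: vec_eq_iff)
  with 1 show "X *v yv h = 0 \<and> wv h v* X = 0" by simp
 qed (simp add: vec_eq_iff)
 finally show ?thesis .
qed

text \<open>An element of N is fixed iff its strictly triangular part is, and the fixed parts form a
  subspace closed under products, so \<open>lie_alg_affine\<close> applies.\<close>

lemma std_lie_N_Int_H:
 fixes h :: "'n::{finite,linorder} rmat"
 assumes n: "CARD('n) \<ge> 2" and s: "std h j i"
 shows "lie_alg (unipotent_radical (Ad h ` Bup) \<inter> Hgrp) = Ad h ` {X \<in> nn. X *v yv h = 0 \<and> wv h v* X = 0}"
proof -
 note h = std_SL[OF s]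
 let ?W = "{X \<in> nn. X *v yv h = 0 \<and> wv h v* X = 0}"
 have "unipotent_radical (Ad h ` Bup) \<inter> Hgrp = Ad h ` {g. g - mat 1 \<in> ?W}"
 proof -
  have "Ad h x \<in> Hgrp \<longleftrightarrow> x - mat 1 \<in> ?W" if x: "x \<in> Uni" for x
  proof -
  have xn: "x - mat 1 \<in> nn" using x by (simp add: Uni_eq_affine)
  have "Ad h x \<in> carrier SL" using h Uni_SL[OF x] by blast
  then have "Ad h x \<in> Hgrp \<longleftrightarrow> sigma (Ad h x) = Ad h x" by (simp add: Hgrp_def)
  also have "\<dots> \<longleftrightarrow> sigma (Ad h (x - mat 1)) = Ad h (x - mat 1)"
  by (simp add: linear_diff[OF Ad_linear] h sigma_eq[OF n] Smat_Smat[OF n])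
  finally show ?thesis using xn unfolding sigma_fixed_nn[OF n s xn] by blast
  qed
  then show ?thesis unfolding unipotent_radical_conj[OF h] by (auto simp: Uni_eq_affine)
 qed
 moreover have sc: "wv h v* (c *\<^sub>R x) = c *\<^sub>R (wv h v* x)" for c and x :: "'n rmat"
  by (simp add: vec_eq_iff vector_matrix_mult_def sum_distrib_left mult_ac)
 have "subspace ?W"
  using subspace_nn unfolding subspace_def
  by (auto simp: matrix_vector_mult_add_rdistrib vector_matrix_mult_add_rdistrib
  scaleR_matrix_vector_assoc[symmetric] sc)
 moreover have "A ** B \<in> ?W" if "A \<in> ?W" "B \<in> ?W" for A B
  using that nn_mult[of A B] 
  by (auto simp: matrix_vector_mul_assoc[symmetric] vector_matrix_mul_assoc[symmetric])
 ultimately show ?thesis using lie_alg_affine[of ?W] lie_alg_Ad[OF h] by simp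
qed

lemma dim_coordinate_matrices:
 fixes T :: "('n::finite \<times> 'n) set"
 shows "dim {X :: 'n rmat. \<forall>k l. (k, l) \<notin> T --> X $ k $ l = 0} = card T"
proof -
 let ?d = "(%(k, l). unit_mat k l) ` T"
 have inj: "inj_on (%(k, l). unit_mat k l :: 'n rmat) UNIV"
  by (auto simp: inj_on_def unit_mat_eq_iff)
 have sub: "?d \<subseteq> Basis" by (auto simp: unit_mat_def axis_in_Basis_iff)
 have inner: "X \<bullet> unit_mat k l = X $ k $ l" for X :: "'n rmat" and k l
  by (simp add: unit_mat_def inner_axis)
 have "{X :: 'n rmat. \<forall>k l. (k, l) \<notin> T --> X $ k $ l = 0} = {X. \<forall>i\<in>Basis. i \<notin> ?d --> X \<bullet> i = 0}"
 proof (intro equalityI subsetI CollectI allI impI ballI)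
  fix X :: "'n rmat" and b :: "'n rmat"
  assume X: "X \<in> {X. \<forall>k l. (k, l) \<notin> T --> X $ k $ l = 0}" and b: "b \<in> Basis" "b \<notin> ?d"
  obtain k l where "b = unit_mat k l" using b(1) by (auto simp: Basis_vec_def unit_mat_def)
  then show "X \<bullet> b = 0" using X b(2) by (auto simp: inner)
 next
  fix X :: "'n rmat" and k l
  assume X: "X \<in> {X. \<forall>i\<in>Basis. i \<notin> ?d --> X \<bullet> i = 0}" and kl: "(k, l) \<notin> T"
  have "(unit_mat k l :: 'n rmat) \<in> Basis" by (simp add: unit_mat_def axis_in_Basis_iff)
  moreover have "unit_mat k l \<notin> ?d" using kl by (auto simp: unit_mat_eq_iff)
  ultimately show "X $ k $ l = 0" using X by (auto simp: inner[symmetric])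
 qed
 then have "dim {X :: 'n rmat. \<forall>k l. (k, l) \<notin> T --> X $ k $ l = 0} = card ?d"
  using dim_substandard[OF sub] by simp
 also have "\<dots> = card T" by (rule card_image) (rule inj_on_subset[OF inj], simp)
 finally show ?thesis .
qed

text \<open>The conditions on X say that columns i and j cancel, and so do rows i and j. The shear 1
  + E_ji on both sides turns this into the vanishing of column i and row j. What is left is a count
  of pairs, in which i and j enter only through the length of the gap.\<close>

lemma std_dim_N_Int_H:
 fixes h :: "'n::{finite,linorder} rmat"
 assumes n: "CARD('n) \<ge> 2" and s: "std h j i" and ji: "j < i"
 shows "dim (lie_alg (unipotent_radical (Ad h ` Bup) \<inter> Hgrp)) + CARD('n) + card {j<..<i} =
  card {(k, l :: 'n). k < l} + 1"
proof -
 note h = std_SL[OF s]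
 let ?W = "{X \<in> nn. X *v yv h = 0 \<and> wv h v* X = 0}"
 let ?T = "{(k, l). k < l \<and> l ~= i \<and> k ~= j}"
 let ?V = "{X :: 'n rmat. \<forall>k l. (k, l) \<notin> ?T --> X $ k $ l = 0}"
 define E where "E = mat 1 + unit_mat j i"
 define F where "F = mat 1 - unit_mat j i"
 have col: "(X ** unit_mat j i) $ p $ q = (if q = i then X $ p $ j else 0)" for X :: "'n rmat" and p q
  using unit_mat_mult[of X j i "mat 1" p q] unfolding matrix_mul_rid by (auto simp: mat_def)
 have row: "(unit_mat j i ** X) $ p $ q = (if p = j then X $ i $ q else 0)" for X :: "'n rmat" and p q
  using unit_mat_mult[of "mat 1" j i X p q] unfolding matrix_mul_lid by (auto simp: mat_def)
 have uu: "unit_mat j i ** unit_mat j i = (0 :: 'n rmat)"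
  using ji by (auto simp: vec_eq_iff col unit_mat_nth)
 have EF: "E ** F = mat 1" "F ** E = mat 1" by (simp_all add: E_def F_def uu)
 have nnE: "unit_mat j i \<in> nn" using ji by (auto simp: nn_def unit_mat_nth)
 have y: "yv h = axis i 1 + axis j 1" and w: "wv h = (1/2) *\<^sub>R (axis i 1 + axis j 1)"
  using s ji by (auto simp: std_def)
 have Xy: "(X *v yv h) $ p = X $ p $ i + X $ p $ j" for X :: "'n rmat" and p
  unfolding y by (simp add: matrix_vector_right_distrib matrix_vector_mult_basis column_def)
 have wX: "(wv h v* X) $ q = (X $ i $ q + X $ j $ q) / 2" for X :: "'n rmat" and q
  unfolding w by (simp add: vector_matrix_mult_def axis_def algebra_simps sum.distrib if_distrib[of "%c. _ * c"] cong: if_cong)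
 have EXE: "(E ** X ** E) $ p $ q = (X $ p $ q + (if p = j then X $ i $ q else 0)) + 
  (if q = i then X $ p $ j + (if p = j then X $ i $ j else 0) else 0)" for X :: "'n rmat" and p q
  by (simp add: E_def col row)
 have "(%X. E ** X ** E) ` ?W = ?V"
 proof (intro equalityI subsetI)
  fix Z assume "Z \<in> (%X. E ** X ** E) ` ?W"
  then obtain X where X: "X \<in> nn" "\<And>p. X $ p $ i + X $ p $ j = 0" "\<And>q. X $ i $ q + X $ j $ q = 0"
  and Z: "Z = E ** X ** E" by (auto simp: vec_eq_iff Xy wX)
  have "Z $ p $ q = 0" if "q \<le> p \<or> q = i \<or> p = j" for p q
  unfolding Z EXE using X(1) X(2)[of p] X(2)[of i] X(3)[of q] X(3)[of j] that ji
  by (auto simp: nn_def algebra_simps)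
  then show "Z \<in> ?V" by auto (metis not_le)
 next
  fix Z assume Z: "Z \<in> ?V"
  then have Z0: "Z $ p $ q = 0" if "q \<le> p \<or> q = i \<or> p = j" for p q
  using that by (auto dest: leD)
  define X where "X = F ** Z ** F"
  have FZF: "X $ p $ q = (Z $ p $ q - (if p = j then Z $ i $ q else 0)) -
  (if q = i then Z $ p $ j - (if p = j then Z $ i $ j else 0) else 0)" for p q
  by (simp add: X_def F_def col row)
  have "X \<in> nn" unfolding nn_def
  proof (intro CollectI allI impI)
  fix p q :: 'n assume qp: "q \<le> p"
  have "Z $ p $ q = 0" "Z $ i $ j = 0" "Z $ i $ i = 0" using qp less_imp_le[OF ji] by (auto intro!: Z0)
  moreover have "p = j ==> Z $ i $ q = 0" "q = i ==> Z $ p $ j = 0" using qp ji by (auto intro!: Z0)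
  ultimately show "X $ p $ q = 0" by (simp add: FZF)
  qed
  moreover have "X *v yv h = 0" "wv h v* X = 0"
  using Z0 ji by (auto simp: vec_eq_iff Xy wX FZF)
  ultimately have "X \<in> ?W" by simp
  moreover have "Z = E ** X ** E"
  proof -
  have "E ** X ** E = (E ** F) ** Z ** (F ** E)" unfolding X_def by (simp only: matrix_mul_assoc)
  then show ?thesis using EF by simp
  qed
  ultimately show "Z \<in> (%X. E ** X ** E) ` ?W" by blast
 qed
 moreover have "dim ((%X. E ** X ** E) ` ?W) = dim ?W"
 proof (rule dim_image_eq)
  show "linear (%X. E ** X ** E)" by (rule linearI) simp_all
  have FX: "F ** (E ** X ** E) ** F = X" for X
  proof -
  have "F ** (E ** X ** E) ** F = (F ** E) ** X ** (E ** F)" by (simp only: matrix_mul_assoc)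
  then show ?thesis using EF by simp
  qed
  show "inj_on (%X. E ** X ** E) (span ?W)" by (rule inj_on_inverseI[where g = "%Y. F ** Y ** F"]) (rule FX)
 qed
 moreover have "dim (Ad h ` ?W) = dim ?W"
  by (rule dim_image_eq[OF Ad_linear]) (use Ad_inj[OF h] in \<open>auto intro: inj_on_subset\<close>)
 ultimately have d: "dim (lie_alg (unipotent_radical (Ad h ` Bup) \<inter> Hgrp)) = card ?T"
  unfolding std_lie_N_Int_H[OF n s] dim_coordinate_matrices[symmetric] by simp
 have "{(k, l :: 'n). k < l} = ?T \<union> ({..<i} \<times> {i} \<union> {j} \<times> {j<..})" by auto
 then have "card {(k, l :: 'n). k < l} = card ?T + card ({..<i} \<times> {i} \<union> {j} \<times> {j<..})"
  by (simp only:) (rule card_Un_disjoint, auto)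
 \<comment> \<open>The forbidden column and the forbidden row share the single pair (j, i).\<close>
 moreover have "card ({..<i} \<times> {i} \<union> {j} \<times> {j<..}) + card {(j, i)} = card ({..<i} \<times> {i}) + card ({j} \<times> {j<..})"
 proof -
  have "({..<i} \<times> {i}) \<inter> ({j} \<times> {j<..}) = {(j, i)}" using ji by auto
  then show ?thesis using card_Un_Int[of "{..<i} \<times> {i}" "{j} \<times> {j<..}"] by simp
 qed
 moreover have "card {..<i} + card {i<..} + 1 = CARD('n)" "card {..<j} + card {j<..} + 1 = CARD('n)"
  using card_split_point by blast+
 moreover note card_split_pair[OF ji]
 ultimately show ?thesis using d by (simp add: card_cartesian_product)
qed


section \<open>Existence of standard frames, and flags with maximal stabilizer\<close>

lemma adj_exists:
 assumes n: "CARD('n::{finite,linorder}) \<ge> 2"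
 shows "\<exists>j i :: 'n. adj j i"
proof -
 define j :: 'n where "j = Min UNIV"
 have "{j<..} ~= {}"
 proof
  assume "{j<..} = {}"
  then have "k = j" for k
  using Min_le[of UNIV k] by (metis UNIV_I emptyE finite greaterThan_iff j_def order_le_less)
  then have "(UNIV :: 'n set) = {j}" by blast
  then have "CARD('n) = card {j}" by simp
  then show False using n by simp
 qed
 define i where "i = Min {j<..}"
 have "j < i" using Min_in[OF _ \<open>{j<..} ~= {}\<close>] by (auto simp: i_def)
 moreover have "{j<..<i} = {}"
 proof (rule ccontr)
  assume "{j<..<i} ~= {}"
  then obtain k where "k < i" "j < k" by auto
  then have "Min {j<..} \<le> k" by (intro Min_le) auto
  then show False using \<open>k < i\<close> unfolding i_def by (rule leD[THEN notE])
 qed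
 ultimately show ?thesis by (auto simp: adj_def)
qed

text \<open>A hyperbolic change of basis turns a flag of rank zero into one of rank one.\<close>

lemma std_zero_to_one:
 fixes h :: "'n::{finite,linorder} rmat"
 assumes s: "std h i i" and ji: "j < i" and n: "CARD('n) \<ge> 3"
 obtains h' where "std h' j i"
proof -
 note hS = std_SL[OF s]
 \<comment> \<open>m carries (e_i + e_j) / 2 to e_i and, acting on rows, e_i to e_i + e_j. This is
   the rank one pair up to a factor 2, which the diagonal d below moves from one vector to the
   other.\<close>
 define m where "m = (mat 1 - (1/2) *\<^sub>R unit_mat j i) ** (mat 1 + unit_mat i j)"
 have up: "mat 1 - (1/2) *\<^sub>R unit_mat j i \<in> carrier SL"
  using ji by (simp add: mem_SL, subst det_upper_triangular) (auto simp: unit_mat_nth mat_def intro!: prod.neutral)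
 have "mat 1 + unit_mat i j \<in> carrier SL"
 proof -
  have "det (mat 1 + unit_mat i j) = det (transpose (mat 1 + unit_mat i j))" by (simp add: det_transpose)
  also have "transpose (mat 1 + unit_mat i j) = mat 1 + unit_mat j i"
  by (auto simp: transpose_def vec_eq_iff unit_mat_nth mat_def)
  also have "det (mat 1 + unit_mat j i) = 1"
  using ji by (subst det_upper_triangular) (auto simp: unit_mat_nth mat_def intro!: prod.neutral)
  finally show ?thesis by (simp add: mem_SL)
 qed
 with up have mS: "m \<in> carrier SL" unfolding m_def by blast
 have ij: "i ~= j" using ji by auto
 have w1: "axis i 1 v* m = axis i 1 + axis j 1"
 proof -
  have "axis i 1 v* A = row i A" for A :: "'n rmat"
  by (simp add: vec_eq_iff vector_matrix_mult_def axis_def row_def if_distrib[of "%c. _ * c"] if_distrib[of "%c. c * _"] cong: if_cong)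
  moreover have "row i (mat 1 - (1/2) *\<^sub>R unit_mat j i) = axis i 1"
  using ij by (auto simp: row_def vec_eq_iff axis_def unit_mat_nth mat_def)
  moreover have "row i (mat 1 + unit_mat i j) = axis i 1 + axis j 1"
  by (auto simp: row_def vec_eq_iff axis_def unit_mat_nth mat_def)
  ultimately show ?thesis unfolding m_def vector_matrix_mul_assoc[symmetric] by simp
 qed
 have y1: "m *v ((1/2) *\<^sub>R (axis i 1 + axis j 1)) = axis i 1"
 proof -
  have E: "unit_mat a b *v x = x $ b *\<^sub>R axis a 1" for a b and x :: "'n rvec"
  by (auto simp: vec_eq_iff matrix_vector_mult_def unit_mat_nth axis_def if_distrib[of "%c. c * _"] cong: if_cong)
  have c: "(c *\<^sub>R A) *v x = c *\<^sub>R (A *v x)" for c and A :: "'n rmat" and x :: "'n rvec" 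
  by (simp add: scaleR_matrix_vector_assoc)
  show ?thesis unfolding m_def matrix_vector_mul_assoc[symmetric]
  using ij by (simp add: matrix_vector_mult_add_rdistrib matrix_vector_mult_diff_rdistrib E c)
  (auto simp: vec_eq_iff axis_def)
 qed
 obtain d :: "'n rvec" where d: "\<And>k. k \<in> {i,j} ==> d $ k = 1/2" "(\<Prod>k\<in>UNIV. d $ k) = 1"
 proof (rule exists_prescribed_diagonal[of "{i,j}" "%k. 1/2"])
  show "{i,j} ~= UNIV"
  proof
  assume "{i,j} = UNIV"
  then have "card {i,j} = CARD('n)" by simp
  then show False using n ij by simp
  qed
 qed (use that in auto)
 have dS: "dg d \<in> carrier SL" using d by (simp add: mem_SL det_dg)
 have mi: "matrix_inv (dg d) = dg (\<chi> k. 1 / d $ k)" by (rule matrix_inv_dg) (rule prod_one_nz[OF d(2)])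
 have "yv h = axis i 1" "wv h = axis i 1" using s by (auto simp: std_def)
 then have y2: "yv (h ** m) = (1/2) *\<^sub>R (axis i 1 + axis j 1)"
  unfolding yv_wv_mult[OF hS mS] using SL_cancel_vec(2)[OF mS] y1 by metis
 have w2: "wv (h ** m) = axis i 1 + axis j 1"
  unfolding yv_wv_mult[OF hS mS] using \<open>wv h = axis i 1\<close> w1 by simp
 have "yv (h ** m ** dg d) = axis i 1 + axis j 1"
  unfolding yv_wv_mult[OF SL_mult[OF hS mS] dS] y2 mi using d(1) ij
  by (auto simp: vec_eq_iff axis_def)
 moreover have "wv (h ** m ** dg d) = (1/2) *\<^sub>R (axis i 1 + axis j 1)"
  unfolding yv_wv_mult[OF SL_mult[OF hS mS] dS] w2 using d(1) ij
  by (auto simp: vec_eq_iff axis_def)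
 ultimately have "std (h ** m ** dg d) j i" 
  using ji ij hS mS dS by (auto simp: std_def)
 then show thesis using that by blast
qed

text \<open>A rotation taking e_i to \<open>uvec\<close> works: its inverse is its transpose, so
  both vectors become e_i.\<close>

lemma std_zero_exists:
 fixes i :: "'n::{finite,linorder}"
 assumes n: "CARD('n) \<ge> 2"
 obtains h where "std h i i"
proof -
 have "norm (uvec :: 'n rvec) = 1" using uvec_inner[OF n] by (simp add: norm_eq_sqrt_inner)
 then obtain f where f: "orthogonal_transformation f" "det (matrix f) = 1" "f (axis i 1) = (uvec :: 'n rvec)"
  using rotation_exists[of "axis i 1" "uvec :: 'n rvec"] n by auto
 define h where "h = matrix f"
 have oh: "orthogonal_matrix h" using f(1) by (simp add: h_def orthogonal_transformation_matrix)
 have hS: "h \<in> carrier SL" using f(2) by (simp add: h_def mem_SL)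
 have hv: "h *v x = f x" for x
  unfolding h_def using f(1) by (simp add: orthogonal_transformation_def)
 have tr: "matrix_inv h = transpose h"
  using oh by (intro matrix_inv_eqI) (simp add: orthogonal_matrix_def)
 have "yv h = axis i 1" unfolding yv_def using SL_cancel_vec(2)[OF hS, of "axis i 1"] hv f(3) by metis
 moreover have "wv h = transpose h *v uvec" by (simp add: wv_def transpose_matrix_vector)
 ultimately have "std h i i" using hS by (simp add: std_def yv_def tr)
 then show thesis using that by blast
qed

text \<open>Stabilizer dimension plus length of the gap is the same for all rank one flags, so the
  dimension is largest when the gap is empty; such flags exist by tilting a rank zero frame.\<close>

lemma std_cal_P_star:
 fixes h :: "'n::{finite,linorder} rmat"
 assumes n: "CARD('n) \<ge> 3" and s: "std h j i" and ji: "j < i"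
 shows "Ad h ` Bup \<in> cal_P_star \<longleftrightarrow> adj j i"
proof -
 have n2: "CARD('n) \<ge> 2" using n by simp
 note dimh = std_dim_N_Int_H[OF n2 s ji]
 show ?thesis
 proof
  assume st: "Ad h ` Bup \<in> cal_P_star"
  obtain j' i' :: 'n where a: "adj j' i'" using adj_exists[OF n2] by auto
  obtain g where g: "std g i' i'" using std_zero_exists[OF n2] by blast
  obtain h' where h': "std h' j' i'" using std_zero_to_one[OF g] a n by (auto simp: adj_def)
  have j'i': "j' < i'" using a by (simp add: adj_def)
  have "Ad h' ` Bup \<in> cal_P" using std_cal_P_cal_Q(1)[OF n h'] j'i' by simp
  then have "dim (lie_alg (unipotent_radical (Ad h' ` Bup) \<inter> Hgrp)) \<le> dim (lie_alg (unipotent_radical (Ad h ` Bup) \<inter> Hgrp))"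
  using st by (simp add: cal_P_star_def)
  then have "card {j<..<i} \<le> card {j'<..<i'}"
  using std_dim_N_Int_H[OF n2 h' j'i'] dimh by linarith
  then show "adj j i" using a ji by (simp add: adj_def)
 next
  assume a: "adj j i"
  show "Ad h ` Bup \<in> cal_P_star" unfolding cal_P_star_def
  proof (rule CollectI, intro conjI ballI)
  show "Ad h ` Bup \<in> cal_P" using std_cal_P_cal_Q(1)[OF n s] ji by simp
  fix Q :: "'n rmat set" assume Q: "Q \<in> cal_P"
  then obtain A where A: "sigma_split_component A Q" and Qm: "Q \<in> min_parabolics"
  by (auto simp: cal_P_def sigma_rank_is_def)
  obtain h' j' i' where h': "std h' j' i'" "Q = Ad h' ` Bup" using min_parabolic_std[OF n Qm A] by metis
  have "j' < i'" using std_cal_P_cal_Q(1)[OF n h'(1)] Q h' by simp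
  then show "dim (lie_alg (unipotent_radical Q \<inter> Hgrp)) \<le> dim (lie_alg (unipotent_radical (Ad h ` Bup) \<inter> Hgrp))"
  using std_dim_N_Int_H[OF n2 h'(1)] dimh a by (simp add: h'(2) adj_def)
  qed
 qed
qed

subsection \<open>Admissible data and the modulus function\<close>

text \<open>In a standard frame with j < i these are the diagonals of the elements of \<aa> \<inter>
  \<qq>.\<close>

definition hv :: "'n::finite => 'n => real => 'n rvec" where
 "hv j i s = s *\<^sub>R (axis j 1 - axis i 1)"

lemma hv_sum: "(\<Sum>k\<in>UNIV. hv j i s $ k) = 0"
 using sum_axis_diff_zero[of j i] by (simp add: hv_def flip: sum_distrib_left)

lemma hv_nth: "j ~= i ==> hv j i s $ k = (if k = j then s else if k = i then - s else 0)"
 by (auto simp: hv_def axis_def)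

lemma sum_pairs:
 fixes x :: "'n::{finite,linorder} rvec"
 shows "(\<Sum>(k, l)\<in>{(k, l). k < l}. x $ k - x $ l) = (\<Sum>k\<in>UNIV. x $ k * (real (card {k<..}) - real (card {..<k})))"
proof -
 have 1: "(\<Sum>(k, l)\<in>{(k, l :: 'n). k < l}. x $ k) = (\<Sum>k\<in>UNIV. x $ k * real (card {k<..}))"
 proof -
  have "{(k, l :: 'n). k < l} = (SIGMA k:UNIV. {k<..})" by auto
  then show ?thesis by (simp add: sum.Sigma[symmetric] mult.commute)
 qed
 have 2: "(\<Sum>(k, l)\<in>{(k, l :: 'n). k < l}. x $ l) = (\<Sum>k\<in>UNIV. x $ k * real (card {..<k}))"
 proof -
  have "{(k, l :: 'n). k < l} = prod.swap ` (SIGMA l:UNIV. {..<l})" by auto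
  then have "(\<Sum>(k, l)\<in>{(k, l :: 'n). k < l}. x $ l) = (\<Sum>(l, k)\<in>(SIGMA l:UNIV. {..<l}). x $ l)"
  by (simp add: sum.reindex case_prod_unfold)
  then show ?thesis by (simp add: sum.Sigma[symmetric] mult.commute)
 qed
 have "(\<Sum>(k, l)\<in>{(k, l). k < l}. x $ k - x $ l) =
  (\<Sum>(k, l)\<in>{(k, l :: 'n). k < l}. x $ k) - (\<Sum>(k, l)\<in>{(k, l :: 'n). k < l}. x $ l)"
  by (simp add: case_prod_unfold sum_subtractf)
 then show ?thesis unfolding 1 2 by (simp add: right_diff_distrib sum_subtractf)
qed

lemma sum_pairs_hv:
 fixes i j :: "'n::{finite,linorder}"
 assumes a: "adj j i"
 shows "(\<Sum>(k, l)\<in>{(k, l). k < l}. hv j i s $ k - hv j i s $ l) = 2 * s"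
proof -
 have ji: "j ~= i" "j < i" using a by (auto simp: adj_def)
 have "(\<Sum>k\<in>UNIV. hv j i s $ k * (real (card {k<..}) - real (card {..<k})))
  = (\<Sum>k\<in>{i,j}. hv j i s $ k * (real (card {k<..}) - real (card {..<k})))"
  by (rule sum.mono_neutral_right) (auto simp: hv_nth[OF ji(1)])
 also have "\<dots> = s * (real (card {j<..}) - real (card {..<j}) - (real (card {i<..}) - real (card {..<i})))"
  using ji by (simp add: hv_nth algebra_simps)
 \<comment> \<open>For adjacent indices the number above and the number below each change by
   one.\<close>
 also have "real (card {j<..}) - real (card {..<j}) - (real (card {i<..}) - real (card {..<i})) = 2"
  using card_split_pair[OF ji(2)] card_split_point[of i] card_split_point[of j] a by (simp add: adj_def)
 finally show ?thesis unfolding sum_pairs by simp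
qed

lemma rho_apply:
 fixes h :: "'n::{finite,linorder} rmat"
 assumes h: "h \<in> carrier SL" and x: "(\<Sum>k\<in>UNIV. x $ k) = 0"
 shows "rho (Ad h ` a0) (Ad h ` Bup) (Ad h (dg x)) = (1/2) * (\<Sum>(k, l)\<in>{(k, l). k < l}. x $ k - x $ l)"
proof -
 have "roots_of (Ad h ` a0) (Ad h ` Bup) = (%(k, l). al h k l) ` {(k, l). k < l}"
  unfolding roots_of_eq[OF h] by auto
 moreover have "(\<Sum>alpha\<in>(%(k, l). al h k l) ` {(k, l). k < l}. alpha (Ad h (dg x))) = (\<Sum>(k, l)\<in>{(k, l). k < l}. x $ k - x $ l)"
  by (subst sum.reindex) (auto intro!: sum.cong inj_on_subset[OF inj_al[OF h]] simp: al_apply[OF h x])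
 ultimately show ?thesis by (simp add: rho_def)
qed

lemma std_lie_A_Int_q:
 fixes h :: "'n::{finite,linorder} rmat"
 assumes n: "CARD('n) \<ge> 2" and s: "std h j i" and ji: "j < i"
 shows "v \<in> lie_alg (Ad h ` Dpos) \<inter> q_alg \<longleftrightarrow> (\<exists>s. v = Ad h (dg (hv j i s)))"
proof
 note hS = std_SL[OF s]
 assume v: "v \<in> lie_alg (Ad h ` Dpos) \<inter> q_alg"
 then obtain x where x: "v = Ad h (dg x)" "(\<Sum>k\<in>UNIV. x $ k) = 0" by (auto simp: std_lie_A[OF s] a0_def)
 have "Ad h (dg (\<chi> k. x $ Transposition.transpose i j k)) = Ad h (dg (- x))"
  using v std_sigma_dg[OF n s, of x] by (simp add: q_alg_def x dg_scaleR[of "-1", simplified] linear_neg[OF Ad_linear])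
 then have "(\<chi> k. x $ Transposition.transpose i j k) = - x"
  by (simp add: inj_eq[OF Ad_inj[OF hS]] dg_eq_iff)
 then have eq: "x $ Transposition.transpose i j k = - x $ k" for k
  by (metis uminus_vec_def vec_lambda_beta)
 have "x = hv j i (x $ j)"
  using eq eq[of i] ji by (auto simp: vec_eq_iff hv_nth) (metis Transposition.transpose_apply_other equal_neg_zero)
 then show "\<exists>s. v = Ad h (dg (hv j i s))" using x by metis
next
 note hS = std_SL[OF s]
 assume "\<exists>s. v = Ad h (dg (hv j i s))"
 then obtain c where v: "v = Ad h (dg (hv j i c))" by auto
 have "(\<chi> k. hv j i c $ Transposition.transpose i j k) = - hv j i c"
  using ji by (auto simp: vec_eq_iff hv_nth Transposition.transpose_def)
 then have "sigma v = - v"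
  unfolding v std_sigma_dg[OF n s] by (simp add: dg_scaleR[of "-1", simplified] linear_neg[OF Ad_linear])
 moreover have "dg (hv j i c) \<in> a0" unfolding a0_def using hv_sum by blast
 then have "v \<in> Ad h ` a0" by (simp add: v)
 moreover have "v \<in> sl" using hv_sum by (simp add: sl_def v trace_Ad hS trace_dg)
 ultimately show "v \<in> lie_alg (Ad h ` Dpos) \<inter> q_alg" by (simp add: std_lie_A[OF s] q_alg_def)
qed

lemma admissible_std:
 fixes h :: "'n::{finite,linorder} rmat"
 assumes n: "CARD('n) \<ge> 3" and s: "std h j i" and a: "adj j i" and c: "0 < c"
 shows "admissible (Ad h ` Bup) (Ad h ` Dpos) (Ad h (dg (hv j i c)))"
proof -
 have n2: "CARD('n) \<ge> 2" using n by simp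
 have ji: "j < i" using a by (simp add: adj_def)
 show ?thesis unfolding admissible_def
 proof (intro conjI)
  show "sigma_split_component (Ad h ` Dpos) (Ad h ` Bup)" by (rule std_sigma_split_component[OF n2 s])
  show "Ad h (dg (hv j i c)) \<in> lie_alg (Ad h ` Dpos) \<inter> q_alg"
  unfolding std_lie_A_Int_q[OF n2 s ji] by blast
  show "0 < rho (lie_alg (Ad h ` Dpos)) (Ad h ` Bup) (Ad h (dg (hv j i c)))"
  unfolding std_lie_A[OF s] rho_apply[OF std_SL[OF s] hv_sum] sum_pairs_hv[OF a] using c by simp
 qed
qed

text \<open>The given component differs from the standard one by a triangular b that fixes both y
  and w. Its diagonal entries at i and j are therefore 1, and dividing out the diagonal of b leaves
  a unipotent \<open>nu\<close> that still fixes both vectors.\<close>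

lemma admissible_obtain:
 fixes h :: "'n::{finite,linorder} rmat"
 assumes n: "CARD('n) \<ge> 3" and s: "std h j i" and a: "adj j i" and adm: "admissible (Ad h ` Bup) A v"
 obtains nu c where "nu \<in> Uni" "nu *v yv h = yv h" "wv h v* nu = wv h" "std (h ** nu) j i"
  "A = Ad (h ** nu) ` Dpos" "0 < c" "v = Ad (h ** nu) (dg (hv j i c))"
proof -
 have n2: "CARD('n) \<ge> 2" using n by simp
 have ji: "j < i" using a by (simp add: adj_def)
 note hS = std_SL[OF s]
 obtain b j' i' where b: "b \<in> Bup" "std (h ** b) j' i'" "A = Ad (h ** b) ` Dpos"
  using sigma_split_component_std[OF n hS] adm unfolding admissible_def by blast
 have ji': "j' = j" "i' = i" using std_unique[OF s b(2,1)] by auto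
 have bS: "b \<in> carrier SL" using b by (simp add: Bup_iff)
 have y1: "yv (h ** b) = yv h" and w1: "wv (h ** b) = wv h"
  using b(2) s ji ji' by (auto simp: std_def)
 have by1: "b *v yv h = yv h" 
  using y1 SL_cancel_vec(1)[OF bS, of "yv h"] unfolding yv_wv_mult[OF hS bS] by simp
 have wb: "wv h v* b = wv h" using w1 unfolding yv_wv_mult[OF hS bS] .
 have "(b *v yv h) $ i = b $ i $ i * yv h $ i"
  by (rule upper_mult_vec(1)) (use b std_yv(2)[OF s] in \<open>auto simp: Bup_iff\<close>)
 then have bi: "b $ i $ i = 1" using by1 std_yv(1)[OF s] by simp
 have "(wv h v* b) $ j = wv h $ j * b $ j $ j"
  by (rule upper_mult_vec(2)) (use b std_yv(4)[OF s] in \<open>auto simp: Bup_iff\<close>)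
 then have bj: "b $ j $ j = 1" using wb std_yv(3)[OF s] by simp
 define d where "d = (\<chi> k. b $ k $ k)"
 have dprod: "(\<Prod>k\<in>UNIV. d $ k) = 1"
  using b det_upper_triangular[of b] by (simp add: d_def Bup_iff mem_SL)
 have dD: "dg d \<in> Dall" using dprod by (auto simp: Dall_def)
 have dS: "dg d \<in> carrier SL" by (rule Dall_SL[OF dD])
 have dB: "dg d \<in> Bup" using dD Dall_sub_Bup by blast
 have mi: "matrix_inv (dg d) = dg (\<chi> k. 1 / d $ k)" by (rule matrix_inv_dg) (rule prod_one_nz[OF dprod])
 have dk: "d $ k = b $ k $ k" for k by (simp add: d_def)
 define nu where "nu = b ** matrix_inv (dg d)"
 have nuU: "nu \<in> Uni"
  using Bup_mult[OF b(1) Bup_inv[OF dB]] upper_mult(2)[of b "matrix_inv (dg d)"] b(1) Bup_inv[OF dB] Bup_diag_nz[OF b(1)]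
  mi[THEN arg_cong, of "%A. A $ k $ k" for k]
  dk by (auto simp: Uni_def nu_def Bup_iff dg_nth)
 have nuS: "nu \<in> carrier SL" by (rule Uni_SL[OF nuU])
 have bnu: "b = nu ** dg d" by (simp add: nu_def SL_cancel_left[OF dS])
 have dy: "matrix_inv (dg d) *v yv h = yv h"
  unfolding mi using bi bj by (auto simp: vec_eq_iff std_yv(5)[OF s] d_def)
 have wd: "wv h v* matrix_inv (dg d) = wv h"
  unfolding mi using bi bj by (auto simp: vec_eq_iff std_yv(6)[OF s] d_def)
 have 1: "nu *v yv h = yv h" by (simp add: nu_def dy by1 flip: matrix_vector_mul_assoc)
 have 2: "wv h v* nu = wv h" by (simp add: nu_def wd wb flip: vector_matrix_mul_assoc)
 have ynu: "yv (h ** nu) = yv h" "wv (h ** nu) = wv h"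
  unfolding yv_wv_mult[OF hS nuS] using 2 SL_cancel_vec(2)[OF nuS, of "yv h"] 1 by simp_all
 have st: "std (h ** nu) j i" using s ynu nuS by (auto simp: std_def)
 have A: "A = Ad (h ** nu) ` Dpos"
  using Ad_dg_Dpos[OF SL_mult[OF hS nuS] dD] b(3) bnu by (simp add: matrix_mul_assoc)
 have P: "Ad h ` Bup = Ad (h ** nu) ` Bup"
  using conj_Bup_mult[OF hS, of nu] nuU Uni_sub_Bup by blast
 have vq: "v \<in> lie_alg (Ad (h ** nu) ` Dpos) \<inter> q_alg" using adm A by (simp add: admissible_def)
 obtain c where v: "v = Ad (h ** nu) (dg (hv j i c))"
  using vq unfolding std_lie_A_Int_q[OF n2 st ji] by blast
 have "0 < rho (lie_alg A) (Ad h ` Bup) v" using adm by (simp add: admissible_def)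
 then have "0 < c"
  unfolding A P v std_lie_A[OF st] rho_apply[OF std_SL[OF st] hv_sum] sum_pairs_hv[OF a] by simp
 then show thesis using that[OF nuU 1 2 st A _ v] by blast
qed

text \<open>Conjugated matrix units are eigenvectors, and the type of index pairs is large enough
  for \<open>det_on_eigenbasis\<close>.\<close>

lemma det_on_coordinate:
 fixes h :: "'n::finite rmat"
 assumes h: "h \<in> carrier SL" and d: "dg d \<in> carrier SL"
 shows "det_on (Ad h ` {X. \<forall>k l. (k, l) \<notin> T --> X $ k $ l = 0}) (Ad (Ad h (dg d))) = (\<Prod>(k, l)\<in>T. d $ k / d $ l)"
proof -
 define E where "E = (%(k, l). Ad h (unit_mat k l))"
 define U where "U = (%(k, l). unit_mat k l :: 'n rmat) ` T"
 have dnz: "d $ k ~= 0" for k using d prod_one_nz[of "%k. d $ k"] by (simp add: mem_SL det_dg)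
 have injE: "inj_on E T"
  by (auto simp: inj_on_def E_def inj_eq[OF Ad_inj[OF h]] unit_mat_eq_iff)
 have ET: "E ` T = Ad h ` U" by (auto simp: E_def U_def image_image case_prod_unfold)
 have indU: "independent U" by (rule independent_mono[OF independent_Basis]) (auto simp: U_def unit_mat_def axis_in_Basis_iff)
 have ind: "independent (E ` T)" unfolding ET
  by (rule linear_independent_injective_image[OF Ad_linear indU]) (use Ad_inj[OF h] in \<open>auto intro: inj_on_subset\<close>)
 have spanU: "span U = {X. \<forall>k l. (k, l) \<notin> T --> X $ k $ l = 0}"
 proof
  show "span U \<subseteq> {X. \<forall>k l. (k, l) \<notin> T --> X $ k $ l = 0}"
  by (rule span_minimal) (auto simp: U_def unit_mat_nth subspace_def)
  show "{X. \<forall>k l. (k, l) \<notin> T --> X $ k $ l = 0} \<subseteq> span U"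
  proof
  fix X :: "'n rmat" assume X: "X \<in> {X. \<forall>k l. (k, l) \<notin> T --> X $ k $ l = 0}"
  have "X = (\<Sum>p\<in>T. X $ fst p $ snd p *\<^sub>R unit_mat (fst p) (snd p))"
  proof -
  have "(\<Sum>p\<in>T. X $ fst p $ snd p *\<^sub>R unit_mat (fst p) (snd p)) $ a $ b = X $ a $ b" for a b
  proof -
  have "(\<Sum>p\<in>T. X $ fst p $ snd p *\<^sub>R unit_mat (fst p) (snd p)) $ a $ b =
  (\<Sum>p\<in>T. X $ fst p $ snd p * unit_mat (fst p) (snd p) $ a $ b)" by simp
  also have "\<dots> = (\<Sum>p\<in>T. if p = (a, b) then X $ a $ b else 0)"
  by (intro sum.cong refl) (auto simp: unit_mat_nth)
  finally have "(\<Sum>p\<in>T. X $ fst p $ snd p *\<^sub>R unit_mat (fst p) (snd p)) $ a $ b =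
  (\<Sum>p\<in>T. if p = (a, b) then X $ a $ b else 0)" .
  then show ?thesis using X by (auto simp: finite_subset[OF subset_UNIV])
  qed
  then show ?thesis by (simp add: vec_eq_iff)
  qed
  also have "\<dots> \<in> span U" by (intro span_sum span_scale span_base) (auto simp: U_def)
  finally show "X \<in> span U" .
  qed
 qed
 have span: "span (E ` T) = Ad h ` {X. \<forall>k l. (k, l) \<notin> T --> X $ k $ l = 0}"
  unfolding ET linear_span_image[OF Ad_linear] spanU ..
 \<comment> \<open>The eigenvalue as a function of the matrix itself, the form
   \<open>det_on_eigenbasis\<close> expects; on a conjugated matrix unit the double sum has a single
   term.\<close>
 define lam where "lam Z = (\<Sum>k\<in>UNIV. \<Sum>l\<in>UNIV. Ad (matrix_inv h) Z $ k $ l * (d $ k / d $ l))" for Z :: "'n rmat"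
 have lam: "lam (E (k, l)) = d $ k / d $ l" for k l
 proof -
  have "lam (E (k, l)) = (\<Sum>a\<in>UNIV. \<Sum>b\<in>UNIV. unit_mat k l $ a $ b * (d $ a / d $ b))"
  unfolding lam_def E_def by (simp add: h)
  also have "\<dots> = (\<Sum>a\<in>UNIV. if a = k then \<Sum>b\<in>UNIV. if b = l then d $ k / d $ l else 0 else 0)"
  proof (rule sum.cong[OF refl])
  fix a
  have "(\<Sum>b\<in>UNIV. unit_mat k l $ a $ b * (d $ a / d $ b)) =
  (\<Sum>b\<in>UNIV. if a = k then if b = l then d $ k / d $ l else 0 else 0)"
  by (intro sum.cong refl) (auto simp: unit_mat_nth)
  then show "(\<Sum>b\<in>UNIV. unit_mat k l $ a $ b * (d $ a / d $ b)) =
  (if a = k then \<Sum>b\<in>UNIV. if b = l then d $ k / d $ l else 0 else 0)" by auto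
  qed
  finally show ?thesis by simp
 qed
 have "det_on (Ad h ` {X. \<forall>k l. (k, l) \<notin> T --> X $ k $ l = 0}) (Ad (Ad h (dg d))) = (\<Prod>c\<in>E ` T. lam c)"
 proof (rule det_on_eigenbasis[where 'm = "'n \<times> 'n", OF Ad_linear ind span])
  show "card (E ` T) \<le> CARD('n \<times> 'n)"
  using card_image_le[of T E] card_mono[of UNIV T] by (simp add: card_prod)
  fix c assume "c \<in> E ` T"
  then obtain k l where c: "c = E (k, l)" by auto
  have mi: "matrix_inv (dg d) = dg (\<chi> k. 1 / d $ k)" by (rule matrix_inv_dg) (rule dnz)
  have "Ad (dg d) (unit_mat k l) = (d $ k / d $ l) *\<^sub>R unit_mat k l"
  unfolding Ad_def mi by (auto simp: vec_eq_iff unit_mat_nth)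
  then have "Ad h (Ad (dg d) (unit_mat k l)) = (d $ k / d $ l) *\<^sub>R Ad h (unit_mat k l)"
  by (simp add: linear_cmul[OF Ad_linear])
  moreover have "Ad (Ad h (dg d)) (Ad h X) = Ad h (Ad (dg d) X)" for X
  unfolding Ad_def[of "dg d"] Ad_def[of "Ad h (dg d)"]
  by (simp add: Ad_mult h Ad_inverse SL_invertible[OF d])
  ultimately show "Ad (Ad h (dg d)) c = lam c *\<^sub>R c" unfolding c lam by (simp add: E_def)
 qed
 also have "\<dots> = (\<Prod>p\<in>T. lam (E p))" by (simp add: prod.reindex[OF injE])
 also have "\<dots> = (\<Prod>(k, l)\<in>T. d $ k / d $ l)" by (intro prod.cong refl) (auto simp: lam)
 finally show ?thesis .
qed

text \<open>Over all pairs the exponents add up to 2 c. The pairs avoiding i and j, which span the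
  centralizer of \<aa> \<inter> \<qq> in the nilradical, contribute nothing because
  \<open>hv\<close> vanishes there. Signs disappear under the absolute value.\<close>

lemma std_delta:
 fixes h :: "'n::{finite,linorder} rmat"
 assumes n: "CARD('n) \<ge> 3" and s: "std h j i" and a: "adj j i"
  and d: "dg d \<in> carrier SL" "\<And>k. \<bar>d $ k\<bar> = exp (hv j i c $ k)"
 shows "delta_P (Ad h ` Bup) (Ad h ` Dpos) (Ad h (dg d)) = exp c"
proof -
 have n2: "CARD('n) \<ge> 2" using n by simp
 have ji: "j < i" using a by (simp add: adj_def)
 note hS = std_SL[OF s]
 let ?T = "{(k, l). k < l}" and ?T' = "{(k, l :: 'n). k < l \<and> k \<notin> {i,j} \<and> l \<notin> {i,j}}"
 have nnT: "nn = {X :: 'n rmat. \<forall>k l. (k, l) \<notin> ?T --> X $ k $ l = 0}"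
  by (auto simp: nn_def)
 have eq: "Ad h ` nn \<inter> lie_centralizer (lie_alg (Ad h ` Dpos) \<inter> q_alg) =
  Ad h ` {X :: 'n rmat. \<forall>k l. (k, l) \<notin> ?T' --> X $ k $ l = 0}"
 proof -
  have "Ad h X \<in> lie_centralizer (lie_alg (Ad h ` Dpos) \<inter> q_alg) \<longleftrightarrow>
  (\<forall>k l. (k, l) \<notin> ?T' --> X $ k $ l = 0)" if X: "X \<in> nn" for X
  proof -
  have X0: "X $ k $ k = 0" for k using X by (simp add: nn_def)
  have "trace X = 0" using X0 by (simp add: trace_def)
  then have "Ad h X \<in> sl" by (simp add: sl_def trace_Ad hS)
  then have "Ad h X \<in> lie_centralizer (lie_alg (Ad h ` Dpos) \<inter> q_alg) \<longleftrightarrow>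
  (\<forall>s. Ad h (dg (hv j i s) ** X) = Ad h (X ** dg (hv j i s)))"
  unfolding lie_centralizer_def Ball_def std_lie_A_Int_q[OF n2 s ji] by (auto simp: Ad_mult hS)
  also have "\<dots> \<longleftrightarrow> (\<forall>s k l. hv j i s $ k * X $ k $ l = X $ k $ l * hv j i s $ l)"
  unfolding inj_eq[OF Ad_inj[OF hS]] by (simp add: vec_eq_iff)
  also have "\<dots> \<longleftrightarrow> (\<forall>k l. (k, l) \<notin> ?T' --> X $ k $ l = 0)"
  proof
  assume h1: "\<forall>s k l. hv j i s $ k * X $ k $ l = X $ k $ l * hv j i s $ l"
  show "\<forall>k l. (k, l) \<notin> ?T' --> X $ k $ l = 0"
  proof (intro allI impI)
  fix k l assume kl: "(k, l) \<notin> ?T'"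
  show "X $ k $ l = 0"
  proof (cases "k < l")
  case True
  then have "k \<in> {i,j} \<or> l \<in> {i,j}" "k ~= l" using kl by auto
  then have "hv j i 1 $ k ~= hv j i 1 $ l" using ji by (auto simp: hv_nth)
  then show ?thesis using h1[rule_format, of 1 k l] by (auto simp: mult.commute)
  qed (use X in \<open>auto simp: nn_def\<close>)
  qed
  next
  assume h2: "\<forall>k l. (k, l) \<notin> ?T' --> X $ k $ l = 0"
  show "\<forall>s k l. hv j i s $ k * X $ k $ l = X $ k $ l * hv j i s $ l"
  proof (intro allI)
  fix s k l show "hv j i s $ k * X $ k $ l = X $ k $ l * hv j i s $ l"
  proof (cases "(k, l) \<in> ?T'")
  case True then show ?thesis using ji by (auto simp: hv_nth)
  qed (use h2 in auto)
  qed
  qed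
  finally show ?thesis .
  qed
  moreover have "{X :: 'n rmat. \<forall>k l. (k, l) \<notin> ?T' --> X $ k $ l = 0} \<subseteq> nn" by (auto simp: nn_def dest: leD)
  ultimately show ?thesis by blast
 qed
 have abs1: "\<bar>\<Prod>(k, l)\<in>T. d $ k / d $ l\<bar> = exp (\<Sum>(k, l)\<in>T. hv j i c $ k - hv j i c $ l)" for T :: "('n \<times> 'n) set"
  by (simp add: abs_prod case_prod_unfold d(2) exp_sum exp_diff)
 have one: "(\<Sum>(k, l)\<in>?T'. hv j i c $ k - hv j i c $ l) = 0"
  by (intro sum.neutral) (use ji in \<open>auto simp: hv_nth\<close>)
 have "delta_P (Ad h ` Bup) (Ad h ` Dpos) (Ad h (dg d)) =
  sqrt (\<bar>\<Prod>(k, l)\<in>?T. d $ k / d $ l\<bar> / \<bar>\<Prod>(k, l)\<in>?T'. d $ k / d $ l\<bar>)"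
  unfolding delta_P_def Let_def std_lie_N[OF hS] eq unfolding nnT
  by (simp only: det_on_coordinate[OF hS d(1)] abs_divide)
 also have "\<dots> = sqrt (exp (2 * c))" unfolding abs1 one sum_pairs_hv[OF a] by simp
 also have "\<dots> = exp c" by (simp add: exp_double)
 finally show ?thesis .
qed

lemma exp_std: 
 assumes "h \<in> carrier SL"
 shows "mat_exp (t *\<^sub>R Ad h (dg (hv j i c))) = Ad h (dg (\<chi> k. exp (hv j i (t * c) $ k)))"
proof -
 have "t *\<^sub>R Ad h (dg (hv j i c)) = Ad h (dg (hv j i (t * c)))"
  by (simp add: hv_def flip: linear_cmul[OF Ad_linear] dg_scaleR)
 then show ?thesis by (simp add: mat_exp_Ad assms mat_exp_dg)
qed

text \<open>Commuting with a regular element makes M diagonal in the frame h. Powers stay in the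
  compact M, so no diagonal entry exceeds 1 in absolute value, and the same holds for the
  inverse.\<close>

lemma maximal_compact_signs:
 fixes h :: "'n::{finite,linorder} rmat"
 assumes h: "h \<in> carrier SL" and M: "maximal_compact_subgroup M (centralizer_SL (Ad h ` Dpos))" and m: "m \<in> M"
 obtains e where "m = Ad h (dg e)" "\<And>k. \<bar>e $ k\<bar> = 1" "(\<Prod>k\<in>UNIV. e $ k) = 1"
proof -
 have diag: "\<exists>e. x = Ad h (dg e) \<and> (\<Prod>k\<in>UNIV. e $ k) = 1" if x: "x \<in> M" for x
 proof -
  have xc: "x \<in> centralizer_SL (Ad h ` Dpos)" using M x by (auto simp: maximal_compact_subgroup_def)
  define X where "X = Ad (matrix_inv h) x"
  have xX: "x = Ad h X" by (simp add: X_def h)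
  have "x ** Ad h (dg regvec) = Ad h (dg regvec) ** x"
  using xc regvec_Dpos by (auto simp: centralizer_SL_def)
  then have "X ** dg regvec = dg regvec ** X"
  unfolding xX Ad_mult[OF h] by (simp add: inj_eq[OF Ad_inj[OF h]])
  then have Xd: "X = dg (\<chi> k. X $ k $ k)"
  using commute_regular[OF regvec(3)] by (intro diagonal_eq_dg) blast
  have "X \<in> carrier SL" using xc h by (auto simp: X_def centralizer_SL_def)
  then have "det (dg (\<chi> k. X $ k $ k)) = 1" using Xd by (simp add: mem_SL)
  then show ?thesis using xX Xd by (metis det_dg)
 qed
 define f where "f k x = Ad (matrix_inv h) x $ k $ k" for k and x :: "'n rmat"
 have "\<exists>B. \<forall>x\<in>M. \<bar>f k x\<bar> \<le> B" for k
 proof -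
  have "compact (f k ` M)"
  by (rule compact_continuous_image) (use M in \<open>auto simp: f_def maximal_compact_subgroup_def intro!: continuous_intros continuous_on_Ad\<close>)
  then show ?thesis using compact_imp_bounded bounded_iff by (metis imageI real_norm_def)
 qed
 then obtain B where B: "\<And>k x. x \<in> M ==> \<bar>f k x\<bar> \<le> B k" by metis
 have sub: "subgroup M SL" using M by (simp add: maximal_compact_subgroup_def)
 then have Mone: "mat 1 \<in> M" and Mmult: "\<And>x y. x \<in> M ==> y \<in> M ==> x ** y \<in> M" and Minv: "\<And>x. x \<in> M ==> matrix_inv x \<in> M"
  by (auto simp: subgroup_SL_iff)
 have le1: "\<bar>e $ k\<bar> \<le> 1" if e: "Ad h (dg e) \<in> M" for e k
 proof (rule ccontr)
  assume "\<not> \<bar>e $ k\<bar> \<le> 1"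
  then obtain p where p: "B k < \<bar>e $ k\<bar> ^ p" using real_arch_pow[of "\<bar>e $ k\<bar>" "B k"] by auto
  have "mat_pow (Ad h (dg e)) p \<in> M" by (induct p) (auto simp: mat_pow_def Mone intro: Mmult e)
  then have "\<bar>f k (mat_pow (Ad h (dg e)) p)\<bar> \<le> B k" by (rule B)
  moreover have "f k (mat_pow (Ad h (dg e)) p) = (e $ k) ^ p"
  by (simp add: f_def mat_pow_Ad h mat_pow_dg dg_nth)
  ultimately show False using p by (simp add: power_abs)
 qed
 obtain e where e: "m = Ad h (dg e)" "(\<Prod>k\<in>UNIV. e $ k) = 1" using diag[OF m] by blast
 have enz: "e $ k ~= 0" for k by (rule prod_one_nz[OF e(2)])
 have mi: "matrix_inv (dg e) = dg (\<chi> k. 1 / e $ k)" by (rule matrix_inv_dg) (rule enz)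
 have "dg e \<in> carrier SL" using e by (simp add: mem_SL det_dg)
 then have "matrix_inv m = Ad h (dg (\<chi> k. 1 / e $ k))"
  unfolding e(1) using h mi by (simp add: Ad_inverse SL_invertible)
 then have "\<bar>1 / e $ k\<bar> \<le> 1" for k using le1[of "\<chi> k. 1 / e $ k" k] Minv[OF m] by simp
 then have "1 \<le> \<bar>e $ k\<bar>" for k
  using enz[of k] by (metis abs_divide abs_one divide_le_eq_1_pos zero_less_abs_iff)
 moreover have "\<bar>e $ k\<bar> \<le> 1" for k using le1 m e by blast
 ultimately have "\<bar>e $ k\<bar> = 1" for k by (meson order_antisym)
 then show thesis using that e by blast
qed

subsection \<open>Invariant measures in coordinates\<close>

lemma continuous_on_matrix_mult [continuous_intros]:
 fixes f g :: "'a::topological_space => 'n::finite rmat"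
 assumes "continuous_on S f" "continuous_on S g"
 shows "continuous_on S (%x. f x ** g x)"
 unfolding matrix_matrix_mult_def
 by (intro continuous_on_vec_lambda continuous_intros assms)

lemma continuous_on_matrix_vector_mult [continuous_intros]:
 fixes f :: "'a::topological_space => 'n::finite rmat"
 assumes "continuous_on S f" "continuous_on S g"
 shows "continuous_on S (%x. f x *v g x)" "continuous_on S (%x. g x v* f x)"
 unfolding matrix_vector_mult_def vector_matrix_mult_def
 by (intro continuous_on_vec_lambda continuous_intros assms)+

text \<open>The Neumann series, finite because \<open>mat 1 - nu\<close> is nilpotent; it makes
  inversion polynomial on \<open>Uni\<close>, hence continuous.\<close>

lemma matrix_inv_Uni:
 fixes nu :: "'n::{finite,linorder} rmat"
 assumes "nu \<in> Uni"
 shows "matrix_inv nu = (\<Sum>k\<le>CARD('n). mat_pow (mat 1 - nu) k)"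
proof (rule matrix_inv_eqI)
 define X where "X = mat 1 - nu"
 have "nu ** (\<Sum>k\<le>m. mat_pow X k) = mat 1 - mat_pow X (Suc m)" for m
 proof (induct m)
  case 0 show ?case by (simp add: mat_pow_def X_def)
 next
  case (Suc m)
  have "nu ** mat_pow X (Suc m) = mat_pow X (Suc m) - mat_pow X (Suc (Suc m))"
  by (simp add: mat_pow_def X_def)
  then show ?case using Suc by simp
 qed
 moreover have "mat_pow X (Suc CARD('n)) = 0"
  by (rule strict_upper_nilpotent) (use assms in \<open>auto simp: X_def Uni_def mat_def le_less\<close>)
 ultimately show "nu ** (\<Sum>k\<le>CARD('n). mat_pow (mat 1 - nu) k) = mat 1" by (simp add: X_def)
qed

lemma continuous_on_mat_pow:
 fixes f :: "'a::topological_space => 'n::finite rmat"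
 assumes "continuous_on S f"
 shows "continuous_on S (%x. mat_pow (f x) k)"
 by (induct k) (auto simp: mat_pow_def intro!: continuous_intros assms)

lemma continuous_on_inv_Uni: "continuous_on (Uni :: 'n::{finite,linorder} rmat set) matrix_inv"
proof -
 have "continuous_on (Uni :: 'n rmat set) (%nu. \<Sum>k\<le>CARD('n). mat_pow (mat 1 - nu) k)"
  by (intro continuous_intros continuous_on_mat_pow)
 then show ?thesis by (rule continuous_on_eq) (simp add: matrix_inv_Uni)
qed

text \<open>Tonelli's argument for the uniqueness of Haar measure, on a quotient of
 \<open>real^'n\<close> by a coordinate line; the unused coordinate is confined to \<open>[0,1]\<close>.\<close>

lemma invariant_measure_coordinates:
 fixes ms :: "'c measure" and q :: "'c => 'n::finite rvec" and p :: "'n rvec => 'c" and i :: 'n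
 assumes sf: "sigma_finite_measure ms"
  and q[measurable]: "q \<in> measurable ms borel" and p[measurable]: "p \<in> measurable borel ms"
  and pq: "\<And>c. c \<in> space ms ==> p (q c) = c"
  and qp: "\<And>x k. q (p x) $ k = (if k = i then 0 else x $ k)"
  and inv: "\<And>b. distr ms ms (%c. p (q c + b)) = ms"
  and fin: "emeasure ms {c \<in> space ms. - q c \<in> cbox 0 1} < \<infinity>" and nz: "emeasure ms (space ms) ~= 0"
 obtains C :: real where "0 < C"
  "ms = distr (density lborel (%x. ennreal (C * indicator {x. x $ i \<in> {0..1}} x))) ms p"
proof -
 interpret S: sigma_finite_measure ms by (rule sf)
 interpret L: sigma_finite_measure "lborel :: 'n rvec measure" by (rule sigma_finite_lborel)
 interpret PS: pair_sigma_finite ms "lborel :: 'n rvec measure" ..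
 define K where "K = (cbox 0 1 :: 'n rvec set)"
 have K: "x \<in> K \<longleftrightarrow> (\<forall>k. 0 \<le> x $ k \<and> x $ k \<le> 1)" for x by (auto simp: K_def cbox_def Basis_vec_def inner_axis)
 have [measurable]: "K \<in> sets borel" by (simp add: K_def)
 have K1: "(\<integral>\<^sup>+ y. indicator K y \<partial>lborel) = 1"
 proof -
  have "emeasure lborel K = 1" unfolding K_def
  by (subst emeasure_lborel_cbox) (auto simp: Basis_vec_def inner_axis intro!: prod.neutral)
  then show ?thesis by simp
 qed
 have shift: "(\<integral>\<^sup>+ y. f (y + b) \<partial>lborel) = (\<integral>\<^sup>+ y. f y \<partial>lborel)" 
  if [measurable]: "f \<in> borel_measurable borel" for f and b :: "'n rvec"
 proof -
  have "(\<integral>\<^sup>+ y. f y \<partial>lborel) = (\<integral>\<^sup>+ y. f y \<partial>distr lborel borel ((+) b))" by (simp add: lborel_distr_plus)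
  also have "\<dots> = (\<integral>\<^sup>+ y. f (b + y) \<partial>lborel)" by (subst nn_integral_distr) auto
  finally show ?thesis by (simp add: add.commute)
 qed
 define I where "I = {x :: 'n rvec. x $ i \<in> {0..1}}"
 have [measurable]: "I \<in> sets borel" unfolding I_def by measurable
 define C where "C = emeasure ms {c \<in> space ms. - q c \<in> K}"
 have [measurable]: "{c \<in> space ms. - q c \<in> K} \<in> sets ms" by measurable
 have main: "emeasure ms E = C * (\<integral>\<^sup>+ y. indicator E (p y) * indicator I y \<partial>lborel)" if E[measurable]: "E \<in> sets ms" for E
 proof -
  let ?f = "indicator E :: 'c => ennreal"
  have qi: "q c $ i = 0" if "c \<in> space ms" for c using qp[of "q c" i] pq[OF that] by simp
  have Tm[measurable]: "(%c. p (q c + b)) \<in> measurable ms ms" for b by measurable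
  have "emeasure ms E = (\<integral>\<^sup>+ c. ?f c \<partial>ms)" by simp
  \<comment> \<open>Insert 1 as the Lebesgue integral of the unit cube translated by q c. After
    exchanging the integrals, invariance of \<open>ms\<close> moves the translation from the cube
    into the argument of f.\<close>
  also have "\<dots> = (\<integral>\<^sup>+ c. \<integral>\<^sup>+ y. ?f c * indicator K (y - q c) \<partial>lborel \<partial>ms)"
  proof (intro nn_integral_cong)
  fix c
  have "(\<integral>\<^sup>+ y. ?f c * indicator K (y - q c) \<partial>lborel) = ?f c * (\<integral>\<^sup>+ y. indicator K (y + (- q c)) \<partial>lborel)"
  by (subst nn_integral_cmult) auto
  also have "\<dots> = ?f c" by (subst shift) (auto simp: K1)
  finally show "?f c = (\<integral>\<^sup>+ y. ?f c * indicator K (y - q c) \<partial>lborel)" ..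
  qed
  also have "\<dots> = (\<integral>\<^sup>+ y. \<integral>\<^sup>+ c. ?f c * indicator K (y - q c) \<partial>ms \<partial>lborel)"
  by (rule PS.Fubini'[symmetric]) measurable
  also have "\<dots> = (\<integral>\<^sup>+ y. \<integral>\<^sup>+ c. ?f (p (q c + y)) * indicator K (axis i (y $ i) - q c) \<partial>ms \<partial>lborel)"
  proof (rule nn_integral_cong)
  fix y :: "'n rvec"
  have "(\<integral>\<^sup>+ c. ?f c * indicator K (y - q c) \<partial>ms) = (\<integral>\<^sup>+ c. ?f c * indicator K (y - q c) \<partial>distr ms ms (%c. p (q c + y)))"
  by (simp only: inv)
  also have "\<dots> = (\<integral>\<^sup>+ c. ?f (p (q c + y)) * indicator K (y - q (p (q c + y))) \<partial>ms)"
  by (subst nn_integral_distr) (auto simp: inv)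
  also have "\<dots> = (\<integral>\<^sup>+ c. ?f (p (q c + y)) * indicator K (axis i (y $ i) - q c) \<partial>ms)"
  proof (intro nn_integral_cong arg_cong2[where f = "(*)"] refl arg_cong[where f = "indicator K"])
  fix c assume c: "c \<in> space ms"
  show "y - q (p (q c + y)) = axis i (y $ i) - q c"
  using qi[OF c] by (auto simp: vec_eq_iff qp axis_def)
  qed
  finally show "(\<integral>\<^sup>+ c. ?f c * indicator K (y - q c) \<partial>ms) =
  (\<integral>\<^sup>+ c. ?f (p (q c + y)) * indicator K (axis i (y $ i) - q c) \<partial>ms)" .
  qed
  also have "\<dots> = (\<integral>\<^sup>+ c. \<integral>\<^sup>+ y. ?f (p (q c + y)) * indicator K (axis i (y $ i) - q c) \<partial>lborel \<partial>ms)"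
  proof (rule PS.Fubini')
  have [measurable]: "(%y :: 'n rvec. axis i (y $ i)) \<in> borel_measurable borel"
  proof -
  have "continuous_on UNIV (%y :: 'n rvec. if k = i then y $ i else 0)" for k
  by (cases "k = i") (auto intro!: continuous_intros)
  then show ?thesis unfolding axis_def
  by (intro borel_measurable_continuous_onI continuous_on_vec_lambda)
  qed
  show "(%(c, y). ?f (p (q c + y)) * indicator K (axis i (y $ i) - q c)) \<in> borel_measurable (ms \<Otimes>\<^sub>M lborel)"
  by measurable
  qed
  also have "\<dots> = (\<integral>\<^sup>+ c. indicator {c \<in> space ms. - q c \<in> K} c * (\<integral>\<^sup>+ y. ?f (p y) * indicator I y \<partial>lborel) \<partial>ms)"
  proof (intro nn_integral_cong)
  fix c assume c: "c \<in> space ms"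
  have "(\<integral>\<^sup>+ y. ?f (p (q c + y)) * indicator K (axis i (y $ i) - q c) \<partial>lborel) =
  (\<integral>\<^sup>+ y. (%z. indicator {c \<in> space ms. - q c \<in> K} c * (?f (p z) * indicator I z)) (y + q c) \<partial>lborel)"
  proof (intro nn_integral_cong)
  fix y :: "'n rvec"
  \<comment> \<open>The condition separates: the i-th coordinate of y lies in the unit interval, and
    -q c lies in the cube. The latter integrates to the constant C.\<close>
  have "axis i (y $ i) - q c \<in> K \<longleftrightarrow> - q c \<in> K \<and> y + q c \<in> I"
  proof -
  have e: "(axis i (y $ i) - q c) $ k = (if k = i then y $ i else (- q c) $ k)" for k
  using qi[OF c] by (auto simp: axis_def)
  have b: "(- q c) $ i = 0" "(y + q c) $ i = y $ i" using qi[OF c] by simp_all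
  show ?thesis
  proof
  assume "axis i (y $ i) - q c \<in> K"
  then have 1: "0 \<le> (if k = i then y $ i else (- q c) $ k) \<and> (if k = i then y $ i else (- q c) $ k) \<le> 1" for k
  unfolding K e by blast
  have "0 \<le> (- q c) $ k \<and> (- q c) $ k \<le> 1" for k using 1[of k] b(1) by (cases "k = i") auto
  then show "- q c \<in> K \<and> y + q c \<in> I" using 1[of i] unfolding K I_def mem_Collect_eq b(2) by auto
  next
  assume "- q c \<in> K \<and> y + q c \<in> I"
  then show "axis i (y $ i) - q c \<in> K" unfolding K e I_def mem_Collect_eq b(2) by auto
  qed
  qed
  then show "?f (p (q c + y)) * indicator K (axis i (y $ i) - q c) =
  (%z. indicator {c \<in> space ms. - q c \<in> K} c * (?f (p z) * indicator I z)) (y + q c)"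
  using c by (auto simp: indicator_def add.commute)
  qed
  also have "\<dots> = (\<integral>\<^sup>+ z. indicator {c \<in> space ms. - q c \<in> K} c * (?f (p z) * indicator I z) \<partial>lborel)"
  by (rule shift) measurable
  also have "\<dots> = indicator {c \<in> space ms. - q c \<in> K} c * (\<integral>\<^sup>+ y. ?f (p y) * indicator I y \<partial>lborel)"
  by (rule nn_integral_cmult) measurable
  finally show "(\<integral>\<^sup>+ y. ?f (p (q c + y)) * indicator K (axis i (y $ i) - q c) \<partial>lborel) =
  indicator {c \<in> space ms. - q c \<in> K} c * (\<integral>\<^sup>+ y. ?f (p y) * indicator I y \<partial>lborel)" .
  qed
  also have "\<dots> = C * (\<integral>\<^sup>+ y. ?f (p y) * indicator I y \<partial>lborel)"
  by (subst nn_integral_multc) (auto simp: C_def)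
  finally show ?thesis .
 qed
 have Cfin: "C < \<infinity>" using fin by (simp add: C_def K_def)
 have C0: "C ~= 0" using main[of "space ms"] nz by auto
 obtain C' where C': "C = ennreal C'" "0 \<le> C'" using Cfin by (cases C) auto
 have C'0: "0 < C'" using C' C0 by (cases "C' = 0") auto
 have "ms = distr (density lborel (%x. ennreal (C' * indicator {x. x $ i \<in> {0..1}} x))) ms p"
 proof (rule measure_eqI)
  fix E assume E[measurable]: "E \<in> sets ms"
  have "emeasure (distr (density lborel (%x. ennreal (C' * indicator {x. x $ i \<in> {0..1}} x))) ms p) E
  = (\<integral>\<^sup>+ x. ennreal (C' * indicator I x) * indicator (p -` E) x \<partial>lborel)"
  unfolding I_def[symmetric]
  by (subst emeasure_distr) (auto simp: emeasure_density measurable_sets_borel[OF p E] space_borel)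
  also have "\<dots> = (\<integral>\<^sup>+ x. C * (indicator E (p x) * indicator I x) \<partial>lborel)"
  by (intro nn_integral_cong) (auto simp: indicator_def C')
  also have "\<dots> = emeasure ms E" unfolding main[OF E] by (rule nn_integral_cmult) measurable
  finally show "emeasure ms E = emeasure (distr (density lborel (%x. ennreal (C' * indicator {x. x $ i \<in> {0..1}} x))) ms p) E" ..
 qed simp
 then show thesis using that C'0 by blast
qed

text \<open>\<open>i\<close> is the last index with \<open>y\<^sub>i ~= 0\<close> and \<open>r\<close> the first index with \<open>w\<^sub>r ~= 0\<close>.\<close>

definition pivot :: "'n::{finite,linorder} rmat => 'n => 'n => bool" where
 "pivot g r i \<longleftrightarrow> g \<in> carrier SL \<and> yv g $ i = 1 \<and> (\<forall>l>i. yv g $ l = 0) \<and> wv g $ r ~= 0 \<and>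
  (\<forall>k<r. wv g $ k = 0) \<and> (\<forall>l>i. wv g $ l = 0) \<and> r \<le> i \<and> {r<..<i} = {}"

section \<open>Coordinates on the horospheres\<close>

definition qc :: "'n::{finite,linorder} rmat => 'n => 'n rmat => 'n rvec" where
 "qc g i nu = (\<chi> k. if k < i then (nu *v yv g) $ k else if i < k then (wv g v* matrix_inv nu) $ k else 0)"

text \<open>\<open>Xi\<close> and \<open>Eta\<close> rebuild the moved pair of vectors from its n -
  1 free entries; slot i of x is the spare one. The i-th entry of \<open>Eta\<close> is forced by
  the pairing being 1.\<close>

definition Xi :: "'n::{finite,linorder} => 'n rvec => 'n rvec" where
 "Xi i x = (\<chi> k. if k < i then x $ k else if k = i then 1 else 0)"

definition Eta :: "'n::{finite,linorder} rvec => 'n => 'n rvec => 'n rvec" where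
 "Eta w i x = (\<chi> k. if i < k then x $ k else if k = i then 1 - (\<Sum>m | m < i. w $ m * x $ m) else w $ k)"

text \<open>Unitriangular matrices do not move y from i on, nor w up to r; as no index lies strictly
  between r and i, all of w before i is fixed. The pairing is preserved and equals 1, which
  determines the i-th entry of w.\<close>

lemma Uni_orbit:
 assumes n: "CARD('n) \<ge> 2" and p: "pivot (g :: 'n::{finite,linorder} rmat) r i" and nu: "nu \<in> Uni"
 shows "nu *v yv g = Xi i (qc g i nu)" "wv g v* matrix_inv nu = Eta (wv g) i (qc g i nu)"
proof -
 have S: "nu \<in> carrier SL" by (rule Uni_SL[OF nu])
 have up: "(nu *v yv g) $ l = yv g $ l" if "i \<le> l" for l
  using upper_mult_vec(1)[of nu i "yv g" l] nu p that by (auto simp: Uni_def pivot_def)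
 show y: "nu *v yv g = Xi i (qc g i nu)"
  using up p by (auto simp: vec_eq_iff Xi_def qc_def pivot_def not_less le_less)
 have iU: "matrix_inv nu \<in> Uni" by (rule Uni_inv[OF nu])
 have low: "(wv g v* matrix_inv nu) $ k = wv g $ k" if "k < i" for k
 proof -
  have "k \<le> r" using p that by (auto simp: pivot_def) (metis emptyE greaterThanLessThan_iff not_le)
  then show ?thesis
  using upper_mult_vec(2)[of "matrix_inv nu" r "wv g" k] iU p by (auto simp: Uni_def pivot_def)
 qed
 have "(wv g v* matrix_inv nu) \<bullet> (nu *v yv g) = 1"
  using wv_yv[OF n, of g] p by (simp add: dot_lmul_matrix SL_cancel_vec[OF S] pivot_def)
 then have "1 = (\<Sum>k\<in>UNIV. (wv g v* matrix_inv nu) $ k * Xi i (qc g i nu) $ k)" by (simp add: inner_vec_def y)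
 also have "\<dots> = (\<Sum>k\<in>insert i {..<i}. (wv g v* matrix_inv nu) $ k * Xi i (qc g i nu) $ k)"
  by (rule sum.mono_neutral_right) (auto simp: Xi_def)
 also have "\<dots> = (wv g v* matrix_inv nu) $ i + (\<Sum>k | k < i. wv g $ k * qc g i nu $ k)"
  by (auto simp: Xi_def lessThan_def low intro!: sum.cong)
 finally show "wv g v* matrix_inv nu = Eta (wv g) i (qc g i nu)"
  using low by (auto simp: vec_eq_iff Eta_def qc_def)
qed

lemma orb_conj:
 assumes "g \<in> carrier SL" "nu \<in> carrier SL"
 shows "orb (Ad g nu) = Ad g (outer (nu *v yv g) (wv g v* matrix_inv nu))"
 unfolding orb_def Ad_inverse[OF assms(1) SL_invertible[OF assms(2)]]
 by (simp add: Ad_def mult_outer outer_mult yv_def wv_def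
  matrix_vector_mul_assoc vector_matrix_mul_assoc matrix_mul_assoc)

text \<open>The pair can be recovered from its outer product because the i-th entry of the first
  vector is normalized to 1.\<close>

lemma qc_eq_iff:
 assumes n: "CARD('n) \<ge> 2" and p: "pivot (g :: 'n::{finite,linorder} rmat) r i" and nu: "nu \<in> Uni" "nu' \<in> Uni"
 shows "qc g i nu = qc g i nu' \<longleftrightarrow> orb (Ad g nu) = orb (Ad g nu')"
proof -
 have g: "g \<in> carrier SL" using p by (simp add: pivot_def)
 have "orb (Ad g nu) = orb (Ad g nu') \<longleftrightarrow> outer (Xi i (qc g i nu)) (Eta (wv g) i (qc g i nu)) =
  outer (Xi i (qc g i nu')) (Eta (wv g) i (qc g i nu'))"
  unfolding orb_conj[OF g Uni_SL[OF nu(1)]] orb_conj[OF g Uni_SL[OF nu(2)]] Uni_orbit[OF n p nu(1)] Uni_orbit[OF n p nu(2)]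
  by (rule inj_eq[OF Ad_inj[OF g]])
 also have "\<dots> \<longleftrightarrow> qc g i nu = qc g i nu'"
 proof
  assume eq: "outer (Xi i (qc g i nu)) (Eta (wv g) i (qc g i nu)) = outer (Xi i (qc g i nu')) (Eta (wv g) i (qc g i nu'))"
  have "Eta (wv g) i (qc g i nu) = Eta (wv g) i (qc g i nu')"
  proof -
  have "outer (Xi i (qc g i nu)) (Eta (wv g) i (qc g i nu)) $ i $ k = outer (Xi i (qc g i nu')) (Eta (wv g) i (qc g i nu')) $ i $ k" for k
  using eq by simp
  then show ?thesis by (simp add: vec_eq_iff Xi_def)
  qed
  note E = this
  have "wv g v* matrix_inv nu ~= 0"
  proof
  assume "wv g v* matrix_inv nu = 0"
  then have "wv g = 0" using SL_cancel_vec(4)[OF Uni_SL[OF nu(1)], of "wv g"] by simp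
  then show False using p by (simp add: pivot_def)
  qed
  then obtain m where m: "Eta (wv g) i (qc g i nu) $ m ~= 0" unfolding Uni_orbit(2)[OF n p nu(1)] by (auto simp: vec_eq_iff)
  have "outer (Xi i (qc g i nu)) (Eta (wv g) i (qc g i nu)) $ k $ m = outer (Xi i (qc g i nu')) (Eta (wv g) i (qc g i nu')) $ k $ m" for k
  using eq by simp
  then have X: "Xi i (qc g i nu) $ k = Xi i (qc g i nu') $ k" for k using m by (simp add: E)
  have E': "Eta (wv g) i (qc g i nu) $ k = Eta (wv g) i (qc g i nu') $ k" for k using E by simp
  show "qc g i nu = qc g i nu'"
  proof (rule vec_eq_iff[THEN iffD2], rule allI)
  fix k show "qc g i nu $ k = qc g i nu' $ k"
  using X[of k] E'[of k] by (cases k i rule: linorder_cases) (auto simp: Xi_def Eta_def qc_def[of g i nu] qc_def[of g i nu'])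
  qed
 qed simp
 finally show ?thesis by simp
qed

text \<open>\<open>col_mat\<close> and \<open>row_mat\<close> translate the coordinates before and
  after i. The sign and the divisor c in \<open>row_mat\<close> arise because w is moved by the
  inverse matrix and has r-th entry c.\<close>

definition col_mat :: "'n::{finite,linorder} => 'n rvec => 'n rmat" where
 "col_mat i b = (\<chi> k l. if l = i \<and> k < i then b $ k else if k = l then 1 else 0)"

definition row_mat :: "'n::{finite,linorder} => 'n => real => 'n rvec => 'n rmat" where
 "row_mat r i c b = (\<chi> k l. if k = r \<and> i < l then - b $ l / c else if k = l then 1 else 0)"

lemma col_mat_Uni: "col_mat i b \<in> Uni"
 by (auto simp: Uni_def col_mat_def)

lemma row_mat_Uni: "r \<le> i ==> row_mat r i c b \<in> Uni"
 by (auto simp: Uni_def row_mat_def)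

lemma vec_mult_inv_eq:
 assumes "A \<in> carrier SL"
 shows "(x v* matrix_inv A) v* A = x"
 by (rule SL_cancel_vec(4)[OF assms])

lemma qc_col_mat:
 assumes n: "CARD('n) \<ge> 2" and p: "pivot (g :: 'n::{finite,linorder} rmat) r i" and nu: "nu \<in> Uni"
 shows "qc g i (col_mat i b ** nu) = (\<chi> k. if k < i then qc g i nu $ k + b $ k else qc g i nu $ k)"
proof -
 define A where "A = col_mat i b"
 have AU: "A \<in> Uni" by (simp add: A_def col_mat_Uni)
 have AS: "A \<in> carrier SL" and nuS: "nu \<in> carrier SL" using AU nu Uni_SL by auto
 have 1: "(A ** nu *v yv g) $ k = qc g i nu $ k + b $ k" if k: "k < i" for k
 proof -
  have "(A ** nu *v yv g) $ k = (\<Sum>l\<in>UNIV. A $ k $ l * Xi i (qc g i nu) $ l)"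
  by (simp add: Uni_orbit(1)[OF n p nu, symmetric] matrix_vector_mul_assoc[symmetric] matrix_vector_mult_def[of A])
  also have "\<dots> = (\<Sum>l\<in>{k,i}. A $ k $ l * Xi i (qc g i nu) $ l)"
  by (rule sum.mono_neutral_right) (auto simp: A_def col_mat_def)
  finally show ?thesis using k by (auto simp: A_def col_mat_def Xi_def)
 qed
 have 2: "(wv g v* matrix_inv (A ** nu)) $ l = (wv g v* matrix_inv nu) $ l" if l: "i < l" for l
 proof -
  define e where "e = wv g v* matrix_inv (A ** nu)"
  have "e v* A = wv g v* matrix_inv nu"
  unfolding e_def SL_inv_mult[OF AS nuS] vector_matrix_mul_assoc[symmetric] by (rule vec_mult_inv_eq[OF AS])
  moreover have "(e v* A) $ l = (\<Sum>k\<in>{l}. e $ k * A $ k $ l)"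
  unfolding vector_matrix_mult_def vec_lambda_beta
  by (rule sum.mono_neutral_right) (use l in \<open>auto simp: A_def col_mat_def\<close>)
  ultimately have "(wv g v* matrix_inv nu) $ l = e $ l" using l by (auto simp: A_def col_mat_def)
  then show ?thesis by (simp add: e_def)
 qed
 show ?thesis unfolding A_def[symmetric] using 1 2 by (auto simp: vec_eq_iff qc_def[of g i "A ** nu"]) (simp add: qc_def)+
qed

lemma qc_row_mat:
 assumes n: "CARD('n) \<ge> 2" and p: "pivot (g :: 'n::{finite,linorder} rmat) r i" and nu: "nu \<in> Uni"
 shows "qc g i (row_mat r i (wv g $ r) b ** nu) = (\<chi> k. if i < k then qc g i nu $ k + b $ k else qc g i nu $ k)"
proof -
 define A where "A = row_mat r i (wv g $ r) b"
 have ri: "r \<le> i" using p by (simp add: pivot_def)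
 have AU: "A \<in> Uni" by (simp add: A_def row_mat_Uni ri)
 have AS: "A \<in> carrier SL" and nuS: "nu \<in> carrier SL" using AU nu Uni_SL by auto
 have 1: "(A ** nu *v yv g) $ k = (nu *v yv g) $ k" for k
 proof -
  have "(A ** nu *v yv g) $ k = (\<Sum>l\<in>UNIV. A $ k $ l * Xi i (qc g i nu) $ l)"
  by (simp add: Uni_orbit(1)[OF n p nu, symmetric] matrix_vector_mul_assoc[symmetric] matrix_vector_mult_def[of A])
  also have "\<dots> = (\<Sum>l\<in>{k}. A $ k $ l * Xi i (qc g i nu) $ l)"
  by (rule sum.mono_neutral_right) (auto simp: A_def row_mat_def Xi_def)
  finally show ?thesis using ri by (auto simp: A_def row_mat_def Uni_orbit(1)[OF n p nu])
 qed
 have etar: "(wv g v* matrix_inv B) $ r = wv g $ r" if B: "B \<in> Uni" for B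
 proof -
  have "(wv g v* matrix_inv B) $ r = wv g $ r * matrix_inv B $ r $ r"
  by (rule upper_mult_vec(2)[of _ r]) (use Uni_inv[OF B] p in \<open>auto simp: Uni_def pivot_def\<close>)
  then show ?thesis using Uni_inv[OF B] by (simp add: Uni_def)
 qed
 have 2: "(wv g v* matrix_inv (A ** nu)) $ l = (wv g v* matrix_inv nu) $ l + b $ l" if l: "i < l" for l
 proof -
  define e where "e = wv g v* matrix_inv (A ** nu)"
  have "e v* A = wv g v* matrix_inv nu"
  unfolding e_def SL_inv_mult[OF AS nuS] vector_matrix_mul_assoc[symmetric] by (rule vec_mult_inv_eq[OF AS])
  moreover have "(e v* A) $ l = (\<Sum>k\<in>{l,r}. e $ k * A $ k $ l)"
  unfolding vector_matrix_mult_def vec_lambda_beta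
  by (rule sum.mono_neutral_right) (use l in \<open>auto simp: A_def row_mat_def\<close>)
  moreover have "e $ r = wv g $ r" unfolding e_def using etar Uni_mult[OF AU nu] by blast
  moreover have "wv g $ r ~= 0" "l ~= r" using p l by (auto simp: pivot_def)
  ultimately have "(wv g v* matrix_inv nu) $ l = e $ l - b $ l" using l by (simp add: A_def row_mat_def)
  then show ?thesis by (simp add: e_def)
 qed
 show ?thesis unfolding A_def[symmetric] using 1 2 by (auto simp: vec_eq_iff qc_def[of g i "A ** nu"]) (simp add: qc_def)+
qed

definition shift_mat :: "'n::{finite,linorder} rmat => 'n => 'n => 'n rvec => 'n rmat" where
 "shift_mat g r i b = row_mat r i (wv g $ r) b ** col_mat i b"

lemma shift_mat_Uni: "pivot g r i ==> shift_mat g r i b \<in> Uni"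
 unfolding shift_mat_def by (intro Uni_mult col_mat_Uni row_mat_Uni) (simp add: pivot_def)

lemma qc_shift_mat:
 assumes n: "CARD('n) \<ge> 2" and p: "pivot (g :: 'n::{finite,linorder} rmat) r i" and nu: "nu \<in> Uni"
 shows "qc g i (shift_mat g r i b ** nu) = (\<chi> k. if k = i then 0 else qc g i nu $ k + b $ k)"
 unfolding shift_mat_def matrix_mul_assoc[symmetric]
  qc_row_mat[OF n p Uni_mult[OF col_mat_Uni nu]] qc_col_mat[OF n p nu]
 by (auto simp: vec_eq_iff) (simp add: qc_def)

text \<open>The translation that carries the coordinates of the identity to x; it serves as a
  continuous section of \<open>qc\<close>.\<close>

definition sec :: "'n::{finite,linorder} rmat => 'n => 'n => 'n rvec => 'n rmat" where
 "sec g r i x = shift_mat g r i (x - qc g i (mat 1))"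

lemma one_Uni: "mat 1 \<in> Uni" by (auto simp: Uni_def mat_def)

lemma sec_Uni: "pivot g r i ==> sec g r i x \<in> Uni"
 unfolding sec_def by (rule shift_mat_Uni)

lemma qc_sec:
 assumes n: "CARD('n) \<ge> 2" and p: "pivot (g :: 'n::{finite,linorder} rmat) r i"
 shows "qc g i (sec g r i x) = (\<chi> k. if k = i then 0 else x $ k)"
 using qc_shift_mat[OF n p one_Uni, of "x - qc g i (mat 1)"] by (simp add: sec_def vec_eq_iff)

lemma continuous_on_sec: "continuous_on S (sec g r i)"
proof -
 have 1: "continuous_on S (%x. if l = i \<and> k < i then (x - v) $ k else if k = l then 1 else (0::real))" for k l v
  by (cases "l = i \<and> k < i") (auto intro!: continuous_intros)
 have 2: "continuous_on S (%x. if k = r \<and> i < l then - (x - v) $ l / c else if k = l then 1 else (0::real))" for k l v c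
  by (cases "k = r \<and> i < l"; cases "c = 0") (auto intro!: continuous_intros)
 show ?thesis unfolding sec_def shift_mat_def row_mat_def col_mat_def
  by (intro continuous_intros continuous_on_vec_lambda 1 2)
qed


subsection \<open>Integration over the horospheres\<close>

definition cos_rep :: "'n::{finite,linorder} rmat => 'n => 'n => 'n rvec => 'n rmat" where
 "cos_rep g r i x = Ad g (sec g r i x)"

lemma mem_l_coset: "a \<in> x <#\<^bsub>SL\<^esub> J \<longleftrightarrow> (\<exists>h\<in>J. a = x ** h)"
 by (simp add: l_coset_def SL_def)

lemma l_coset_eq_iff:
 fixes J :: "'n::finite rmat set"
 assumes J: "subgroup J SL" and x: "x \<in> carrier SL" "x' \<in> carrier SL"
 shows "x <#\<^bsub>SL\<^esub> J = x' <#\<^bsub>SL\<^esub> J \<longleftrightarrow> matrix_inv x ** x' \<in> J"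
proof -
 have one: "mat 1 \<in> J" and mult: "\<And>a b. a \<in> J ==> b \<in> J ==> a ** b \<in> J" and inv: "\<And>a. a \<in> J ==> matrix_inv a \<in> J"
  and sub: "J \<subseteq> carrier SL"
  using J by (auto simp: subgroup_SL_iff)
 show ?thesis
 proof
  assume "x <#\<^bsub>SL\<^esub> J = x' <#\<^bsub>SL\<^esub> J"
  moreover have "x' \<in> x' <#\<^bsub>SL\<^esub> J" using one by (auto simp: mem_l_coset intro!: bexI[of _ "mat 1"])
  ultimately obtain h where "h \<in> J" "x' = x ** h" by (metis mem_l_coset)
  then show "matrix_inv x ** x' \<in> J" by (simp add: SL_cancel_left x)
 next
  assume h: "matrix_inv x ** x' \<in> J"
  define h0 where "h0 = matrix_inv x ** x'"
  have h0: "h0 \<in> J" "h0 \<in> carrier SL" using h sub by (auto simp: h0_def)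
  have x': "x' = x ** h0" by (simp add: h0_def SL_cancel_left x)
  show "x <#\<^bsub>SL\<^esub> J = x' <#\<^bsub>SL\<^esub> J"
  proof (intro equalityI subsetI)
  fix a assume "a \<in> x <#\<^bsub>SL\<^esub> J"
  then obtain k where k: "k \<in> J" "a = x ** k" by (auto simp: mem_l_coset)
  have "a = x' ** (matrix_inv h0 ** k)"
  unfolding x' k(2) by (simp only: matrix_mul_assoc[symmetric] SL_cancel_left[OF h0(2)])
  then show "a \<in> x' <#\<^bsub>SL\<^esub> J" using k mult inv h0 by (auto simp: mem_l_coset)
  next
  fix a assume "a \<in> x' <#\<^bsub>SL\<^esub> J"
  then obtain k where k: "k \<in> J" "a = x' ** k" by (auto simp: mem_l_coset)
  then show "a \<in> x <#\<^bsub>SL\<^esub> J" using mult h0 by (auto simp: mem_l_coset x' matrix_mul_assoc[symmetric])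
  qed
 qed
qed

lemma l_coset_mult:
 fixes J :: "'n::finite rmat set"
 shows "x <#\<^bsub>SL\<^esub> (y <#\<^bsub>SL\<^esub> J) = (x ** y) <#\<^bsub>SL\<^esub> J"
proof -
 have "x <#\<^bsub>SL\<^esub> J = (%h. x ** h) ` J" for x and J :: "'n rmat set"
  by (auto simp: l_coset_def SL_def)
 then show ?thesis by (simp add: image_image matrix_mul_assoc)
qed

lemma sigma_finite_of_compact_exhaustion:
 assumes "\<And>m :: nat. B m \<in> sets ms" "\<And>m. emeasure ms (B m) < \<infinity>" "space ms = (\<Union>m. B m)"
 shows "sigma_finite_measure ms"
 by (unfold_locales, rule exI[of _ "range B"]) (use assms in \<open>auto simp: less_top\<close>)

text \<open>\<open>qc\<close> identifies N/(N \<inter> H) with a coordinate hyperplane on which the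
  matrices \<open>shift_mat\<close> act by all translations. An invariant Radon measure becomes
  translation invariant and finite on bounded sets, and \<open>invariant_measure_coordinates\<close>
  applies.\<close>

lemma horosphere_measure:
 fixes g :: "'n::{finite,linorder} rmat"
 assumes n: "CARD('n) \<ge> 2" and p: "pivot g r i"
  and ms: "nonzero_invariant_radon (Ad g ` Uni) (Ad g ` Uni \<inter> Hgrp) ms"
 obtains C :: real where "0 < C"
  "ms = distr (density lborel (%x. ennreal (C * indicator {x. x $ i \<in> {0..1}} x))) ms
  (%x. cos_rep g r i x <#\<^bsub>SL\<^esub> (Ad g ` Uni \<inter> Hgrp))"
  "(%x. cos_rep g r i x <#\<^bsub>SL\<^esub> (Ad g ` Uni \<inter> Hgrp)) \<in> measurable borel ms"
  "\<And>F :: 'n rvec => complex. continuous_on UNIV F ==>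
  (%c. F (qc g i (Ad (matrix_inv g) (SOME n. n \<in> c)))) \<in> borel_measurable ms"
  "space ms = range (%x. cos_rep g r i x <#\<^bsub>SL\<^esub> (Ad g ` Uni \<inter> Hgrp))"
proof -
 define N where "N = Ad g ` Uni"
 define J where "J = N \<inter> Hgrp"
 define cl where "cl x = cos_rep g r i x <#\<^bsub>SL\<^esub> J" for x
 define q where "q c = qc g i (Ad (matrix_inv g) (SOME n. n \<in> c))" for c
 have g: "g \<in> carrier SL" using p by (simp add: pivot_def)
 have sN: "subgroup N SL" unfolding N_def by (rule subgroup_Ad[OF g subgroup_Uni])
 have sJ: "subgroup J SL" unfolding J_def
  using sN subgroup_Hgrp[OF n] by (auto simp: subgroup_SL_iff)
 have NS: "N \<subseteq> carrier SL" using sN by (simp add: subgroup_SL_iff)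
 have coset_eq: "Ad g nu <#\<^bsub>SL\<^esub> J = Ad g nu' <#\<^bsub>SL\<^esub> J \<longleftrightarrow> qc g i nu = qc g i nu'" if "nu \<in> Uni" "nu' \<in> Uni" for nu nu'
 proof -
  have S: "Ad g nu \<in> N" "Ad g nu' \<in> N" using that by (auto simp: N_def)
  then have "matrix_inv (Ad g nu) ** Ad g nu' \<in> N" using sN by (simp add: subgroup_SL_iff)
  then show ?thesis
  using l_coset_eq_iff[OF sJ, of "Ad g nu" "Ad g nu'"] orb_eq_iff[OF n, of "Ad g nu" "Ad g nu'"]
  qc_eq_iff[OF n p that] S NS by (auto simp: J_def)
 qed
 have repU: "sec g r i x \<in> Uni" for x by (rule sec_Uni[OF p])
 have repN: "cos_rep g r i x \<in> N" for x using repU by (simp add: cos_rep_def N_def)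
 \<comment> \<open>\<open>q\<close> evaluates \<open>qc\<close> at a representative picked by
   choice; by \<open>coset_eq\<close> the choice does not matter.\<close>
 have qAd: "q (Ad g nu <#\<^bsub>SL\<^esub> J) = qc g i nu" if nu: "nu \<in> Uni" for nu
 proof -
  have "Ad g nu \<in> Ad g nu <#\<^bsub>SL\<^esub> J" using sJ by (auto simp: mem_l_coset subgroup_SL_iff intro!: bexI[of _ "mat 1"])
  then have "(SOME m. m \<in> Ad g nu <#\<^bsub>SL\<^esub> J) \<in> Ad g nu <#\<^bsub>SL\<^esub> J" by (rule someI)
  then obtain h where h: "h \<in> J" "(SOME m. m \<in> Ad g nu <#\<^bsub>SL\<^esub> J) = Ad g nu ** h" by (auto simp: mem_l_coset)
  have "Ad g nu \<in> N" using nu by (auto simp: N_def)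
  then have "Ad g nu ** h \<in> N" using h sN by (auto simp: J_def subgroup_SL_iff)
  then obtain nu' where nu': "nu' \<in> Uni" "Ad g nu ** h = Ad g nu'" by (auto simp: N_def)
  have "Ad g nu <#\<^bsub>SL\<^esub> J = Ad g nu' <#\<^bsub>SL\<^esub> J"
  using l_coset_eq_iff[OF sJ, of "Ad g nu" "Ad g nu'"] \<open>Ad g nu \<in> N\<close> \<open>Ad g nu ** h \<in> N\<close> NS h nu'
  by (metis SL_cancel_left(2) subsetD)
  then show ?thesis using coset_eq[OF nu nu'(1)] h nu' g by (simp add: q_def)
 qed
 have qcl: "q (cl x) $ k = (if k = i then 0 else x $ k)" for x k
  using qAd[OF repU] qc_sec[OF n p] by (simp add: cl_def cos_rep_def)
 have cosets: "coset_space N J = {Ad g nu <#\<^bsub>SL\<^esub> J | nu. nu \<in> Uni}"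
  by (auto simp: coset_space_def LCOSETS_def l_coset_def N_def SL_def)
 have clAd: "Ad g nu <#\<^bsub>SL\<^esub> J = cl x" if "nu \<in> Uni" "\<And>k. k ~= i ==> x $ k = qc g i nu $ k" for nu x
  unfolding cl_def cos_rep_def coset_eq[OF that(1) repU] qc_sec[OF n p]
  using that(2) by (auto simp: vec_eq_iff) (simp add: qc_def)
 have clq: "cl (q c) = c" if c: "c \<in> coset_space N J" for c
 proof -
  obtain nu where "nu \<in> Uni" "c = Ad g nu <#\<^bsub>SL\<^esub> J" using c cosets by auto
  then show ?thesis using clAd[of nu "q c"] qAd[of nu] by simp
 qed
 have cl_in: "cl x \<in> coset_space N J" for x using repU by (auto simp: cosets cl_def cos_rep_def)
 have range: "coset_space N J = range cl" using clq cl_in by (metis image_eqI rangeI subset_antisym subsetI image_subset_iff)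
 define T where "T = coset_topology N J"
 have openT: "openin T U \<longleftrightarrow> U \<subseteq> coset_space N J \<and> openin (top_of_set N) {n \<in> N. n <#\<^bsub>SL\<^esub> J \<in> U}" for U
  unfolding T_def by (rule openin_coset_topology)
 have topT: "topspace T = coset_space N J"
 proof
  show "topspace T \<subseteq> coset_space N J" using openT by (auto simp: topspace_def)
  have "{n \<in> N. n <#\<^bsub>SL\<^esub> J \<in> coset_space N J} = N" unfolding cosets by (auto simp: N_def)
  then have "openin T (coset_space N J)" by (simp add: openT)
  then show "coset_space N J \<subseteq> topspace T" by (rule openin_subset)
 qed
 have cont_rep: "continuous_on S (cos_rep g r i)" for S
  unfolding cos_rep_def
  by (rule continuous_on_compose2[OF continuous_on_Ad[of UNIV] continuous_on_sec]) auto
 have cl_open: "open (cl -` U)" if U: "openin T U" for U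
 proof -
  obtain W where W: "open W" "{n \<in> N. n <#\<^bsub>SL\<^esub> J \<in> U} = N \<inter> W" using U unfolding openT openin_open by auto
  have "cl -` U = cos_rep g r i -` W" using W(2) repN by (auto simp: cl_def)
  moreover have "isCont (cos_rep g r i) x" for x
  using cont_rep[of UNIV] by (simp add: continuous_on_eq_continuous_at)
  ultimately show ?thesis using continuous_open_vimage[OF W(1), of "cos_rep g r i"] by simp
 qed
 have rad: "radon_measure T ms" and nz: "emeasure ms (space ms) ~= 0"
  and inv0: "\<And>m E. m \<in> N ==> E \<in> sets ms ==> emeasure ms ((%c. m <#\<^bsub>SL\<^esub> c) ` E) = emeasure ms E"
  using ms unfolding nonzero_invariant_radon_def T_def N_def J_def by auto
 have sp: "space ms = coset_space N J" and sets: "sets ms = sigma_sets (coset_space N J) {U. openin T U}"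
  and cptfin: "\<And>C. compactin T C ==> emeasure ms C < \<infinity>"
  using rad by (auto simp: radon_measure_def topT)
 have opensub: "{U. openin T U} \<subseteq> Pow (coset_space N J)" using openT by auto
 have cl_meas[measurable]: "cl \<in> measurable borel ms"
  by (rule measurable_sigma_sets[OF sets opensub]) (use cl_in cl_open in auto)
 have cont_qc: "continuous_on Uni (qc g i)"
 proof -
  have c: "continuous_on Uni (%nu. if k < i then (nu *v yv g) $ k else if i < k then (wv g v* matrix_inv nu) $ k else 0)" for k
  by (cases "k < i"; cases "i < k") (auto intro!: continuous_intros continuous_on_inv_Uni)
  show ?thesis unfolding qc_def by (intro continuous_on_vec_lambda c)
 qed
 have q_open: "openin T {c \<in> coset_space N J. q c \<in> W}" if W: "open W" for W
  unfolding openT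
 proof
  have "{n \<in> N. n <#\<^bsub>SL\<^esub> J \<in> {c \<in> coset_space N J. q c \<in> W}} = {n \<in> N. qc g i (Ad (matrix_inv g) n) \<in> W}"
  using qAd g unfolding cosets by (auto simp: N_def)
  also have "\<dots> = N \<inter> (%n. qc g i (Ad (matrix_inv g) n)) -` W" by auto
  also have "openin (top_of_set N) \<dots>"
  proof (rule continuous_openin_preimage_gen[OF _ W])
  show "continuous_on N (%n. qc g i (Ad (matrix_inv g) n))"
  by (rule continuous_on_compose2[OF cont_qc continuous_on_Ad]) (use g in \<open>auto simp: N_def\<close>)
  qed
  finally show "openin (top_of_set N) {n \<in> N. n <#\<^bsub>SL\<^esub> J \<in> {c \<in> coset_space N J. q c \<in> W}}" .
 qed auto
 have q_meas[measurable]: "q \<in> measurable ms borel"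
 proof (rule borel_measurableI)
  fix W :: "'n rvec set" assume "open W"
  then have "openin T {c \<in> coset_space N J. q c \<in> W}" by (rule q_open)
  moreover have "q -` W \<inter> space ms = {c \<in> coset_space N J. q c \<in> W}" by (auto simp: sp)
  ultimately show "q -` W \<inter> space ms \<in> sets ms" by (auto simp: sets)
 qed
 have cl_cont: "continuous_map euclidean T cl"
  unfolding continuous_map_def using cl_in cl_open by (auto simp: topT vimage_def)
 have fin: "emeasure ms (cl ` K) < \<infinity>" if "compact K" for K
  by (rule cptfin, rule image_compactin[OF _ cl_cont]) (use that in auto)
 \<comment> \<open>Cosets with coordinates in a compact set lie in its image under
   \<open>cl\<close>, which is compact, and a Radon measure is finite there.\<close>
 have bounded_fin: "emeasure ms {c \<in> space ms. q c \<in> K} < \<infinity>" if K: "compact K" for K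
 proof -
  have "{c \<in> space ms. q c \<in> K} \<subseteq> cl ` K" using clq by (force simp: sp)
  moreover have "cl ` K \<in> sets ms"
  proof -
  have "cl ` K = {c \<in> space ms. q c \<in> (%x. \<chi> k. if k = i then 0 else x $ k) ` K}"
  proof (intro equalityI subsetI)
  fix c assume "c \<in> cl ` K"
  then obtain x where x: "x \<in> K" "c = cl x" by auto
  have "q (cl x) = (\<chi> k. if k = i then 0 else x $ k)" by (simp add: vec_eq_iff qcl)
  then show "c \<in> {c \<in> space ms. q c \<in> (%x. \<chi> k. if k = i then 0 else x $ k) ` K}" using x cl_in by (auto simp: sp)
  next
  fix c assume "c \<in> {c \<in> space ms. q c \<in> (%x. \<chi> k. if k = i then 0 else x $ k) ` K}"
  then obtain x where x: "x \<in> K" "c \<in> coset_space N J" "q c = (\<chi> k. if k = i then 0 else x $ k)" by (auto simp: sp)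
  have "q c = q (cl x)" using x by (simp add: vec_eq_iff qcl)
  then have "c = cl x" using clq[OF x(2)] clq[OF cl_in[of x]] by metis
  then show "c \<in> cl ` K" using x by auto
  qed
  moreover have "compact ((%x :: 'n rvec. \<chi> k. if k = i then 0 else x $ k) ` K)"
  proof (rule compact_continuous_image[OF _ K], rule continuous_on_vec_lambda)
  show "continuous_on K (%x :: 'n rvec. if k = i then 0 else x $ k)" for k
  by (cases "k = i") (auto intro!: continuous_intros)
  qed
  then have [measurable]: "(%x :: 'n rvec. \<chi> k. if k = i then 0 else x $ k) ` K \<in> sets borel"
  by (simp add: borel_compact)
  ultimately show ?thesis by simp
  qed
  ultimately have "emeasure ms {c \<in> space ms. q c \<in> K} \<le> emeasure ms (cl ` K)" by (rule emeasure_mono)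
  then show ?thesis using fin[OF K] by (rule le_less_trans)
 qed
 have sf: "sigma_finite_measure ms"
 proof (rule sigma_finite_of_compact_exhaustion)
  fix m :: nat
  have "q -` cball 0 (real m) \<inter> space ms \<in> sets ms" by (rule measurable_sets[OF q_meas]) simp
  then show "{c \<in> space ms. q c \<in> cball 0 (real m)} \<in> sets ms" by (simp add: vimage_def Int_def conj_commute)
  show "emeasure ms {c \<in> space ms. q c \<in> cball 0 (real m)} < \<infinity>" by (rule bounded_fin) simp
 next
  show "space ms = (\<Union>m. {c \<in> space ms. q c \<in> cball 0 (real m)})"
  using real_arch_simple by (auto simp: dist_norm)
 qed
 have trans: "shift_mat g r i b \<in> Uni \<and> (\<forall>c\<in>coset_space N J. cl (q c + b) = Ad g (shift_mat g r i b) <#\<^bsub>SL\<^esub> c)" for b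
 proof (intro conjI ballI)
  show sU: "shift_mat g r i b \<in> Uni" by (rule shift_mat_Uni[OF p])
  fix c assume "c \<in> coset_space N J"
  then obtain nu where nu: "nu \<in> Uni" "c = Ad g nu <#\<^bsub>SL\<^esub> J" using cosets by auto
  have "Ad g (shift_mat g r i b) <#\<^bsub>SL\<^esub> c = Ad g (shift_mat g r i b ** nu) <#\<^bsub>SL\<^esub> J"
  by (simp add: nu l_coset_mult Ad_mult g)
  also have "\<dots> = cl (q c + b)"
  by (rule clAd) (use nu sU qc_shift_mat[OF n p nu(1)] qAd[OF nu(1)] in \<open>auto intro: Uni_mult\<close>)
  finally show "cl (q c + b) = Ad g (shift_mat g r i b) <#\<^bsub>SL\<^esub> c" ..
 qed
 have inv: "distr ms ms (%c. cl (q c + b)) = ms" for b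
 proof (rule measure_eqI)
  have Tm[measurable]: "(%c. cl (q c + b)) \<in> measurable ms ms" for b by measurable
  have qT: "cl (q (cl (q c + a)) + b) = cl (q c + a + b)" if "c \<in> coset_space N J" for a b c
  proof -
  have "q (cl (q (cl (q c + a)) + b)) = q (cl (q c + a + b))" by (simp add: vec_eq_iff qcl)
  then show ?thesis using clq[OF cl_in] by metis
  qed
  fix E assume "E \<in> sets (distr ms ms (%c. cl (q c + b)))"
  then have E: "E \<in> sets ms" by simp
  have Esub: "E \<subseteq> coset_space N J" using sets.sets_into_space[OF E] by (simp add: sp)
  \<comment> \<open>The preimage under translation by b is the image under translation by -b, which
    is left multiplication by an element of N.\<close>
  have "(%c. cl (q c + b)) -` E \<inter> space ms = (%c. Ad g (shift_mat g r i (- b)) <#\<^bsub>SL\<^esub> c) ` E"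
  proof (intro equalityI subsetI)
  fix c assume c: "c \<in> (%c. cl (q c + b)) -` E \<inter> space ms"
  then have "c = cl (q (cl (q c + b)) + (- b))" using qT[of c b "- b"] clq[of c] by (simp add: sp)
  also have "\<dots> = Ad g (shift_mat g r i (- b)) <#\<^bsub>SL\<^esub> (cl (q c + b))" using trans[of "- b"] cl_in by blast
  finally show "c \<in> (%c. Ad g (shift_mat g r i (- b)) <#\<^bsub>SL\<^esub> c) ` E" using c by blast
  next
  fix c assume "c \<in> (%c. Ad g (shift_mat g r i (- b)) <#\<^bsub>SL\<^esub> c) ` E"
  then obtain d where d: "d \<in> E" "c = Ad g (shift_mat g r i (- b)) <#\<^bsub>SL\<^esub> d" by auto
  have dC: "d \<in> coset_space N J" using d Esub by auto
  have c: "c = cl (q d + (- b))" using trans[of "- b"] dC d by simp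
  have "c \<in> coset_space N J" unfolding c by (rule cl_in)
  moreover have "cl (q c + b) = d" unfolding c qT[OF dC] using clq[OF dC] by simp
  ultimately show "c \<in> (%c. cl (q c + b)) -` E \<inter> space ms" using d(1) by (simp add: sp)
  qed
  then show "emeasure (distr ms ms (%c. cl (q c + b))) E = emeasure ms E"
  using E trans[of "- b"] by (subst emeasure_distr) (auto simp: inv0 N_def)
 qed simp
 have finK: "emeasure ms {c \<in> space ms. - q c \<in> cbox 0 1} < \<infinity>"
 proof -
  have "- z \<in> cbox 0 1 \<longleftrightarrow> z \<in> cbox (- 1) 0" for z :: "'n rvec"
  by (auto simp: mem_box minus_le_iff)
  then show ?thesis using bounded_fin[of "cbox (- 1) 0"] by simp
 qed
 obtain C :: real where C: "0 < C"
  "ms = distr (density lborel (%x. ennreal (C * indicator {x. x $ i \<in> {0..1}} x))) ms cl"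
  by (rule invariant_measure_coordinates[OF sf q_meas cl_meas _ qcl inv finK nz]) (use clq sp in auto)
 have Fm: "(%c. F (q c)) \<in> borel_measurable ms" if "continuous_on UNIV F" for F :: "'n rvec => complex"
  by (rule measurable_compose[OF q_meas borel_measurable_continuous_onI[OF that]])
 show thesis
  by (rule that[OF C(1)]) (use C(2) cl_meas Fm range sp in \<open>simp_all add: cl_def[abs_def] q_def[abs_def] J_def N_def\<close>)
qed

text \<open>At s = cosh (2 t) this is comparable with 1 + |t|. It is at least 1 and
  submultiplicative, so the logarithm of a product can be split between its factors.\<close>

definition Lam :: "real => real" where "Lam s = 1 + ln (1 + s)"

subsection \<open>Logarithmic weights\<close>

lemma Lam_ge_1: "0 \<le> s ==> 1 \<le> Lam s"
 by (simp add: Lam_def)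

lemma Lam_pos: "0 \<le> s ==> 0 < Lam s"
 using Lam_ge_1[of s] by linarith

lemma Lam_mono: "0 \<le> s ==> s \<le> t ==> Lam s \<le> Lam t"
 by (simp add: Lam_def)

lemma Lam_mult:
 assumes "0 \<le> a" "0 \<le> b"
 shows "Lam (a * b) \<le> Lam a * Lam b"
proof -
 have "1 + a * b \<le> (1 + a) * (1 + b)" using assms by (simp add: algebra_simps)
 then have "ln (1 + a * b) \<le> ln ((1 + a) * (1 + b))" using assms by (subst ln_le_cancel_iff) (auto simp: add_pos_nonneg)
 also have "\<dots> = ln (1 + a) + ln (1 + b)" using assms by (intro ln_mult_pos) auto
 finally have "Lam (a * b) \<le> 1 + ln (1 + a) + ln (1 + b)" by (simp add: Lam_def)
 also have "\<dots> \<le> Lam a * Lam b" using assms by (simp add: Lam_def algebra_simps)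
 finally show ?thesis .
qed

lemma Lam_power_bound:
 fixes \<delta> :: real
 assumes \<delta>: "0 < \<delta>"
 shows "\<exists>C\<ge>0. \<forall>u\<ge>0. Lam u ^ m \<le> C * (max 1 u) powr \<delta>"
proof -
 \<comment> \<open>Bounding the logarithm by a power with exponent a costs m a < \<delta> in total;
   the +1 covers m = 0.\<close>
 define a where "a = \<delta> / (real m + 1)"
 have a: "a > 0" using \<delta> by (simp add: a_def)
 define c where "c = 1 + 2 powr a / a"
 have c: "c \<ge> 1" using a by (simp add: c_def)
 have "Lam u ^ m \<le> c ^ m * (max 1 u) powr \<delta>" if u: "u \<ge> 0" for u
 proof -
  let ?M = "max 1 u"
  have M1: "?M powr a \<ge> 1" using a by (simp add: ge_one_powr_ge_zero)
  have "ln (1 + u) \<le> ln (2 * ?M)" using u by (subst ln_le_cancel_iff) auto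
  also have "\<dots> \<le> (2 * ?M) powr a / a" by (rule ln_powr_bound) (use a in auto)
  also have "\<dots> = 2 powr a / a * ?M powr a" by (simp add: powr_mult)
  finally have "Lam u \<le> c * ?M powr a" using M1 by (simp add: Lam_def c_def algebra_simps)
  then have "Lam u ^ m \<le> (c * ?M powr a) ^ m" using Lam_ge_1[OF u] by (intro power_mono) auto
  also have "\<dots> = c ^ m * ?M powr (a * real m)" by (simp add: power_mult_distrib powr_power mult.commute)
  also have "\<dots> \<le> c ^ m * ?M powr \<delta>"
  proof (intro mult_left_mono powr_mono)
  show "a * real m \<le> \<delta>" using \<delta> by (simp add: a_def field_simps)
  qed (use c in auto)
  finally show ?thesis .
 qed
 then show ?thesis using c by (intro exI[of _ "c ^ m"]) auto
qed

text \<open>Barely integrable: two logarithms save 1/|x|, as 1 / ((1 + x) (Lam x)^2) has the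
  antiderivative -1 / Lam x.\<close>

definition G0 :: "real => real" where "G0 x = 1 / (max 1 \<bar>x\<bar> * Lam \<bar>x\<bar> ^ 2)"

text \<open>Adds a singularity at 0, integrable for gam < 1; it is needed where a rescaled vector
  may become short.\<close>

definition Gs :: "real => real => real" where
 "Gs gam x = G0 x + indicator {- 1..1} x * \<bar>x\<bar> powr (- gam)"

lemma G0_pos: "0 < G0 x"
 unfolding G0_def by (intro divide_pos_pos mult_pos_pos zero_less_power Lam_pos) auto

lemma Gs_ge: "G0 x \<le> Gs gam x" "0 < Gs gam x"
 using G0_pos[of x] by (auto simp: Gs_def add_pos_nonneg)

lemma G0_meas [measurable]: "G0 \<in> borel_measurable borel"
 unfolding G0_def[abs_def] Lam_def by measurable

lemma Gs_meas [measurable]: "Gs gam \<in> borel_measurable borel"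
 unfolding Gs_def[abs_def] by measurable

lemma nn_integral_even:
 fixes f :: "real => ennreal"
 assumes [measurable]: "f \<in> borel_measurable borel" and even: "\<And>x. f (- x) = f x"
 shows "(\<integral>\<^sup>+ x. f x \<partial>lborel) \<le> 2 * (\<integral>\<^sup>+ x. f x * indicator {0..} x \<partial>lborel)"
proof -
 have "(\<integral>\<^sup>+ x. f x \<partial>lborel) \<le> (\<integral>\<^sup>+ x. f x * indicator {0..} x + f (- x) * indicator {0..} (- x) \<partial>lborel)"
  by (intro nn_integral_mono) (auto simp: indicator_def even)
 also have "\<dots> = (\<integral>\<^sup>+ x. f x * indicator {0..} x \<partial>lborel) + (\<integral>\<^sup>+ x. f (- x) * indicator {0..} (- x) \<partial>lborel)"
  by (rule nn_integral_add) measurable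
 also have "(\<integral>\<^sup>+ x. f (- x) * indicator {0..} (- x) \<partial>lborel) = (\<integral>\<^sup>+ x. f x * indicator {0..} x \<partial>lborel)"
  using nn_integral_real_affine[of "%x. f x * indicator {0..} x" "- 1" 0] by simp
 finally show ?thesis by (simp add: mult_2)
qed

lemma G0_finite: "(\<integral>\<^sup>+ x. ennreal (G0 x) \<partial>lborel) < \<infinity>"
proof -
 define f where "f x = 1 / ((1 + x) * Lam x ^ 2)" for x :: real
 have fm: "f \<in> borel_measurable borel" unfolding f_def[abs_def] Lam_def by measurable
 have lim: "((%x. - 1 / Lam x) \<longlongrightarrow> 0) at_top"
 proof -
  have "filterlim (%x. 1 + x :: real) at_top at_top"
  using filterlim_tendsto_add_at_top[OF tendsto_const filterlim_ident] by blast
  then have "filterlim (%x :: real. ln (1 + x)) at_top at_top"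
  by (rule filterlim_compose[OF ln_at_top])
  then have "filterlim Lam at_top at_top" unfolding Lam_def[abs_def]
  using filterlim_tendsto_add_at_top[OF tendsto_const] by blast
  then show ?thesis by (intro tendsto_divide_0[OF tendsto_const] filterlim_at_top_imp_at_infinity)
 qed
 have int_f: "(\<integral>\<^sup>+ x. ennreal (f x) * indicator {0..} x \<partial>lborel) = ennreal (0 - (- 1 / Lam 0))"
 proof (rule nn_integral_FTC_atLeast[OF fm _ _ lim])
  fix x :: real assume x: "0 \<le> x"
  show "0 \<le> f x" using x Lam_pos[of x] by (simp add: f_def)
  have "DERIV Lam x :> 1 / (1 + x)" unfolding Lam_def[abs_def] using x by (auto intro!: derivative_eq_intros)
  then show "((%x. - 1 / Lam x) has_real_derivative f x) (at x)"
  using Lam_pos[OF x] x by (auto intro!: derivative_eq_intros simp: f_def power2_eq_square)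
 qed
 have "(\<integral>\<^sup>+ x. ennreal (G0 x) * indicator {0..} x \<partial>lborel) \<le> (\<integral>\<^sup>+ x. ennreal 2 * (ennreal (f x) * indicator {0..} x) \<partial>lborel)"
 proof (intro nn_integral_mono)
  fix x :: real
  have "G0 x \<le> 2 * f x" if x: "0 \<le> x"
  proof -
  have "(1 + x) * Lam x ^ 2 \<le> 2 * (max 1 \<bar>x\<bar> * Lam \<bar>x\<bar> ^ 2)"
  using x Lam_pos[OF x] by (simp add: max_def mult_right_mono flip: mult.assoc)
  moreover have "0 < (1 + x) * Lam x ^ 2" using x Lam_pos[OF x] by simp
  moreover have "0 < max 1 \<bar>x\<bar> * Lam \<bar>x\<bar> ^ 2" using Lam_pos[of "\<bar>x\<bar>"] by simp
  ultimately show ?thesis by (simp add: G0_def f_def divide_simps mult_ac)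
  qed
  moreover have "0 \<le> f x" if "0 \<le> x" using that Lam_pos[OF that] by (simp add: f_def)
  ultimately have "0 \<le> x ==> ennreal (G0 x) \<le> ennreal 2 * ennreal (f x)"
  by (subst ennreal_mult[symmetric]) (auto intro!: ennreal_leI)
  then show "ennreal (G0 x) * indicator {0..} x \<le> ennreal 2 * (ennreal (f x) * indicator {0..} x)"
  by (simp add: indicator_def)
 qed
 also have "\<dots> = ennreal 2 * (\<integral>\<^sup>+ x. ennreal (f x) * indicator {0..} x \<partial>lborel)"
  by (rule nn_integral_cmult) (use fm in measurable)
 finally have "(\<integral>\<^sup>+ x. ennreal (G0 x) * indicator {0..} x \<partial>lborel) < \<infinity>"
  unfolding int_f by (rule le_less_trans) (simp add: ennreal_mult_less_top)
 then have "2 * (\<integral>\<^sup>+ x. ennreal (G0 x) * indicator {0..} x \<partial>lborel) < \<infinity>"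
  by (simp add: ennreal_mult_less_top)
 moreover have "(\<integral>\<^sup>+ x. ennreal (G0 x) \<partial>lborel) \<le> 2 * (\<integral>\<^sup>+ x. ennreal (G0 x) * indicator {0..} x \<partial>lborel)"
  by (rule nn_integral_even) (measurable, simp add: G0_def)
 ultimately show ?thesis by (rule le_less_trans[rotated])
qed

lemma Gs_finite:
 assumes "gam < 1"
 shows "(\<integral>\<^sup>+ x. ennreal (Gs gam x) \<partial>lborel) < \<infinity>"
proof -
 let ?h = "%x :: real. indicator {- 1..1} x * \<bar>x\<bar> powr (- gam)"
 have "(\<integral>\<^sup>+ x. ennreal (?h x) * indicator {0..} x \<partial>lborel) = (\<integral>\<^sup>+ x. ennreal (if x \<in> {0..1} then x powr (- gam) else 0) \<partial>lborel)"
  by (intro nn_integral_cong) (auto simp: indicator_def)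
 also have "\<dots> = ennreal (1 powr (- gam + 1) / (- gam + 1))"
 proof (rule nn_integral_has_integral_lborel)
  have "((%x. x powr (- gam)) has_integral 1 powr (- gam + 1) / (- gam + 1)) {0..1}"
  by (rule has_integral_powr_from_0) (use assms in auto)
  then show "((%x. if x \<in> {0..1} then x powr (- gam) else 0) has_integral 1 powr (- gam + 1) / (- gam + 1)) UNIV"
  by (simp only: has_integral_restrict_UNIV)
 qed auto
 finally have "(\<integral>\<^sup>+ x. ennreal (?h x) * indicator {0..} x \<partial>lborel) < \<infinity>" by simp
 then have "2 * (\<integral>\<^sup>+ x. ennreal (?h x) * indicator {0..} x \<partial>lborel) < \<infinity>"
  by (simp add: ennreal_mult_less_top)
 moreover have "(\<integral>\<^sup>+ x. ennreal (?h x) \<partial>lborel) \<le> 2 * (\<integral>\<^sup>+ x. ennreal (?h x) * indicator {0..} x \<partial>lborel)"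
  by (rule nn_integral_even) (measurable, auto simp: indicator_def)
 ultimately have h: "(\<integral>\<^sup>+ x. ennreal (?h x) \<partial>lborel) < \<infinity>" by (rule le_less_trans[rotated])
 have "(\<integral>\<^sup>+ x. ennreal (Gs gam x) \<partial>lborel) = (\<integral>\<^sup>+ x. ennreal (G0 x) + ennreal (?h x) \<partial>lborel)"
  unfolding Gs_def using G0_pos by (intro nn_integral_cong ennreal_plus) (auto simp: less_imp_le)
 also have "\<dots> = (\<integral>\<^sup>+ x. ennreal (G0 x) \<partial>lborel) + (\<integral>\<^sup>+ x. ennreal (?h x) \<partial>lborel)"
  by (rule nn_integral_add) measurable
 finally show ?thesis using h G0_finite by simp
qed

subsection \<open>Product bounds\<close>

lemma nn_integral_coordinate_product:
 fixes g :: "'n::finite => real => real"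
 assumes m: "\<And>k. g k \<in> borel_measurable borel" and nn: "\<And>k x. 0 \<le> g k x" and fin: "\<And>k. (\<integral>\<^sup>+ x. ennreal (g k x) \<partial>lborel) < \<infinity>"
 shows "(\<integral>\<^sup>+ x. ennreal (\<Prod>k\<in>UNIV. g k (x $ k)) \<partial>(lborel :: 'n rvec measure)) < \<infinity>"
proof -
 have B: "Basis = range (%k :: 'n. axis k (1 :: real))" by (auto simp: Basis_vec_def)
 have inj: "inj (%k :: 'n. axis k (1 :: real))" by (auto simp: inj_def axis_eq_axis)
 have "(\<integral>\<^sup>+ x. ennreal (\<Prod>k\<in>UNIV. g k (x $ k)) \<partial>(lborel :: 'n rvec measure)) =
  (\<integral>\<^sup>+ x. (\<Prod>b\<in>Basis. ennreal (g (axis_index b) (x \<bullet> b))) \<partial>(lborel :: 'n rvec measure))"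
  by (intro nn_integral_cong) (simp add: B prod.reindex[OF inj] inner_axis prod_ennreal nn axis_index_axis)
 also have "\<dots> = (\<Prod>b\<in>(Basis :: 'n rvec set). \<integral>\<^sup>+ x. ennreal (g (axis_index b) x) \<partial>lborel)"
  by (rule nn_integral_lborel_prod) (use m in auto)
 also have "\<dots> < \<infinity>"
 proof -
  have "(\<Prod>b\<in>F. \<integral>\<^sup>+ x. ennreal (g (axis_index b) x) \<partial>lborel) < \<infinity>" if "finite F" for F :: "'n rvec set"
  using that by induction (use fin in \<open>auto simp: ennreal_mult_less_top\<close>)
  then show ?thesis by simp
 qed
 finally show ?thesis .
qed

lemma nn_integral_scale:
 fixes s t :: "'n::finite => real" and f :: "'n rvec => ennreal"
 assumes s: "\<And>k. s k ~= 0" and f[measurable]: "f \<in> borel_measurable borel"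
 shows "(\<integral>\<^sup>+ x. f x \<partial>lborel) = ennreal (\<Prod>k\<in>UNIV. \<bar>s k\<bar>) * (\<integral>\<^sup>+ x. f (\<chi> k. t k + s k * x $ k) \<partial>lborel)"
  and "g \<in> borel_measurable borel ==>
  (LINT x|lborel. g x) = (\<Prod>k\<in>UNIV. \<bar>s k\<bar>) *\<^sub>R (LINT x|lborel. (g :: 'n rvec => complex) (\<chi> k. t k + s k * x $ k))"
proof -
 have B: "Basis = range (%k :: 'n. axis k (1 :: real))" by (auto simp: Basis_vec_def)
 have inj: "inj (%k :: 'n. axis k (1 :: real))" by (auto simp: inj_def axis_eq_axis)
 define T where "T x = (\<chi> k. t k) + (\<Sum>j\<in>Basis. (s (axis_index j) * (x \<bullet> j)) *\<^sub>R j)" for x :: "'n rvec"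
 have T: "T x = (\<chi> k. t k + s k * x $ k)" for x
 proof -
  have "(\<Sum>j\<in>Basis. (s (axis_index j) * (x \<bullet> j)) *\<^sub>R j) = (\<Sum>k\<in>UNIV. (s k * x $ k) *\<^sub>R axis k 1)"
  by (simp add: B sum.reindex[OF inj] inner_axis axis_index_axis)
  also have "\<dots> = (\<chi> k. s k * x $ k)"
  by (simp add: vec_eq_iff axis_def if_distrib cong: if_cong)
  finally show ?thesis by (simp add: T_def vec_eq_iff)
 qed
 have lb: "lborel = density (distr lborel borel T) (%_. ennreal (\<Prod>j\<in>(Basis :: 'n rvec set). \<bar>s (axis_index j)\<bar>))"
  using lborel_affine_euclidean[of "%j :: 'n rvec. s (axis_index j)" "\<chi> k. t k"] s by (simp add: T_def[abs_def])
 have P: "(\<Prod>j\<in>(Basis :: 'n rvec set). \<bar>s (axis_index j)\<bar>) = (\<Prod>k\<in>UNIV. \<bar>s k\<bar>)"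
  by (simp add: B prod.reindex[OF inj] axis_index_axis)
 have Tm[measurable]: "T \<in> borel_measurable borel" unfolding T_def[abs_def] by measurable
 show "(\<integral>\<^sup>+ x. f x \<partial>lborel) = ennreal (\<Prod>k\<in>UNIV. \<bar>s k\<bar>) * (\<integral>\<^sup>+ x. f (\<chi> k. t k + s k * x $ k) \<partial>lborel)"
  by (subst lb) (simp add: P nn_integral_density nn_integral_distr nn_integral_cmult T)
 assume g[measurable]: "g \<in> borel_measurable borel"
 have "(LINT x|lborel. g x) = (LINT x|density (distr lborel borel T) (%_. ennreal (\<Prod>k\<in>UNIV. \<bar>s k\<bar>)). g x)"
  by (subst lb) (simp add: P)
 also have "\<dots> = (LINT x|distr lborel borel T. (\<Prod>k\<in>UNIV. \<bar>s k\<bar>) *\<^sub>R g x)"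
  by (rule integral_density) (auto intro!: prod_nonneg)
 also have "\<dots> = (LINT x|lborel. (\<Prod>k\<in>UNIV. \<bar>s k\<bar>) *\<^sub>R g (T x))" by (rule integral_distr) measurable
 also have "\<dots> = (\<Prod>k\<in>UNIV. \<bar>s k\<bar>) *\<^sub>R (LINT x|lborel. g (T x))" by (rule integral_scaleR_right) 
 finally show "(LINT x|lborel. g x) = (\<Prod>k\<in>UNIV. \<bar>s k\<bar>) *\<^sub>R (LINT x|lborel. g (\<chi> k. t k + s k * x $ k))" by (simp only: T)
qed

lemma AE_coordinate_neq: "AE x in (lborel :: 'n::finite rvec measure). x $ k ~= c"
proof -
 have "negligible {x :: 'n rvec. axis k 1 \<bullet> x = c}"
  by (rule negligible_hyperplane) (simp add: axis_eq_0_iff)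
 then have "{x :: 'n rvec. x $ k = c} \<in> null_sets lebesgue" by (simp add: negligible_iff_null_sets inner_axis' )
 moreover have "{x :: 'n rvec. x $ k = c} \<in> sets lborel" by measurable
 ultimately have "{x :: 'n rvec. x $ k = c} \<in> null_sets lborel" by (simp add: null_sets_completion_iff)
 then show ?thesis by (rule AE_not_in[THEN AE_mp]) auto
qed

abbreviation wt :: "real => real => nat => real => real" where
 "wt kappa c m r \<equiv> r powr (- kappa) / Lam (c * r) ^ m"

text \<open>A and B stand for the norms of the two vectors, x for their own coordinates, z for the
  shared one; T carries the decay kept for the final estimate.\<close>

abbreviation nondegenerate :: "'n::finite set => 'n set => real => real => real => real => nat => nat => real => bool" where
 "nondegenerate I K kappa c0 lo K1 N m D \<equiv> \<forall>A B T z (x :: 'n => real). lo \<le> A --> lo \<le> B --> (\<forall>k\<in>I. \<bar>x k\<bar> \<le> A) --> (\<forall>k\<in>K. \<bar>x k\<bar> \<le> B) -->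
  \<bar>z\<bar> \<le> A --> (kappa = real (card K) \<or> max 1 \<bar>z\<bar> \<le> K1 * B) --> 0 \<le> T --> T \<le> A -->
  (A * B) powr (- kappa) / Lam (c0 * (A * B)) ^ m \<le> D / Lam T ^ N * (G0 z * ((\<Prod>k\<in>I. G0 (x k)) * (\<Prod>k\<in>K. G0 (x k))))"

text \<open>Give a factor 1/A to each coordinate in I and 1/B to each in K. Exactly one power is
  left, shared between A and B, and pays for z. Two logarithms per coordinate make the factors
  integrable and N further ones yield the decay in T: hence the value of m.\<close>

lemma nondegenerate_bound:
 fixes I K :: "'n::finite set" and kappa c0 a0 K1 :: real and N :: nat
 assumes a0: "0 < a0" "a0 \<le> 1" and c0: "0 < c0" and K1: "1 \<le> K1" 
  and kappa: "real (card I) \<le> kappa" "real (card K) \<le> kappa" "real (card I) + real (card K) + 1 = 2 * kappa"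
 defines "m \<equiv> N + 2 * (card I + card K + 1)"
 shows "\<exists>D\<ge>0. nondegenerate I K kappa c0 a0 K1 N m D"
proof -
 \<comment> \<open>A is the product A B divided by B, and B \<ge> a0. So Lam A, and likewise Lam B,
   is bounded by the logarithm of the product up to the factor Q.\<close>
 define Q where "Q = Lam (1 / (c0 * a0))"
 have Q1: "Q \<ge> 1" using a0 c0 by (simp add: Q_def Lam_ge_1)
 define D where "D = Q ^ m * (K1 / a0) * (1 / a0) ^ (card I + card K)"
 have D0: "D \<ge> 0" using Q1 a0 K1 by (simp add: D_def)
 show ?thesis
 proof (intro exI[of _ D] conjI allI impI D0)
  fix A B T z :: real and x :: "'n => real"
  assume A: "a0 \<le> A" and B: "a0 \<le> B" and xI: "\<forall>k\<in>I. \<bar>x k\<bar> \<le> A" and xK: "\<forall>k\<in>K. \<bar>x k\<bar> \<le> B"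
  and z: "\<bar>z\<bar> \<le> A" and zB: "kappa = real (card K) \<or> max 1 \<bar>z\<bar> \<le> K1 * B" and T: "0 \<le> T" "T \<le> A"
  have A0: "A > 0" and B0: "B > 0" using A B a0 by auto
  define L where "L = Lam (c0 * (A * B))"
  have L1: "L \<ge> 1" using A0 B0 c0 by (simp add: L_def Lam_ge_1)
  define M where "M = L * Q"
  have M1: "M \<ge> 1" using mult_mono[OF L1 Q1] L1 by (simp add: M_def)
  have LA: "Lam A \<le> M"
  proof -
  have "Lam A = Lam (c0 * (A * B) * (1 / (c0 * B)))" using B0 c0 by simp
  also have "\<dots> \<le> L * Lam (1 / (c0 * B))" unfolding L_def using A0 B0 c0 by (intro Lam_mult) auto
  also have "\<dots> \<le> L * Q" unfolding Q_def using A0 B0 c0 a0 B L1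
  by (intro mult_left_mono Lam_mono divide_left_mono) auto
  finally show ?thesis by (simp add: M_def)
  qed
  have LB: "Lam B \<le> M"
  proof -
  have "Lam B = Lam (c0 * (A * B) * (1 / (c0 * A)))" using A0 c0 by simp
  also have "\<dots> \<le> L * Lam (1 / (c0 * A))" unfolding L_def using A0 B0 c0 by (intro Lam_mult) auto
  also have "\<dots> \<le> L * Q" unfolding Q_def using A0 B0 c0 a0 A L1
  by (intro mult_left_mono Lam_mono divide_left_mono) auto
  finally show ?thesis by (simp add: M_def)
  qed
  have factor: "1 / (E * M\<^sup>2) \<le> (1 / a0) * G0 v" if E: "a0 \<le> E" "Lam E \<le> M" "\<bar>v\<bar> \<le> E" for E v
  proof -
  have E0: "E > 0" using E a0 by simp
  have "\<bar>v\<bar> * a0 \<le> \<bar>v\<bar>" using a0 by (intro mult_left_le) auto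
  then have "max 1 \<bar>v\<bar> \<le> E / a0" using E a0 by (simp add: pos_le_divide_eq)
  moreover have "Lam \<bar>v\<bar> \<le> M" using Lam_mono[of "\<bar>v\<bar>" E] E by simp
  ultimately have "max 1 \<bar>v\<bar> * Lam \<bar>v\<bar> ^ 2 \<le> E / a0 * M\<^sup>2"
  using Lam_ge_1[of "\<bar>v\<bar>"] E0 a0 by (intro mult_mono power_mono) auto
  moreover have "0 < max 1 \<bar>v\<bar> * Lam \<bar>v\<bar> ^ 2" using Lam_pos[of "\<bar>v\<bar>"] by simp
  ultimately have "1 / (E / a0 * M\<^sup>2) \<le> G0 v" unfolding G0_def by (intro divide_left_mono) (use E0 a0 M1 in auto)
  then show ?thesis using a0 E0 M1 by (simp add: field_simps)
  qed
  \<comment> \<open>The powers left over from A and B; by the three hypotheses on kappa they are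
    nonnegative and add up to 1.\<close>
  define c1 where "c1 = kappa - real (card I)"
  define c2 where "c2 = kappa - real (card K)"
  have c12: "0 \<le> c1" "0 \<le> c2" "c1 + c2 = 1" using kappa by (auto simp: c1_def c2_def)
  have zfac: "A powr (- c1) * B powr (- c2) / M\<^sup>2 \<le> K1 / a0 * G0 z"
  proof -
  let ?m = "max 1 \<bar>z\<bar>"
  have mA: "a0 * ?m \<le> A" using A z a0 mult_left_le[of a0 "\<bar>z\<bar>"] by (auto simp: max_def mult.commute)
  have "A powr (- c1) * B powr (- c2) \<le> K1 / a0 * (1 / ?m)"
  \<comment> \<open>Without a power of B the bound |z| \<le> A suffices; otherwise z must be
    compared with B as well.\<close>
  proof (cases "c2 = 0")
  case True
  then have "c1 = 1" using c12 by simp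
  then have "A powr (- c1) * B powr (- c2) = 1 / A" using True A0 B0 by (simp add: powr_minus_divide)
  also have "\<dots> \<le> 1 / (a0 * ?m)" using mA a0 A0 by (intro divide_left_mono) auto
  also have "\<dots> \<le> K1 / (a0 * ?m)" using K1 a0 by (intro divide_right_mono) auto
  finally show ?thesis by simp
  next
  case False
  then have mB: "?m \<le> K1 * B" using zB by (auto simp: c2_def)
  have m1: "?m \<ge> 1" by simp
  have "A powr (- c1) \<le> (a0 * ?m) powr (- c1)" using mA a0 c12 by (intro powr_mono2') auto
  moreover have "B powr (- c2) \<le> (?m / K1) powr (- c2)"
  using mB K1 c12 m1 by (intro powr_mono2') (auto simp: field_simps)
  ultimately have "A powr (- c1) * B powr (- c2) \<le> (a0 * ?m) powr (- c1) * (?m / K1) powr (- c2)"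
  by (intro mult_mono) auto
  also have "\<dots> = a0 powr (- c1) * K1 powr c2 * (?m powr (- c1) * ?m powr (- c2))"
  using a0 K1 m1 by (simp add: powr_mult powr_divide powr_minus_divide field_simps)
  also have "?m powr (- c1) * ?m powr (- c2) = 1 / ?m"
  using c12 m1 by (simp add: powr_add[symmetric] powr_minus_divide)
  also have "a0 powr (- c1) * K1 powr c2 \<le> (1 / a0) * K1"
  proof (intro mult_mono)
  have "a0 powr (- c1) \<le> a0 powr (- 1)" using a0 c12 by (intro powr_mono') auto
  then show "a0 powr (- c1) \<le> 1 / a0" using a0 by (simp add: powr_minus_divide)
  have "K1 powr c2 \<le> K1 powr 1" using K1 c12 by (intro powr_mono) auto
  then show "K1 powr c2 \<le> K1" using K1 by simp
  qed (use a0 in auto)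
  finally show ?thesis using m1 by (simp add: mult_right_mono divide_right_mono)
  qed
  then have "A powr (- c1) * B powr (- c2) / M\<^sup>2 \<le> K1 / a0 * (1 / ?m) / M\<^sup>2" by (rule divide_right_mono) simp
  also have "\<dots> = K1 / a0 * (1 / (?m * M\<^sup>2))" by simp
  also have "\<dots> \<le> K1 / a0 * G0 z"
  proof (rule mult_left_mono)
  have "Lam \<bar>z\<bar> \<le> M" using Lam_mono[of "\<bar>z\<bar>" A] z LA by simp
  then have "Lam \<bar>z\<bar> ^ 2 \<le> M\<^sup>2" using Lam_ge_1[of "\<bar>z\<bar>"] by (intro power_mono) auto
  then have "?m * Lam \<bar>z\<bar> ^ 2 \<le> ?m * M\<^sup>2" by (intro mult_left_mono) auto
  moreover have "0 < ?m * Lam \<bar>z\<bar> ^ 2" using Lam_pos[of "\<bar>z\<bar>"] by simp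
  ultimately show "1 / (?m * M\<^sup>2) \<le> G0 z" unfolding G0_def
  by (intro divide_left_mono) (use M1 in auto)
  show "0 \<le> K1 / a0" using K1 a0 by simp
  qed
  finally show ?thesis .
  qed
  have If: "(1 / (A * M\<^sup>2)) ^ card I \<le> (1 / a0) ^ card I * (\<Prod>k\<in>I. G0 (x k))"
  proof -
  have "(\<Prod>k\<in>I. 1 / (A * M\<^sup>2)) \<le> (\<Prod>k\<in>I. (1 / a0) * G0 (x k))"
  using factor[OF A LA] xI A0 by (intro prod_mono) auto
  then show ?thesis by (simp only: prod.distrib prod_constant)
  qed
  have Kf: "(1 / (B * M\<^sup>2)) ^ card K \<le> (1 / a0) ^ card K * (\<Prod>k\<in>K. G0 (x k))"
  proof -
  have "(\<Prod>k\<in>K. 1 / (B * M\<^sup>2)) \<le> (\<Prod>k\<in>K. (1 / a0) * G0 (x k))"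
  using factor[OF B LB] xK B0 by (intro prod_mono) auto
  then show ?thesis by (simp only: prod.distrib prod_constant)
  qed
  have Tf: "1 / M ^ N \<le> 1 / Lam T ^ N"
  proof -
  have "Lam T \<le> M" using Lam_mono[OF T] LA by simp
  then have "Lam T ^ N \<le> M ^ N" using Lam_ge_1[OF T(1)] by (intro power_mono) auto
  then show ?thesis using Lam_pos[OF T(1)] M1 by (intro divide_left_mono) auto
  qed
  have GI: "(\<Prod>k\<in>J. G0 (x k)) \<ge> 0" for J using G0_pos by (intro prod_nonneg) (auto simp: less_imp_le)
  have "(A * B) powr (- kappa) / M ^ m =
  (A powr (- c1) * B powr (- c2) / M\<^sup>2) * ((1 / (A * M\<^sup>2)) ^ card I * (1 / (B * M\<^sup>2)) ^ card K) * (1 / M ^ N)"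
  proof -
  have "(A * B) powr (- kappa) = A powr (- kappa) * B powr (- kappa)" using A0 B0 by (simp add: powr_mult)
  also have "A powr (- kappa) = A powr (- c1) / A ^ card I"
  using A0 by (simp add: c1_def powr_diff powr_realpow powr_minus_divide)
  also have "B powr (- kappa) = B powr (- c2) / B ^ card K"
  using B0 by (simp add: c2_def powr_diff powr_realpow powr_minus_divide)
  finally have e: "(A * B) powr (- kappa) = A powr (- c1) / A ^ card I * (B powr (- c2) / B ^ card K)" .
  have "M ^ m = M ^ N * (M\<^sup>2) ^ card I * (M\<^sup>2) ^ card K * M\<^sup>2"
  by (simp add: m_def power_add power_mult[symmetric] algebra_simps) (simp add: power2_eq_square)
  then show ?thesis unfolding e by (simp add: power_divide power_mult_distrib field_simps)
  qed
  also have "\<dots> \<le> (K1 / a0 * G0 z) * (((1 / a0) ^ card I * (\<Prod>k\<in>I. G0 (x k))) * ((1 / a0) ^ card K * (\<Prod>k\<in>K. G0 (x k)))) * (1 / Lam T ^ N)"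
  using zfac If Kf Tf A0 B0 M1 a0 K1 G0_pos[of z] GI
  by (intro mult_mono) (auto intro!: mult_nonneg_nonneg simp: less_imp_le)
  finally have fin: "(A * B) powr (- kappa) / M ^ m \<le> (K1 / a0 * G0 z) * (((1 / a0) ^ card I * (\<Prod>k\<in>I. G0 (x k))) * ((1 / a0) ^ card K * (\<Prod>k\<in>K. G0 (x k)))) * (1 / Lam T ^ N)" .
  have "(A * B) powr (- kappa) / L ^ m = Q ^ m * ((A * B) powr (- kappa) / M ^ m)"
  using Q1 L1 by (simp add: M_def power_mult_distrib)
  also have "\<dots> \<le> Q ^ m * ((K1 / a0 * G0 z) * (((1 / a0) ^ card I * (\<Prod>k\<in>I. G0 (x k))) * ((1 / a0) ^ card K * (\<Prod>k\<in>K. G0 (x k)))) * (1 / Lam T ^ N))"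
  using fin Q1 by (intro mult_left_mono) auto
  also have "\<dots> = D / Lam T ^ N * (G0 z * ((\<Prod>k\<in>I. G0 (x k)) * (\<Prod>k\<in>K. G0 (x k))))"
  by (simp add: D_def power_add)
  finally show "wt kappa c0 m (A * B) \<le> D / Lam T ^ N * (G0 z * ((\<Prod>k\<in>I. G0 (x k)) * (\<Prod>k\<in>K. G0 (x k))))"
  by (simp add: L_def)
 qed
qed

lemma G0_le_1: "G0 x \<le> 1"
proof -
 have "1 \<le> Lam \<bar>x\<bar> ^ 2" using Lam_ge_1[of "\<bar>x\<bar>"] by simp
 then have "1 * 1 \<le> max 1 \<bar>x\<bar> * Lam \<bar>x\<bar> ^ 2" by (intro mult_mono) auto
 then show ?thesis by (simp add: G0_def)
qed

lemma Lam_ratio: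
 assumes "0 \<le> s" "0 < u" "s \<le> r * u" "0 \<le> r"
 shows "Lam s \<le> Lam r * Lam u"
 using order_trans[OF Lam_mono[OF assms(1,3)] Lam_mult] assms by simp

text \<open>Here B has no lower bound. Replacing it by max 1 B costs R^kappa and logarithms, where R
  = max 1 (1/B). All card K + 1 coordinates v of the second vector satisfy |v| \<le> B, so this cost
  can be spread over them as |v|^(-gam); gam < 1 is possible because kappa < card K + 1.\<close>

lemma singular_bound:
 fixes I K :: "'n::finite set" and kappa c0 :: real and N :: nat
 assumes c0: "0 < c0" and kappa: "real (card I) \<le> kappa" "real (card K) \<le> kappa" "real (card I) + real (card K) + 1 = 2 * kappa"
  and K1: "kappa < real (card K) + 1"
 defines "m \<equiv> N + 2 * (card I + card K + 1)"
 shows "\<exists>D\<ge>0. \<exists>gam<1. \<forall>A B \<epsilon> w (x :: 'n => real). 1/2 \<le> A --> (\<forall>k\<in>I. \<bar>x k\<bar> \<le> A) --> (\<forall>k\<in>K. \<bar>x k\<bar> \<le> B \<and> x k ~= 0) -->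
  \<bar>w\<bar> \<le> A --> \<bar>2 - w\<bar> \<le> B --> w ~= 2 --> 0 < \<epsilon> --> \<epsilon> \<le> 1 -->
  (A * B) powr (- kappa) / Lam (c0 * (A * B) / \<epsilon>) ^ m \<le> D / Lam (1 / \<epsilon>) ^ N * ((G0 w + Gs gam (w - 2)) * ((\<Prod>k\<in>I. G0 (x k)) * (\<Prod>k\<in>K. Gs gam (x k))))"
proof -
 define m0 where "m0 = 0 + 2 * (card I + card K + 1)"
 have h: "(0 :: real) < 1 / 2" "(1 / 2 :: real) \<le> 1" "(1 :: real) \<le> 3" by auto
 obtain D0 where D0: "D0 \<ge> 0" and nd: "nondegenerate I K kappa c0 (1/2) 3 0 m0 D0"
  using nondegenerate_bound[of "1/2" c0 3 I kappa K 0, OF h(1,2) c0 h(3) kappa, folded m0_def] by blast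
 \<comment> \<open>Half of the available margin pays for the logarithms; the other half keeps gam
   below 1.\<close>
 define \<delta> where "\<delta> = (real (card K) + 1 - kappa) / 2"
 have \<delta>: "\<delta> > 0" using K1 by (simp add: \<delta>_def)
 define gam where "gam = (kappa + \<delta>) / (real (card K) + 1)"
 have gam: "gam < 1" "0 \<le> gam" using K1 kappa by (auto simp: gam_def \<delta>_def field_simps)
 have gams: "gam * (real (card K) + 1) = kappa + \<delta>" by (simp add: gam_def)
 obtain C where C: "C \<ge> 0" "\<And>u. u \<ge> 0 ==> Lam u ^ m \<le> C * (max 1 u) powr \<delta>"
  using Lam_power_bound[OF \<delta>, of m] by auto
 define q where "q = Lam (2 / c0) ^ N"
 have q: "q \<ge> 0" using c0 Lam_pos[of "2 / c0"] by (simp add: q_def)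
 define D where "D = D0 * q * (1 + C)"
 have m: "m = N + m0" by (simp add: m_def m0_def)
 have Gp: "(\<Prod>k\<in>J. G0 (x k)) \<ge> 0" for J :: "'n set" and x :: "'n => real" using G0_pos by (intro prod_nonneg) (auto simp: less_imp_le)
 have "(A * B) powr (- kappa) / Lam (c0 * (A * B) / \<epsilon>) ^ m \<le> D / Lam (1 / \<epsilon>) ^ N * ((G0 w + Gs gam (w - 2)) * ((\<Prod>k\<in>I. G0 (x k)) * (\<Prod>k\<in>K. Gs gam (x k))))"
  if A: "1/2 \<le> A" and xI: "\<forall>k\<in>I. \<bar>x k\<bar> \<le> A" and xK: "\<forall>k\<in>K. \<bar>x k\<bar> \<le> B \<and> x k ~= 0"
  and w: "\<bar>w\<bar> \<le> A" "\<bar>2 - w\<bar> \<le> B" "w ~= 2" and \<epsilon>: "0 < \<epsilon>" "\<epsilon> \<le> 1" for A B \<epsilon> w :: real and x :: "'n => real"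
 proof -
  have A0: "A > 0" and B0: "B > 0" using A w by auto
  define L where "L = Lam (c0 * (A * B) / \<epsilon>)"
  define B' where "B' = max 1 B"
  define R where "R = max 1 (1 / B)"
  have R1: "R \<ge> 1" by (simp add: R_def)
  have BR: "B' = B * R" using B0 by (auto simp: B'_def R_def max_def field_simps)
  have L1: "L \<ge> 1" using A0 B0 c0 \<epsilon> by (simp add: L_def Lam_ge_1)
  have LR1: "Lam R \<ge> 1" using R1 by (intro Lam_ge_1) auto
  have l1: "Lam (c0 * (A * B')) \<le> L * Lam R" unfolding L_def
  proof (rule Lam_ratio)
  have "c0 * (A * B') * \<epsilon> \<le> c0 * (A * B')" using A0 c0 \<epsilon> by (intro mult_left_le) (auto simp: B'_def)
  then show "c0 * (A * B') \<le> c0 * (A * B) / \<epsilon> * R" using \<epsilon> by (simp add: BR field_simps)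
  qed (use A0 B0 c0 \<epsilon> R1 in \<open>auto simp: B'_def\<close>)
  \<comment> \<open>2 A (max 1 B) is at least 1, so the argument c0 A B / \<epsilon> controls 1 /
    \<epsilon> up to the factor 2 R / c0. This is the source of the decay in \<epsilon>.\<close>
  have l2: "Lam (1 / \<epsilon>) \<le> L * (Lam (2 / c0) * Lam R)"
  proof -
  have "1 * 1 \<le> (2 * A) * B'" using A by (intro mult_mono) (auto simp: B'_def)
  then have "1 / \<epsilon> \<le> c0 * (A * B) / \<epsilon> * (2 / c0 * R)" using c0 \<epsilon> by (simp add: BR field_simps)
  then have "Lam (1 / \<epsilon>) \<le> L * Lam (2 / c0 * R)" unfolding L_def
  by (intro Lam_ratio) (use A0 B0 c0 \<epsilon> R1 in auto)
  also have "\<dots> \<le> L * (Lam (2 / c0) * Lam R)" using L1 c0 R1 by (intro mult_left_mono Lam_mult) auto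
  finally show ?thesis .
  qed
  let ?P = "(\<Prod>k\<in>I. G0 (x k))" and ?Q = "(\<Prod>k\<in>K. G0 (x k))" and ?S = "(\<Prod>k\<in>K. Gs gam (x k))"
  have n1: "wt kappa c0 m0 (A * B') \<le> D0 * (G0 w * (?P * ?Q))"
  proof -
  have "1/2 \<le> B'" "max 1 \<bar>w\<bar> \<le> 3 * B'" using w by (auto simp: B'_def)
  moreover have "\<forall>k\<in>K. \<bar>x k\<bar> \<le> B'" using xK by (auto simp: B'_def)
  ultimately show ?thesis using nd[rule_format, of A B' x w 0] A xI w A0 by simp
  qed
  have lm: "Lam (c0 * (A * B')) ^ m0 * Lam (1 / \<epsilon>) ^ N \<le> L ^ m * (q * Lam R ^ m)"
  proof -
  have "Lam (c0 * (A * B')) ^ m0 * Lam (1 / \<epsilon>) ^ N \<le> (L * Lam R) ^ m0 * (L * (Lam (2 / c0) * Lam R)) ^ N"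
  using l1 l2 A0 c0 \<epsilon> L1 LR1 by (intro mult_mono power_mono zero_le_power) (auto simp: B'_def intro!: Lam_pos[THEN less_imp_le])
  then show ?thesis by (simp add: m q_def power_add power_mult_distrib mult_ac)
  qed
  have "(A * B) powr (- kappa) / L ^ m = R powr kappa * (A * B') powr (- kappa) / L ^ m"
  proof -
  have "(A * B') powr (- kappa) = (A * B) powr (- kappa) * R powr (- kappa)" using A0 B0 R1 by (simp add: BR powr_mult)
  then show ?thesis using R1 by (simp add: powr_minus)
  qed
  also have "\<dots> \<le> R powr kappa * (A * B') powr (- kappa) * (q * Lam R ^ m / (Lam (c0 * (A * B')) ^ m0 * Lam (1 / \<epsilon>) ^ N))"
  proof -
  have "0 < Lam (c0 * (A * B')) ^ m0 * Lam (1 / \<epsilon>) ^ N"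
  using A0 c0 \<epsilon> by (intro mult_pos_pos zero_less_power Lam_pos) (auto simp: B'_def)
  then have "1 / L ^ m \<le> q * Lam R ^ m / (Lam (c0 * (A * B')) ^ m0 * Lam (1 / \<epsilon>) ^ N)"
  using lm L1 by (simp add: divide_simps mult_ac)
  from mult_left_mono[OF this, of "R powr kappa * (A * B') powr (- kappa)"] show ?thesis by (simp add: mult_ac)
  qed
  also have "\<dots> = (R powr kappa * Lam R ^ m) * (q / Lam (1 / \<epsilon>) ^ N) * (wt kappa c0 m0 (A * B'))"
  by (simp add: mult_ac)
  also have "\<dots> \<le> (R powr kappa * Lam R ^ m) * (q / Lam (1 / \<epsilon>) ^ N) * (D0 * (G0 w * (?P * ?Q)))"
  using n1 q R1 LR1 \<epsilon> by (intro mult_left_mono mult_nonneg_nonneg divide_nonneg_nonneg zero_le_power) (auto intro!: Lam_pos[THEN less_imp_le])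
  finally have main: "(A * B) powr (- kappa) / L ^ m \<le> (R powr kappa * Lam R ^ m) * (q / Lam (1 / \<epsilon>) ^ N) * (D0 * (G0 w * (?P * ?Q)))" .
  have QS: "?Q \<le> ?S" using Gs_ge G0_pos by (intro prod_mono) (auto simp: less_imp_le)
  have key: "(R powr kappa * Lam R ^ m) * (G0 w * ?Q) \<le> (1 + C) * ((G0 w + Gs gam (w - 2)) * ?S)"
  proof (cases "B \<ge> 1")
  case True
  then have R: "R = 1" by (auto simp: R_def)
  have "Lam 1 ^ m \<le> C" using C(2)[of 1] by simp
  moreover have "G0 w * ?Q \<le> (G0 w + Gs gam (w - 2)) * ?S"
  using QS G0_pos[of w] Gs_ge(2)[of gam "w - 2"] Gp[of x K] by (intro mult_mono) auto
  moreover have "0 \<le> G0 w * ?Q" using G0_pos[of w] Gp[of x K] by simp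
  ultimately show ?thesis unfolding R using C(1) by (auto intro!: mult_mono)
  next
  case False
  then have R: "R = 1 / B" using B0 by (auto simp: R_def field_simps)
  have "R powr kappa * Lam R ^ m \<le> R powr kappa * (C * R powr \<delta>)"
  using C(2)[of R] R1 by (intro mult_left_mono) (auto simp: max_def)
  also have "\<dots> = C * R powr (gam * (real (card K) + 1))" by (simp add: gams powr_add)
  also have "R powr (gam * (real (card K) + 1)) = R powr gam * (\<Prod>k\<in>K. R powr gam)"
  using R1 by (simp add: powr_add distrib_left powr_powr[symmetric] powr_realpow)
  also have "C * \<dots> \<le> C * (Gs gam (w - 2) * ?S)"
  proof (intro mult_left_mono mult_mono prod_mono conjI C(1))
  have st: "R powr gam \<le> Gs gam v" if "v ~= 0" "\<bar>v\<bar> \<le> B" for v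
  proof -
  have "R powr gam \<le> (1 / \<bar>v\<bar>) powr gam" unfolding R using that gam B0 by (intro powr_mono2 divide_left_mono) auto
  also have "\<dots> = \<bar>v\<bar> powr (- gam)" using that by (simp add: powr_minus_divide powr_divide)
  also have "\<dots> \<le> Gs gam v"
  proof -
  have "v \<in> {- 1..1}" using that False by auto
  then show ?thesis using G0_pos[of v] by (simp add: Gs_def)
  qed
  finally show ?thesis .
  qed
  show "R powr gam \<le> Gs gam (w - 2)" using w by (intro st) auto
  show "R powr gam \<le> Gs gam (x k)" if "k \<in> K" for k using that xK by (intro st) auto
  qed (auto intro!: prod_nonneg Gs_ge(2)[THEN less_imp_le])
  finally have a: "R powr kappa * Lam R ^ m \<le> C * (Gs gam (w - 2) * ?S)" .
  have "?Q \<le> 1" using G0_le_1 G0_pos by (intro prod_le_1) (auto simp: less_imp_le)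
  then have "G0 w * ?Q \<le> 1 * 1" using G0_le_1[of w] Gp[of x K] by (intro mult_mono) auto
  then have "(R powr kappa * Lam R ^ m) * (G0 w * ?Q) \<le> C * (Gs gam (w - 2) * ?S)"
  using a R1 LR1 by (intro order_trans[OF mult_left_le a]) auto
  also have "\<dots> \<le> (1 + C) * ((G0 w + Gs gam (w - 2)) * ?S)"
  using C(1) G0_pos[of w] Gs_ge(2)[of gam "w - 2"] by (intro mult_mono mult_nonneg_nonneg) (auto intro!: prod_nonneg Gs_ge(2)[THEN less_imp_le])
  finally show ?thesis .
  qed
  have "(R powr kappa * Lam R ^ m) * (q / Lam (1 / \<epsilon>) ^ N) * (D0 * (G0 w * (?P * ?Q))) =
  (q / Lam (1 / \<epsilon>) ^ N * D0 * ?P) * ((R powr kappa * Lam R ^ m) * (G0 w * ?Q))" by (simp add: mult_ac)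
  also have "\<dots> \<le> (q / Lam (1 / \<epsilon>) ^ N * D0 * ?P) * ((1 + C) * ((G0 w + Gs gam (w - 2)) * ?S))"
  using key q D0 Gp[of x I] \<epsilon> by (intro mult_left_mono mult_nonneg_nonneg divide_nonneg_nonneg zero_le_power) (auto intro!: Lam_pos[THEN less_imp_le])
  also have "\<dots> = D / Lam (1 / \<epsilon>) ^ N * ((G0 w + Gs gam (w - 2)) * (?P * ?S))" by (simp add: D_def mult_ac)
  finally show ?thesis using main unfolding L_def by linarith
 qed
 moreover have "D \<ge> 0" using D0 q C(1) by (simp add: D_def)
 ultimately show ?thesis using gam(1) by (intro exI[of _ D] conjI exI[of _ gam]) auto
qed


section \<open>Integrals over a horosphere at scale tau\<close>

definition splitting :: "'n => 'n => 'n set => 'n set => bool" where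
 "splitting c e I K \<longleftrightarrow> UNIV = insert c (insert e (I \<union> K)) \<and> c ~= e \<and> c \<notin> I \<union> K \<and> e \<notin> I \<union> K \<and> I \<inter> K = {}"

lemma splitting_swap: "splitting c e I K ==> splitting c e K I"
 by (auto simp: splitting_def)

lemma splitting_prod:
 fixes c :: "'n::finite"
 assumes "splitting c e I K"
 shows "(\<Prod>k\<in>UNIV. g k) = g c * (g e * ((\<Prod>k\<in>I. g k) * (\<Prod>k\<in>K. g k)))"
proof -
 have *: "UNIV = insert c (insert e (I \<union> K))" "c \<notin> insert e (I \<union> K)" "e \<notin> I \<union> K" "I \<inter> K = {}"
  using assms by (auto simp: splitting_def)
 have "(\<Prod>k\<in>UNIV. g k) = (\<Prod>k\<in>insert c (insert e (I \<union> K)). g k)" by (rule arg_cong[OF *(1)])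
 also have "\<dots> = g c * (g e * ((\<Prod>k\<in>I. g k) * (\<Prod>k\<in>K. g k)))" using *(2-) by (simp add: prod.union_disjoint)
 finally show ?thesis .
qed

text \<open>Entrywise lower bounds for the norms A and B of the rescaled vectors. In the application
  c is j: entries i and j of the first vector have size tau and |x_c| / tau, entries j and i of the
  second tau / 2 and |2 - x_c| / (2 tau).\<close>

definition strip :: "'n => 'n set => 'n set => real => real => real => 'n::finite rvec => bool" where
 "strip c I K tau A B x \<longleftrightarrow> tau \<le> A \<and> \<bar>x $ c\<bar> / tau \<le> A \<and> (\<forall>k\<in>I. \<bar>x $ k\<bar> \<le> A) \<and>
  tau / 2 \<le> B \<and> \<bar>2 - x $ c\<bar> / (2 * tau) \<le> B \<and> (\<forall>k\<in>K. \<bar>x $ k\<bar> \<le> B)"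

definition refl_at :: "'n => 'n::finite rvec => 'n rvec" where
 "refl_at c x = (\<chi> k. (if k = c then 2 else 0) + (if k = c then - 1 else 1) * x $ k)"

text \<open>Replacing x_c by 2 - x_c exchanges the roles of the two vectors up to a factor
  2.\<close>

lemma strip_refl:
 assumes "strip c I K tau A B (refl_at c x)" "c \<notin> I \<union> K" "0 < tau"
 shows "strip c K I tau (2 * B) A x"
proof -
 have *: "tau \<le> A" "\<bar>2 - x $ c\<bar> / tau \<le> A" "\<forall>k\<in>I. \<bar>x $ k\<bar> \<le> A" "tau / 2 \<le> B" "\<bar>x $ c\<bar> / (2 * tau) \<le> B" "\<forall>k\<in>K. \<bar>x $ k\<bar> \<le> B"
  using assms(1,2) by (auto simp: strip_def refl_at_def split: if_splits)
 have "\<bar>2 - x $ c\<bar> / (2 * tau) \<le> \<bar>2 - x $ c\<bar> / tau" using assms(3) by (intro divide_left_mono) auto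
 then have "\<bar>2 - x $ c\<bar> / (2 * tau) \<le> A" using *(2) by linarith
 moreover have "\<bar>x $ k\<bar> \<le> 2 * B" if "k \<in> K" for k using *(6) that by (smt (verit))
 moreover have "\<bar>x $ c\<bar> / tau \<le> 2 * B" using *(5) assms(3) by (simp add: field_simps)
 ultimately show ?thesis using * assms(3) unfolding strip_def by auto
qed

lemma nn_integral_product_scaled:
 fixes g :: "'n::finite => real => real"
 assumes m: "\<And>k. g k \<in> borel_measurable borel" and nn: "\<And>k x. 0 \<le> g k x" and fin: "\<And>k. (\<integral>\<^sup>+ x. ennreal (g k x) \<partial>lborel) < \<infinity>"
 shows "\<exists>D\<ge>0. \<forall>s :: 'n => real. (\<forall>k. 0 < s k) -->
  (\<integral>\<^sup>+ x. ennreal (\<Prod>k\<in>UNIV. g k (s k * x $ k)) \<partial>(lborel :: 'n rvec measure)) \<le> ennreal (D / (\<Prod>k\<in>UNIV. s k))"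
proof -
 let ?f = "%x :: 'n rvec. ennreal (\<Prod>k\<in>UNIV. g k (x $ k))"
 have [measurable]: "g k \<in> borel_measurable borel" for k by (rule m)
 have fm: "?f \<in> borel_measurable borel" by measurable
 define D where "D = enn2real (integral\<^sup>N lborel ?f)"
 have D: "integral\<^sup>N lborel ?f = ennreal D"
  using nn_integral_coordinate_product[of g, OF m nn fin] by (simp add: D_def)
 have "(\<integral>\<^sup>+ x. ennreal (\<Prod>k\<in>UNIV. g k (s k * x $ k)) \<partial>(lborel :: 'n rvec measure)) \<le> ennreal (D / (\<Prod>k\<in>UNIV. s k))"
  if s: "\<forall>k. 0 < s k" for s :: "'n => real"
 proof -
  let ?J = "\<integral>\<^sup>+ x. ennreal (\<Prod>k\<in>UNIV. g k (s k * x $ k)) \<partial>(lborel :: 'n rvec measure)"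
  have p: "0 < (\<Prod>k\<in>UNIV. s k)" using s by (simp add: prod_pos)
  have "s k ~= 0" for k using s by (metis less_irrefl)
  from nn_integral_scale(1)[of s ?f "%_. 0", OF this fm]
  have "ennreal D = ennreal (\<Prod>k\<in>UNIV. s k) * ?J" using s by (simp add: D abs_of_pos)
  then have "ennreal (1 / (\<Prod>k\<in>UNIV. s k)) * ennreal D = (ennreal (1 / (\<Prod>k\<in>UNIV. s k)) * ennreal (\<Prod>k\<in>UNIV. s k)) * ?J"
  by (simp add: mult.assoc)
  also have "ennreal (1 / (\<Prod>k\<in>UNIV. s k)) * ennreal (\<Prod>k\<in>UNIV. s k) = 1"
  proof -
  have "1 / q * q = 1" if "0 < q" for q :: real using that by simp
  note this[OF p]
  then show ?thesis using p by (subst ennreal_mult'[symmetric]) (auto simp del: prod_zero_iff)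
  qed
  finally show ?thesis using p by (simp add: ennreal_mult'[symmetric] D_def)
 qed
 then show ?thesis by (intro exI[of _ D]) (auto simp: D_def)
qed

lemma nn_integral_le_product:
 fixes g :: "'n::finite => real => real"
 assumes m: "\<And>k. g k \<in> borel_measurable borel" and nn: "\<And>k x. 0 \<le> g k x" and fin: "\<And>k. (\<integral>\<^sup>+ x. ennreal (g k x) \<partial>lborel) < \<infinity>"
 shows "\<exists>D\<ge>0. \<forall>(s :: 'n => real) E f. (\<forall>k. 0 < s k) --> 0 \<le> E -->
  (AE x in lborel. f x \<le> E * (\<Prod>k\<in>UNIV. g k (s k * x $ k))) -->
  (\<integral>\<^sup>+ x. ennreal (f x) \<partial>(lborel :: 'n rvec measure)) \<le> ennreal (E * D / (\<Prod>k\<in>UNIV. s k))"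
proof -
 obtain D where D: "D \<ge> 0" and J: "\<And>s :: 'n => real. (\<forall>k. 0 < s k) ==>
  (\<integral>\<^sup>+ x. ennreal (\<Prod>k\<in>UNIV. g k (s k * x $ k)) \<partial>(lborel :: 'n rvec measure)) \<le> ennreal (D / (\<Prod>k\<in>UNIV. s k))"
  using nn_integral_product_scaled[of g, OF m nn fin] by auto
 have [measurable]: "g k \<in> borel_measurable borel" for k by (rule m)
 have "(\<integral>\<^sup>+ x. ennreal (f x) \<partial>(lborel :: 'n rvec measure)) \<le> ennreal (E * D / (\<Prod>k\<in>UNIV. s k))"
  if s: "\<forall>k. 0 < s k" and E: "0 \<le> E" and f: "AE x in lborel. f x \<le> E * (\<Prod>k\<in>UNIV. g k (s k * x $ k))" for s :: "'n => real" and E f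
 proof -
  have "(\<integral>\<^sup>+ x. ennreal (f x) \<partial>(lborel :: 'n rvec measure)) \<le> (\<integral>\<^sup>+ x. ennreal E * ennreal (\<Prod>k\<in>UNIV. g k (s k * x $ k)) \<partial>lborel)"
  using f by (intro nn_integral_mono_AE) (auto simp: ennreal_mult'[OF E, symmetric] intro: ennreal_leI)
  also have "\<dots> = ennreal E * (\<integral>\<^sup>+ x. ennreal (\<Prod>k\<in>UNIV. g k (s k * x $ k)) \<partial>lborel)" by (rule nn_integral_cmult) measurable
  also have "\<dots> \<le> ennreal E * ennreal (D / (\<Prod>k\<in>UNIV. s k))" by (intro mult_left_mono J s) auto
  also have "\<dots> = ennreal (E * D / (\<Prod>k\<in>UNIV. s k))" using E by (simp add: ennreal_mult'[symmetric])
  finally show ?thesis .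
 qed
 then show ?thesis using D by (intro exI[of _ D]) auto
qed

text \<open>In this and the next two bounds the factor tau is the one that cancels the modulus
  1/tau. Mc is the Schwartz constant, and e the spare coordinate, confined to the unit
  interval.\<close>

abbreviation large_bounded :: "'n::finite => 'n => 'n set => 'n set => real => real => nat => nat => real => real => bool" where
 "large_bounded c e I K kappa c0 N m tau0 D \<equiv> \<forall>tau A B f Mc. tau0 \<le> tau --> 0 \<le> Mc --> (\<forall>x. strip c I K tau (A x) (B x) x) -->
  (\<forall>x :: 'n rvec. f x \<le> Mc * (wt kappa c0 m (A x * B x))) -->
  (\<integral>\<^sup>+ x. ennreal (indicator {0..1} (x $ e) * f x) \<partial>lborel) \<le> ennreal (tau * (Mc * D / Lam tau ^ N))"

abbreviation outer_bounded :: "'n::finite => 'n => 'n set => 'n set => real => real => nat => nat => real => bool" where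
 "outer_bounded c e I K kappa c0 N m D \<equiv> \<forall>tau A B f Mc. 0 < tau --> tau \<le> 1 --> 0 \<le> Mc --> (\<forall>x. strip c I K tau (A x) (B x) x) -->
  (\<forall>x :: 'n rvec. f x \<le> Mc * (wt kappa c0 m (A x * B x))) -->
  (\<integral>\<^sup>+ x. ennreal (indicator {x. x $ e \<in> {0..1} \<and> 1/2 \<le> \<bar>x $ c\<bar>} x * f x) \<partial>lborel) \<le> ennreal (tau * (Mc * D / Lam (1 / tau\<^sup>2) ^ N))"

abbreviation small_bounded :: "'n::finite => 'n => 'n set => 'n set => real => real => nat => nat => real => bool" where
 "small_bounded c e I K kappa c0 N m D \<equiv> \<forall>tau A B f Mc. 0 < tau --> tau \<le> 1 --> 0 \<le> Mc --> (\<forall>x. strip c I K tau (A x) (B x) x) --> f \<in> borel_measurable borel -->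
  (\<forall>x :: 'n rvec. 0 \<le> f x \<and> f x \<le> Mc * (wt kappa c0 m (A x * B x))) -->
  (\<integral>\<^sup>+ x. ennreal (indicator {0..1} (x $ e) * f x) \<partial>lborel) \<le> ennreal (tau * (Mc * D / Lam (1 / tau\<^sup>2) ^ N))"

text \<open>Both norms stay bounded below, so \<open>nondegenerate_bound\<close> applies with z =
  x_c / tau. Only the coordinate c is rescaled, which produces the factor tau.\<close>

lemma strip_integral_large:
 fixes c e :: "'n::finite" and kappa c0 :: real and N :: nat
 assumes sp: "splitting c e I K" and c0: "0 < c0" and tau0: "0 < tau0"
  and kappa: "real (card I) \<le> kappa" "real (card K) \<le> kappa" "real (card I) + real (card K) + 1 = 2 * kappa"
 defines "m \<equiv> N + 2 * (card I + card K + 1)"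
 shows "\<exists>D\<ge>0. large_bounded c e I K kappa c0 N m tau0 D"
proof -
 define a0 where "a0 = min 1 (tau0 / 2)"
 have a0: "0 < a0" "a0 \<le> 1" "a0 \<le> tau0 / 2" using tau0 by (auto simp: a0_def)
 \<comment> \<open>Chosen so that both 1 and |x_c| / tau are at most K1 B: use |x_c| \<le> 2 + |2 -
   x_c| and B \<ge> a0.\<close>
 define K1 where "K1 = 2 + 2 / (tau0 * a0) + 1 / a0"
 have K1: "1 \<le> K1" using a0 tau0 by (simp add: K1_def)
 obtain D where D: "D \<ge> 0" and nd: "nondegenerate I K kappa c0 a0 K1 N m D"
  using nondegenerate_bound[of a0 c0 K1 I kappa K N, OF a0(1,2) c0 K1 kappa, folded m_def] by blast
 define g where "g k = (if k = e then indicator {0..1} else G0)" for k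
 have gm: "g k \<in> borel_measurable borel" "0 \<le> g k y" "(\<integral>\<^sup>+ y. ennreal (g k y) \<partial>lborel) < \<infinity>" for k y
  using G0_finite by (auto simp: g_def G0_pos less_imp_le ennreal_indicator)
 obtain D' where D': "D' \<ge> 0" and int: "\<forall>(s :: 'n => real) E f. (\<forall>k. 0 < s k) --> 0 \<le> E -->
  (AE x in lborel. f x \<le> E * (\<Prod>k\<in>UNIV. g k (s k * x $ k))) -->
  (\<integral>\<^sup>+ x. ennreal (f x) \<partial>(lborel :: 'n rvec measure)) \<le> ennreal (E * D' / (\<Prod>k\<in>UNIV. s k))"
  using nn_integral_le_product[of g, OF gm] by (elim exE conjE) (rule that)
 have ne: "c ~= e" "c \<notin> I" "c \<notin> K" "e \<notin> I" "e \<notin> K" using sp by (auto simp: splitting_def)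
 have "(\<integral>\<^sup>+ x. ennreal (indicator {0..1} (x $ e) * f x) \<partial>lborel) \<le> ennreal (tau * (Mc * (D * D') / Lam tau ^ N))"
  if tau: "tau0 \<le> tau" and Mc: "0 \<le> Mc" and st: "\<forall>x. strip c I K tau (A x) (B x) x"
  and f: "\<forall>x. f x \<le> Mc * (wt kappa c0 m (A x * B x))" for tau A B f Mc
 proof -
  have taup: "tau > 0" using tau tau0 by simp
  define s where "s k = (if k = c then 1 / tau else 1)" for k :: 'n
  define E where "E = Mc * D / Lam tau ^ N"
  have E: "0 \<le> E" using Mc D taup Lam_pos[of tau] by (simp add: E_def)
  have "indicator {0..1} (x $ e) * f x \<le> E * (\<Prod>k\<in>UNIV. g k (s k * x $ k))" for x
  proof -
  define A' where "A' = A x"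
  define B' where "B' = B x"
  have S: "tau \<le> A'" "\<bar>x $ c\<bar> / tau \<le> A'" "\<forall>k\<in>I. \<bar>x $ k\<bar> \<le> A'" "tau / 2 \<le> B'" "\<bar>2 - x $ c\<bar> / (2 * tau) \<le> B'" "\<forall>k\<in>K. \<bar>x $ k\<bar> \<le> B'"
  using st[rule_format, of x] unfolding strip_def A'_def B'_def by auto
  have Ba: "a0 \<le> B'" using S(4) a0 tau by simp
  then have B1: "1 \<le> B' / a0" using a0 by simp
  have "max 1 \<bar>x $ c / tau\<bar> \<le> K1 * B'"
  proof -
  have B0: "B' > 0" using Ba a0 by linarith
  have "\<bar>x $ c / tau\<bar> \<le> (2 + \<bar>2 - x $ c\<bar>) / tau" using taup by (simp add: abs_divide divide_right_mono)
  also have "\<dots> = 2 / tau * 1 + 2 * (\<bar>2 - x $ c\<bar> / (2 * tau))" using taup by (simp add: field_simps)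
  also have "\<dots> \<le> 2 / tau0 * (B' / a0) + 2 * B'"
  using S(5) B1 tau tau0 by (intro add_mono mult_mono divide_left_mono) auto
  also have "\<dots> \<le> K1 * B'" using B0 a0 by (simp add: K1_def algebra_simps)
  finally have "\<bar>x $ c / tau\<bar> \<le> K1 * B'" .
  moreover have "1 / a0 * B' \<le> K1 * B'" using B0 a0 tau0 by (intro mult_right_mono) (auto simp: K1_def)
  then have "1 \<le> K1 * B'" using B1 by simp
  ultimately show ?thesis by simp
  qed
  then have "wt kappa c0 m (A' * B') \<le> D / Lam tau ^ N * (G0 (x $ c / tau) * ((\<Prod>k\<in>I. G0 (x $ k)) * (\<Prod>k\<in>K. G0 (x $ k))))"
  using nd[rule_format, of A' B' "%k. x $ k" "x $ c / tau" tau] S a0 Ba tau taup by (simp add: abs_divide)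
  then have "f x \<le> Mc * (D / Lam tau ^ N * (G0 (x $ c / tau) * ((\<Prod>k\<in>I. G0 (x $ k)) * (\<Prod>k\<in>K. G0 (x $ k)))))"
  unfolding A'_def B'_def by (rule order_trans[OF f[rule_format] mult_left_mono[OF _ Mc]])
  then have "indicator {0..1} (x $ e) * f x \<le> indicator {0..1} (x $ e) * (Mc * (D / Lam tau ^ N * (G0 (x $ c / tau) * ((\<Prod>k\<in>I. G0 (x $ k)) * (\<Prod>k\<in>K. G0 (x $ k))))))"
  by (rule mult_left_mono) simp
  also have "(\<Prod>k\<in>I. G0 (x $ k)) = (\<Prod>k\<in>I. g k (s k * x $ k))"
  using ne by (intro prod.cong) (auto simp: g_def s_def)
  also have "(\<Prod>k\<in>K. G0 (x $ k)) = (\<Prod>k\<in>K. g k (s k * x $ k))"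
  using ne by (intro prod.cong) (auto simp: g_def s_def)
  finally show ?thesis unfolding splitting_prod[OF sp] using ne by (simp add: g_def s_def E_def mult_ac)
  qed
  then have "(\<integral>\<^sup>+ x. ennreal (indicator {0..1} (x $ e) * f x) \<partial>lborel) \<le> ennreal (E * D' / (\<Prod>k\<in>UNIV. s k))"
  using taup by (intro int[rule_format] E) (auto simp: s_def)
  also have "(\<Prod>k\<in>UNIV. s k) = 1 / tau" unfolding s_def by simp
  finally show ?thesis by (simp add: E_def mult_ac)
 qed
 then show ?thesis using D D' by (intro exI[of _ "D * D'"]) auto
qed

text \<open>Multiply the norms by tau and 2 tau. Where |x_c| \<ge> 1/2 the first then stays away
  from 0 while the second may degenerate, which is the situation of \<open>singular_bound\<close>
  with \<epsilon> = tau^2.\<close>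

lemma strip_integral_outer:
 fixes c e :: "'n::finite" and kappa c0 :: real and N :: nat
 assumes sp: "splitting c e I K" and c0: "0 < c0"
  and kappa: "real (card I) \<le> kappa" "real (card K) \<le> kappa" "real (card I) + real (card K) + 1 = 2 * kappa" "kappa < real (card K) + 1"
 defines "m \<equiv> N + 2 * (card I + card K + 1)"
 shows "\<exists>D\<ge>0. outer_bounded c e I K kappa c0 N m D"
proof -
 have c2: "0 < c0 / 2" using c0 by simp
 obtain D gam where D: "D \<ge> 0" "gam < 1" and sb: "\<forall>A B \<epsilon> w (x :: 'n => real). 1/2 \<le> A --> (\<forall>k\<in>I. \<bar>x k\<bar> \<le> A) --> (\<forall>k\<in>K. \<bar>x k\<bar> \<le> B \<and> x k ~= 0) -->
  \<bar>w\<bar> \<le> A --> \<bar>2 - w\<bar> \<le> B --> w ~= 2 --> 0 < \<epsilon> --> \<epsilon> \<le> 1 -->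
  (A * B) powr (- kappa) / Lam (c0 / 2 * (A * B) / \<epsilon>) ^ m \<le> D / Lam (1 / \<epsilon>) ^ N * ((G0 w + Gs gam (w - 2)) * ((\<Prod>k\<in>I. G0 (x k)) * (\<Prod>k\<in>K. Gs gam (x k))))"
  using singular_bound[of "c0 / 2" I kappa K N, OF c2 kappa, folded m_def] by blast
 define g where "g k = (if k = e then indicator {0..1} else if k = c then (%w. G0 w + Gs gam (w - 2)) else if k \<in> I then G0 else Gs gam)" for k
 have gm: "g k \<in> borel_measurable borel" "0 \<le> g k y" "(\<integral>\<^sup>+ y. ennreal (g k y) \<partial>lborel) < \<infinity>" for k y
 proof -
  show "g k \<in> borel_measurable borel" unfolding g_def by auto
  show "0 \<le> g k y" by (auto simp: g_def G0_pos Gs_ge less_imp_le add_nonneg_nonneg)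
  have "(\<integral>\<^sup>+ w. ennreal (G0 w + Gs gam (w - 2)) \<partial>lborel) = (\<integral>\<^sup>+ w. ennreal (G0 w) + ennreal (Gs gam (w - 2)) \<partial>lborel)"
  by (intro nn_integral_cong ennreal_plus) (auto simp: G0_pos Gs_ge less_imp_le)
  also have "\<dots> = (\<integral>\<^sup>+ w. ennreal (G0 w) \<partial>lborel) + (\<integral>\<^sup>+ w. ennreal (Gs gam (w - 2)) \<partial>lborel)"
  by (rule nn_integral_add) measurable
  also have "(\<integral>\<^sup>+ w. ennreal (Gs gam (w - 2)) \<partial>lborel) = (\<integral>\<^sup>+ w. ennreal (Gs gam w) \<partial>lborel)"
  using nn_integral_real_affine[of "%w. ennreal (Gs gam w)" 1 "- 2"] by simp
  finally have "(\<integral>\<^sup>+ w. ennreal (G0 w + Gs gam (w - 2)) \<partial>lborel) < \<infinity>" using G0_finite Gs_finite[OF D(2)] by simp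
  then show "(\<integral>\<^sup>+ y. ennreal (g k y) \<partial>lborel) < \<infinity>"
  using G0_finite Gs_finite[OF D(2)] by (auto simp: g_def ennreal_indicator)
 qed
 obtain D' where D': "D' \<ge> 0" and int: "\<forall>(s :: 'n => real) E f. (\<forall>k. 0 < s k) --> 0 \<le> E -->
  (AE x in lborel. f x \<le> E * (\<Prod>k\<in>UNIV. g k (s k * x $ k))) -->
  (\<integral>\<^sup>+ x. ennreal (f x) \<partial>(lborel :: 'n rvec measure)) \<le> ennreal (E * D' / (\<Prod>k\<in>UNIV. s k))"
  using nn_integral_le_product[of g, OF gm] by (elim exE conjE) (rule that)
 have ne: "c ~= e" "c \<notin> I" "c \<notin> K" "e \<notin> I" "e \<notin> K" "I \<inter> K = {}" using sp by (auto simp: splitting_def)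
 have "(\<integral>\<^sup>+ x. ennreal (indicator {x. x $ e \<in> {0..1} \<and> 1/2 \<le> \<bar>x $ c\<bar>} x * f x) \<partial>lborel) \<le> ennreal (tau * (Mc * (2 powr kappa * D * D') / Lam (1 / tau\<^sup>2) ^ N))"
  if tau: "0 < tau" "tau \<le> 1" and Mc: "0 \<le> Mc" and st: "\<forall>x. strip c I K tau (A x) (B x) x"
  and f: "\<forall>x. f x \<le> Mc * (wt kappa c0 m (A x * B x))" for tau A B f Mc
 proof -
  define s where "s k = (if k = c \<or> k = e then 1 else tau)" for k :: 'n
  define Z where "Z = (2 * tau\<^sup>2) powr kappa"
  define E where "E = Mc * Z * D / Lam (1 / tau\<^sup>2) ^ N"
  have Z: "Z > 0" using tau by (simp add: Z_def)
  have E: "0 \<le> E" using Mc D tau Lam_pos[of "1 / tau\<^sup>2"] Z by (simp add: E_def)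
  have bound: "indicator {x. x $ e \<in> {0..1} \<and> 1/2 \<le> \<bar>x $ c\<bar>} x * f x \<le> E * (\<Prod>k\<in>UNIV. g k (s k * x $ k))"
  if x: "x $ c ~= 2" "\<forall>k. x $ k ~= 0" for x
  proof (cases "1/2 \<le> \<bar>x $ c\<bar>")
  case False
  then show ?thesis using E gm(2) by (auto intro!: mult_nonneg_nonneg prod_nonneg)
  next
  case True
  define A' where "A' = tau * A x"
  define B' where "B' = 2 * tau * B x"
  have S: "tau \<le> A x" "\<bar>x $ c\<bar> / tau \<le> A x" "\<forall>k\<in>I. \<bar>x $ k\<bar> \<le> A x" "tau / 2 \<le> B x" "\<bar>2 - x $ c\<bar> / (2 * tau) \<le> B x" "\<forall>k\<in>K. \<bar>x $ k\<bar> \<le> B x"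
  using st[rule_format, of x] unfolding strip_def by auto
  have s1: "\<bar>x $ c\<bar> \<le> A'" "\<bar>2 - x $ c\<bar> \<le> B'" using S(2,5) tau by (auto simp: A'_def B'_def field_simps)
  have s2: "\<forall>k\<in>I. \<bar>tau * x $ k\<bar> \<le> A'" using S(3) tau by (auto simp: A'_def abs_mult)
  have s3: "\<forall>k\<in>K. \<bar>tau * x $ k\<bar> \<le> B' \<and> tau * x $ k ~= 0"
  proof
  fix k assume "k \<in> K"
  then have "tau * \<bar>x $ k\<bar> \<le> tau * B x" using S(6) tau by (intro mult_left_mono) auto
  moreover have "0 \<le> tau * \<bar>x $ k\<bar>" using tau by simp
  ultimately show "\<bar>tau * x $ k\<bar> \<le> B' \<and> tau * x $ k ~= 0" using x tau by (auto simp: B'_def abs_mult)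
  qed
  have eps: "0 < tau\<^sup>2" "tau\<^sup>2 \<le> 1" using tau by (auto simp: power_le_one)
  have AB: "A x * B x = A' * B' / (2 * tau\<^sup>2)" using tau by (simp add: A'_def B'_def power2_eq_square)
  have p: "A' > 0" "B' > 0" using S tau by (auto simp: A'_def B'_def intro!: mult_pos_pos)
  have "wt kappa c0 m (A x * B x) = Z * ((A' * B') powr (- kappa) / Lam (c0 / 2 * (A' * B') / tau\<^sup>2) ^ m)"
  proof -
  have "(A x * B x) powr (- kappa) = Z * (A' * B') powr (- kappa)"
  unfolding AB using p tau by (simp add: powr_divide powr_minus_divide Z_def)
  moreover have "c0 * (A x * B x) = c0 / 2 * (A' * B') / tau\<^sup>2" unfolding AB by simp
  ultimately show ?thesis by simp
  qed
  also have "\<dots> \<le> Z * (D / Lam (1 / tau\<^sup>2) ^ N * ((G0 (x $ c) + Gs gam (x $ c - 2)) * ((\<Prod>k\<in>I. G0 (tau * x $ k)) * (\<Prod>k\<in>K. Gs gam (tau * x $ k)))))"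
  using sb[rule_format, of A' "%k. tau * x $ k" B' "x $ c" "tau\<^sup>2"] s1 s2 s3 eps x True Z by (intro mult_left_mono) auto
  finally have "f x \<le> Mc * (Z * (D / Lam (1 / tau\<^sup>2) ^ N * ((G0 (x $ c) + Gs gam (x $ c - 2)) * ((\<Prod>k\<in>I. G0 (tau * x $ k)) * (\<Prod>k\<in>K. Gs gam (tau * x $ k))))))"
  by (rule order_trans[OF f[rule_format] mult_left_mono[OF _ Mc]])
  then have "indicator {0..1} (x $ e) * f x \<le> indicator {0..1} (x $ e) * (Mc * (Z * (D / Lam (1 / tau\<^sup>2) ^ N * ((G0 (x $ c) + Gs gam (x $ c - 2)) * ((\<Prod>k\<in>I. G0 (tau * x $ k)) * (\<Prod>k\<in>K. Gs gam (tau * x $ k)))))))"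
  by (rule mult_left_mono) simp
  also have "(\<Prod>k\<in>I. G0 (tau * x $ k)) = (\<Prod>k\<in>I. g k (s k * x $ k))"
  using ne by (intro prod.cong) (auto simp: g_def s_def)
  also have "(\<Prod>k\<in>K. Gs gam (tau * x $ k)) = (\<Prod>k\<in>K. g k (s k * x $ k))"
  using ne by (intro prod.cong) (auto simp: g_def s_def)
  finally show ?thesis unfolding splitting_prod[OF sp] using ne True by (simp add: g_def s_def E_def mult_ac indicator_def)
  qed
  \<comment> \<open>\<open>singular_bound\<close> holds off the poles of its singular factors; the
    exceptional hyperplanes are null sets.\<close>
  have "AE x in (lborel :: 'n rvec measure). x $ c ~= 2" by (rule AE_coordinate_neq)
  moreover have "AE x in (lborel :: 'n rvec measure). \<forall>k. x $ k ~= 0"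
  by (intro eventually_all_finite AE_coordinate_neq)
  ultimately have "AE x in (lborel :: 'n rvec measure). indicator {x. x $ e \<in> {0..1} \<and> 1/2 \<le> \<bar>x $ c\<bar>} x * f x \<le> E * (\<Prod>k\<in>UNIV. g k (s k * x $ k))"
  by eventually_elim (rule bound)
  then have "(\<integral>\<^sup>+ x. ennreal (indicator {x. x $ e \<in> {0..1} \<and> 1/2 \<le> \<bar>x $ c\<bar>} x * f x) \<partial>lborel) \<le> ennreal (E * D' / (\<Prod>k\<in>UNIV. s k))"
  using tau by (intro int[rule_format] E) (auto simp: s_def)
  also have "(\<Prod>k\<in>UNIV. s k) = tau ^ (card I + card K)"
  proof -
  have "(\<Prod>k\<in>I. s k) = tau ^ card I" "(\<Prod>k\<in>K. s k) = tau ^ card K"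
  using ne by (auto simp: s_def intro!: prod_constant[THEN trans[rotated]] prod.cong)
  then show ?thesis unfolding splitting_prod[OF sp] by (simp add: s_def power_add)
  qed
  \<comment> \<open>The prefactor (2 tau^2)^kappa contributes tau^(2 kappa), the Jacobian takes away
    one tau for every coordinate in I and K, and 2 kappa is one more than their number.\<close>
  also have "E * D' / tau ^ (card I + card K) = tau * (Mc * (2 powr kappa * D * D') / Lam (1 / tau\<^sup>2) ^ N)"
  proof -
  have "Z = 2 powr kappa * tau powr (2 * kappa)"
  using tau by (simp add: Z_def powr_mult powr_powr flip: powr_numeral)
  also have "tau powr (2 * kappa) = tau ^ (card I + card K) * tau"
  proof -
  have "tau powr (2 * kappa) = tau powr (real (card I + card K + 1))" unfolding kappa(3)[symmetric] by (simp add: add_ac)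
  also have "\<dots> = tau ^ (card I + card K + 1)" using tau(1) by (rule powr_realpow)
  finally show ?thesis by simp
  qed
  finally show ?thesis using tau by (simp add: E_def)
  qed
  finally show ?thesis .
 qed
 then show ?thesis using D D' by (intro exI[of _ "2 powr kappa * D * D'"]) auto
qed

lemma refl_at_nth [simp]: "refl_at c x $ k = (if k = c then 2 - x $ k else x $ k)"
 by (simp add: refl_at_def)

lemma refl_at_measurable [measurable]: "refl_at c \<in> borel_measurable (borel :: 'n::finite rvec measure)"
 by (rule borel_measurable_continuous_onI) (auto simp: refl_at_def[abs_def] intro!: continuous_intros)

lemma integral_refl_at:
 fixes c :: "'n::finite"
 shows "f \<in> borel_measurable borel ==> (\<integral>\<^sup>+ x. f (refl_at c x) \<partial>lborel) = (\<integral>\<^sup>+ x. f x \<partial>(lborel :: 'n rvec measure))"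
  and "g \<in> borel_measurable borel ==> (LINT x|lborel. g (refl_at c x)) = (LINT x|lborel. (g :: 'n rvec => complex) x)"
proof -
 define s where "s k = (if k = c then - 1 else 1 :: real)" for k
 have s: "s k ~= 0" for k by (simp add: s_def)
 have p: "(\<Prod>k\<in>UNIV. \<bar>s k\<bar>) = 1" by (intro prod.neutral) (auto simp: s_def)
 have r: "(\<chi> k. (if k = c then 2 else 0) + s k * x $ k) = refl_at c x" for x
  by (simp add: refl_at_def s_def)
 show "f \<in> borel_measurable borel ==> (\<integral>\<^sup>+ x. f (refl_at c x) \<partial>lborel) = (\<integral>\<^sup>+ x. f x \<partial>(lborel :: 'n rvec measure))"
  using nn_integral_scale(1)[of s f "%k. if k = c then 2 else 0", OF s] by (simp add: p r)
 show "g \<in> borel_measurable borel ==> (LINT x|lborel. g (refl_at c x)) = (LINT x|lborel. (g :: 'n rvec => complex) x)"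
  using nn_integral_scale(2)[of s _ g "%k. if k = c then 2 else 0", OF s borel_measurable_const] by (simp add: p r)
qed

text \<open>The factor 2 in the reflected norms costs a constant and halves the scale inside the
  logarithm.\<close>

lemma strip_refl_weight:
 fixes A B kappa :: real
 assumes "0 \<le> A" "0 \<le> B"
 shows "Mc * (wt kappa c0 m (A * B)) = Mc * 2 powr kappa * (wt kappa (c0 / 2) m (2 * B * A))"
proof -
 have "(2 * B * A) powr (- kappa) = 2 powr (- kappa) * (A * B) powr (- kappa)"
  using assms by (simp add: powr_mult[symmetric] mult_ac)
 moreover have "2 powr kappa * 2 powr (- kappa) = (1 :: real)" by (simp flip: powr_add)
 then have "2 powr kappa * (2 powr (- kappa) * z) = z" for z :: real by (simp flip: mult.assoc)
 moreover have "c0 / 2 * (2 * B * A) = c0 * (A * B)" by simp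
 ultimately show ?thesis by (simp only: times_divide_eq_right mult.assoc)
qed

lemma strip_nonneg: "strip c I K tau A B x ==> 0 < tau ==> 0 < A \<and> 0 < B"
 by (auto simp: strip_def)

text \<open>The outer bound covers |x_c| \<ge> 1/2. The reflection carries the rest into that region
  with I and K exchanged, and the outer bound applies again: for I and K of equal size, kappa is
  that size plus 1/2.\<close>

lemma strip_integral_small:
 fixes c e :: "'n::finite" and kappa c0 :: real and N :: nat
 assumes sp: "splitting c e I K" and c0: "0 < c0"
  and kappa: "card I = card K" "real (card I) + real (card K) + 1 = 2 * kappa"
 defines "m \<equiv> N + 2 * (card I + card K + 1)"
 shows "\<exists>D\<ge>0. small_bounded c e I K kappa c0 N m D"
proof -
 have kappa': "real (card I) \<le> kappa" "real (card K) \<le> kappa" "kappa < real (card K) + 1" "kappa < real (card I) + 1"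
  "real (card K) + real (card I) + 1 = 2 * kappa" using kappa by auto
 have m: "m = N + 2 * (card K + card I + 1)" by (simp add: m_def)
 have c2: "0 < c0 / 2" using c0 by simp
 obtain D1 where D1: "D1 \<ge> 0" and b1: "outer_bounded c e I K kappa c0 N m D1"
  using strip_integral_outer[OF sp c0 kappa'(1,2) kappa(2) kappa'(3), of N, folded m_def] by (elim exE conjE) (rule that)
 obtain D2 where D2: "D2 \<ge> 0" and b2: "outer_bounded c e K I kappa (c0 / 2) N m D2"
  using strip_integral_outer[OF splitting_swap[OF sp] c2 kappa'(2,1,5,4), of N, folded m] by (elim exE conjE) (rule that)
 have ce: "e ~= c" "c \<notin> I \<union> K" using sp by (auto simp: splitting_def)
 have "(\<integral>\<^sup>+ x. ennreal (indicator {0..1} (x $ e) * f x) \<partial>lborel) \<le> ennreal (tau * (Mc * (D1 + 2 powr kappa * D2) / Lam (1 / tau\<^sup>2) ^ N))"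
  if tau: "0 < tau" "tau \<le> 1" and Mc: "0 \<le> Mc" and st: "\<forall>x. strip c I K tau (A x) (B x) x" and fm[measurable]: "f \<in> borel_measurable borel"
  and f: "\<forall>x. 0 \<le> f x \<and> f x \<le> Mc * (wt kappa c0 m (A x * B x))" for tau A B f Mc
 proof -
  let ?U = "{x :: 'n rvec. x $ e \<in> {0..1} \<and> 1/2 \<le> \<bar>x $ c\<bar>}"
  let ?V = "{x :: 'n rvec. x $ e \<in> {0..1} \<and> \<bar>x $ c\<bar> < 1/2}"
  have [measurable]: "?U \<in> sets borel" "?V \<in> sets borel" by measurable
  have "(\<integral>\<^sup>+ x. ennreal (indicator {0..1} (x $ e) * f x) \<partial>lborel) = (\<integral>\<^sup>+ x. ennreal (indicator ?U x * f x) + ennreal (indicator ?V x * f x) \<partial>lborel)"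
  by (intro nn_integral_cong) (auto simp: indicator_def)
  also have "\<dots> = (\<integral>\<^sup>+ x. ennreal (indicator ?U x * f x) \<partial>lborel) + (\<integral>\<^sup>+ x. ennreal (indicator ?V x * f x) \<partial>lborel)"
  by (rule nn_integral_add) measurable
  also have "(\<integral>\<^sup>+ x. ennreal (indicator ?U x * f x) \<partial>lborel) \<le> ennreal (tau * (Mc * D1 / Lam (1 / tau\<^sup>2) ^ N))"
  by (rule b1[rule_format, OF tau Mc]) (use st f in auto)
  also have "(\<integral>\<^sup>+ x. ennreal (indicator ?V x * f x) \<partial>lborel) = (\<integral>\<^sup>+ x. ennreal (indicator ?V (refl_at c x) * f (refl_at c x)) \<partial>lborel)"
  by (rule integral_refl_at(1)[symmetric]) measurable
  also have "\<dots> \<le> (\<integral>\<^sup>+ x. ennreal (indicator ?U x * f (refl_at c x)) \<partial>lborel)"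
  using f ce by (intro nn_integral_mono ennreal_leI) (auto simp: indicator_def)
  also have "\<dots> \<le> ennreal (tau * (Mc * 2 powr kappa * D2 / Lam (1 / tau\<^sup>2) ^ N))"
  proof (rule b2[rule_format, OF tau])
  show "0 \<le> Mc * 2 powr kappa" using Mc by simp
  fix x
  have s: "strip c I K tau (A (refl_at c x)) (B (refl_at c x)) (refl_at c x)" using st by simp
  show "strip c K I tau (2 * B (refl_at c x)) (A (refl_at c x)) x" by (rule strip_refl[OF s ce(2) tau(1)])
  show "f (refl_at c x) \<le> Mc * 2 powr kappa * (wt kappa (c0 / 2) m (2 * B (refl_at c x) * A (refl_at c x)))"
  using f[rule_format, of "refl_at c x"] strip_nonneg[OF s tau(1)] by (subst strip_refl_weight[symmetric]) auto
  qed
  finally have "(\<integral>\<^sup>+ x. ennreal (indicator {0..1} (x $ e) * f x) \<partial>lborel) \<le> ennreal (tau * (Mc * D1 / Lam (1 / tau\<^sup>2) ^ N)) + ennreal (tau * (Mc * 2 powr kappa * D2 / Lam (1 / tau\<^sup>2) ^ N))"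
  by (simp add: add_mono)
  also have "\<dots> = ennreal (tau * (Mc * (D1 + 2 powr kappa * D2) / Lam (1 / tau\<^sup>2) ^ N))"
  proof (subst ennreal_plus[symmetric])
  have "0 \<le> Lam (1 / tau\<^sup>2)" by (rule Lam_pos[THEN less_imp_le]) simp
  then show "0 \<le> tau * (Mc * D1 / Lam (1 / tau\<^sup>2) ^ N)" "0 \<le> tau * (Mc * 2 powr kappa * D2 / Lam (1 / tau\<^sup>2) ^ N)"
  using tau Mc D1 D2 by (intro mult_nonneg_nonneg divide_nonneg_nonneg zero_le_power; simp)+
  qed (simp only: add_divide_distrib distrib_left mult.assoc)
  finally show ?thesis .
 qed
 then show ?thesis using D1 D2 by (intro exI[of _ "D1 + 2 powr kappa * D2"]) auto
qed

section \<open>The limit at small scale\<close>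

definition squeeze :: "'n => 'n set => 'n set => real => 'n::finite rvec => 'n rvec" where
 "squeeze c I K tau y = (\<chi> k. (if k = c then tau\<^sup>2 else if k \<in> I then tau else if k \<in> K then 1 / tau else 1) * y $ k)"

lemma squeeze_measurable [measurable]: "squeeze c I K tau \<in> borel_measurable (borel :: 'n::finite rvec measure)"
 by (rule borel_measurable_continuous_onI) (auto simp: squeeze_def[abs_def] intro!: continuous_intros)

text \<open>The Jacobian is tau^(2 + card I - card K), which is tau when K has one element more than
  I.\<close>

lemma integral_squeeze:
 fixes c e :: "'n::finite" and g :: "'n rvec => complex"
 assumes sp: "splitting c e I K" and K: "card K = card I + 1" and tau: "0 < tau" and g: "g \<in> borel_measurable borel"
 shows "(LINT x|lborel. g x) = tau *\<^sub>R (LINT x|lborel. g (squeeze c I K tau x))"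
proof -
 define s where "s k = (if k = c then tau\<^sup>2 else if k \<in> I then tau else if k \<in> K then 1 / tau else 1)" for k
 have s: "s k > 0" for k using tau by (simp add: s_def)
 have s0: "s k ~= 0" for k using s[of k] by simp
 have ne: "c ~= e" "c \<notin> I" "c \<notin> K" "e \<notin> I" "e \<notin> K" "I \<inter> K = {}" using sp by (auto simp: splitting_def)
 have "(\<Prod>k\<in>UNIV. \<bar>s k\<bar>) = (\<Prod>k\<in>UNIV. s k)" using s by (simp add: abs_of_pos)
 also have "\<dots> = tau\<^sup>2 * (1 * (tau ^ card I * (1 / tau) ^ card K))"
 proof -
  have "(\<Prod>k\<in>I. s k) = (\<Prod>k\<in>I. tau)" by (rule prod.cong) (use ne in \<open>auto simp: s_def\<close>)
  moreover have "(\<Prod>k\<in>K. s k) = (\<Prod>k\<in>K. 1 / tau)" by (rule prod.cong) (use ne in \<open>auto simp: s_def\<close>)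
  ultimately show ?thesis unfolding splitting_prod[OF sp] using ne by (simp add: s_def)
 qed
 also have "\<dots> = tau" using tau by (simp add: K power_divide power2_eq_square)
 finally show ?thesis
  using nn_integral_scale(2)[of s _ g "%_. 0", OF s0 borel_measurable_const g] by (simp add: squeeze_def s_def)
qed

text \<open>A function that is not integrable has Bochner integral 0, which settles that
  case.\<close>

lemma norm_integral_le:
 fixes f :: "'a => complex"
 assumes "(\<integral>\<^sup>+ x. ennreal (norm (f x)) \<partial>M) \<le> ennreal b" "0 \<le> b"
 shows "norm (LINT x|M. f x) \<le> b"
proof (cases "integrable M f")
 case True
 then have "ennreal (norm (LINT x|M. f x)) \<le> (\<integral>\<^sup>+ x. ennreal (norm (f x)) \<partial>M)" by (rule integral_norm_bound_ennreal)
 then show ?thesis using assms by (meson ennreal_le_iff order_trans)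
qed (use assms in \<open>simp add: not_integrable_integral_eq\<close>)

lemma Lam_at_top: "filterlim Lam at_top at_top"
proof -
 have "filterlim (%x. 1 + x :: real) at_top at_top"
  using filterlim_tendsto_add_at_top[OF tendsto_const filterlim_ident] by blast
 then have "filterlim (%x :: real. ln (1 + x)) at_top at_top"
  by (rule filterlim_compose[OF ln_at_top])
 then show ?thesis unfolding Lam_def[abs_def]
  using filterlim_tendsto_add_at_top[OF tendsto_const] by blast
qed

text \<open>After division by tau the region |x_c| \<ge> 1/2 contributes O(1 / Lam (1 / tau^2)) and
  drops out. On the rest, \<open>squeeze\<close> has Jacobian tau and makes both suitably scaled
  norms at least 1 uniformly in tau, so \<open>nondegenerate_bound\<close> with kappa = card K
  provides an integrable majorant.\<close>

lemma strip_limit: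
 fixes c e :: "'n::finite" and c0 :: real and F :: "real => 'n rvec => complex"
 assumes sp: "splitting c e I K" and c0: "0 < c0" and K: "card K = card I + 1" and Mc: "0 \<le> Mc"
  and tau: "\<And>t. 0 < tau t" "(tau \<longlongrightarrow> 0) at_top"
  and st: "\<And>t x. strip c I K (tau t) (A t x) (B t x) x"
  and F: "\<And>t. F t \<in> borel_measurable borel"
  and bound: "\<And>t x. norm (F t x) \<le> Mc * (wt (real (card K)) c0 (1 + 2 * (card I + card K + 1)) (A t x * B t x))"
  and lim: "\<And>y. ((%t. F t (squeeze c I K (tau t) y)) \<longlongrightarrow> F0 y) at_top"
 shows "((%t. (1 / tau t) *\<^sub>R (LINT x|lborel. indicator {0..1} (x $ e) *\<^sub>R F t x)) \<longlongrightarrow> (LINT y|lborel. indicator {0..1} (y $ e) *\<^sub>R F0 y)) at_top"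
proof -
 define kappa where "kappa = real (card K)"
 define m where "m = 1 + 2 * (card I + card K + 1)"
 have kappa: "real (card I) \<le> kappa" "real (card K) \<le> kappa" "real (card I) + real (card K) + 1 = 2 * kappa" "kappa < real (card K) + 1"
  using K by (auto simp: kappa_def)
 have [measurable]: "F t \<in> borel_measurable borel" for t by (rule F)
 have ne: "c ~= e" "c \<notin> I" "c \<notin> K" "e \<notin> I" "e \<notin> K" "I \<inter> K = {}" using sp by (auto simp: splitting_def)
 have F': "norm (F t x) \<le> Mc * (wt kappa c0 m (A t x * B t x))" for t x
  using bound[of t x] by (simp add: kappa_def m_def)
 let ?U = "{x :: 'n rvec. x $ e \<in> {0..1} \<and> 1/2 \<le> \<bar>x $ c\<bar>}"
 let ?V = "{x :: 'n rvec. x $ e \<in> {0..1} \<and> \<bar>x $ c\<bar> < 1/2}"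
 have [measurable]: "?U \<in> sets borel" "?V \<in> sets borel" by measurable
 have int: "integrable lborel (%x. indicator {0..1} (x $ e) *\<^sub>R F t x)" for t
 proof (rule integrableI_bounded)
  obtain D where "large_bounded c e I K kappa c0 1 m (tau t) D"
  using strip_integral_large[OF sp c0 tau(1)[of t] kappa(1-3), of 1, folded m_def] by (elim exE conjE) (rule that)
  from this[rule_format, of "tau t" Mc "A t" "B t" "%x. norm (F t x)"]
  have "(\<integral>\<^sup>+ x. ennreal (indicator {0..1} (x $ e) * norm (F t x)) \<partial>lborel) \<le> ennreal (tau t * (Mc * D / Lam (tau t) ^ 1))"
  using Mc st F' by auto
  then show "(\<integral>\<^sup>+ x. ennreal (norm (indicator {0..1} (x $ e) *\<^sub>R F t x)) \<partial>lborel) < \<infinity>"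
  by (auto elim: le_less_trans)
 qed measurable
 have split: "(LINT x|lborel. indicator {0..1} (x $ e) *\<^sub>R F t x) = (LINT x|lborel. indicator ?U x *\<^sub>R F t x) + (LINT x|lborel. indicator ?V x *\<^sub>R F t x)" for t
 proof -
  have a: "integrable lborel (%x. indicator W x *\<^sub>R F t x)" if "W \<subseteq> {x. x $ e \<in> {0..1}}" "W \<in> sets borel" for W
  proof -
  have "(%x. indicator W x *\<^sub>R indicator {0..1} (x $ e) *\<^sub>R F t x) = (%x. indicator W x *\<^sub>R F t x)"
  using that by (auto simp: indicator_def fun_eq_iff)
  then show ?thesis using integrable_mult_indicator[OF _ int[of t], of W] that by simp
  qed
  have iU: "integrable lborel (%x. indicator ?U x *\<^sub>R F t x)" by (rule a) auto
  have iV: "integrable lborel (%x. indicator ?V x *\<^sub>R F t x)" by (rule a) auto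
  have "(LINT x|lborel. indicator {0..1} (x $ e) *\<^sub>R F t x) = (LINT x|lborel. indicator ?U x *\<^sub>R F t x + indicator ?V x *\<^sub>R F t x)"
  by (intro Bochner_Integration.integral_cong) (auto simp: indicator_def)
  then show ?thesis using iU iV by simp
 qed
 have ev: "\<forall>\<^sub>F t in at_top. tau t < 1" using tau(2) by (rule order_tendstoD) simp
 have limU: "((%t. (1 / tau t) *\<^sub>R (LINT x|lborel. indicator ?U x *\<^sub>R F t x)) \<longlongrightarrow> 0) at_top"
 proof -
  obtain D where D: "0 \<le> D" and b: "outer_bounded c e I K kappa c0 1 m D"
  using strip_integral_outer[OF sp c0 kappa, of 1, folded m_def] by (elim exE conjE) (rule that)
  have "\<forall>\<^sub>F t in at_top. norm ((1 / tau t) *\<^sub>R (LINT x|lborel. indicator ?U x *\<^sub>R F t x)) \<le> Mc * D / Lam (1 / (tau t)\<^sup>2)"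
  using ev
  proof eventually_elim
  case (elim t)
  have L: "Lam (1 / (tau t)\<^sup>2) > 0" by (rule Lam_pos) simp
  have "norm (LINT x|lborel. indicator ?U x *\<^sub>R F t x) \<le> tau t * (Mc * D / Lam (1 / (tau t)\<^sup>2) ^ 1)"
  proof (rule norm_integral_le)
  have "(\<integral>\<^sup>+ x. ennreal (norm (indicator ?U x *\<^sub>R F t x)) \<partial>lborel) = (\<integral>\<^sup>+ x. ennreal (indicator ?U x * norm (F t x)) \<partial>lborel)"
  by (intro nn_integral_cong) simp
  also have "\<dots> \<le> ennreal (tau t * (Mc * D / Lam (1 / (tau t)\<^sup>2) ^ 1))"
  by (rule b[rule_format, OF tau(1) _ Mc]) (use elim st F' in auto)
  finally show "(\<integral>\<^sup>+ x. ennreal (norm (indicator ?U x *\<^sub>R F t x)) \<partial>lborel) \<le> ennreal (tau t * (Mc * D / Lam (1 / (tau t)\<^sup>2) ^ 1))" .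
  qed (use tau(1)[of t] Mc D L in auto)
  then show ?case using tau(1)[of t] by (simp add: field_simps)
  qed
  moreover have "((%t. Mc * D / Lam (1 / (tau t)\<^sup>2)) \<longlongrightarrow> 0) at_top"
  proof -
  have "((%t. (tau t)\<^sup>2) \<longlongrightarrow> 0) at_top" using tendsto_power[OF tau(2), of 2] by simp
  then have "filterlim (%t. (tau t)\<^sup>2) (at_right 0) at_top"
  using tau(1) by (auto simp: filterlim_at less_imp_neq[symmetric])
  then have "filterlim (%t. 1 / (tau t)\<^sup>2) at_top at_top"
  using filterlim_compose[OF filterlim_inverse_at_top_right] by (simp add: inverse_eq_divide)
  then have "filterlim (%t. Lam (1 / (tau t)\<^sup>2)) at_top at_top" by (rule filterlim_compose[OF Lam_at_top])
  then show ?thesis by (intro tendsto_divide_0[OF tendsto_const] filterlim_at_top_imp_at_infinity)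
  qed
  ultimately show ?thesis by (rule Lim_null_comparison)
 qed
 have limV: "((%t. (1 / tau t) *\<^sub>R (LINT x|lborel. indicator ?V x *\<^sub>R F t x)) \<longlongrightarrow> (LINT y|lborel. indicator {0..1} (y $ e) *\<^sub>R F0 y)) at_top"
 proof -
  let ?S = "%t. squeeze c I K (tau t)"
  have eq: "(1 / tau t) *\<^sub>R (LINT x|lborel. indicator ?V x *\<^sub>R F t x) = (LINT y|lborel. indicator ?V (?S t y) *\<^sub>R F t (?S t y))" for t
  using integral_squeeze[OF sp K tau(1), of "%x. indicator ?V x *\<^sub>R F t x" t] tau(1)[of t] by simp
  have h: "(0 :: real) < 1" "(1 :: real) \<le> 1" "0 < c0 / 2" using c0 by auto
  obtain D where D: "D \<ge> 0" and nd: "nondegenerate I K kappa (c0 / 2) 1 1 1 m D"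
  using nondegenerate_bound[of 1 "c0 / 2" 1 I kappa K 1, OF h(1,2,3,2) kappa(1-3), folded m_def] by (elim exE conjE) (rule that)
  define w where "w y = Mc * 2 powr kappa * D * (\<Prod>k\<in>UNIV. (if k = e then indicator {0..1} else G0) (y $ k))" for y :: "'n rvec"
  have gm: "(if k = e then indicator {0..1} else G0) \<in> borel_measurable borel" for k by auto
  have w_int: "integrable lborel w"
  proof -
  have "(\<integral>\<^sup>+ y. ennreal (\<Prod>k\<in>UNIV. (if k = e then indicator {0..1} else G0) (y $ k)) \<partial>(lborel :: 'n rvec measure)) < \<infinity>"
  by (rule nn_integral_coordinate_product) (use G0_finite in \<open>auto simp: G0_pos less_imp_le ennreal_indicator\<close>)
  moreover have "0 \<le> (\<Prod>k\<in>UNIV. (if k = e then indicator {0..1} else G0) (y $ k))" for y :: "'n rvec"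
  by (auto intro!: prod_nonneg simp: G0_pos less_imp_le)
  moreover have "(%y :: 'n rvec. (\<Prod>k\<in>UNIV. (if k = e then indicator {0..1} else G0) (y $ k))) \<in> borel_measurable borel"
  by (rule borel_measurable_prod) (use gm in \<open>auto intro: measurable_compose[rotated]\<close>)
  ultimately have "integrable lborel (%y :: 'n rvec. (\<Prod>k\<in>UNIV. (if k = e then indicator {0..1} else G0) (y $ k)))"
  by (intro integrableI_nonneg) auto
  then show ?thesis unfolding w_def[abs_def] by (rule integrable_mult_right)
  qed
  have dom: "norm (indicator ?V (?S t y) *\<^sub>R F t (?S t y)) \<le> w y" if t: "tau t < 1" for t y
  proof (cases "?S t y \<in> ?V")
  case False
  have "0 \<le> (\<Prod>k\<in>UNIV. (if k = e then indicator {0..1} else G0) (y $ k))"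
  by (auto intro!: prod_nonneg simp: G0_pos less_imp_le)
  then have "0 \<le> w y" unfolding w_def using Mc D by (intro mult_nonneg_nonneg) auto
  then show ?thesis using False by simp
  next
  case True
  have taup: "tau t > 0" by (rule tau(1))
  \<comment> \<open>The first norm is divided by tau and the second multiplied by 2 tau; in the
    squeezed coordinates the lower bounds from \<open>strip\<close> used below are then free of tau,
    except for |2 - tau^2 y_c|, which is at least 1 on this region.\<close>
  define A' where "A' = A t (?S t y) / tau t"
  define B' where "B' = 2 * tau t * B t (?S t y)"
  have Sc: "?S t y $ c = (tau t)\<^sup>2 * y $ c" "?S t y $ e = y $ e" using ne by (auto simp: squeeze_def)
  have SI: "?S t y $ k = tau t * y $ k" if "k \<in> I" for k using ne that by (auto simp: squeeze_def)
  have SK: "?S t y $ k = y $ k / tau t" if "k \<in> K" for k using ne that by (auto simp: squeeze_def)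
  have S: "tau t \<le> A t (?S t y)" "\<bar>(tau t)\<^sup>2 * y $ c\<bar> / tau t \<le> A t (?S t y)" "\<And>k. k\<in>I ==> \<bar>tau t * y $ k\<bar> \<le> A t (?S t y)"
  "\<bar>2 - (tau t)\<^sup>2 * y $ c\<bar> / (2 * tau t) \<le> B t (?S t y)" "\<And>k. k\<in>K ==> \<bar>y $ k / tau t\<bar> \<le> B t (?S t y)"
  using st[of t "?S t y"] SI SK unfolding strip_def Sc by auto
  have A1: "1 \<le> A'" using S(1) taup by (simp add: A'_def)
  have Ac: "\<bar>y $ c\<bar> \<le> A'" using S(2) taup by (simp add: A'_def field_simps abs_mult power2_eq_square)
  have AI: "\<forall>k\<in>I. \<bar>y $ k\<bar> \<le> A'" using S(3) taup by (auto simp: A'_def field_simps abs_mult)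
  have Bc: "1 \<le> B'"
  proof -
  have "\<bar>(tau t)\<^sup>2 * y $ c\<bar> < 1/2" using True Sc by simp
  then have "1 \<le> \<bar>2 - (tau t)\<^sup>2 * y $ c\<bar>" by linarith
  also have "\<dots> \<le> B'" using S(4) taup by (simp add: B'_def field_simps)
  finally show ?thesis .
  qed
  have BK: "\<forall>k\<in>K. \<bar>y $ k\<bar> \<le> B'"
  proof
  fix k assume "k \<in> K"
  then have "\<bar>y $ k\<bar> \<le> tau t * B t (?S t y)" using S(5) taup by (auto simp: field_simps)
  moreover have "0 \<le> \<bar>y $ k\<bar>" by simp
  ultimately show "\<bar>y $ k\<bar> \<le> B'" unfolding B'_def by linarith
  qed
  have AB: "2 * B t (?S t y) * A t (?S t y) = A' * B'" using taup by (simp add: A'_def B'_def)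
  have "norm (F t (?S t y)) \<le> Mc * 2 powr kappa * (wt kappa (c0 / 2) m (A' * B'))"
  using F'[of t "?S t y"] strip_nonneg[OF st[of t "?S t y"] taup] unfolding AB[symmetric] 
  by (subst strip_refl_weight[symmetric]) auto
  also have "\<dots> \<le> Mc * 2 powr kappa * (D / Lam 0 ^ 1 * (G0 (y $ c) * ((\<Prod>k\<in>I. G0 (y $ k)) * (\<Prod>k\<in>K. G0 (y $ k)))))"
  using nd[rule_format, of A' B' "%k. y $ k" "y $ c" 0] A1 Ac AI Bc BK Mc by (intro mult_left_mono) (auto simp: kappa_def)
  also have "\<dots> = w y"
  proof -
  have "(\<Prod>k\<in>J. (if k = e then indicator {0..1} else G0) (y $ k)) = (\<Prod>k\<in>J. G0 (y $ k))" if "e \<notin> J" for J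
  using that by (intro prod.cong) auto
  then show ?thesis unfolding w_def splitting_prod[OF sp] using ne True Sc by (simp add: Lam_def)
  qed
  finally show ?thesis using True by simp
  qed
  have pt: "((%t. indicator ?V (?S t y) *\<^sub>R F t (?S t y)) \<longlongrightarrow> indicator {0..1} (y $ e) *\<^sub>R F0 y) at_top" for y
  proof -
  have "((%t. \<bar>(tau t)\<^sup>2 * y $ c\<bar>) \<longlongrightarrow> \<bar>0\<^sup>2 * y $ c\<bar>) at_top" by (intro tendsto_intros tau(2))
  then have "\<forall>\<^sub>F t in at_top. \<bar>(tau t)\<^sup>2 * y $ c\<bar> < 1/2" by (rule order_tendstoD) simp
  then have "\<forall>\<^sub>F t in at_top. indicator ?V (?S t y) *\<^sub>R F t (?S t y) = indicator {0..1} (y $ e) *\<^sub>R F t (?S t y)"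
  by eventually_elim (use ne in \<open>auto simp: squeeze_def indicator_def\<close>)
  moreover have "((%t. indicator {0..1} (y $ e) *\<^sub>R F t (?S t y)) \<longlongrightarrow> indicator {0..1} (y $ e) *\<^sub>R F0 y) at_top"
  by (intro tendsto_intros lim)
  ultimately show ?thesis by (rule iffD2[OF tendsto_cong])
  qed
  have meas: "(%y. indicator ?V (?S t y) *\<^sub>R F t (?S t y)) \<in> borel_measurable lborel" for t by measurable
  \<comment> \<open>Measurability of the limit function comes from convergence along the
    integers.\<close>
  have F0m: "(%y. indicator {0..1} (y $ e) *\<^sub>R F0 y) \<in> borel_measurable lborel"
  proof (rule borel_measurable_LIMSEQ_metric[of "%n y. indicator ?V (?S (real n) y) *\<^sub>R F (real n) (?S (real n) y)"])
  show "(%n. indicator ?V (?S (real n) y) *\<^sub>R F (real n) (?S (real n) y)) \<longlonglongrightarrow> indicator {0..1} (y $ e) *\<^sub>R F0 y" for y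
  by (rule filterlim_compose[OF pt filterlim_real_sequentially])
  qed (rule meas)
  show ?thesis unfolding eq
  proof (rule integral_dominated_convergence_at_top[OF F0m meas w_int])
  show "\<forall>\<^sub>F t in at_top. AE y in lborel. norm (indicator ?V (?S t y) *\<^sub>R F t (?S t y)) \<le> w y"
  using ev by eventually_elim (intro AE_I2 dom)
  show "AE y in lborel. ((%t. indicator ?V (?S t y) *\<^sub>R F t (?S t y)) \<longlongrightarrow> indicator {0..1} (y $ e) *\<^sub>R F0 y) at_top"
  by (intro AE_I2 pt)
  qed
 qed
 from tendsto_add[OF limU limV] show ?thesis unfolding split by (simp add: scaleR_add_right)
qed

text \<open>Reflecting x_c to 2 - x_c exchanges I and K and reduces this to
  \<open>strip_limit\<close>.\<close>

lemma strip_limit_refl: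
 fixes c e :: "'n::finite" and c0 :: real and F :: "real => 'n rvec => complex"
 assumes sp: "splitting c e I K" and c0: "0 < c0" and K: "card I = card K + 1" and Mc: "0 \<le> Mc"
  and tau: "\<And>t. 0 < tau t" "(tau \<longlongrightarrow> 0) at_top"
  and st: "\<And>t x. strip c I K (tau t) (A t x) (B t x) x"
  and F: "\<And>t. F t \<in> borel_measurable borel"
  and bound: "\<And>t x. norm (F t x) \<le> Mc * (wt (real (card I)) c0 (1 + 2 * (card I + card K + 1)) (A t x * B t x))"
  and lim: "\<And>y. ((%t. F t (refl_at c (squeeze c K I (tau t) y))) \<longlongrightarrow> F0 y) at_top"
 shows "((%t. (1 / tau t) *\<^sub>R (LINT x|lborel. indicator {0..1} (x $ e) *\<^sub>R F t x)) \<longlongrightarrow> (LINT y|lborel. indicator {0..1} (y $ e) *\<^sub>R F0 y)) at_top"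
proof -
 have ce: "e ~= c" "c \<notin> I \<union> K" using sp by (auto simp: splitting_def)
 have [measurable]: "F t \<in> borel_measurable borel" for t by (rule F)
 have c2: "0 < c0 / 2" and Mc2: "0 \<le> Mc * 2 powr (real (card I))" using c0 Mc by auto
 have "((%t. (1 / tau t) *\<^sub>R (LINT x|lborel. indicator {0..1} (x $ e) *\<^sub>R F t (refl_at c x))) \<longlongrightarrow> (LINT y|lborel. indicator {0..1} (y $ e) *\<^sub>R F0 y)) at_top"
 proof (rule strip_limit[OF splitting_swap[OF sp] c2 K Mc2 tau])
  fix t x
  have s: "strip c I K (tau t) (A t (refl_at c x)) (B t (refl_at c x)) (refl_at c x)" by (rule st)
  show "strip c K I (tau t) (2 * B t (refl_at c x)) (A t (refl_at c x)) x" by (rule strip_refl[OF s ce(2) tau(1)])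
  show "norm (F t (refl_at c x)) \<le> Mc * 2 powr (real (card I)) * (wt (real (card I)) (c0 / 2) (1 + 2 * (card K + card I + 1)) (2 * B t (refl_at c x) * A t (refl_at c x)))"
  using bound[of t "refl_at c x"] strip_nonneg[OF s tau(1)] by (subst strip_refl_weight[symmetric]) (auto simp: add.commute)
  show "(%x. F t (refl_at c x)) \<in> borel_measurable borel" by measurable
 qed (rule lim)
 moreover have "(LINT x|lborel. indicator {0..1} (x $ e) *\<^sub>R F t (refl_at c x)) = (LINT x|lborel. indicator {0..1} (x $ e) *\<^sub>R F t x)" for t
  using integral_refl_at(2)[of "%x. indicator {0..1} (x $ e) *\<^sub>R F t x" c] ce by simp
 ultimately show ?thesis by simp
qed

subsection \<open>Schwartz functions\<close>

lemma schwartz_invariant: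
 fixes phi :: "'n::{finite,linorder} rmat => complex"
 assumes n: "CARD('n) \<ge> 2" and phi: "phi \<in> schwartz" and g: "g \<in> carrier SL" "g' \<in> carrier SL" and eq: "orb g = orb g'"
 shows "phi g = phi g'"
proof -
 have "matrix_inv g ** g' \<in> Hgrp" using orb_eq_iff[OF n g] eq by simp
 then have "phi (g ** (matrix_inv g ** g')) = phi g" using phi g by (auto simp: schwartz_def)
 then show ?thesis by (simp add: SL_cancel_left g)
qed

lemma schwartz_continuous:
 fixes phi :: "'n::{finite,linorder} rmat => complex"
 assumes phi: "phi \<in> schwartz"
 shows "continuous_on (carrier SL) phi"
 unfolding continuous_on_def
proof
 fix g :: "'n rmat" assume g: "g \<in> carrier SL"
 have "smooth_on_SL phi" using phi by (simp add: schwartz_def)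
 then obtain U F where U: "open U" "g \<in> U" "\<forall>k. Ck_on k F U" "\<And>x. x \<in> U \<inter> carrier SL ==> F x = phi x"
  using g unfolding smooth_on_SL_def by meson
 have "Ck_on 0 F U" using U(3) by blast
 then have "continuous_on U F" by simp
 then have "isCont F g" using U by (simp add: continuous_on_eq_continuous_at)
 then have "(F \<longlongrightarrow> F g) (at g within carrier SL)"
  using continuous_at_imp_continuous_within continuous_within by blast
 moreover have "eventually (%x. F x = phi x) (at g within carrier SL)"
  unfolding eventually_at_topological using U by (intro exI[of _ U]) auto
 ultimately show "(phi \<longlongrightarrow> phi g) (at g within carrier SL)"
  using U(4)[of g] U(2) g by (auto elim!: Lim_transform_eventually)
qed

lemma orb_idem:
 fixes g :: "'n::{finite,linorder} rmat"
 assumes n: "CARD('n) \<ge> 2" and g: "g \<in> carrier SL"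
 shows "orb g ** orb g = orb g"
proof -
 have "(uvec v* matrix_inv g) \<bullet> (g *v uvec) = 1"
  by (simp add: dot_lmul_matrix SL_cancel_vec[OF g] uvec_inner[OF n])
 then show ?thesis by (simp add: orb_def mult_outer outer_mult_vec)
qed

lemma det_scaleR_matrix:
 fixes A :: "'n::finite rmat"
 shows "det (c *\<^sub>R A) = c ^ CARD('n) * det A"
proof -
 have "c *\<^sub>R A = dg (\<chi> k. c) ** A" by (simp add: vec_eq_iff)
 then show ?thesis by (simp add: det_mul det_dg)
qed

text \<open>If \<open>X\<close> and \<open>X'\<close> are involutions, then \<open>(1 + X' X)/2\<close> intertwines them and is close to \<open>1\<close>
 when \<open>X'\<close> is close to \<open>X\<close>. This replaces a local section of \<open>G \<rightarrow> G/H\<close>.\<close>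

lemma schwartz_tendsto:
 fixes phi :: "'n::{finite,linorder} rmat => complex"
 assumes n: "CARD('n) \<ge> 2" and phi: "phi \<in> schwartz" and g: "g \<in> carrier SL" and G: "\<And>t. G t \<in> carrier SL"
  and lim: "((%t. orb (G t)) \<longlongrightarrow> orb g) F"
 shows "((%t. phi (G t)) \<longlongrightarrow> phi g) F"
proof -
 define X where "X t = mat 1 - 2 *\<^sub>R orb (G t)" for t
 define Y where "Y = mat 1 - 2 *\<^sub>R orb g"
 have XX: "X t ** X t = mat 1" for t
  by (simp add: X_def orb_idem[OF n G] vec_eq_iff)
 have YY: "Y ** Y = mat 1" by (simp add: Y_def orb_idem[OF n g] vec_eq_iff)
 define h where "h t = (1/2) *\<^sub>R (mat 1 + X t ** Y)" for t
 have cm: "continuous_on UNIV (%A :: 'n rmat. A ** B)" for B :: "'n rmat" by (intro continuous_intros)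
 have "(X \<longlongrightarrow> Y) F" unfolding X_def Y_def by (intro tendsto_intros lim)
 then have "((%t. X t ** Y) \<longlongrightarrow> Y ** Y) F"
  using continuous_on_tendsto_compose[OF cm, of X Y F Y] by simp
 then have "(h \<longlongrightarrow> (1/2) *\<^sub>R (mat 1 + mat 1)) F" unfolding h_def by (intro tendsto_intros) (simp add: YY)
 then have hlim: "(h \<longlongrightarrow> mat 1) F" by (simp flip: scaleR_2)
 have cd: "continuous_on UNIV (det :: 'n rmat => real)"
  unfolding det_def by (intro continuous_intros)
 then have dlim: "((%t. det (h t)) \<longlongrightarrow> 1) F"
  using continuous_on_tendsto_compose[OF cd hlim] by simp
 \<comment> \<open>Normalizes the determinant of the intertwiner to 1; this determinant tends to 1,
   so it is eventually positive.\<close>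
 define c where "c t = 1 / root CARD('n) (det (h t))" for t
 have n0: "0 < CARD('n)" by simp
 have "((%t. 1 / root CARD('n) (det (h t))) \<longlongrightarrow> 1 / root CARD('n) 1) F"
  by (intro tendsto_divide tendsto_const tendsto_real_root dlim) simp
 moreover have "1 / root CARD('n) 1 = (1 :: real)" by simp
 ultimately have clim: "(c \<longlongrightarrow> 1) F" unfolding c_def[abs_def] by (simp only:)
 have lim2: "((%t. (c t *\<^sub>R h t) ** g) \<longlongrightarrow> g) F"
 proof -
  have "((%t. c t *\<^sub>R h t) \<longlongrightarrow> 1 *\<^sub>R mat 1) F" by (intro tendsto_intros clim hlim)
  then show ?thesis using continuous_on_tendsto_compose[OF cm[of g], of "%t. c t *\<^sub>R h t" "mat 1" F] by simp
 qed
 have ev: "eventually (%t. (c t *\<^sub>R h t) ** g \<in> carrier SL \<and> phi ((c t *\<^sub>R h t) ** g) = phi (G t)) F"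
 proof -
  have "eventually (%t. det (h t) > 0) F" by (rule order_tendstoD(1)[OF dlim]) simp
  then show ?thesis
  proof (rule eventually_mono)
  fix t assume d: "det (h t) > 0"
  define k where "k = c t *\<^sub>R h t"
  have "det k = (c t) ^ CARD('n) * det (h t)" by (simp add: k_def det_scaleR_matrix)
  also have "(c t) ^ CARD('n) = 1 / det (h t)"
  using d by (simp add: c_def power_one_over real_root_pow_pos2)
  finally have kS: "k \<in> carrier SL" using d by (simp add: mem_SL)
  \<comment> \<open>Both sides equal (X + Y) / 2, as X and Y are involutions.\<close>
  have "X t ** h t = h t ** Y"
  by (simp add: h_def XX matrix_mul_assoc) (simp add: YY flip: matrix_mul_assoc)
  then have "X t ** k = k ** Y" by (simp add: k_def)
  then have "orb (G t) ** k = k ** orb g" by (simp add: X_def Y_def)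
  then have "orb (G t) ** k ** matrix_inv k = k ** orb g ** matrix_inv k" by simp
  then have "orb (G t) = orb (k ** g)" by (simp add: orb_mult[OF kS g] SL_cancel_left[OF kS])
  then show "(c t *\<^sub>R h t) ** g \<in> carrier SL \<and> phi ((c t *\<^sub>R h t) ** g) = phi (G t)"
  unfolding k_def[symmetric] using schwartz_invariant[OF n phi SL_mult[OF kS g] G] kS g by auto
  qed
 qed
 have "((%t. phi ((c t *\<^sub>R h t) ** g)) \<longlongrightarrow> phi g) F"
  by (rule continuous_on_tendsto_compose[OF schwartz_continuous[OF phi] lim2 g]) (use ev in \<open>auto elim: eventually_mono\<close>)
 then show ?thesis by (rule Lim_transform_eventually) (use ev in \<open>auto elim: eventually_mono\<close>)
qed

section \<open>Householder reflections and the polar decomposition of G/H\<close>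

definition refl_mat :: "'n::finite rvec => 'n rmat" where
 "refl_mat v = mat 1 - (2 / (v \<bullet> v)) *\<^sub>R outer v v"

lemma refl_mat_vec: "refl_mat v *v x = x - (2 * (v \<bullet> x) / (v \<bullet> v)) *\<^sub>R v"
 by (simp add: refl_mat_def matrix_vector_mult_diff_rdistrib outer_mult_vec scaleR_matrix_vector_assoc[symmetric])

lemma refl_mat_orthogonal: "orthogonal_matrix (refl_mat v)"
proof -
 have "transpose (refl_mat v) = refl_mat v"
  by (simp add: refl_mat_def transpose_def vec_eq_iff mat_def)
 moreover have "refl_mat v ** refl_mat v = mat 1"
 proof (cases "v = 0")
  case False
  have "outer v v ** outer v v = (v \<bullet> v) *\<^sub>R outer v v"
  by (simp add: mult_outer outer_mult_vec outer_scaleR)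
  then show ?thesis using False by (simp add: refl_mat_def) (simp add: vec_eq_iff)
 qed (simp add: refl_mat_def)
 ultimately show ?thesis by (simp add: orthogonal_matrix_def)
qed

lemma refl_mat_swap:
 assumes "norm p = norm p'"
 shows "refl_mat (p - p') *v p = p'"
proof (cases "p = p'")
 case False
 have pp: "p \<bullet> p = p' \<bullet> p'" using assms by (simp add: norm_eq)
 then have eq: "(p - p') \<bullet> (p - p') = 2 * ((p - p') \<bullet> p)"
  by (simp add: inner_diff_left inner_diff_right inner_commute)
 have ne: "(p - p') \<bullet> (p - p') ~= 0" using False by simp
 have "2 * ((p - p') \<bullet> p) / ((p - p') \<bullet> (p - p')) = 1" unfolding eq[symmetric] by (rule divide_self[OF ne])
 then show ?thesis unfolding refl_mat_vec by (simp only: scaleR_one) simp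
qed (simp add: refl_mat_vec)

text \<open>Conjugating by a rotation that takes a basis vector to the direction of e makes the
  reflection diagonal with a single entry -1.\<close>

lemma det_refl_mat:
 fixes e :: "'n::finite rvec"
 assumes n: "CARD('n) \<ge> 2" and e: "e ~= 0"
 shows "det (refl_mat e) = - 1"
proof -
 fix i :: 'n
 define e1 where "e1 = e /\<^sub>R norm e"
 have e1: "norm e1 = 1" using e by (simp add: e1_def)
 obtain f where f: "orthogonal_transformation f" "det (matrix f) = 1" "f (axis i 1) = e1"
  using rotation_exists[of "axis i 1" e1] n e1 by auto
 define h where "h = matrix f"
 have oh: "orthogonal_matrix h" using f(1) by (simp add: h_def orthogonal_transformation_matrix)
 have hv: "h *v axis i 1 = e1" using f by (simp add: h_def orthogonal_transformation_def)
 have hv': "axis i 1 v* transpose h = e1" using hv by (metis transpose_matrix_vector transpose_transpose)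
 have "h ** (mat 1 - 2 *\<^sub>R outer (axis i 1) (axis i 1)) ** transpose h = refl_mat e"
 proof -
  have "h ** (mat 1 - 2 *\<^sub>R outer (axis i 1) (axis i 1)) ** transpose h = mat 1 - 2 *\<^sub>R outer e1 e1"
  using oh by (simp add: mult_outer outer_mult hv hv' orthogonal_matrix_def)
  also have "outer e1 e1 = (1 / (e \<bullet> e)) *\<^sub>R outer e e"
  by (simp add: e1_def vec_eq_iff power2_eq_square[symmetric] divide_simps flip: power2_norm_eq_inner)
  finally show ?thesis by (simp add: refl_mat_def)
 qed
 then have "det (refl_mat e) = det h * det (mat 1 - 2 *\<^sub>R outer (axis i 1) (axis i 1 :: 'n rvec)) * det h"
  by (metis det_mul det_transpose)
 also have "mat 1 - 2 *\<^sub>R outer (axis i 1) (axis i 1 :: 'n rvec) = dg (\<chi> k. if k = i then - 1 else 1)"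
  by (auto simp: vec_eq_iff mat_def axis_def dg_nth)
 also have "det \<dots> = - 1" unfolding det_dg
  by (subst prod.remove[of _ i]) (auto intro!: prod.neutral)
 finally show ?thesis using f(2) by (simp add: h_def)
qed

text \<open>One reflection takes p to p'. A second one corrects q and fixes p', because equal inner
  products make q1 - q' orthogonal to p'. If the determinant is -1, a reflection along a vector
  orthogonal to p' and q' repairs it; n \<ge> 3 provides such a vector.\<close>

lemma pair_rotation:
 fixes p q p' q' :: "'n::finite rvec"
 assumes n: "CARD('n) \<ge> 3" and eq: "norm p = norm p'" "norm q = norm q'" "p \<bullet> q = p' \<bullet> q'"
 obtains k where "k \<in> SO" "k *v p = p'" "k *v q = q'"
proof -
 have ot: "(A *v x) \<bullet> (A *v y) = x \<bullet> y" if "orthogonal_matrix A" for A :: "'n rmat" and x y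
 proof -
  have "(A *v x) \<bullet> (A *v y) = (x v* transpose A) \<bullet> (A *v y)" by (metis transpose_matrix_vector transpose_transpose)
  also have "\<dots> = x \<bullet> (transpose A *v (A *v y))" by (rule dot_lmul_matrix)
  finally show ?thesis using that by (simp add: matrix_vector_mul_assoc orthogonal_matrix_def)
 qed
 have on: "norm (A *v x) = norm x" if "orthogonal_matrix A" for A :: "'n rmat" and x
  using ot[OF that, of x x] by (simp add: norm_eq)
 define k1 where "k1 = refl_mat (p - p')"
 have k1: "orthogonal_matrix k1" "k1 *v p = p'" by (simp_all add: k1_def refl_mat_orthogonal refl_mat_swap eq)
 define q1 where "q1 = k1 *v q"
 define k2 where "k2 = refl_mat (q1 - q')"
 have nq: "norm q1 = norm q'" using on[OF k1(1), of q] eq by (simp add: q1_def)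
 have k2: "orthogonal_matrix k2" "k2 *v q1 = q'" by (simp_all add: k2_def refl_mat_orthogonal refl_mat_swap nq)
 have "p' \<bullet> q1 = p \<bullet> q" using ot[OF k1(1), of p q] k1(2) by (simp add: q1_def)
 then have "(q1 - q') \<bullet> p' = 0" using eq by (simp add: inner_diff_left inner_diff_right inner_commute)
 then have k2p: "k2 *v p' = p'" by (simp add: k2_def refl_mat_vec)
 define k where "k = k2 ** k1"
 have k: "orthogonal_matrix k" "k *v p = p'" "k *v q = q'"
  using k1 k2 k2p by (simp_all add: k_def orthogonal_matrix_mul q1_def flip: matrix_vector_mul_assoc)
 show thesis
 proof (cases "det k = 1")
  case True
  then show ?thesis using that k by (simp add: SO_def)
 next
  case False
  then have dk: "det k = - 1" using det_orthogonal_matrix[OF k(1)] by auto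
  have "dim {p', q'} < DIM('n rvec)"
  proof -
  have "dim {p', q'} \<le> card {p', q'}" by (rule dim_le_card') simp
  also have "card {p', q'} \<le> 2" by (simp add: card_insert_if)
  finally show ?thesis using n by simp
  qed
  then obtain e where e: "e ~= 0" "\<And>x. x \<in> span {p', q'} ==> orthogonal e x"
  using orthogonal_to_subspace_exists by metis
  have "e \<bullet> p' = 0" "e \<bullet> q' = 0" using e(2)[of p'] e(2)[of q'] by (simp_all add: span_base orthogonal_def)
  then have "refl_mat e *v p' = p'" "refl_mat e *v q' = q'" by (simp_all add: refl_mat_vec)
  moreover have "det (refl_mat e ** k) = 1" using det_refl_mat[of e] e(1) n dk by (simp add: det_mul)
  ultimately show ?thesis using that[of "refl_mat e ** k"] k
  by (simp add: SO_def orthogonal_matrix_mul refl_mat_orthogonal flip: matrix_vector_mul_assoc)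
 qed
qed


text \<open>Pairs of vectors with pairing 1 are classified under rotations by their two norms, and
  after balancing only the product of the norms remains; for \<open>a_elt t\<close> it is cosh (2
  t).\<close>

lemma polar_decomposition:
 fixes g :: "'n::{finite,linorder} rmat"
 assumes n: "CARD('n) \<ge> 3" and g: "g \<in> carrier SL"
 obtains k t where "k \<in> SO" "orb (k ** a_elt t) = orb g" "norm (orb g) = cosh (2 * t)" "k ** a_elt t \<in> carrier SL"
proof -
 have n2: "CARD('n) \<ge> 2" using n by simp
 have fl: "(first_ix :: 'n) ~= last_ix" by (rule first_neq_last[OF n2])
 define xi where "xi = g *v uvec"
 define eta where "eta = uvec v* matrix_inv g"
 have etaxi: "eta \<bullet> xi = 1"
  by (simp add: xi_def eta_def dot_lmul_matrix SL_cancel_vec[OF g] uvec_inner[OF n2])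
 have nz: "xi ~= 0" "eta ~= 0" using etaxi by auto
 have og: "orb g = outer xi eta" by (simp add: orb_def xi_def eta_def)
 have ge1: "1 \<le> norm xi * norm eta" using Cauchy_Schwarz_ineq2[of eta xi] etaxi by (simp add: mult.commute)
 define t where "t = arcosh (norm xi * norm eta) / 2"
 have ct: "cosh (2 * t) = norm xi * norm eta" using ge1 by (simp add: t_def)
 have a_dg: "a_elt s = dg (\<chi> k :: 'n. if k = first_ix then exp s else if k = last_ix then exp (- s) else 1)" for s
  by (auto simp: a_elt_def dg_def vec_eq_iff)
 have a_inv: "matrix_inv (a_elt s) = (a_elt (- s) :: 'n rmat)" for s
 proof (rule matrix_inv_eqI)
  show "a_elt s ** a_elt (- s) = (mat 1 :: 'n rmat)"
  unfolding a_dg dg_mult by (auto simp: vec_eq_iff dg_nth mat_def exp_minus)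
 qed
 have a_SL: "(a_elt s :: 'n rmat) \<in> carrier SL" for s
 proof -
  have "(\<Prod>k\<in>UNIV. if k = first_ix then exp s else if k = (last_ix :: 'n) then exp (- s) else 1) =
  (\<Prod>k\<in>{first_ix, last_ix :: 'n}. if k = first_ix then exp s else if k = last_ix then exp (- s) else 1)"
  by (rule prod.mono_neutral_right) auto
  then show ?thesis using fl by (simp add: mem_SL a_dg det_dg exp_minus)
 qed
 define p where "p = a_elt t *v (uvec :: 'n rvec)"
 define q where "q = a_elt (- t) *v (uvec :: 'n rvec)"
 have u: "uvec $ k = (if k = first_ix \<or> k = last_ix then 1 / sqrt 2 else 0)" for k :: 'n
  using fl by (auto simp: uvec_def axis_def)
 have in2: "x \<bullet> y = x $ first_ix * y $ first_ix + x $ last_ix * y $ last_ix"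
  if "\<And>k. k ~= first_ix ==> k ~= last_ix ==> x $ k = 0" for x y :: "'n rvec"
 proof -
  have "x \<bullet> y = (\<Sum>k\<in>{first_ix, last_ix}. x $ k * y $ k)"
  unfolding inner_vec_def inner_real_def by (rule sum.mono_neutral_right) (auto simp: that)
  then show ?thesis using fl by simp
 qed
 have au: "(a_elt s *v (uvec :: 'n rvec)) $ k = (if k = first_ix then exp s / sqrt 2 else if k = last_ix then exp (- s) / sqrt 2 else 0)" for s k
  by (simp add: a_dg u)
 have pp: "p \<bullet> p = cosh (2 * t)" "q \<bullet> q = cosh (2 * t)" "p \<bullet> q = 1"
 proof -
  have "(a_elt s *v (uvec :: 'n rvec)) \<bullet> (a_elt s' *v uvec) = cosh (s + s')" for s s'
  proof -
  have "(a_elt s *v (uvec :: 'n rvec)) \<bullet> (a_elt s' *v uvec) =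
  exp s / sqrt 2 * (exp s' / sqrt 2) + exp (- s) / sqrt 2 * (exp (- s') / sqrt 2)"
  using fl by (subst in2) (simp_all add: au)
  also have "\<dots> = (exp s * exp s' + exp (- s) * exp (- s')) / 2" by (simp add: add_divide_distrib)
  finally show ?thesis by (simp add: cosh_def flip: exp_add)
  qed
  from this[of t t] this[of "- t" "- t"] this[of t "- t"]
  show "p \<bullet> p = cosh (2 * t)" "q \<bullet> q = cosh (2 * t)" "p \<bullet> q = 1"
  by (simp_all add: p_def q_def flip: mult_2)
 qed
 \<comment> \<open>Scaling the two vectors inversely does not change the idempotent; this s makes
   their norms equal, as they are for \<open>a_elt t\<close>.\<close>
 define s where "s = sqrt (norm eta / norm xi)"
 have s0: "s > 0" using nz by (simp add: s_def)
 have s2: "s * s = norm eta / norm xi" by (simp add: s_def)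
 have "norm (s *\<^sub>R xi) = norm p" "norm ((1/s) *\<^sub>R eta) = norm q"
 proof -
  have "(norm (s *\<^sub>R xi))\<^sup>2 = (s * s) * (norm xi)\<^sup>2" by (simp add: power_mult_distrib power2_eq_square)
  also have "\<dots> = (norm p)\<^sup>2" using nz by (simp add: s2 power2_norm_eq_inner pp ct) (simp add: power2_norm_eq_inner[symmetric] power2_eq_square)
  finally show "norm (s *\<^sub>R xi) = norm p" by (simp add: power2_eq_iff_nonneg)
  have "(norm ((1/s) *\<^sub>R eta))\<^sup>2 = (norm eta)\<^sup>2 / (s * s)" using s0 by (simp add: power_mult_distrib power2_eq_square divide_simps)
  also have "\<dots> = (norm q)\<^sup>2" using nz by (simp add: s2 power2_norm_eq_inner pp ct) (simp add: power2_norm_eq_inner[symmetric] power2_eq_square)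
  finally show "norm ((1/s) *\<^sub>R eta) = norm q" by (simp add: power2_eq_iff_nonneg)
 qed
 moreover have "p \<bullet> q = (s *\<^sub>R xi) \<bullet> ((1/s) *\<^sub>R eta)" using pp etaxi s0 by (simp add: inner_commute)
 ultimately obtain k where k: "k \<in> SO" "k *v p = s *\<^sub>R xi" "k *v q = (1/s) *\<^sub>R eta"
  using pair_rotation[OF n, of p "s *\<^sub>R xi" q "(1/s) *\<^sub>R eta"] by metis
 have kS: "k \<in> carrier SL" using k by (simp add: SO_def mem_SL)
 have kinv: "matrix_inv k = transpose k"
  using k(1) by (intro matrix_inv_eqI) (simp add: SO_def orthogonal_matrix_def)
 have ta: "transpose (a_elt s :: 'n rmat) = a_elt s" for s by (auto simp: transpose_def a_elt_def vec_eq_iff)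
 have "uvec v* matrix_inv (k ** a_elt t) = k *v q"
 proof -
  have "uvec v* matrix_inv (k ** a_elt t) = (uvec v* a_elt (- t)) v* transpose k"
  unfolding SL_inv_mult[OF kS a_SL] a_inv kinv by (rule vector_matrix_mul_assoc[symmetric])
  also have "uvec v* a_elt (- t) = q"
  unfolding q_def by (metis ta transpose_matrix_vector)
  also have "q v* transpose k = k *v q" by (rule vector_transpose_matrix)
  finally show ?thesis .
 qed
 then have "orb (k ** a_elt t) = outer (k *v p) (k *v q)"
  by (simp add: orb_def p_def matrix_vector_mul_assoc)
 also have "\<dots> = orb g" using s0 by (simp add: k og outer_scaleR)
 finally have oe: "orb (k ** a_elt t) = orb g" .
 show thesis
 proof (rule that[OF k(1) oe])
  show "k ** a_elt t \<in> carrier SL" by (rule SL_mult[OF kS a_SL])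
  show "norm (orb g) = cosh (2 * t)" unfolding og norm_outer by (rule ct[symmetric])
 qed
qed

text \<open>Since norm (orb g) = cosh (2 t) \<le> 2 (cosh t)^2, the weight (cosh t)^(n - 1)
  dominates the norm to the power (n - 1)/2 up to a constant, and 1 + |t| is at least half of
  \<open>Lam\<close> of the norm.\<close>

lemma schwartz_bound:
 fixes phi :: "'n::{finite,linorder} rmat => complex"
 assumes n: "CARD('n) \<ge> 3" and phi: "phi \<in> schwartz"
 shows "\<exists>C\<ge>0. \<forall>g\<in>carrier SL. norm (phi g) \<le> C * (norm (orb g) powr (- ((real CARD('n) - 1) / 2)) / Lam (norm (orb g)) ^ m)"
proof -
 have n2: "CARD('n) \<ge> 2" using n by simp
 have "\<forall>D\<in>Ug_ops. \<forall>m. bdd_above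
  ((%(k, t). cosh t ^ (CARD('n) - 1) * (1 + \<bar>t\<bar>) ^ m * norm (D phi (k ** a_elt t))) ` (SO \<times> UNIV))"
  using phi by (simp add: schwartz_def)
 from spec[OF bspec[OF this Ug_one], of m] have "bdd_above ((%(k, t). cosh t ^ (CARD('n) - 1) * (1 + \<bar>t\<bar>) ^ m * norm (phi (k ** a_elt t))) ` (SO \<times> UNIV))"
  by simp
 then obtain D where D: "\<And>k t. k \<in> SO ==> cosh t ^ (CARD('n) - 1) * (1 + \<bar>t\<bar>) ^ m * norm (phi (k ** a_elt t)) \<le> D"
  unfolding bdd_above_def by auto
 have one_SO: "mat 1 \<in> (SO :: 'n rmat set)" by (simp add: SO_def orthogonal_matrix_id)
 have "norm (phi (mat 1 ** a_elt 0)) \<le> D" using D[OF one_SO, of 0] by simp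
 then have D0: "0 \<le> D" by (rule order_trans[OF norm_ge_zero])
 define kappa where "kappa = (real CARD('n) - 1) / 2"
 have kappa0: "kappa \<ge> 0" using n by (simp add: kappa_def)
 define C where "C = D * 2 powr kappa * 2 ^ m"
 have "norm (phi g) \<le> C * (norm (orb g) powr (- kappa) / Lam (norm (orb g)) ^ m)" if g: "g \<in> carrier SL" for g
 proof -
  obtain k t where k: "k \<in> SO" "orb (k ** a_elt t) = orb g" "norm (orb g) = cosh (2 * t)" "k ** a_elt t \<in> carrier SL"
  by (rule polar_decomposition[OF n g])
  define X where "X = norm (orb g)"
  have X1: "X \<ge> 1" using k(3) cosh_real_ge_1[of "2 * t"] by (simp add: X_def)
  have "phi g = phi (k ** a_elt t)" using schwartz_invariant[OF n2 phi g k(4)] k(2) by simp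
  then have b: "cosh t ^ (CARD('n) - 1) * (1 + \<bar>t\<bar>) ^ m * norm (phi g) \<le> D" using D[OF k(1)] by simp
  have c2: "(cosh t)\<^sup>2 \<ge> X / 2"
  using k(3) cosh_real_ge_1[of "2 * t"] cosh_double_cosh[of t] by (simp add: X_def)
  have cosh1: "cosh t ^ (CARD('n) - 1) \<ge> (X / 2) powr kappa"
  proof -
  have "(X / 2) powr kappa \<le> ((cosh t)\<^sup>2) powr kappa" using c2 X1 kappa0 by (intro powr_mono2) auto
  also have "(cosh t)\<^sup>2 = cosh t powr 2" by (simp add: powr_numeral)
  also have "(cosh t powr 2) powr kappa = cosh t powr (real (CARD('n) - 1))"
  using n by (subst powr_powr) (simp add: kappa_def of_nat_diff diff_divide_distrib)
  also have "\<dots> = cosh t ^ (CARD('n) - 1)" by (rule powr_realpow) (rule cosh_real_pos)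
  finally show ?thesis .
  qed
  have lam: "Lam X \<le> 2 * (1 + \<bar>t\<bar>)"
  proof -
  have "cosh (2 * t) \<le> exp (2 * \<bar>t\<bar>)"
  proof -
  have "exp (2 * t) \<le> exp (2 * \<bar>t\<bar>)" "exp (- (2 * t)) \<le> exp (2 * \<bar>t\<bar>)" by auto
  then have "exp (2 * t) + exp (- (2 * t)) \<le> exp (2 * \<bar>t\<bar>) * 2"
  unfolding mult_2_right by (rule add_mono)
  then show ?thesis unfolding cosh_field_def by (simp only: divide_le_eq_numeral1)
  qed
  then have "1 + X \<le> 2 * exp (2 * \<bar>t\<bar>)" 
  unfolding mult_2[of "exp (2 * \<bar>t\<bar>)"] X_def k(3) by (intro add_mono) auto
  then have "ln (1 + X) \<le> ln (2 * exp (2 * \<bar>t\<bar>))" using X1 by (subst ln_le_cancel_iff) auto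
  also have "\<dots> = ln 2 + 2 * \<bar>t\<bar>" by (simp add: ln_mult)
  finally show ?thesis using ln_le_minus_one[of 2] by (simp add: Lam_def)
  qed
  have L1: "Lam X \<ge> 1" using X1 by (simp add: Lam_def)
  have "(X / 2) powr kappa * (Lam X / 2) ^ m * norm (phi g) \<le> D"
  proof (rule order_trans[OF _ b])
  have "(X / 2) powr kappa * (Lam X / 2) ^ m \<le> cosh t ^ (CARD('n) - 1) * (1 + \<bar>t\<bar>) ^ m"
  using cosh1 lam L1 by (intro mult_mono power_mono) (auto simp: cosh_real_nonneg)
  then show "(X / 2) powr kappa * (Lam X / 2) ^ m * norm (phi g) \<le> cosh t ^ (CARD('n) - 1) * (1 + \<bar>t\<bar>) ^ m * norm (phi g)"
  by (rule mult_right_mono) simp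
  qed
  then have "norm (phi g) * (X powr kappa * Lam X ^ m) \<le> D * 2 powr kappa * 2 ^ m"
  using X1 by (simp add: powr_divide power_divide field_simps)
  moreover have "X powr kappa * Lam X ^ m > 0" using X1 L1 by auto
  ultimately have "norm (phi g) \<le> C / (X powr kappa * Lam X ^ m)" by (simp add: C_def pos_le_divide_eq)
  then show ?thesis using X1 by (simp add: X_def[symmetric] powr_minus field_simps)
 qed
 moreover have "C \<ge> 0" using D0 by (simp add: C_def)
 ultimately show ?thesis unfolding kappa_def by blast
qed

section \<open>Horospherical integrals in coordinates\<close>

lemma orb_cos_rep:
 fixes g :: "'n::{finite,linorder} rmat"
 assumes n: "CARD('n) \<ge> 2" and p: "pivot g r i"
 shows "orb (cos_rep g r i x) = Ad g (outer (Xi i x) (Eta (wv g) i x))" "cos_rep g r i x \<in> carrier SL"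
proof -
 have g: "g \<in> carrier SL" using p by (simp add: pivot_def)
 have sU: "sec g r i x \<in> Uni" by (rule sec_Uni[OF p])
 show "cos_rep g r i x \<in> carrier SL" unfolding cos_rep_def using g Uni_SL[OF sU] by blast
 have "Xi i (qc g i (sec g r i x)) = Xi i x" "Eta (wv g) i (qc g i (sec g r i x)) = Eta (wv g) i x"
  unfolding qc_sec[OF n p] by (auto simp: Xi_def Eta_def vec_eq_iff intro!: sum.cong)
 then show "orb (cos_rep g r i x) = Ad g (outer (Xi i x) (Eta (wv g) i x))"
  unfolding cos_rep_def orb_conj[OF g Uni_SL[OF sU]] Uni_orbit[OF n p sU] by simp
qed

lemma self_l_coset:
 assumes "subgroup J SL" shows "x \<in> x <#\<^bsub>SL\<^esub> J"
 unfolding mem_l_coset using assms by (intro bexI[of _ "mat 1"]) (auto simp: subgroup_SL_iff)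

abbreviation (input) "invariant_on dn P \<equiv> nonzero_invariant_radon (unipotent_radical P) (unipotent_radical P \<inter> Hgrp) (dn P)"

text \<open>\<open>horosphere_measure\<close> combined with right invariance. The constant depends
  on the measure but neither on phi nor on h, which later lets one group element serve all Schwartz
  functions.\<close>

lemma hor_int_formula:
 fixes g :: "'n::{finite,linorder} rmat"
 assumes n: "CARD('n) \<ge> 2" and p: "pivot g r i"
  and ms: "invariant_on dn (Ad g ` Bup)"
 obtains C :: real where "0 < C"
  "\<And>phi h. phi \<in> schwartz ==> h \<in> carrier SL ==>
  hor_int dn (Ad g ` Bup) phi h = C *\<^sub>R (LINT x|lborel. indicator {x. x $ i \<in> {0..1}} x *\<^sub>R phi (h ** cos_rep g r i x))"
  "\<And>phi h. phi \<in> schwartz ==> h \<in> carrier SL ==> (%x. phi (h ** cos_rep g r i x)) \<in> borel_measurable borel"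
proof -
 have g: "g \<in> carrier SL" using p by (simp add: pivot_def)
 let ?J = "Ad g ` Uni \<inter> Hgrp"
 define ms' where "ms' = dn (Ad g ` Bup)"
 have ms1: "nonzero_invariant_radon (Ad g ` Uni) ?J ms'" using ms unfolding unipotent_radical_conj[OF g] ms'_def .
 have sJ: "subgroup ?J SL"
  using subgroup_Ad[OF g subgroup_Uni] subgroup_Hgrp[OF n] by (auto simp: subgroup_SL_iff)
 obtain C :: real where C: "0 < C"
  "ms' = distr (density lborel (%x. ennreal (C * indicator {x. x $ i \<in> {0..1}} x))) ms'
  (%x. cos_rep g r i x <#\<^bsub>SL\<^esub> ?J)"
  and cm: "(%x. cos_rep g r i x <#\<^bsub>SL\<^esub> ?J) \<in> measurable borel ms'"
  and Fm: "\<And>F :: 'n rvec => complex. continuous_on UNIV F ==>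
  (%c. F (qc g i (Ad (matrix_inv g) (SOME n. n \<in> c)))) \<in> borel_measurable ms'"
  and sp: "space ms' = range (%x. cos_rep g r i x <#\<^bsub>SL\<^esub> ?J)"
  by (rule horosphere_measure[OF n p ms1]) blast
 have cont: "continuous_on UNIV (%x. phi (h ** cos_rep g r i x))" if "phi \<in> schwartz" "h \<in> carrier SL" for phi :: "'n rmat => complex" and h :: "'n rmat"
 proof (rule continuous_on_compose2[OF schwartz_continuous[OF that(1)]])
  have "continuous_on UNIV (cos_rep g r i)" unfolding cos_rep_def
  by (rule continuous_on_compose2[OF continuous_on_Ad[of UNIV] continuous_on_sec]) auto
  then show "continuous_on UNIV (%x. h ** cos_rep g r i x)" by (intro continuous_intros)
  show "(%x. h ** cos_rep g r i x) ` UNIV \<subseteq> carrier SL" using that(2) orb_cos_rep(2)[OF n p] by auto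
 qed
 show thesis
 proof (rule that[OF C(1)])
  fix phi :: "'n rmat => complex" and h :: "'n rmat" assume phi: "phi \<in> schwartz" and h: "h \<in> carrier SL"
  show meas: "(%x. phi (h ** cos_rep g r i x)) \<in> borel_measurable borel"
  by (rule borel_measurable_continuous_onI[OF cont[OF phi h]])
  let ?f = "%c. phi (h ** (SOME n. n \<in> c))"
  have rep: "?f (cos_rep g r i x <#\<^bsub>SL\<^esub> ?J) = phi (h ** cos_rep g r i x)" for x
  proof -
  let ?c = "cos_rep g r i x <#\<^bsub>SL\<^esub> ?J"
  have "cos_rep g r i x \<in> ?c" by (rule self_l_coset[OF sJ])
  then have "(SOME n. n \<in> ?c) \<in> ?c" by (rule someI)
  then obtain k where k: "k \<in> ?J" "(SOME n. n \<in> ?c) = cos_rep g r i x ** k" unfolding mem_l_coset by blast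
  have "phi (h ** cos_rep g r i x ** k) = phi (h ** cos_rep g r i x)"
  using phi k(1) SL_mult[OF h orb_cos_rep(2)[OF n p]] by (auto simp: schwartz_def)
  then show ?thesis unfolding k(2) by (simp add: matrix_mul_assoc)
  qed
  \<comment> \<open>The integrand picks representatives by choice; on every coset it agrees with a
    continuous function of the coordinates, since the two points have the same
    \<open>orb\<close>.\<close>
  have fm: "?f \<in> borel_measurable ms'"
  proof (rule measurable_cong[THEN iffD1, OF _ Fm[OF cont[OF phi h]]])
  fix c assume "c \<in> space ms'"
  then obtain x where c: "c = cos_rep g r i x <#\<^bsub>SL\<^esub> ?J" using sp by auto
  have "cos_rep g r i x \<in> c" unfolding c by (rule self_l_coset[OF sJ])
  then have "(SOME n. n \<in> c) \<in> c" by (rule someI)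
  then obtain k where k: "k \<in> ?J" "(SOME n. n \<in> c) = cos_rep g r i x ** k" unfolding c mem_l_coset by blast
  obtain nu where nu: "nu \<in> Uni" "(SOME n. n \<in> c) = Ad g nu"
  proof -
  have "cos_rep g r i x \<in> Ad g ` Uni" using sec_Uni[OF p] by (auto simp: cos_rep_def)
  then have "cos_rep g r i x ** k \<in> Ad g ` Uni" using k(1) subgroup_Ad[OF g subgroup_Uni] by (auto simp: subgroup_SL_iff)
  then show thesis using that k(2) by auto
  qed
  have q: "qc g i (Ad (matrix_inv g) (SOME n. n \<in> c)) = qc g i nu" using nu g by simp
  have "orb (Ad g nu) = orb (cos_rep g r i (qc g i nu))"
  unfolding orb_cos_rep(1)[OF n p] orb_conj[OF g Uni_SL[OF nu(1)]] Uni_orbit[OF n p nu(1)] ..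
  then have "orb (h ** Ad g nu) = orb (h ** cos_rep g r i (qc g i nu))"
  using orb_mult[OF h Ad_SL[OF g Uni_SL[OF nu(1)]]] orb_mult[OF h orb_cos_rep(2)[OF n p]] by simp
  then show "phi (h ** cos_rep g r i (qc g i (Ad (matrix_inv g) (SOME n. n \<in> c)))) = phi (h ** (SOME n. n \<in> c))"
  using schwartz_invariant[OF n phi SL_mult[OF h orb_cos_rep(2)[OF n p]] SL_mult[OF h Ad_SL[OF g Uni_SL[OF nu(1)]]]]
  by (simp only: q) (simp only: nu(2))
  qed
  have cm': "(%x. cos_rep g r i x <#\<^bsub>SL\<^esub> ?J) \<in> measurable (density lborel (%x. ennreal (C * indicator {x. x $ i \<in> {0..1}} x))) ms'"
  using cm by simp
  have [measurable]: "{x :: 'n rvec. x $ i \<in> {0..1}} \<in> sets borel" by measurable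
  have "hor_int dn (Ad g ` Bup) phi h = integral\<^sup>L ms' ?f" by (simp add: hor_int_def ms'_def)
  also have "\<dots> = integral\<^sup>L (distr (density lborel (%x. ennreal (C * indicator {x. x $ i \<in> {0..1}} x))) ms'
  (%x. cos_rep g r i x <#\<^bsub>SL\<^esub> ?J)) ?f" using C(2) by simp
  also have "\<dots> = integral\<^sup>L (density lborel (%x. ennreal (C * indicator {x. x $ i \<in> {0..1}} x))) (%x. phi (h ** cos_rep g r i x))"
  by (subst integral_distr[OF cm' fm]) (simp only: rep)
  also have "\<dots> = (LINT x|lborel. (C * indicator {x. x $ i \<in> {0..1}} x) *\<^sub>R phi (h ** cos_rep g r i x))"
  by (rule integral_density) (use meas C(1) in auto)
  also have "\<dots> = C *\<^sub>R (LINT x|lborel. indicator {x. x $ i \<in> {0..1}} x *\<^sub>R phi (h ** cos_rep g r i x))"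
  by (simp flip: integral_scaleR_right)
  finally show "hor_int dn (Ad g ` Bup) phi h = C *\<^sub>R (LINT x|lborel. indicator {x. x $ i \<in> {0..1}} x *\<^sub>R phi (h ** cos_rep g r i x))" .
 qed
qed

lemma hor_int_translate:
 fixes g :: "'n::{finite,linorder} rmat"
 assumes n: "CARD('n) \<ge> 2" and g: "g \<in> carrier SL" and phi: "phi \<in> schwartz"
  and ms: "invariant_on dn (Ad g ` Bup)"
  and x: "x \<in> carrier SL" and nu: "nu \<in> Uni"
 shows "hor_int dn (Ad g ` Bup) phi (x ** Ad g nu) = hor_int dn (Ad g ` Bup) phi x"
proof -
 define N where "N = Ad g ` Uni"
 define J where "J = N \<inter> Hgrp"
 define M where "M = dn (Ad g ` Bup)"
 define T where "T = coset_topology N J"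
 define C where "C = coset_space N J"
 define u where "u = Ad g nu"
 have NS: "m \<in> carrier SL" if "m \<in> N" for m using that g Uni_SL by (auto simp: N_def)
 have Nm: "a ** b \<in> N" if "a \<in> N" "b \<in> N" for a b
  using that by (auto simp: N_def Ad_mult[OF g] intro: Uni_mult)
 have u: "u \<in> N" using nu by (auto simp: u_def N_def)
 define u' where "u' = Ad g (matrix_inv nu)"
 have u': "u' \<in> N" using Uni_inv[OF nu] by (auto simp: u'_def N_def)
 have one: "Ad g (mat 1) = mat 1" using g by (simp add: Ad_def SL_cancel)
 have uu: "u ** u' = mat 1" using Uni_SL[OF nu] by (simp add: u_def u'_def Ad_mult[OF g] SL_cancel one)
 have J1: "mat 1 \<in> J" using subgroup_Hgrp[OF n] one_Uni one by (auto simp: J_def N_def subgroup_SL_iff intro!: image_eqI[of _ _ "mat 1"])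
 have inv: "nonzero_invariant_radon N J M" using ms by (simp add: unipotent_radical_conj[OF g] N_def J_def M_def)
 have Ceq: "C = {m <#\<^bsub>SL\<^esub> J | m. m \<in> N}" by (auto simp: C_def coset_space_def LCOSETS_def l_coset_def SL_def)
 have openT: "openin T U \<longleftrightarrow> U \<subseteq> C \<and> openin (top_of_set N) {n \<in> N. n <#\<^bsub>SL\<^esub> J \<in> U}" for U
  by (simp add: T_def C_def openin_coset_topology)
 have topT: "topspace T = C"
 proof
  show "topspace T \<subseteq> C" using openT by (auto simp: topspace_def)
  have "{n \<in> N. n <#\<^bsub>SL\<^esub> J \<in> C} = N" unfolding Ceq by auto
  then have "openin T C" by (simp add: openT)
  then show "C \<subseteq> topspace T" by (rule openin_subset)
 qed
 have sp: "space M = C" and sets: "sets M = sigma_sets C {U. openin T U}"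
  and inv0: "\<And>m E. m \<in> N ==> E \<in> sets M ==> emeasure M ((%c. m <#\<^bsub>SL\<^esub> c) ` E) = emeasure M E"
  using inv by (auto simp: nonzero_invariant_radon_def radon_measure_def topT T_def[symmetric])
 have op: "openin T U ==> U \<in> sets M" for U unfolding sets by (rule sigma_sets.Basic) simp
 define \<T> where "\<T> c = u <#\<^bsub>SL\<^esub> c" for c
 have TJ: "\<T> (m <#\<^bsub>SL\<^esub> J) = (u ** m) <#\<^bsub>SL\<^esub> J" for m by (simp add: \<T>_def l_coset_mult)
 have TC: "\<T> c \<in> C" if "c \<in> C" for c using that Nm[OF u] by (auto simp: Ceq TJ)
 have TM: "\<T> \<in> measurable M M"
 proof (rule measurable_sigma_sets[OF sets])
  show "{U. openin T U} \<subseteq> Pow C" using openT by auto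
  show "\<T> \<in> space M \<rightarrow> C" using TC by (auto simp: sp)
  fix U assume "U \<in> {U. openin T U}"
  then have U: "openin (top_of_set N) {n \<in> N. n <#\<^bsub>SL\<^esub> J \<in> U}" using openT by auto
  have "{m \<in> N. m <#\<^bsub>SL\<^esub> J \<in> \<T> -` U \<inter> C} = N \<inter> (%m. u ** m) -` {n \<in> N. n <#\<^bsub>SL\<^esub> J \<in> U}"
  using Nm[OF u] by (auto simp: TJ Ceq)
  also have "openin (top_of_set N) \<dots>"
  by (rule continuous_openin_preimage[OF _ _ U]) (use Nm[OF u] in \<open>auto intro!: continuous_intros\<close>)
  finally have "openin T (\<T> -` U \<inter> C)" by (simp add: openT)
  then show "\<T> -` U \<inter> space M \<in> sets M" unfolding sp by (rule op)
 qed
 have dist: "distr M M \<T> = M"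
 proof (rule measure_eqI)
  fix E assume "E \<in> sets (distr M M \<T>)"
  then have E: "E \<in> sets M" by simp
  have "\<T> ` (\<T> -` E \<inter> space M) = E"
  proof
  show "E \<subseteq> \<T> ` (\<T> -` E \<inter> space M)"
  proof
  fix c assume c: "c \<in> E"
  then have "c \<in> C" using sets.sets_into_space[OF E] sp by auto
  then obtain m where m: "m \<in> N" "c = m <#\<^bsub>SL\<^esub> J" by (auto simp: Ceq)
  have "\<T> ((u' ** m) <#\<^bsub>SL\<^esub> J) = c" by (simp add: TJ m matrix_mul_assoc uu)
  moreover have "(u' ** m) <#\<^bsub>SL\<^esub> J \<in> C" using Nm[OF u' m(1)] by (auto simp: Ceq)
  ultimately show "c \<in> \<T> ` (\<T> -` E \<inter> space M)" using c by (intro image_eqI[of _ _ "(u' ** m) <#\<^bsub>SL\<^esub> J"]) (auto simp: sp)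
  qed
  qed auto
  moreover have "\<T> -` E \<inter> space M \<in> sets M" by (rule measurable_sets[OF TM E])
  ultimately show "emeasure (distr M M \<T>) E = emeasure M E"
  using inv0[OF u, of "\<T> -` E \<inter> space M"] emeasure_distr[OF TM E] by (simp add: \<T>_def[abs_def])
 qed simp
 define f :: "'n rmat => 'n rmat set => complex" where "f y c = phi (y ** (SOME m. m \<in> c))" for y c
 have f: "f y (m <#\<^bsub>SL\<^esub> J) = phi (y ** m)" if "m \<in> N" "y \<in> carrier SL" for y m
 proof -
  have "m \<in> m <#\<^bsub>SL\<^esub> J" using J1 by (auto simp: mem_l_coset intro!: bexI[of _ "mat 1"])
  then have "(SOME a. a \<in> m <#\<^bsub>SL\<^esub> J) \<in> m <#\<^bsub>SL\<^esub> J" by (rule someI)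
  then obtain h where h: "h \<in> J" "(SOME a. a \<in> m <#\<^bsub>SL\<^esub> J) = m ** h" by (auto simp: mem_l_coset)
  have "phi (y ** m ** h) = phi (y ** m)" using phi h that NS by (auto simp: schwartz_def J_def)
  then show ?thesis by (simp add: f_def h matrix_mul_assoc)
 qed
 have fM: "f x \<in> borel_measurable M"
 proof (rule borel_measurableI)
  fix W :: "complex set" assume W: "open W"
  have "{m \<in> N. m <#\<^bsub>SL\<^esub> J \<in> f x -` W \<inter> C} = N \<inter> (%m. phi (x ** m)) -` W"
  using f[OF _ x] by (auto simp: Ceq)
  also have "openin (top_of_set N) \<dots>"
  proof (rule continuous_openin_preimage_gen)
  show "continuous_on N (%m. phi (x ** m))"
  by (rule continuous_on_compose2[OF schwartz_continuous[OF phi]]) (use x NS in \<open>auto intro!: continuous_intros\<close>)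
  qed (rule W)
  finally have "openin T (f x -` W \<inter> C)" by (simp add: openT)
  then show "f x -` W \<inter> space M \<in> sets M" unfolding sp by (rule op)
 qed
 have "hor_int dn (Ad g ` Bup) phi (x ** u) = (LINT c|M. f (x ** u) c)" by (simp add: hor_int_def M_def f_def)
 also have "\<dots> = (LINT c|M. f x (\<T> c))"
 proof (rule Bochner_Integration.integral_cong[OF refl])
  fix c assume "c \<in> space M"
  then obtain m where m: "m \<in> N" "c = m <#\<^bsub>SL\<^esub> J" by (auto simp: sp Ceq)
  show "f (x ** u) c = f x (\<T> c)"
  using f[OF m(1) SL_mult[OF x NS[OF u]]] f[OF Nm[OF u m(1)] x] by (simp add: m TJ matrix_mul_assoc)
 qed
 also have "\<dots> = (LINT c|distr M M \<T>. f x c)" by (rule integral_distr[OF TM fM, symmetric])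
 also have "\<dots> = (LINT c|M. f x c)" by (simp only: dist)
 also have "\<dots> = hor_int dn (Ad g ` Bup) phi x" by (simp add: hor_int_def M_def f_def)
 finally show ?thesis by (simp add: u_def)
qed

section \<open>The rescaled vectors and the decay of the transform\<close>

definition Xd :: "'n::{finite,linorder} => 'n rvec => 'n rvec => 'n rvec" where
 "Xd i d x = (\<chi> k. d $ k * Xi i x $ k)"

definition Ed :: "'n::{finite,linorder} rvec => 'n => 'n rvec => 'n rvec => 'n rvec" where
 "Ed w i d x = (\<chi> k. Eta w i x $ k / d $ k)"

lemma dg_SL_nz:
 assumes "dg d \<in> carrier SL"
 shows "d $ k ~= 0"
proof
 assume "d $ k = 0"
 then have "det (dg d) = 0" unfolding det_dg by (intro prod_zero) auto
 then show False using assms unfolding mem_SL by linarith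
qed

lemma orb_translate:
 fixes g :: "'n::{finite,linorder} rmat"
 assumes n: "CARD('n) \<ge> 2" and p: "pivot g r i" and w: "w \<in> carrier SL" and d: "dg d \<in> carrier SL"
 shows "orb (w ** Ad g (dg d) ** cos_rep g r i x) = Ad (w ** g) (outer (Xd i d x) (Ed (wv g) i d x))"
  and "w ** Ad g (dg d) ** cos_rep g r i x \<in> carrier SL"
  and "orb (w ** cos_rep g r i x) = Ad (w ** g) (outer (Xi i x) (Eta (wv g) i x))"
  and "w ** cos_rep g r i x \<in> carrier SL"
proof -
 have g: "g \<in> carrier SL" using p by (simp add: pivot_def)
 have orbA: "orb (W ** cos_rep g r i x) = Ad (W ** g) (outer (Xi i x) (Eta (wv g) i x))" if W: "W \<in> carrier SL" for W
 proof -
  have "orb (W ** cos_rep g r i x) = Ad W (orb (cos_rep g r i x))"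
  using orb_mult[OF W orb_cos_rep(2)[OF n p]] by (simp add: Ad_def)
  then show ?thesis by (simp add: orb_cos_rep(1)[OF n p] Ad_Ad[OF W g])
 qed
 have W: "w ** Ad g (dg d) \<in> carrier SL" using w g d by blast
 show "w ** Ad g (dg d) ** cos_rep g r i x \<in> carrier SL" "w ** cos_rep g r i x \<in> carrier SL"
  using W w orb_cos_rep(2)[OF n p] by blast+
 show "orb (w ** cos_rep g r i x) = Ad (w ** g) (outer (Xi i x) (Eta (wv g) i x))" by (rule orbA[OF w])
 have "Ad g (dg d) ** g = g ** dg d"
  unfolding Ad_def by (simp only: matrix_mul_assoc[symmetric] SL_cancel[OF g] matrix_mul_rid)
 then have "w ** Ad g (dg d) ** g = w ** g ** dg d" by (metis matrix_mul_assoc)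
 then have "orb (w ** Ad g (dg d) ** cos_rep g r i x) = Ad (w ** g) (Ad (dg d) (outer (Xi i x) (Eta (wv g) i x)))"
  using orbA[OF W] Ad_Ad[OF SL_mult[OF w g] d] by simp
 also have "Ad (dg d) (outer (Xi i x) (Eta (wv g) i x)) = outer (Xd i d x) (Ed (wv g) i d x)"
 proof -
  have "matrix_inv (dg d) = dg (\<chi> k. 1 / d $ k)" by (rule matrix_inv_dg) (rule dg_SL_nz[OF d])
  moreover have "dg d *v Xi i x = Xd i d x" by (simp add: vec_eq_iff Xd_def)
  moreover have "Eta (wv g) i x v* dg (\<chi> k. 1 / d $ k) = Ed (wv g) i d x" by (simp add: vec_eq_iff Ed_def)
  ultimately show ?thesis by (simp add: Ad_def mult_outer outer_mult)
 qed
 finally show "orb (w ** Ad g (dg d) ** cos_rep g r i x) = Ad (w ** g) (outer (Xd i d x) (Ed (wv g) i d x))" .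
qed

text \<open>Conjugation by the fixed element w g distorts norms by a bounded factor, so the norm of
  \<open>orb\<close> can be replaced by the product of the norms of the rescaled vectors. c0 records
  the distortion and is chosen before m.\<close>

lemma weight_bound:
 fixes g :: "'n::{finite,linorder} rmat"
 assumes n: "CARD('n) \<ge> 3" and p: "pivot g r i" and w: "w \<in> carrier SL" and phi: "phi \<in> schwartz"
 shows "\<exists>c0>0. \<forall>m. \<exists>Mc\<ge>0. \<forall>d x. dg d \<in> carrier SL -->
  norm (phi (w ** Ad g (dg d) ** cos_rep g r i x)) \<le>
  Mc * (wt ((real CARD('n) - 1) / 2) c0 m (norm (Xd i d x) * norm (Ed (wv g) i d x)))"
proof -
 have n2: "CARD('n) \<ge> 2" using n by simp
 have g: "g \<in> carrier SL" using p by (simp add: pivot_def)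
 have wg: "w ** g \<in> carrier SL" using w g by blast
 define kappa where "kappa = (real CARD('n) - 1) / 2"
 have kappa0: "kappa \<ge> 0" using n by (simp add: kappa_def)
 obtain K where K: "K > 0" "\<And>Y. norm (Ad (matrix_inv (w ** g)) Y) \<le> K * norm (Y :: 'n rmat)"
  using linear_bounded_pos[OF Ad_linear, of "matrix_inv (w ** g)"] by metis
 define c0 where "c0 = 1 / K"
 have c0: "c0 > 0" using K by (simp add: c0_def)
 have "\<exists>Mc\<ge>0. \<forall>d x. dg d \<in> carrier SL -->
  norm (phi (w ** Ad g (dg d) ** cos_rep g r i x)) \<le>
  Mc * (wt kappa c0 m (norm (Xd i d x) * norm (Ed (wv g) i d x)))" for m
 proof -
  obtain C where C: "C \<ge> 0" "\<And>h. h \<in> carrier SL ==> norm (phi h) \<le> C * (norm (orb h) powr (- kappa) / Lam (norm (orb h)) ^ m)"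
  using schwartz_bound[OF n phi, of m] by (auto simp: kappa_def)
  have "norm (phi (w ** Ad g (dg d) ** cos_rep g r i x)) \<le>
  C * c0 powr (- kappa) * (wt kappa c0 m (norm (Xd i d x) * norm (Ed (wv g) i d x)))"
  if d: "dg d \<in> carrier SL" for d x
  proof -
  define h where "h = w ** Ad g (dg d) ** cos_rep g r i x"
  define rh where "rh = norm (Xd i d x) * norm (Ed (wv g) i d x)"
  have o: "orb h = Ad (w ** g) (outer (Xd i d x) (Ed (wv g) i d x))" unfolding h_def by (rule orb_translate(1)[OF n2 p w d])
  have h: "h \<in> carrier SL" unfolding h_def by (rule orb_translate(2)[OF n2 p w d])
  have rh: "rh = norm (outer (Xd i d x) (Ed (wv g) i d x))" by (simp add: rh_def norm_outer)
  have rh0: "0 \<le> rh" by (simp add: rh_def)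
  have "rh \<le> K * norm (orb h)" unfolding o rh using K(2)[of "Ad (w ** g) (outer (Xd i d x) (Ed (wv g) i d x))"] wg by simp
  then have le: "c0 * rh \<le> norm (orb h)" using K(1) by (simp add: c0_def field_simps)
  have "norm (orb h) powr (- kappa) / Lam (norm (orb h)) ^ m \<le> c0 powr (- kappa) * (rh powr (- kappa) / Lam (c0 * rh) ^ m)"
  proof (cases "rh = 0")
  case True
  then have "orb h = 0" unfolding o rh using linear_0[OF Ad_linear, of "w ** g"] by simp
  then show ?thesis using True by simp
  next
  case False
  then have r: "0 < c0 * rh" using c0 rh0 by simp
  have "norm (orb h) powr (- kappa) / Lam (norm (orb h)) ^ m \<le> (c0 * rh) powr (- kappa) / Lam (c0 * rh) ^ m"
  using le r kappa0 Lam_mono[of "c0 * rh" "norm (orb h)"] Lam_pos[of "c0 * rh"]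
  by (intro frac_le powr_mono2' power_mono zero_less_power) auto
  then show ?thesis using c0 rh0 by (simp add: powr_mult)
  qed
  from order_trans[OF C(2)[OF h] mult_left_mono[OF this C(1)]] show ?thesis
  unfolding h_def rh_def by (simp only: mult.assoc)
  qed
  then show ?thesis using C(1) by (intro exI[of _ "C * c0 powr (- kappa)"]) auto
 qed
 then show ?thesis using c0 unfolding kappa_def by blast
qed

text \<open>The diagonals of the elements of M exp (R v) in a standard frame: the signs come from M,
  and tau is exp (- t c).\<close>

definition scal :: "'n => 'n => real => 'n::finite rvec => bool" where
 "scal j i tau d \<longleftrightarrow> dg d \<in> carrier SL \<and> 0 < tau \<and> \<bar>d $ j\<bar> = 1 / tau \<and> \<bar>d $ i\<bar> = tau \<and> (\<forall>k. k ~= j --> k ~= i --> \<bar>d $ k\<bar> = 1)"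

lemma std_pivot: "std g j i ==> adj j i \<or> i = j ==> pivot g j i"
 using std_yv[of g j i] by (auto simp: pivot_def std_SL adj_def)

text \<open>In a standard frame w_j = 1/2 is the only nonzero entry of w before i; hence the entry 1
  - x_j / 2 and every later occurrence of 2 - x_j.\<close>

lemma Eta_pair:
 assumes "std g j i" "adj j i"
 shows "Eta (wv g) i x $ k = (if i < k then x $ k else if k = i then 1 - x $ j / 2 else if k = j then 1/2 else 0)"
proof -
 have ji: "j < i" using assms by (simp add: adj_def)
 have "(\<Sum>m | m < i. wv g $ m * x $ m) = (\<Sum>m | m < i. if m = j then x $ j / 2 else 0)"
  using ji std_yv(6)[OF assms(1)] by (intro sum.cong) auto
 also have "\<dots> = x $ j / 2" using ji by simp
 finally show ?thesis using ji std_yv(6)[OF assms(1), of k] by (auto simp: Eta_def)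
qed

lemma adj_splitting: "adj j i ==> splitting j i {..<j} {i<..}"
 by (auto simp: adj_def splitting_def set_eq_iff) (metis linorder_less_linear)

lemma strip_std:
 fixes g :: "'n::{finite,linorder} rmat"
 assumes s: "std g j i" and a: "adj j i" and d: "scal j i tau d"
 shows "strip j {..<j} {i<..} tau (norm (Xd i d x)) (norm (Ed (wv g) i d x)) x"
proof -
 have ji: "j < i" using a by (simp add: adj_def)
 have d': "0 < tau" "\<bar>d $ j\<bar> = 1 / tau" "\<bar>d $ i\<bar> = tau" "\<And>k. k ~= j ==> k ~= i ==> \<bar>d $ k\<bar> = 1"
  using d by (auto simp: scal_def)
 have X: "\<bar>Xd i d x $ k\<bar> \<le> norm (Xd i d x)" for k by (rule component_le_norm_cart)
 have E: "\<bar>Ed (wv g) i d x $ k\<bar> \<le> norm (Ed (wv g) i d x)" for k by (rule component_le_norm_cart)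
 have "\<bar>Xd i d x $ i\<bar> = tau" "\<bar>Xd i d x $ j\<bar> = \<bar>x $ j\<bar> / tau" "\<And>k. k < j ==> \<bar>Xd i d x $ k\<bar> = \<bar>x $ k\<bar>"
  using d' ji by (auto simp: Xd_def Xi_def abs_mult)
 moreover have "\<bar>Ed (wv g) i d x $ j\<bar> = tau / 2" "\<And>k. i < k ==> \<bar>Ed (wv g) i d x $ k\<bar> = \<bar>x $ k\<bar>"
  using d' ji by (auto simp: Ed_def Eta_pair[OF s a] abs_divide)
 moreover have "\<bar>Ed (wv g) i d x $ i\<bar> = \<bar>2 - x $ j\<bar> / (2 * tau)"
 proof -
  have "\<bar>1 - x $ j / 2\<bar> = \<bar>(2 - x $ j) / 2\<bar>" by (simp only: diff_divide_distrib)
  also have "\<dots> = \<bar>2 - x $ j\<bar> / 2" by (subst abs_divide) simp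
  finally have h: "\<bar>1 - x $ j / 2\<bar> = \<bar>2 - x $ j\<bar> / 2" .
  have e: "\<bar>Ed (wv g) i d x $ i\<bar> = \<bar>1 - x $ j / 2\<bar> / tau" using d'(3) by (simp add: Ed_def Eta_pair[OF s a] abs_divide)
  show ?thesis unfolding e h by simp
 qed
 ultimately show ?thesis unfolding strip_def
  using X[of i] X[of j] X E[of i] E[of j] E by (auto simp: lessThan_def greaterThan_def) (metis | smt (verit))+
qed

text \<open>\<open>strip_std\<close> and \<open>weight_bound\<close> put the integrand into the form
  required by the strip estimates. Small tau is treated for L = R, where both vectors have equally
  many coordinates of their own.\<close>

lemma decay:
 fixes g :: "'n::{finite,linorder} rmat"
 assumes n: "CARD('n) \<ge> 3" and s: "std g j i" and a: "adj j i"
  and ms: "invariant_on dn (Ad g ` Bup)"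
  and LR: "card {..<j} \<le> card {i<..} + 1" "card {i<..} \<le> card {..<j} + 1" and phi: "phi \<in> schwartz"
 shows "0 < tau0 ==> \<exists>D\<ge>0. \<forall>tau d. tau0 \<le> tau --> scal j i tau d --> norm (hor_int dn (Ad g ` Bup) phi (Ad g (dg d))) \<le> tau * (D / Lam tau ^ N)"
  and "card {..<j} = card {i<..} ==> \<exists>D\<ge>0. \<forall>tau d. tau \<le> 1 --> scal j i tau d --> norm (hor_int dn (Ad g ` Bup) phi (Ad g (dg d))) \<le> tau * (D / Lam (1 / tau\<^sup>2) ^ N)"
proof -
 have n2: "CARD('n) \<ge> 2" using n by simp
 have ji: "j < i" and gap: "{j<..<i} = {}" using a by (auto simp: adj_def)
 have p: "pivot g j i" using s a by (rule std_pivot[OF _ disjI1])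
 have g: "g \<in> carrier SL" using s by (rule std_SL)
 define kappa where "kappa = (real CARD('n) - 1) / 2"
 define m where "m = N + 2 * (card {..<j} + card {i<..} + 1)"
 have cn: "card {..<j} + card {i<..} + 2 = CARD('n)" using card_split_pair[OF ji] gap by simp
 have kappa: "real (card {..<j}) \<le> kappa" "real (card {i<..}) \<le> kappa" "real (card {..<j}) + real (card {i<..}) + 1 = 2 * kappa"
  using LR cn[symmetric] by (auto simp: kappa_def)
 have sp: "splitting j i {..<j} {i<..}" by (rule adj_splitting[OF a])
 obtain C where C: "0 < C"
  "\<And>phi h. phi \<in> schwartz ==> h \<in> carrier SL ==>
  hor_int dn (Ad g ` Bup) phi h = C *\<^sub>R (LINT x|lborel. indicator {x. x $ i \<in> {0..1}} x *\<^sub>R phi (h ** cos_rep g j i x))"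
  "\<And>phi h. phi \<in> schwartz ==> h \<in> carrier SL ==> (%x. phi (h ** cos_rep g j i x)) \<in> borel_measurable borel"
  by (rule hor_int_formula[where dn = dn, OF n2 p ms]) (rule that)
 obtain c0 where c0: "c0 > 0" and wb: "\<forall>m. \<exists>Mc\<ge>0. \<forall>d x. dg d \<in> carrier SL -->
  norm (phi (mat 1 ** Ad g (dg d) ** cos_rep g j i x)) \<le>
  Mc * (wt kappa c0 m (norm (Xd i d x) * norm (Ed (wv g) i d x)))"
  using weight_bound[OF n p SL_one phi] unfolding kappa_def by blast
 obtain Mc where Mc: "Mc \<ge> 0" and wbm: "\<And>d x. dg d \<in> carrier SL ==>
  norm (phi (Ad g (dg d) ** cos_rep g j i x)) \<le>
  Mc * (wt kappa c0 m (norm (Xd i d x) * norm (Ed (wv g) i d x)))"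
  using spec[OF wb, of m] by auto
 have red: "norm (hor_int dn (Ad g ` Bup) phi (Ad g (dg d))) \<le> C * b"
  if d: "dg d \<in> carrier SL" and b: "(\<integral>\<^sup>+ x. ennreal (indicator {0..1} (x $ i) * norm (phi (Ad g (dg d) ** cos_rep g j i x))) \<partial>lborel) \<le> ennreal b" "0 \<le> b" for d b
 proof -
  have "(\<integral>\<^sup>+ x. ennreal (norm (indicator {x. x $ i \<in> {0..1}} x *\<^sub>R phi (Ad g (dg d) ** cos_rep g j i x))) \<partial>lborel) \<le> ennreal b"
  using b(1) by (simp add: indicator_def)
  from norm_integral_le[OF this b(2)] show ?thesis using C(1) C(2)[OF phi Ad_SL[OF g d]] by (simp add: mult_left_mono)
 qed
 show "\<exists>D\<ge>0. \<forall>tau d. tau0 \<le> tau --> scal j i tau d --> norm (hor_int dn (Ad g ` Bup) phi (Ad g (dg d))) \<le> tau * (D / Lam tau ^ N)"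
  if t0: "0 < tau0"
 proof -
  obtain D where D: "D \<ge> 0" and b: "large_bounded j i {..<j} {i<..} kappa c0 N m tau0 D"
  using strip_integral_large[OF sp c0 t0 kappa, of N, folded m_def] by (elim exE conjE) (rule that)
  have "norm (hor_int dn (Ad g ` Bup) phi (Ad g (dg d))) \<le> tau * ((C * Mc * D) / Lam tau ^ N)" if t: "tau0 \<le> tau" and d: "scal j i tau d" for tau d
  proof -
  have dS: "dg d \<in> carrier SL" using d by (simp add: scal_def)
  have L: "0 \<le> Lam tau" using t t0 by (intro Lam_pos[THEN less_imp_le]) simp
  have "norm (hor_int dn (Ad g ` Bup) phi (Ad g (dg d))) \<le> C * (tau * (Mc * D / Lam tau ^ N))"
  proof (rule red[OF dS])
  show "(\<integral>\<^sup>+ x. ennreal (indicator {0..1} (x $ i) * norm (phi (Ad g (dg d) ** cos_rep g j i x))) \<partial>lborel) \<le> ennreal (tau * (Mc * D / Lam tau ^ N))"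
  by (rule b[rule_format, OF t Mc strip_std[OF s a d] wbm[OF dS]])
  show "0 \<le> tau * (Mc * D / Lam tau ^ N)" using t t0 Mc D L by simp
  qed
  then show ?thesis by (simp add: mult_ac)
  qed
  then show ?thesis using C Mc D by (intro exI[of _ "C * Mc * D"]) auto
 qed
 show "\<exists>D\<ge>0. \<forall>tau d. tau \<le> 1 --> scal j i tau d --> norm (hor_int dn (Ad g ` Bup) phi (Ad g (dg d))) \<le> tau * (D / Lam (1 / tau\<^sup>2) ^ N)"
  if eq: "card {..<j} = card {i<..}"
 proof -
  obtain D where D: "D \<ge> 0" and b: "small_bounded j i {..<j} {i<..} kappa c0 N m D"
  using strip_integral_small[OF sp c0 eq kappa(3), of N, folded m_def] by (elim exE conjE) (rule that)
  have "norm (hor_int dn (Ad g ` Bup) phi (Ad g (dg d))) \<le> tau * ((C * Mc * D) / Lam (1 / tau\<^sup>2) ^ N)" if t: "tau \<le> 1" and d: "scal j i tau d" for tau d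
  proof -
  have dS: "dg d \<in> carrier SL" and tp: "0 < tau" using d by (auto simp: scal_def)
  have L: "0 \<le> Lam (1 / tau\<^sup>2)" by (intro Lam_pos[THEN less_imp_le]) simp
  have [measurable]: "(%x. phi (Ad g (dg d) ** cos_rep g j i x)) \<in> borel_measurable borel" by (rule C(3)[OF phi Ad_SL[OF g dS]])
  have "norm (hor_int dn (Ad g ` Bup) phi (Ad g (dg d))) \<le> C * (tau * (Mc * D / Lam (1 / tau\<^sup>2) ^ N))"
  proof (rule red[OF dS])
  show "(\<integral>\<^sup>+ x. ennreal (indicator {0..1} (x $ i) * norm (phi (Ad g (dg d) ** cos_rep g j i x))) \<partial>lborel) \<le> ennreal (tau * (Mc * D / Lam (1 / tau\<^sup>2) ^ N))"
  by (rule b[rule_format, OF tp t Mc strip_std[OF s a d] _ conjI[OF norm_ge_zero wbm[OF dS]]]) measurable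
  show "0 \<le> tau * (Mc * D / Lam (1 / tau\<^sup>2) ^ N)" using tp Mc D L by simp
  qed
  then show ?thesis by (simp add: mult_ac)
  qed
  then show ?thesis using C Mc D by (intro exI[of _ "C * Mc * D"]) auto
 qed
qed

section \<open>Identification and normalization of the limit\<close>

lemma integral_permute:
 fixes \<pi> :: "'n::finite => 'n" and g :: "'n rvec => complex"
 assumes \<pi>: "\<And>k. \<pi> (\<pi> k) = k" and g: "g \<in> borel_measurable borel"
 shows "(LINT x|lborel. g (\<chi> k. x $ \<pi> k)) = (LINT x|lborel. g x)"
proof -
 define P where "P x = (\<chi> k. x $ \<pi> k)" for x :: "'n rvec"
 have Pm[measurable]: "P \<in> borel_measurable borel"
  by (rule borel_measurable_continuous_onI) (auto simp: P_def[abs_def] intro!: continuous_intros)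
 have B: "Basis = range (%k :: 'n. axis k (1 :: real))" by (auto simp: Basis_vec_def)
 have inj: "inj (%k :: 'n. axis k (1 :: real))" by (auto simp: inj_def axis_eq_axis)
 have "lborel = distr lborel borel P"
 proof (rule lborel_eqI)
  fix l u :: "'n rvec" assume le: "\<And>b. b \<in> Basis ==> l \<bullet> b \<le> u \<bullet> b"
  have le': "l $ k \<le> u $ k" for k using le[of "axis k 1"] by (simp add: B inner_axis)
  have "P -` box l u = box (P l) (P u)"
  proof (rule equalityI; rule subsetI)
  fix x assume "x \<in> P -` box l u"
  then have *: "l $ k < x $ \<pi> k \<and> x $ \<pi> k < u $ k" for k by (simp add: P_def mem_box_cart)
  show "x \<in> box (P l) (P u)" using *[of "\<pi> k" for k] by (simp add: P_def mem_box_cart \<pi>)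
  next
  fix x assume "x \<in> box (P l) (P u)"
  then have *: "l $ \<pi> k < x $ k \<and> x $ k < u $ \<pi> k" for k by (simp add: P_def mem_box_cart)
  show "x \<in> P -` box l u" using *[of "\<pi> k" for k] by (simp add: P_def mem_box_cart \<pi>)
  qed
  then have "emeasure (distr lborel borel P) (box l u) = emeasure lborel (box (P l) (P u))"
  by (subst emeasure_distr) auto
  also have "\<dots> = ennreal (\<Prod>b\<in>Basis. (P u - P l) \<bullet> b)"
  using le' by (intro emeasure_lborel_box) (auto simp: B P_def inner_axis)
  also have "(\<Prod>b\<in>Basis. (P u - P l) \<bullet> b) = (\<Prod>k\<in>UNIV. u $ \<pi> k - l $ \<pi> k)"
  by (simp add: B prod.reindex[OF inj] inner_axis P_def)
  also have "\<dots> = (\<Prod>k\<in>UNIV. u $ k - l $ k)"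
  by (rule prod.reindex_bij_witness[of _ \<pi> \<pi>]) (auto simp: \<pi>)
  also have "\<dots> = (\<Prod>b\<in>Basis. (u - l) \<bullet> b)" by (simp add: B prod.reindex[OF inj] inner_axis)
  finally show "emeasure (distr lborel borel P) (box l u) = ennreal (\<Prod>b\<in>Basis. (u - l) \<bullet> b)" .
 qed simp
 then have "(LINT x|lborel. g x) = (LINT x|distr lborel borel P. g x)" by (rule arg_cong)
 also have "\<dots> = (LINT x|lborel. g (P x))" by (rule integral_distr) (use g in auto)
 finally show ?thesis by (simp add: P_def)
qed

lemma hor_int_strip:
 fixes g :: "'n::{finite,linorder} rmat"
 assumes n: "CARD('n) \<ge> 2" and p: "pivot g r i"
  and ms: "invariant_on dn (Ad g ` Bup)"
 obtains C :: real where "0 < C"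
  "\<And>phi h. phi \<in> schwartz ==> h \<in> carrier SL ==>
  hor_int dn (Ad g ` Bup) phi h = C *\<^sub>R (LINT x|lborel. indicator {0..1} (x $ i) *\<^sub>R phi (h ** cos_rep g r i x))"
  "\<And>phi h. phi \<in> schwartz ==> h \<in> carrier SL ==> (%x. phi (h ** cos_rep g r i x)) \<in> borel_measurable borel"
proof -
 have ind: "indicator {x. x $ i \<in> {0..1}} x = (indicator {0..1} (x $ i) :: real)" for x :: "'n rvec"
  by (simp add: indicator_def)
 show thesis
 proof (rule hor_int_formula[where dn = dn, OF n p ms])
  fix C
  assume C: "0 < C" "\<And>phi h. phi \<in> schwartz ==> h \<in> carrier SL ==>
  hor_int dn (Ad g ` Bup) phi h = C *\<^sub>R (LINT x|lborel. indicator {x. x $ i \<in> {0..1}} x *\<^sub>R phi (h ** cos_rep g r i x))"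
  "\<And>phi h. phi \<in> schwartz ==> h \<in> carrier SL ==> (%x. phi (h ** cos_rep g r i x)) \<in> borel_measurable borel"
  show thesis by (rule that[OF C(1) C(2)[unfolded ind] C(3)])
 qed
qed

lemma Eta_point: "Eta (axis p 1) p x = (\<chi> k. if p < k then x $ k else if k = p then 1 else 0)"
proof -
 have "(\<Sum>m | m < p. axis p 1 $ m * x $ m) = 0" by (rule sum.neutral) (auto simp: axis_def)
 then show ?thesis by (auto simp: Eta_def vec_eq_iff axis_def)
qed

lemma std_point: "std g p p ==> wv g = axis p 1" "std g p p ==> pivot g p p"
 by (auto simp: std_def std_pivot)

text \<open>A diagonal matrix with lam before the pivot and 1/lam behind it scales one coordinate of
  each vector by lam, so the Jacobian is lam^2 = 1/q. In this way a positive constant between two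
  measures is absorbed into the base point.\<close>

lemma hor_int_rescale:
 fixes g :: "'n::{finite,linorder} rmat"
 assumes n: "CARD('n) \<ge> 2" and s: "std g p p" and kl: "k0 < p" "p < l0" and q: "0 < q"
  and ms: "invariant_on dn (Ad g ` Bup)"
 shows "\<exists>a. dg a \<in> carrier SL \<and> (\<forall>phi\<in>schwartz. \<forall>l\<in>carrier SL.
  hor_int dn (Ad g ` Bup) phi (l ** Ad g (dg a)) = q *\<^sub>R hor_int dn (Ad g ` Bup) phi l)"
proof -
 define lam where "lam = 1 / sqrt q"
 have lam: "lam > 0" "lam * lam = 1 / q" using q by (auto simp: lam_def)
 define a :: "'n rvec" where "a = (\<chi> k. if k = k0 then lam else if k = l0 then 1 / lam else 1)"
 define sig where "sig k = (if k = k0 \<or> k = l0 then lam else 1)" for k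
 have kl': "k0 ~= l0" "k0 ~= p" "l0 ~= p" using kl by auto
 have "(\<Prod>k\<in>UNIV. a $ k) = (\<Prod>k\<in>{k0, l0}. a $ k)"
  by (rule prod.mono_neutral_right) (auto simp: a_def)
 then have aS: "dg a \<in> carrier SL" using kl' lam by (simp add: mem_SL det_dg a_def)
 have "(\<Prod>k\<in>UNIV. \<bar>sig k\<bar>) = (\<Prod>k\<in>{k0, l0}. \<bar>sig k\<bar>)"
  by (rule prod.mono_neutral_right) (auto simp: sig_def)
 then have sigp: "(\<Prod>k\<in>UNIV. \<bar>sig k\<bar>) = 1 / q" using kl' lam by (simp add: sig_def)
 have sig0: "sig k ~= 0" for k using lam by (simp add: sig_def)
 note p = std_point(2)[OF s] and w = std_point(1)[OF s]
 have g: "g \<in> carrier SL" using s by (rule std_SL)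
 obtain C where C: "0 < C"
  "\<And>phi h. phi \<in> schwartz ==> h \<in> carrier SL ==>
  hor_int dn (Ad g ` Bup) phi h = C *\<^sub>R (LINT x|lborel. indicator {0..1} (x $ p) *\<^sub>R phi (h ** cos_rep g p p x))"
  "\<And>phi h. phi \<in> schwartz ==> h \<in> carrier SL ==> (%x. phi (h ** cos_rep g p p x)) \<in> borel_measurable borel"
  by (rule hor_int_strip[where dn = dn, OF n p ms]) (rule that)
 have "hor_int dn (Ad g ` Bup) phi (l ** Ad g (dg a)) = q *\<^sub>R hor_int dn (Ad g ` Bup) phi l"
  if phi: "phi \<in> schwartz" and l: "l \<in> carrier SL" for phi l
 proof -
  define h where "h x = indicator {0..1} (x $ p) *\<^sub>R phi (l ** cos_rep g p p x)" for x
  have hm: "h \<in> borel_measurable borel" unfolding h_def[abs_def] using C(3)[OF phi l] by measurable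
  have "indicator {0..1} (x $ p) *\<^sub>R phi (l ** Ad g (dg a) ** cos_rep g p p x) = h (\<chi> k. 0 + sig k * x $ k)" for x
  proof -
  have "Xd p a x = Xi p (\<chi> k. 0 + sig k * x $ k)" using kl kl' by (auto simp: Xd_def Xi_def vec_eq_iff a_def sig_def)
  moreover have "Ed (wv g) p a x = Eta (wv g) p (\<chi> k. 0 + sig k * x $ k)"
  using kl kl' by (auto simp: w Ed_def Eta_point vec_eq_iff a_def sig_def)
  ultimately have "orb (l ** Ad g (dg a) ** cos_rep g p p x) = orb (l ** cos_rep g p p (\<chi> k. 0 + sig k * x $ k))"
  by (simp only: orb_translate(1,3)[OF n p l aS])
  then show ?thesis
  using schwartz_invariant[OF n phi orb_translate(2)[OF n p l aS, of x] orb_translate(4)[OF n p l aS, of "\<chi> k. 0 + sig k * x $ k"]] kl'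
  by (simp add: h_def sig_def)
  qed
  then have "hor_int dn (Ad g ` Bup) phi (l ** Ad g (dg a)) = C *\<^sub>R (LINT x|lborel. h (\<chi> k. 0 + sig k * x $ k))"
  using C(2)[OF phi SL_mult[OF l Ad_SL[OF g aS]]] by simp
  moreover have "hor_int dn (Ad g ` Bup) phi l = C *\<^sub>R (LINT x|lborel. h x)" using C(2)[OF phi l] by (simp add: h_def)
  moreover have "(LINT x|lborel. h x) = (1 / q) *\<^sub>R (LINT x|lborel. h (\<chi> k. 0 + sig k * x $ k))"
  using nn_integral_scale(2)[of sig _ h "%_. 0", OF sig0 borel_measurable_const hm] unfolding sigp .
  ultimately show ?thesis using q by simp
 qed
 then show ?thesis using aS by blast
qed

lemma tendsto_Ad_outer:
 fixes W :: "'n::finite rmat"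
 assumes "(X \<longlongrightarrow> a) F" "(Y \<longlongrightarrow> b) F"
 shows "((%t. Ad W (outer (X t) (Y t))) \<longlongrightarrow> Ad W (outer a b)) F"
proof -
 have "((%t. outer (X t) (Y t)) \<longlongrightarrow> outer a b) F"
  by (intro vec_tendstoI) (use assms in \<open>auto simp: outer_nth intro!: tendsto_intros\<close>)
 then show ?thesis
  using bounded_linear.tendsto[OF linear_conv_bounded_linear[THEN iffD1, OF Ad_linear]] by blast
qed

definition dd :: "'n => 'n => real => 'n::finite rvec" where "dd j i c = (\<chi> k. exp (hv j i c $ k))"

lemma scal_signs:
 fixes e :: "'n::{finite,linorder} rvec"
 assumes ji: "j ~= i" and e: "\<And>k. \<bar>e $ k\<bar> = 1" "(\<Prod>k\<in>UNIV. e $ k) = 1"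
 shows "scal j i (exp (- c)) (\<chi> k. e $ k * dd j i c $ k)"
proof -
 have "(\<Prod>k\<in>UNIV. exp (hv j i c $ k)) = 1" by (simp add: exp_sum[symmetric] hv_sum)
 then have "dg (\<chi> k. e $ k * dd j i c $ k) \<in> carrier SL" by (simp add: mem_SL det_dg prod.distrib e dd_def)
 then show ?thesis using ji by (auto simp: scal_def abs_mult e dd_def hv_nth exp_minus inverse_eq_divide)
qed

lemma H_P_std:
 fixes h :: "'n::{finite,linorder} rmat"
 assumes n: "CARD('n) \<ge> 3" and s: "std h j i" and a: "adj j i"
  and e: "\<And>k. \<bar>e $ k\<bar> = 1" "(\<Prod>k\<in>UNIV. e $ k) = 1"
 shows "H_P dn (Ad h ` Bup) (Ad h ` Dpos) phi (Ad h (dg e) ** mat_exp (t *\<^sub>R Ad h (dg (hv j i c)))) =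
  of_real (exp (t * c)) * hor_int dn (Ad h ` Bup) phi (Ad h (dg (\<chi> k. e $ k * dd j i (t * c) $ k)))"
proof -
 have h: "h \<in> carrier SL" using s by (rule std_SL)
 have ji: "j ~= i" using a by (auto simp: adj_def)
 let ?d = "\<chi> k. e $ k * dd j i (t * c) $ k"
 have "Ad h (dg e) ** mat_exp (t *\<^sub>R Ad h (dg (hv j i c))) = Ad h (dg ?d)"
  unfolding exp_std[OF h] Ad_mult[OF h] dd_def[symmetric] by (simp add: dg_mult)
 moreover have "dg ?d \<in> carrier SL" using scal_signs[OF ji e, of "t * c"] by (simp add: scal_def)
 then have "delta_P (Ad h ` Bup) (Ad h ` Dpos) (Ad h (dg ?d)) = exp (t * c)"
  by (rule std_delta[OF n s a]) (simp add: abs_mult e dd_def)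
 ultimately show ?thesis by (simp add: H_P_def)
qed

text \<open>After squeezing, the first vector is tau times a fixed one, and tau times the second
  tends to the second vector of a rank zero flag with pivot i: its entry at j is tau^2 / 2 and that
  at i tends to 1. So the outer product converges, and \<open>strip_limit\<close> passes to the
  integrals.\<close>

lemma limit_right:
 fixes g gQ :: "'n::{finite,linorder} rmat"
 assumes n: "CARD('n) \<ge> 3" and s: "std g j i" and a: "adj j i" and R: "card {i<..} = card {..<j} + 1" and sQ: "std gQ i i"
  and ms: "invariant_on dn (Ad g ` Bup)"
  and msQ: "invariant_on dn (Ad gQ ` Bup)"
 shows "\<exists>q>0. \<forall>w\<in>carrier SL. \<forall>phi\<in>schwartz. \<forall>c>0.
  ((%t. exp (t * c) *\<^sub>R hor_int dn (Ad g ` Bup) phi (w ** Ad g (dg (dd j i (t * c))))) \<longlongrightarrow>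
  q *\<^sub>R hor_int dn (Ad gQ ` Bup) phi (w ** g ** matrix_inv gQ)) at_top"
proof -
 have n2: "CARD('n) \<ge> 2" using n by simp
 have ji: "j < i" and gap: "{j<..<i} = {}" using a by (auto simp: adj_def)
 have p: "pivot g j i" using s a by (rule std_pivot[OF _ disjI1])
 have g: "g \<in> carrier SL" and gQ: "gQ \<in> carrier SL" using s sQ by (auto intro: std_SL)
 note pQ = std_point(2)[OF sQ] and wQ = std_point(1)[OF sQ]
 have cn: "card {..<j} + card {i<..} + 2 = CARD('n)" using card_split_pair[OF ji] gap by simp
 have kappa: "(real CARD('n) - 1) / 2 = real (card {i<..})" using R cn[symmetric] by simp
 obtain C where C: "0 < C"
  "\<And>phi h. phi \<in> schwartz ==> h \<in> carrier SL ==>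
  hor_int dn (Ad g ` Bup) phi h = C *\<^sub>R (LINT x|lborel. indicator {0..1} (x $ i) *\<^sub>R phi (h ** cos_rep g j i x))"
  "\<And>phi h. phi \<in> schwartz ==> h \<in> carrier SL ==> (%x. phi (h ** cos_rep g j i x)) \<in> borel_measurable borel"
  by (rule hor_int_strip[where dn = dn, OF n2 p ms]) (rule that)
 obtain CQ where CQ: "0 < CQ"
  "\<And>phi h. phi \<in> schwartz ==> h \<in> carrier SL ==>
  hor_int dn (Ad gQ ` Bup) phi h = CQ *\<^sub>R (LINT x|lborel. indicator {0..1} (x $ i) *\<^sub>R phi (h ** cos_rep gQ i i x))"
  "\<And>phi h. phi \<in> schwartz ==> h \<in> carrier SL ==> (%x. phi (h ** cos_rep gQ i i x)) \<in> borel_measurable borel"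
  by (rule hor_int_strip[where dn = dn, OF n2 pQ msQ]) (rule that)
 have "((%t. exp (t * c) *\<^sub>R hor_int dn (Ad g ` Bup) phi (w ** Ad g (dg (dd j i (t * c))))) \<longlongrightarrow>
  (C / CQ) *\<^sub>R hor_int dn (Ad gQ ` Bup) phi (w ** g ** matrix_inv gQ)) at_top"
  if w: "w \<in> carrier SL" and phi: "phi \<in> schwartz" and c: "c > 0" for w phi c
 proof -
  define tau where "tau t = exp (- (t * c))" for t
  have taup: "0 < tau t" for t by (simp add: tau_def)
  have tau0: "(tau \<longlongrightarrow> 0) at_top" unfolding tau_def[abs_def] using c by real_asymp
  define d where "d t = dd j i (t * c)" for t
  have sc: "scal j i (tau t) (d t)" for t
  using scal_signs[of j i "\<chi> k. 1" "t * c"] ji by (simp add: d_def tau_def)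
  have dS: "dg (d t) \<in> carrier SL" for t using sc by (simp add: scal_def)
  define F where "F t x = phi (w ** Ad g (dg (d t)) ** cos_rep g j i x)" for t x
  define l where "l = w ** g ** matrix_inv gQ"
  have l: "l \<in> carrier SL" unfolding l_def using w g gQ SL_inv by blast
  have lg: "l ** gQ = w ** g" unfolding l_def by (simp only: matrix_mul_assoc[symmetric] SL_cancel[OF gQ] matrix_mul_rid)
  define F0 where "F0 y = phi (l ** cos_rep gQ i i y)" for y
  obtain c0 where c0: "c0 > 0" and wb: "\<forall>m. \<exists>Mc\<ge>0. \<forall>d x. dg d \<in> carrier SL -->
  norm (phi (w ** Ad g (dg d) ** cos_rep g j i x)) \<le>
  Mc * (wt (real (card {i<..})) c0 m (norm (Xd i d x) * norm (Ed (wv g) i d x)))"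
  using weight_bound[OF n p w phi] unfolding kappa by blast
  obtain Mc where Mc: "Mc \<ge> 0" and wbm: "\<And>d x. dg d \<in> carrier SL ==>
  norm (phi (w ** Ad g (dg d) ** cos_rep g j i x)) \<le>
  Mc * (wt (real (card {i<..})) c0 (1 + 2 * (card {..<j} + card {i<..} + 1)) (norm (Xd i d x) * norm (Ed (wv g) i d x)))"
  using spec[OF wb, of "1 + 2 * (card {..<j} + card {i<..} + 1)"] by auto
  have "((%t. (1 / tau t) *\<^sub>R (LINT x|lborel. indicator {0..1} (x $ i) *\<^sub>R F t x)) \<longlongrightarrow> (LINT y|lborel. indicator {0..1} (y $ i) *\<^sub>R F0 y)) at_top"
  proof (rule strip_limit[OF adj_splitting[OF a] c0 R Mc taup tau0])
  show "strip j {..<j} {i<..} (tau t) (norm (Xd i (d t) x)) (norm (Ed (wv g) i (d t) x)) x" for t x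
  by (rule strip_std[OF s a sc])
  show "F t \<in> borel_measurable borel" for t
  unfolding F_def[abs_def] by (rule C(3)[OF phi]) (use w g dS in blast)
  show "norm (F t x) \<le> Mc * (wt (real (card {i<..})) c0 (1 + 2 * (card {..<j} + card {i<..} + 1)) (norm (Xd i (d t) x) * norm (Ed (wv g) i (d t) x)))" for t x
  unfolding F_def by (rule wbm[OF dS])
  fix y :: "'n rvec"
  let ?x = "%t. squeeze j {..<j} {i<..} (tau t) y"
  define E where "E t = (\<chi> k. if i < k then y $ k else if k = i then 1 - (tau t)\<^sup>2 * y $ j / 2 else if k = j then (tau t)\<^sup>2 / 2 else 0)" for t
  have dn: "d t $ k = (if k = j then 1 / tau t else if k = i then tau t else 1)" for t k
  using ji by (simp add: d_def dd_def hv_nth tau_def exp_minus inverse_eq_divide)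
  have tri: "k < j \<or> k = j \<or> k = i \<or> i < k" for k
  proof -
  have "k \<notin> {j<..<i}" unfolding gap by simp
  then show ?thesis using linorder_less_linear[of k j] linorder_less_linear[of k i] by auto
  qed
  have X: "Xd i (d t) (?x t) = tau t *\<^sub>R Xi i y" for t
  proof (rule vec_eq_iff[THEN iffD2], rule allI)
  show "Xd i (d t) (?x t) $ k = (tau t *\<^sub>R Xi i y) $ k" for k
  using tri[of k] ji taup[of t] by (auto simp: Xd_def Xi_def squeeze_def dn power2_eq_square)
  qed
  have Ee: "tau t *\<^sub>R Ed (wv g) i (d t) (?x t) = E t" for t
  proof (rule vec_eq_iff[THEN iffD2], rule allI)
  show "(tau t *\<^sub>R Ed (wv g) i (d t) (?x t)) $ k = E t $ k" for k
  using tri[of k] ji taup[of t] by (auto simp: Ed_def Eta_pair[OF s a] squeeze_def dn E_def power2_eq_square)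
  qed
  have oe: "outer (Xd i (d t) (?x t)) (Ed (wv g) i (d t) (?x t)) = outer (Xi i y) (E t)" for t
  unfolding X Ee[symmetric] by (simp add: outer_scaleR)
  have "(E \<longlongrightarrow> Eta (wv gQ) i y) at_top"
  proof (rule vec_tendstoI)
  fix k
  have "((%t. 1 - (tau t)\<^sup>2 * y $ j / 2) \<longlongrightarrow> 1 - 0\<^sup>2 * y $ j / 2) at_top" "((%t. (tau t)\<^sup>2 / 2) \<longlongrightarrow> 0\<^sup>2 / 2) at_top"
  by (intro tendsto_intros tau0; simp)+
  then show "((%t. E t $ k) \<longlongrightarrow> Eta (wv gQ) i y $ k) at_top"
  using ji by (cases "k = i"; cases "k = j") (auto simp: wQ Eta_point E_def)
  qed
  then have "((%t. Ad (w ** g) (outer (Xi i y) (E t))) \<longlongrightarrow> Ad (w ** g) (outer (Xi i y) (Eta (wv gQ) i y))) at_top"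
  by (intro tendsto_Ad_outer tendsto_const)
  then have "((%t. orb (w ** Ad g (dg (d t)) ** cos_rep g j i (?x t))) \<longlongrightarrow> orb (l ** cos_rep gQ i i y)) at_top"
  by (simp only: orb_translate(1)[OF n2 p w dS] orb_translate(3)[OF n2 pQ l SL_one[folded dg_one]] oe lg)
  then show "((%t. F t (?x t)) \<longlongrightarrow> F0 y) at_top" unfolding F_def F0_def
  by (rule schwartz_tendsto[OF n2 phi orb_translate(4)[OF n2 pQ l SL_one[folded dg_one]] orb_translate(2)[OF n2 p w dS]])
  qed
  from tendsto_scaleR[OF tendsto_const[of C] this]
  have "((%t. C *\<^sub>R (1 / tau t) *\<^sub>R (LINT x|lborel. indicator {0..1} (x $ i) *\<^sub>R F t x)) \<longlongrightarrow> C *\<^sub>R (LINT y|lborel. indicator {0..1} (y $ i) *\<^sub>R F0 y)) at_top" .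
  moreover have "exp (t * c) *\<^sub>R hor_int dn (Ad g ` Bup) phi (w ** Ad g (dg (dd j i (t * c)))) = C *\<^sub>R (1 / tau t) *\<^sub>R (LINT x|lborel. indicator {0..1} (x $ i) *\<^sub>R F t x)" for t
  using C(2)[OF phi SL_mult[OF w Ad_SL[OF g dS[of t]]]] by (simp add: F_def d_def tau_def exp_minus divide_inverse mult.commute)
  moreover have "(C / CQ) *\<^sub>R hor_int dn (Ad gQ ` Bup) phi (w ** g ** matrix_inv gQ) = C *\<^sub>R (LINT y|lborel. indicator {0..1} (y $ i) *\<^sub>R F0 y)"
  using CQ(1) CQ(2)[OF phi l] by (simp add: F0_def l_def)
  ultimately show ?thesis by simp
 qed
 then show ?thesis using C(1) CQ(1) by (intro exI[of _ "C / CQ"]) auto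
qed

text \<open>The mirror image: after the reflection the second vector is fixed up to scale, while the
  first loses its entry at i in the limit, so that the limit flag has pivot j.\<close>

lemma limit_left:
 fixes g gQ :: "'n::{finite,linorder} rmat"
 assumes n: "CARD('n) \<ge> 3" and s: "std g j i" and a: "adj j i" and R: "card {..<j} = card {i<..} + 1" and sQ: "std gQ j j"
  and ms: "invariant_on dn (Ad g ` Bup)"
  and msQ: "invariant_on dn (Ad gQ ` Bup)"
 shows "\<exists>q>0. \<forall>w\<in>carrier SL. \<forall>phi\<in>schwartz. \<forall>c>0.
  ((%t. exp (t * c) *\<^sub>R hor_int dn (Ad g ` Bup) phi (w ** Ad g (dg (dd j i (t * c))))) \<longlongrightarrow>
  q *\<^sub>R hor_int dn (Ad gQ ` Bup) phi (w ** g ** matrix_inv gQ)) at_top"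
proof -
 have n2: "CARD('n) \<ge> 2" using n by simp
 have ji: "j < i" and gap: "{j<..<i} = {}" using a by (auto simp: adj_def)
 have p: "pivot g j i" using s a by (rule std_pivot[OF _ disjI1])
 have g: "g \<in> carrier SL" and gQ: "gQ \<in> carrier SL" using s sQ by (auto intro: std_SL)
 note pQ = std_point(2)[OF sQ] and wQ = std_point(1)[OF sQ]
 have cn: "card {..<j} + card {i<..} + 2 = CARD('n)" using card_split_pair[OF ji] gap by simp
 have kappa: "(real CARD('n) - 1) / 2 = real (card {..<j})" using R cn[symmetric] by simp
 obtain C where C: "0 < C"
  "\<And>phi h. phi \<in> schwartz ==> h \<in> carrier SL ==>
  hor_int dn (Ad g ` Bup) phi h = C *\<^sub>R (LINT x|lborel. indicator {0..1} (x $ i) *\<^sub>R phi (h ** cos_rep g j i x))"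
  "\<And>phi h. phi \<in> schwartz ==> h \<in> carrier SL ==> (%x. phi (h ** cos_rep g j i x)) \<in> borel_measurable borel"
  by (rule hor_int_strip[where dn = dn, OF n2 p ms]) (rule that)
 obtain CQ where CQ: "0 < CQ"
  "\<And>phi h. phi \<in> schwartz ==> h \<in> carrier SL ==>
  hor_int dn (Ad gQ ` Bup) phi h = CQ *\<^sub>R (LINT x|lborel. indicator {0..1} (x $ j) *\<^sub>R phi (h ** cos_rep gQ j j x))"
  "\<And>phi h. phi \<in> schwartz ==> h \<in> carrier SL ==> (%x. phi (h ** cos_rep gQ j j x)) \<in> borel_measurable borel"
  by (rule hor_int_strip[where dn = dn, OF n2 pQ msQ]) (rule that)
 \<comment> \<open>The limit pair has the entries 2 and 1/2 at j. Normalizing both to 1 scales the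
   coordinates before j by 1/2 and those after i by 2, with Jacobian J.\<close>
 define sig :: "'n => real" where "sig k = (if k = i \<or> k = j then 1 else if k < j then 1/2 else 2)" for k
 have sig0: "sig k ~= 0" for k by (simp add: sig_def)
 define J where "J = (\<Prod>k\<in>UNIV. \<bar>sig k\<bar>)"
 have J: "J > 0" unfolding J_def using sig0 by (intro prod_pos) simp
 \<comment> \<open>The spare coordinate is i for the given flag but j for the limit flag, hence the
   exchange.\<close>
 define \<pi> where "\<pi> k = (if k = i then j else if k = j then i else k)" for k
 have \<pi>: "\<pi> (\<pi> k) = k" for k using ji by (simp add: \<pi>_def)
 define U where "U y = (\<chi> k. 0 + sig k * (\<chi> k. y $ \<pi> k) $ k)" for y :: "'n rvec"
 have "((%t. exp (t * c) *\<^sub>R hor_int dn (Ad g ` Bup) phi (w ** Ad g (dg (dd j i (t * c))))) \<longlongrightarrow>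
  (C / (J * CQ)) *\<^sub>R hor_int dn (Ad gQ ` Bup) phi (w ** g ** matrix_inv gQ)) at_top"
  if w: "w \<in> carrier SL" and phi: "phi \<in> schwartz" and c: "c > 0" for w phi c
 proof -
  define tau where "tau t = exp (- (t * c))" for t
  have taup: "0 < tau t" for t by (simp add: tau_def)
  have tau0: "(tau \<longlongrightarrow> 0) at_top" unfolding tau_def[abs_def] using c by real_asymp
  define d where "d t = dd j i (t * c)" for t
  have sc: "scal j i (tau t) (d t)" for t
  using scal_signs[of j i "\<chi> k. 1" "t * c"] ji by (simp add: d_def tau_def)
  have dS: "dg (d t) \<in> carrier SL" for t using sc by (simp add: scal_def)
  define F where "F t x = phi (w ** Ad g (dg (d t)) ** cos_rep g j i x)" for t x
  define l where "l = w ** g ** matrix_inv gQ"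
  have l: "l \<in> carrier SL" unfolding l_def using w g gQ SL_inv by blast
  have lg: "l ** gQ = w ** g" unfolding l_def by (simp only: matrix_mul_assoc[symmetric] SL_cancel[OF gQ] matrix_mul_rid)
  define F0 where "F0 y = phi (l ** cos_rep gQ j j (U y))" for y
  obtain c0 where c0: "c0 > 0" and wb: "\<forall>m. \<exists>Mc\<ge>0. \<forall>d x. dg d \<in> carrier SL -->
  norm (phi (w ** Ad g (dg d) ** cos_rep g j i x)) \<le>
  Mc * (wt (real (card {..<j})) c0 m (norm (Xd i d x) * norm (Ed (wv g) i d x)))"
  using weight_bound[OF n p w phi] unfolding kappa by blast
  obtain Mc where Mc: "Mc \<ge> 0" and wbm: "\<And>d x. dg d \<in> carrier SL ==>
  norm (phi (w ** Ad g (dg d) ** cos_rep g j i x)) \<le>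
  Mc * (wt (real (card {..<j})) c0 (1 + 2 * (card {..<j} + card {i<..} + 1)) (norm (Xd i d x) * norm (Ed (wv g) i d x)))"
  using spec[OF wb, of "1 + 2 * (card {..<j} + card {i<..} + 1)"] by auto
  have "((%t. (1 / tau t) *\<^sub>R (LINT x|lborel. indicator {0..1} (x $ i) *\<^sub>R F t x)) \<longlongrightarrow> (LINT y|lborel. indicator {0..1} (y $ i) *\<^sub>R F0 y)) at_top"
  proof (rule strip_limit_refl[OF adj_splitting[OF a] c0 R Mc taup tau0])
  show "strip j {..<j} {i<..} (tau t) (norm (Xd i (d t) x)) (norm (Ed (wv g) i (d t) x)) x" for t x
  by (rule strip_std[OF s a sc])
  show "F t \<in> borel_measurable borel" for t
  unfolding F_def[abs_def] by (rule C(3)[OF phi]) (use w g dS in blast)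
  show "norm (F t x) \<le> Mc * (wt (real (card {..<j})) c0 (1 + 2 * (card {..<j} + card {i<..} + 1)) (norm (Xd i (d t) x) * norm (Ed (wv g) i (d t) x)))" for t x
  unfolding F_def by (rule wbm[OF dS])
  fix y :: "'n rvec"
  let ?x = "%t. refl_at j (squeeze j {i<..} {..<j} (tau t) y)"
  define E where "E = (\<chi> k. if i < k then y $ k else if k = i then y $ j / 2 else if k = j then 1 / 2 else 0)"
  define X0 where "X0 t = (\<chi> k. if k < j then y $ k else if k = j then 2 - (tau t)\<^sup>2 * y $ j else if k = i then (tau t)\<^sup>2 else 0)" for t
  have dn: "d t $ k = (if k = j then 1 / tau t else if k = i then tau t else 1)" for t k
  using ji by (simp add: d_def dd_def hv_nth tau_def exp_minus inverse_eq_divide)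
  have tri: "k < j \<or> k = j \<or> k = i \<or> i < k" for k
  proof -
  have "k \<notin> {j<..<i}" unfolding gap by simp
  then show ?thesis using linorder_less_linear[of k j] linorder_less_linear[of k i] by auto
  qed
  have X: "tau t *\<^sub>R Xd i (d t) (?x t) = X0 t" for t
  proof (rule vec_eq_iff[THEN iffD2], rule allI)
  show "(tau t *\<^sub>R Xd i (d t) (?x t)) $ k = X0 t $ k" for k
  using tri[of k] ji taup[of t] by (auto simp: Xd_def Xi_def squeeze_def dn X0_def power2_eq_square)
  qed
  have Ee: "(1 / tau t) *\<^sub>R Ed (wv g) i (d t) (?x t) = E" for t
  proof (rule vec_eq_iff[THEN iffD2], rule allI)
  show "((1 / tau t) *\<^sub>R Ed (wv g) i (d t) (?x t)) $ k = E $ k" for k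
  using tri[of k] ji taup[of t] by (auto simp: Ed_def Eta_pair[OF s a] squeeze_def dn E_def power2_eq_square field_simps)
  qed
  have oe: "outer (Xd i (d t) (?x t)) (Ed (wv g) i (d t) (?x t)) = outer (X0 t) E" for t
  unfolding X[symmetric] Ee[of t, symmetric] using taup[of t] by (simp add: outer_scaleR)
  define X1 where "X1 = (\<chi> k. if k < j then y $ k else if k = j then 2 else 0)"
  have lim0: "outer X1 E = outer (Xi j (U y)) (Eta (wv gQ) j (U y))"
  proof -
  have "Xi j (U y) = (1 / 2) *\<^sub>R X1"
  proof (rule vec_eq_iff[THEN iffD2], rule allI)
  show "Xi j (U y) $ k = ((1 / 2) *\<^sub>R X1) $ k" for k
  using tri[of k] ji by (auto simp: Xi_def U_def X1_def sig_def \<pi>_def)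
  qed
  moreover have "Eta (wv gQ) j (U y) = 2 *\<^sub>R E"
  proof (rule vec_eq_iff[THEN iffD2], rule allI)
  show "Eta (wv gQ) j (U y) $ k = (2 *\<^sub>R E) $ k" for k
  using tri[of k] ji by (auto simp: wQ Eta_point U_def E_def sig_def \<pi>_def)
  qed
  ultimately show ?thesis by (simp add: outer_scaleR)
  qed
  have "(X0 \<longlongrightarrow> X1) at_top"
  proof (rule vec_tendstoI)
  fix k
  have "((%t. 2 - (tau t)\<^sup>2 * y $ j) \<longlongrightarrow> 2 - 0\<^sup>2 * y $ j) at_top" "((%t. (tau t)\<^sup>2) \<longlongrightarrow> 0\<^sup>2) at_top"
  by (intro tendsto_intros tau0; simp)+
  then show "((%t. X0 t $ k) \<longlongrightarrow> X1 $ k) at_top"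
  using ji by (cases "k = i"; cases "k = j") (auto simp: X1_def X0_def)
  qed
  then have "((%t. Ad (w ** g) (outer (X0 t) E)) \<longlongrightarrow> Ad (w ** g) (outer X1 E)) at_top"
  by (intro tendsto_Ad_outer tendsto_const)
  then have "((%t. orb (w ** Ad g (dg (d t)) ** cos_rep g j i (?x t))) \<longlongrightarrow> orb (l ** cos_rep gQ j j (U y))) at_top"
  by (simp only: orb_translate(1)[OF n2 p w dS] orb_translate(3)[OF n2 pQ l SL_one[folded dg_one]] oe lg lim0)
  then show "((%t. F t (?x t)) \<longlongrightarrow> F0 y) at_top" unfolding F_def F0_def
  by (rule schwartz_tendsto[OF n2 phi orb_translate(4)[OF n2 pQ l SL_one[folded dg_one]] orb_translate(2)[OF n2 p w dS]])
  qed
  from tendsto_scaleR[OF tendsto_const[of C] this]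
  have "((%t. C *\<^sub>R (1 / tau t) *\<^sub>R (LINT x|lborel. indicator {0..1} (x $ i) *\<^sub>R F t x)) \<longlongrightarrow> C *\<^sub>R (LINT y|lborel. indicator {0..1} (y $ i) *\<^sub>R F0 y)) at_top" .
  moreover have "exp (t * c) *\<^sub>R hor_int dn (Ad g ` Bup) phi (w ** Ad g (dg (dd j i (t * c)))) = C *\<^sub>R (1 / tau t) *\<^sub>R (LINT x|lborel. indicator {0..1} (x $ i) *\<^sub>R F t x)" for t
  using C(2)[OF phi SL_mult[OF w Ad_SL[OF g dS[of t]]]] by (simp add: F_def d_def tau_def exp_minus divide_inverse mult.commute)
  moreover have "(C / (J * CQ)) *\<^sub>R hor_int dn (Ad gQ ` Bup) phi (w ** g ** matrix_inv gQ) = C *\<^sub>R (LINT y|lborel. indicator {0..1} (y $ i) *\<^sub>R F0 y)"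
  proof -
  define h where "h x = indicator {0..1} (x $ j) *\<^sub>R phi (l ** cos_rep gQ j j x)" for x
  have hm[measurable]: "h \<in> borel_measurable borel" unfolding h_def[abs_def] using CQ(3)[OF phi l] by measurable
  have "U y $ j = y $ i" for y using ji by (simp add: U_def sig_def \<pi>_def)
  then have "(LINT y|lborel. indicator {0..1} (y $ i) *\<^sub>R F0 y) = (LINT y|lborel. h (U y))" by (simp add: h_def F0_def)
  also have "\<dots> = (LINT y|lborel. h (\<chi> k. 0 + sig k * y $ k))"
  proof -
  have "(%y :: 'n rvec. (\<chi> k. 0 + sig k * y $ k) :: 'n rvec) \<in> borel_measurable borel"
  by (rule borel_measurable_continuous_onI) (auto intro!: continuous_intros)
  from integral_permute[of \<pi> "%y. h (\<chi> k. 0 + sig k * y $ k)", OF \<pi> measurable_compose[OF this hm]]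
  show ?thesis by (simp add: U_def)
  qed
  finally have "(LINT x|lborel. h x) = J *\<^sub>R (LINT y|lborel. indicator {0..1} (y $ i) *\<^sub>R F0 y)"
  using nn_integral_scale(2)[of sig _ h "%_. 0", OF sig0 borel_measurable_const hm] by (simp add: J_def)
  then show ?thesis using CQ(1) CQ(2)[OF phi l] J by (simp add: h_def l_def)
  qed
  ultimately show ?thesis by simp
 qed
 then show ?thesis using C(1) CQ(1) J by (intro exI[of _ "C / (J * CQ)"]) auto
qed

text \<open>The point g1 must serve every admissible A and v. Changing A conjugates by a unipotent
  \<open>nu\<close>, which moves the limit point only by an element of the unipotent radical of the
  limit parabolic, and the integral does not see it. Changing v only rescales t.\<close>

lemma H_P_tendsto:
 fixes g gQ :: "'n::{finite,linorder} rmat"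
 assumes n: "CARD('n) \<ge> 3" and s: "std g j i" and a: "adj j i" and sQ: "std gQ p p" and kl: "k0 < p" "p < l0"
  and LR: "card {i<..} = card {..<j} + 1 \<and> p = i \<or> card {..<j} = card {i<..} + 1 \<and> p = j"
  and ms: "\<And>R. R \<in> min_parabolics ==>
  nonzero_invariant_radon (unipotent_radical R) (unipotent_radical R \<inter> Hgrp) (dn R)"
 shows "\<exists>g1\<in>carrier SL. \<forall>A v. admissible (Ad g ` Bup) A v --> (\<forall>phi\<in>schwartz.
  ((%t. H_P dn (Ad g ` Bup) A phi (mat_exp (t *\<^sub>R v))) \<longlongrightarrow> hor_int dn (Ad gQ ` Bup) phi g1) at_top)"
proof -
 have n2: "CARD('n) \<ge> 2" using n by simp
 have g: "g \<in> carrier SL" and gQ: "gQ \<in> carrier SL" using s sQ by (auto intro: std_SL)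
 note msP = ms[OF std_min_parabolic[OF s]] and msQ = ms[OF std_min_parabolic[OF sQ]]
 obtain q where q: "q > 0" and lim: "\<forall>w\<in>carrier SL. \<forall>phi\<in>schwartz. \<forall>c>0.
  ((%t. exp (t * c) *\<^sub>R hor_int dn (Ad g ` Bup) phi (w ** Ad g (dg (dd j i (t * c))))) \<longlongrightarrow>
  q *\<^sub>R hor_int dn (Ad gQ ` Bup) phi (w ** g ** matrix_inv gQ)) at_top"
  using LR
 proof
  assume "card {i<..} = card {..<j} + 1 \<and> p = i"
  then show thesis using limit_right[of g j i gQ dn, OF n s a _ _ msP msQ] sQ that by blast
 next
  assume "card {..<j} = card {i<..} + 1 \<and> p = j"
  then show thesis using limit_left[of g j i gQ dn, OF n s a _ _ msP msQ] sQ that by blast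
 qed
 obtain b where bS: "dg b \<in> carrier SL" and resc: "\<forall>phi\<in>schwartz. \<forall>l\<in>carrier SL.
  hor_int dn (Ad gQ ` Bup) phi (l ** Ad gQ (dg b)) = q *\<^sub>R hor_int dn (Ad gQ ` Bup) phi l"
  using hor_int_rescale[of gQ p k0 l0 q dn, OF n2 sQ kl q msQ] by blast
 \<comment> \<open>The diagonal b compensates for the constant q between the two integrals.\<close>
 define g1 where "g1 = g ** dg b ** matrix_inv gQ"
 have g1: "g1 \<in> carrier SL" unfolding g1_def using g bS gQ SL_inv by blast
 have "((%t. H_P dn (Ad g ` Bup) A phi (mat_exp (t *\<^sub>R v))) \<longlongrightarrow> hor_int dn (Ad gQ ` Bup) phi g1) at_top"
  if adm: "admissible (Ad g ` Bup) A v" and phi: "phi \<in> schwartz" for A v phi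
 proof -
  obtain nu c where nu: "nu \<in> Uni" "std (g ** nu) j i" "A = Ad (g ** nu) ` Dpos" "0 < c" "v = Ad (g ** nu) (dg (hv j i c))"
  by (rule admissible_obtain[OF n s a adm]) (rule that)
  have nuS: "nu \<in> carrier SL" by (rule Uni_SL[OF nu(1)])
  have h: "g ** nu \<in> carrier SL" using g nuS by blast
  have P: "Ad (g ** nu) ` Bup = Ad g ` Bup" by (rule conj_Bup_mult[OF g subsetD[OF Uni_sub_Bup nu(1)]])
  have dS: "dg (dd j i c) \<in> carrier SL" for c
  using scal_signs[of j i "\<chi> k. 1" c] a by (auto simp: scal_def adj_def)
  have one: "Ad (g ** nu) (dg (\<chi> k. 1)) = mat 1"
  proof -
  have "dg (\<chi> k. 1) = (mat 1 :: 'n rmat)" by (simp add: vec_eq_iff dg_nth mat_def)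
  then show ?thesis using h by (simp add: Ad_def SL_cancel)
  qed
  have conj: "Ad (g ** nu) D = (Ad g nu ** Ad g D) ** Ad g (matrix_inv nu)" for D
  unfolding Ad_mult[OF g] Ad_Ad[OF g nuS, symmetric] by (simp add: Ad_def)
  have H: "H_P dn (Ad g ` Bup) A phi (mat_exp (t *\<^sub>R v)) =
  exp (t * c) *\<^sub>R hor_int dn (Ad g ` Bup) phi (Ad g nu ** Ad g (dg (dd j i (t * c))))" for t
  proof -
  have dd1: "(\<chi> k. (\<chi> k. 1) $ k * dd j i (t * c) $ k) = dd j i (t * c)" by (simp add: vec_eq_iff)
  have "H_P dn (Ad g ` Bup) A phi (mat_exp (t *\<^sub>R v)) =
  of_real (exp (t * c)) * hor_int dn (Ad g ` Bup) phi (Ad (g ** nu) (dg (dd j i (t * c))))"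
  using H_P_std[of "g ** nu" j i "\<chi> k. 1" dn phi t c, OF n nu(2) a] unfolding P one dd1 nu(3,5) by simp
  also have "hor_int dn (Ad g ` Bup) phi (Ad (g ** nu) (dg (dd j i (t * c)))) =
  hor_int dn (Ad g ` Bup) phi (Ad g nu ** Ad g (dg (dd j i (t * c))))"
  unfolding conj
  proof (rule hor_int_translate[where dn = dn, OF n2 g phi msP])
  show "Ad g nu ** Ad g (dg (dd j i (t * c))) \<in> carrier SL" using Ad_SL[OF g nuS] Ad_SL[OF g dS] by blast
  qed (rule Uni_inv[OF nu(1)])
  finally show ?thesis by (simp add: scaleR_conv_of_real)
  qed
  define l where "l = Ad g nu ** g ** matrix_inv gQ"
  have l: "l \<in> carrier SL" unfolding l_def using Ad_SL[OF g nuS] g gQ SL_inv by blast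
  have "((%t. H_P dn (Ad g ` Bup) A phi (mat_exp (t *\<^sub>R v))) \<longlongrightarrow> q *\<^sub>R hor_int dn (Ad gQ ` Bup) phi l) at_top"
  unfolding H l_def using lim Ad_SL[OF g nuS] phi nu(4) by blast
  also have "q *\<^sub>R hor_int dn (Ad gQ ` Bup) phi l = hor_int dn (Ad gQ ` Bup) phi (l ** Ad gQ (dg b))"
  using resc phi l by simp
  also have "l ** Ad gQ (dg b) = g1 ** Ad gQ (Ad (matrix_inv (dg b)) nu)"
  proof -
  have ib: "matrix_inv (matrix_inv (dg b)) = dg b" using SL_cancel[OF bS] by (intro matrix_inv_eqI) auto
  have "l ** Ad gQ (dg b) = g ** nu ** dg b ** matrix_inv gQ"
  unfolding l_def Ad_def
  by (simp only: matrix_mul_assoc SL_cancel_left[OF g] SL_cancel_left[OF gQ] SL_cancel[OF g] SL_cancel[OF gQ] matrix_mul_lid matrix_mul_rid)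
  moreover have "g1 ** Ad gQ (Ad (matrix_inv (dg b)) nu) = g ** nu ** dg b ** matrix_inv gQ"
  unfolding g1_def Ad_def ib
  by (simp only: matrix_mul_assoc SL_cancel_left[OF g] SL_cancel_left[OF gQ] SL_cancel_left[OF bS] SL_cancel[OF g] SL_cancel[OF gQ] matrix_mul_lid matrix_mul_rid)
  ultimately show ?thesis by simp
  qed
  also have "hor_int dn (Ad gQ ` Bup) phi (g1 ** Ad gQ (Ad (matrix_inv (dg b)) nu)) = hor_int dn (Ad gQ ` Bup) phi g1"
  proof (rule hor_int_translate[where dn = dn, OF n2 gQ phi msQ g1])
  have nz: "b $ k ~= 0" for k by (rule dg_SL_nz[OF bS])
  have ib: "matrix_inv (matrix_inv (dg b)) = dg b" using SL_cancel[OF bS] by (intro matrix_inv_eqI) auto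
  show "Ad (matrix_inv (dg b)) nu \<in> Uni"
  using nu(1) nz unfolding Ad_def ib by (simp add: Uni_def matrix_inv_dg)
  qed
  finally show ?thesis .
 qed
 then show ?thesis using g1 by blast
qed

section \<open>From powers of the logarithm to powers of t\<close>

lemma abs_le_Lam:
 assumes c: "0 < c"
 shows "t < r ==> \<bar>t\<bar> \<le> (1 / c + \<bar>r\<bar>) * Lam (exp (- (t * c)))"
  and "0 \<le> t ==> \<bar>t\<bar> \<le> (1 / c) * Lam (1 / (exp (- (t * c)))\<^sup>2)"
proof -
 have L: "- (t * c) \<le> Lam (exp (- (t * c)))"
 proof -
  have "ln (exp (- (t * c))) \<le> ln (1 + exp (- (t * c)))" by (subst ln_le_cancel_iff) (auto simp: add_pos_pos)
  then show ?thesis by (simp add: Lam_def)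
 qed
 have L1: "1 \<le> Lam (exp (- (t * c)))" by (rule Lam_ge_1) simp
 show "\<bar>t\<bar> \<le> (1 / c + \<bar>r\<bar>) * Lam (exp (- (t * c)))" if "t < r"
 proof (cases "t \<le> 0")
  case True
  have "\<bar>t\<bar> = (1 / c) * (- (t * c))" using True c by simp
  also have "\<dots> \<le> (1 / c) * Lam (exp (- (t * c)))" using L c by (intro mult_left_mono) auto
  also have "\<dots> \<le> (1 / c + \<bar>r\<bar>) * Lam (exp (- (t * c)))" using L1 by (intro mult_right_mono) auto
  finally show ?thesis .
 next
  case False
  then have "\<bar>t\<bar> \<le> \<bar>r\<bar> * 1" using that by simp
  also have "\<dots> \<le> (1 / c + \<bar>r\<bar>) * Lam (exp (- (t * c)))" using L1 c by (intro mult_mono) auto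
  finally show ?thesis .
 qed
 show "\<bar>t\<bar> \<le> (1 / c) * Lam (1 / (exp (- (t * c)))\<^sup>2)" if t: "0 \<le> t"
 proof -
  have e: "1 / (exp (- (t * c)))\<^sup>2 = exp (2 * (t * c))"
  by (simp add: exp_minus power_inverse inverse_eq_divide exp_double power_divide)
  have "ln (exp (2 * (t * c))) \<le> ln (1 + exp (2 * (t * c)))" by (subst ln_le_cancel_iff) (auto simp: add_pos_pos)
  moreover have "0 \<le> t * c" using t c by simp
  ultimately have "t * c \<le> Lam (exp (2 * (t * c)))" by (simp add: Lam_def)
  then have "(1 / c) * (t * c) \<le> (1 / c) * Lam (exp (2 * (t * c)))" using c by (intro mult_left_mono) auto
  then show ?thesis unfolding e using t c by simp
 qed
qed

text \<open>The modulus exp (t c) cancels the factor exp (- t c) of the decay estimate, and the N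
  logarithms in B absorb t^N through |t| \<le> E B.\<close>

lemma bdd_above_H_P:
 fixes g :: "'n::{finite,linorder} rmat"
 assumes n: "CARD('n) \<ge> 3" and s: "std g j i" and a: "adj j i" and M: "maximal_compact_subgroup M (centralizer_SL (Ad g ` Dpos))"
  and b: "\<And>t d. t \<in> T ==> scal j i (exp (- (t * c))) d ==> 
  \<exists>E B. 0 \<le> E \<and> 0 < B \<and> \<bar>t\<bar> \<le> E * B \<and> E ^ N \<le> D1 \<and> norm (hor_int dn (Ad g ` Bup) phi (Ad g (dg d))) \<le> exp (- (t * c)) * (D2 / B ^ N)"
  and D: "0 \<le> D2"
 shows "bdd_above ((%(m, t). norm (of_real (t ^ N) * H_P dn (Ad g ` Bup) (Ad g ` Dpos) phi
  (m ** mat_exp (t *\<^sub>R Ad g (dg (hv j i c)))))) ` (M \<times> T))"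
proof (rule bdd_aboveI2)
 fix mt assume "mt \<in> M \<times> T"
 then obtain m t where mt: "mt = (m, t)" "m \<in> M" "t \<in> T" by auto
 have g: "g \<in> carrier SL" using s by (rule std_SL)
 obtain e where e: "m = Ad g (dg e)" "\<And>k. \<bar>e $ k\<bar> = 1" "(\<Prod>k\<in>UNIV. e $ k) = 1"
  by (rule maximal_compact_signs[OF g M mt(2)]) (rule that)
 define d where "d = (\<chi> k. e $ k * dd j i (t * c) $ k)"
 have sc: "scal j i (exp (- (t * c))) d" unfolding d_def using a by (intro scal_signs e) (auto simp: adj_def)
 obtain E B where E: "0 \<le> E" "0 < B" "\<bar>t\<bar> \<le> E * B" "E ^ N \<le> D1"
  "norm (hor_int dn (Ad g ` Bup) phi (Ad g (dg d))) \<le> exp (- (t * c)) * (D2 / B ^ N)"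
  using b[OF mt(3) sc] by blast
 have "norm (of_real (t ^ N) * H_P dn (Ad g ` Bup) (Ad g ` Dpos) phi (m ** mat_exp (t *\<^sub>R Ad g (dg (hv j i c))))) =
  \<bar>t\<bar> ^ N * (exp (t * c) * norm (hor_int dn (Ad g ` Bup) phi (Ad g (dg d))))"
  unfolding e(1) H_P_std[OF n s a e(2,3)] d_def by (simp add: norm_mult norm_power power_abs)
 also have "\<dots> \<le> (E * B) ^ N * (exp (t * c) * (exp (- (t * c)) * (D2 / B ^ N)))"
  using E by (intro mult_mono power_mono) auto
 also have "exp (t * c) * (exp (- (t * c)) * (D2 / B ^ N)) = D2 / B ^ N"
  by (simp add: exp_minus)
 also have "(E * B) ^ N * (D2 / B ^ N) = E ^ N * D2" using E(2) by (simp add: power_mult_distrib)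
 also have "\<dots> \<le> D1 * D2" using E(4) D by (rule mult_right_mono)
 finally show "(%(m, t). norm (of_real (t ^ N) * H_P dn (Ad g ` Bup) (Ad g ` Dpos) phi
  (m ** mat_exp (t *\<^sub>R Ad g (dg (hv j i c)))))) mt \<le> D1 * D2" by (simp add: mt(1))
qed

theorem theorem3p2:
  fixes dn :: "('n::{finite,linorder}) rmat set \<Rightarrow> 'n rmat set measure"
  and P A M :: "'n rmat set"
  and v :: "'n rmat"
  assumes "CARD('n) \<ge> 3"
  and "\<And>R. R \<in> min_parabolics \<Longrightarrow>
  nonzero_invariant_radon (unipotent_radical R) (unipotent_radical R \<inter> Hgrp) (dn R)"
  and "P \<in> cal_P_h \<inter> cal_P_star"
  and "admissible P A v"
  and "maximal_compact_subgroup M (centralizer_SL A)"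
  shows "(even CARD('n) \<longrightarrow>
  (\<forall>\<phi> \<in> schwartz. \<forall>N::nat. bdd_above
  ((\<lambda>(m, t). norm (of_real (t ^ N) * H_P dn P A \<phi> (m ** mat_exp (t *\<^sub>R v))))
  ` (M \<times> (UNIV::real set)))))
  \<and> (odd CARD('n) \<longrightarrow>
  (\<forall>\<phi> \<in> schwartz. \<forall>r::real. \<forall>N::nat. bdd_above
  ((\<lambda>(m, t). norm (of_real (t ^ N) * H_P dn P A \<phi> (m ** mat_exp (t *\<^sub>R v))))
  ` (M \<times> {..<r})))
  \<and> (\<forall>\<phi> \<in> schwartz. \<exists>c. ((\<lambda>t::real. H_P dn P A \<phi> (mat_exp (t *\<^sub>R v))) \<longlongrightarrow> c) at_top)
  \<and> (\<exists>Q \<in> cal_Q. h_compatible Q \<and>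
  (\<exists>g \<in> carrier SL. \<forall>\<phi> \<in> schwartz. mu dn P A v \<phi> = hor_int dn Q \<phi> g))
  \<and> (\<forall>Q \<in> cal_Q. h_compatible Q \<longrightarrow>
  (\<exists>P' \<in> cal_P_h \<inter> cal_P_star. \<exists>g \<in> carrier SL.
  (\<exists>A' v'. admissible P' A' v') \<and>
  (\<forall>A' v'. admissible P' A' v' \<longrightarrow>
  (\<forall>\<phi> \<in> schwartz. hor_int dn Q \<phi> g = mu dn P' A' v' \<phi>)))))"
proof -
 note n = assms(1) and ms = assms(2)
 have n2: "CARD('n) \<ge> 2" using n by simp
 have P: "P \<in> cal_P" "h_compatible P" "P \<in> cal_P_star" using assms(3) by (auto simp: cal_P_h_def)
 have Pm: "P \<in> min_parabolics" using P(1) by (simp add: cal_P_def)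
 have "sigma_split_component A P" using assms(4) by (simp add: admissible_def)
 then obtain h j i where h: "std h j i" "P = Ad h ` Bup" "A = Ad h ` Dpos"
  by (rule min_parabolic_std[OF n Pm]) (rule that)
 have ji: "j < i" using std_cal_P_cal_Q(1)[OF n h(1)] P(1) h(2) by simp
 have a: "adj j i" using std_cal_P_star[OF n h(1) ji] P(3) h(2) by simp
 then have gap: "{j<..<i} = {}" by (simp add: adj_def)
 have LR: "card {..<j} \<le> card {i<..} + 1" "card {i<..} \<le> card {..<j} + 1"
  using std_h_compatible[OF n h(1)] P(2) h(2) ji cc_compatible(1)[of j i] gap by auto
 have cn: "card {..<j} + card {i<..} + 2 = CARD('n)" using card_split_pair[OF ji] gap by simp
 obtain nu c where nu: "nu \<in> Uni" "std (h ** nu) j i" "A = Ad (h ** nu) ` Dpos" "0 < c" "v = Ad (h ** nu) (dg (hv j i c))"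
  using assms(4) unfolding h(2) by (rule admissible_obtain[OF n h(1) a]) (rule that)
 define g where "g = h ** nu"
 have s: "std g j i" and A: "A = Ad g ` Dpos" and v: "v = Ad g (dg (hv j i c))" and c: "0 < c" using nu by (auto simp: g_def)
 have PB: "P = Ad g ` Bup" unfolding g_def h(2)
  by (rule conj_Bup_mult[OF std_SL[OF h(1)] subsetD[OF Uni_sub_Bup nu(1)], symmetric])
 note M = assms(5)[unfolded A]
 note msP = ms[OF Pm, unfolded PB]
 have large: "bdd_above ((%(m, t). norm (of_real (t ^ N) * H_P dn P A phi (m ** mat_exp (t *\<^sub>R v)))) ` (M \<times> {..<r}))"
  if phi: "phi \<in> schwartz" for phi r N
 proof -
  obtain D where D: "D \<ge> 0" "\<forall>tau d. exp (- (r * c)) \<le> tau --> scal j i tau d --> norm (hor_int dn (Ad g ` Bup) phi (Ad g (dg d))) \<le> tau * (D / Lam tau ^ N)"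
  using decay(1)[where dn = dn and N = N, OF n s a msP LR phi exp_gt_zero] by blast
  show ?thesis unfolding PB A v
  proof (rule bdd_above_H_P[OF n s a M _ D(1)])
  fix t d assume t: "t \<in> {..<r}" and d: "scal j i (exp (- (t * c))) d"
  have "exp (- (r * c)) \<le> exp (- (t * c))" using t c by (simp add: mult_right_mono)
  then have "norm (hor_int dn (Ad g ` Bup) phi (Ad g (dg d))) \<le> exp (- (t * c)) * (D / Lam (exp (- (t * c))) ^ N)"
  using D(2) d by blast
  moreover have "0 < Lam (exp (- (t * c)))" by (rule Lam_pos) simp
  ultimately show "\<exists>E B. 0 \<le> E \<and> 0 < B \<and> \<bar>t\<bar> \<le> E * B \<and> E ^ N \<le> (1 / c + \<bar>r\<bar>) ^ N \<and> norm (hor_int dn (Ad g ` Bup) phi (Ad g (dg d))) \<le> exp (- (t * c)) * (D / B ^ N)"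
  using abs_le_Lam(1)[OF c, of t r] t c by (intro exI[of _ "1 / c + \<bar>r\<bar>"] exI[of _ "Lam (exp (- (t * c)))"]) auto
  qed
 qed
 have small: "bdd_above ((%(m, t). norm (of_real (t ^ N) * H_P dn P A phi (m ** mat_exp (t *\<^sub>R v)))) ` (M \<times> {0..}))"
  if phi: "phi \<in> schwartz" and eq: "card {..<j} = card {i<..}" for phi N
 proof -
  obtain D where D: "D \<ge> 0" "\<forall>tau d. tau \<le> 1 --> scal j i tau d --> norm (hor_int dn (Ad g ` Bup) phi (Ad g (dg d))) \<le> tau * (D / Lam (1 / tau\<^sup>2) ^ N)"
  using decay(2)[where dn = dn and N = N, OF n s a msP LR phi eq] by blast
  show ?thesis unfolding PB A v
  proof (rule bdd_above_H_P[OF n s a M _ D(1)])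
  fix t d assume t: "t \<in> {0..}" and d: "scal j i (exp (- (t * c))) d"
  have "exp (- (t * c)) \<le> 1" using t c by simp
  then have "norm (hor_int dn (Ad g ` Bup) phi (Ad g (dg d))) \<le> exp (- (t * c)) * (D / Lam (1 / (exp (- (t * c)))\<^sup>2) ^ N)"
  using D(2) d by blast
  moreover have "0 < Lam (1 / (exp (- (t * c)))\<^sup>2)" by (rule Lam_pos) simp
  ultimately show "\<exists>E B. 0 \<le> E \<and> 0 < B \<and> \<bar>t\<bar> \<le> E * B \<and> E ^ N \<le> (1 / c) ^ N \<and> norm (hor_int dn (Ad g ` Bup) phi (Ad g (dg d))) \<le> exp (- (t * c)) * (D / B ^ N)"
  using abs_le_Lam(2)[OF c, of t] t c by (intro exI[of _ "1 / c"] exI[of _ "Lam (1 / (exp (- (t * c)))\<^sup>2)"]) auto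
  qed
 qed
 have even_case: "bdd_above ((%(m, t). norm (of_real (t ^ N) * H_P dn P A phi (m ** mat_exp (t *\<^sub>R v)))) ` (M \<times> UNIV))"
  if ev: "even CARD('n)" and phi: "phi \<in> schwartz" for phi N
 proof -
  have "even (card {..<j} + card {i<..})" using ev unfolding cn[symmetric] by simp
  \<comment> \<open>L + R = n - 2 is even and |L - R| \<le> 1.\<close>
  then have eq: "card {..<j} = card {i<..}" using LR by presburger
  have "(UNIV :: real set) = {..<0} \<union> {0..}" by auto
  then have "M \<times> (UNIV :: real set) = M \<times> {..<0} \<union> M \<times> {0..}" by blast
  then show ?thesis using large[OF phi, of N 0] small[OF phi eq, of N] by (simp only: image_Un bdd_above_Un)
 qed
 \<comment> \<open>A balanced pivot is neither the first nor the last index because n \<ge> 3;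
   \<open>hor_int_rescale\<close> asks for an index on either side.\<close>
 have bounds: "\<exists>k. k < p" "\<exists>k. p < k" if "card {..<p} = card {p<..}" for p :: 'n
 proof -
  have "card {..<p} ~= 0" "card {p<..} ~= 0" using card_split_point[of p] n that by auto
  then show "\<exists>k. k < p" "\<exists>k. p < k" by (auto simp: card_gt_0_iff)
 qed
 have limit: "\<exists>Q\<in>cal_Q. h_compatible Q \<and> (\<exists>g1\<in>carrier SL. \<forall>phi\<in>schwartz.
  ((%t. H_P dn P A phi (mat_exp (t *\<^sub>R v))) \<longlongrightarrow> hor_int dn Q phi g1) at_top)" if od: "odd CARD('n)"
 proof -
  have "odd (card {..<j} + card {i<..})" using od unfolding cn[symmetric] by simp
  then have "card {i<..} = card {..<j} + 1 \<or> card {..<j} = card {i<..} + 1" using LR by presburger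
  \<comment> \<open>L and R differ by one; p is the one of i and j that leaves equally many indices
    on both sides, which is compatibility in rank zero.\<close>
  then obtain p where p: "card {i<..} = card {..<j} + 1 \<and> p = i \<or> card {..<j} = card {i<..} + 1 \<and> p = j" by blast
  have iL: "{..<i} = insert j {..<j}" and jR: "{j<..} = insert i {i<..}" using a
  by (auto simp: adj_def set_eq_iff) (metis linorder_less_linear)+
  have pp: "card {..<p} = card {p<..}" using p
  proof
  assume "card {i<..} = card {..<j} + 1 \<and> p = i"
  then show ?thesis by (simp add: iL)
  next
  assume "card {..<j} = card {i<..} + 1 \<and> p = j"
  then show ?thesis by (simp add: jR)
  qed
  obtain k0 l0 where kl: "k0 < p" "p < l0" using bounds[OF pp] by blast
  obtain gQ where sQ: "std gQ p p" by (rule std_zero_exists[OF n2]) (rule that)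
  have Q: "Ad gQ ` Bup \<in> cal_Q" using std_cal_P_cal_Q(2)[OF n sQ] by simp
  have hc: "h_compatible (Ad gQ ` Bup)"
  using std_h_compatible[OF n sQ] cc_compatible(2)[of p p] pp by simp
  obtain g1 where "g1 \<in> carrier SL" "\<forall>A v. admissible (Ad g ` Bup) A v --> (\<forall>phi\<in>schwartz.
  ((%t. H_P dn (Ad g ` Bup) A phi (mat_exp (t *\<^sub>R v))) \<longlongrightarrow> hor_int dn (Ad gQ ` Bup) phi g1) at_top)"
  using H_P_tendsto[where dn = dn, OF n s a sQ kl p ms] by blast
  then show ?thesis using Q hc assms(4) unfolding PB by blast
 qed
 have mu_eq: "mu dn P A v phi = l" if "((%t. H_P dn P A phi (mat_exp (t *\<^sub>R v))) \<longlongrightarrow> l) at_top" for P A v phi l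
  unfolding mu_def by (rule tendsto_Lim[OF _ that]) simp
 have converse: "\<exists>P'\<in>cal_P_h \<inter> cal_P_star. \<exists>g\<in>carrier SL. (\<exists>A' v'. admissible P' A' v') \<and>
  (\<forall>A' v'. admissible P' A' v' --> (\<forall>phi\<in>schwartz. hor_int dn Q phi g = mu dn P' A' v' phi))"
  if Q: "Q \<in> cal_Q" and hc: "h_compatible Q" for Q
 proof -
  obtain B where "sigma_split_component B Q" using hc by (auto simp: h_compatible_def)
  moreover have "Q \<in> min_parabolics" using Q by (simp add: cal_Q_def)
  ultimately obtain gQ k p where sQ': "std gQ k p" "Q = Ad gQ ` Bup"
  by (metis min_parabolic_std[OF n])
  then have kp: "k = p" using std_cal_P_cal_Q(2)[OF n sQ'(1)] Q by simp
  note sQ = sQ'(1)[unfolded kp] and QB = sQ'(2)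
  have pp: "card {..<p} = card {p<..}"
  using std_h_compatible[OF n sQ] cc_compatible(2)[of p p] hc QB by simp
  obtain k0 l0 where kl: "k0 < p" "p < l0" using bounds[OF pp] by blast
  \<comment> \<open>The index just below the pivot makes an adjacent pair with one index more above
    than below, so the limit with pivot p on the upper position leads back to Q.\<close>
  define j where "j = Max {..<p}"
  have "{..<p} ~= {}" using kl by blast
  then have jp: "j < p" using Max_in[of "{..<p}"] by (simp add: j_def)
  have jmax: "x \<le> j" if "x < p" for x using that by (simp add: j_def)
  have aj: "adj j p" using jp jmax by (auto simp: adj_def) (meson leD)
  have pL: "{..<p} = insert j {..<j}" using jp jmax by (auto simp: le_less)
  have R: "card {p<..} = card {..<j} + 1" using pp by (simp add: pL)
  obtain h where sh: "std h j p" by (rule std_zero_to_one[OF sQ jp n]) (rule that)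
  have gap: "{j<..<p} = {}" using aj by (simp add: adj_def)
  have "h_compatible (Ad h ` Bup)"
  using std_h_compatible[OF n sh] cc_compatible(1)[of j p] jp gap R by auto
  then have "Ad h ` Bup \<in> cal_P_h \<inter> cal_P_star"
  using std_cal_P_cal_Q(1)[OF n sh] std_cal_P_star[OF n sh jp] jp aj by (simp add: cal_P_h_def)
  moreover have "admissible (Ad h ` Bup) (Ad h ` Dpos) (Ad h (dg (hv j p 1)))" by (rule admissible_std[OF n sh aj]) simp
  moreover obtain g1 where "g1 \<in> carrier SL" "\<forall>A v. admissible (Ad h ` Bup) A v --> (\<forall>phi\<in>schwartz.
  ((%t. H_P dn (Ad h ` Bup) A phi (mat_exp (t *\<^sub>R v))) \<longlongrightarrow> hor_int dn (Ad gQ ` Bup) phi g1) at_top)"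
  using H_P_tendsto[where dn = dn, OF n sh aj sQ kl disjI1[OF conjI[OF R refl]] ms] by blast
  then have "g1 \<in> carrier SL" "\<And>A v phi. admissible (Ad h ` Bup) A v ==> phi \<in> schwartz ==> hor_int dn Q phi g1 = mu dn (Ad h ` Bup) A v phi"
  using mu_eq unfolding QB by metis+
  ultimately show ?thesis by blast
 qed
 have lim1: "\<exists>c. ((%t. H_P dn P A phi (mat_exp (t *\<^sub>R v))) \<longlongrightarrow> c) at_top" if "odd CARD('n)" "phi \<in> schwartz" for phi
  using limit[OF that(1)] that(2) by blast
 have lim2: "\<exists>Q\<in>cal_Q. h_compatible Q \<and> (\<exists>g\<in>carrier SL. \<forall>phi\<in>schwartz. mu dn P A v phi = hor_int dn Q phi g)" if "odd CARD('n)"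
  using limit[OF that] mu_eq by meson
 show ?thesis
  by (intro conjI impI ballI allI; (rule even_case large lim1 lim2 converse; assumption))
qed

end
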